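(* A non-cyclic GBS group $G$ is large if and only if it cannot be represented by a labelled graph homeomorphic to a circle and containing no proper plateau.
   Context: A labelled graph is a finite graph $\Gamma$ (loops and multiple edges allowed) in which each oriented edge $e$ carries a label $\lambda_e$, a nonzero integer (possibly negative). We denote by $o(e)$ the origin of $e$ and by $\tilde e$ the edge $e$ with the opposite orientation; $\lambda_e$ is called the label of $e$ near $o(e)$. A connected labelled graph defines a graph of groups in which all vertex and edge groups are $\mathbb{Z}$ and the inclusion from the edge group $G_e$ (with $G_e=G_{\tilde e}$) into the vertex group $G_{o(e)}$ is multiplication by $\lambda_e$. The fundamental group of this graph of groups is the group represented by $\Gamma$. A generalized Baumslag-Solitar (GBS) group is a group represented by some (finite, connected) labelled graph; a given GBS group may be represented by several labelled graphs. Let $p$ be a prime. A non-empty connected subgraph $P\subset\Gamma$ is a $p$-plateau if for every oriented edge $e$ of $\Gamma$ with $o(e)\in P$: the label $\lambda_e$ is divisible by $p$ if and only if $e$ is not contained in $P$. A plateau is a subgraph that is a $p$-plateau for some prime $p$; it is proper if $P\ne\Gamma$. A group is large if it has a finite index subgroup that admits an epimorphism onto the free group $F_2$ of rank 2. *)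

theory Defs
  imports
    "HOL-Analysis.Analysis"
    "HOL-Algebra.Elementary_Groups"
    "Graph_Theory.Graph_Theory"
begin

section \<open>Presentations\<close>

inductive_set pres_cong :: "'x set \<Rightarrow> ('x list \<times> 'x list) set \<Rightarrow> ('x list \<times> 'x list) set"
  for A :: "'x set" and R :: "('x list \<times> 'x list) set" where
  rel: "\<lbrakk>(l, r) \<in> R; l \<in> lists A; r \<in> lists A; u \<in> lists A; v \<in> lists A\<rbrakk>
    \<Longrightarrow> (u @ l @ v, u @ r @ v) \<in> pres_cong A R"
| refl: "u \<in> lists A \<Longrightarrow> (u, u) \<in> pres_cong A R"
| sym: "(u, v) \<in> pres_cong A R \<Longrightarrow> (v, u) \<in> pres_cong A R"
| trans: "\<lbrakk>(u, v) \<in> pres_cong A R; (v, w) \<in> pres_cong A R\<rbrakk> \<Longrightarrow> (u, w) \<in> pres_cong A R"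

text \<open>The quotient of the free monoid on \<open>A\<close> by the congruence generated by \<open>R\<close>. It is a group
  as soon as the relations provide an inverse for every letter, as in both uses below.\<close>

definition presented :: "'x set \<Rightarrow> ('x list \<times> 'x list) set \<Rightarrow> 'x list set monoid" where
  "presented A R = \<lparr>
     carrier = lists A // pres_cong A R,
     monoid.mult = (\<lambda>X Y. \<Union>x\<in>X. \<Union>y\<in>Y. pres_cong A R `` {x @ y}),
     one = pres_cong A R `` {[]}\<rparr>"

text \<open>The letters \<open>(x, True)\<close> and \<open>(x, False)\<close> stand for the generator \<open>x\<close> and its inverse.\<close>

definition free_group :: "'x set \<Rightarrow> ('x \<times> bool) list set monoid" where
  "free_group X = presented (X \<times> UNIV) {([(x, b), (x, \<not> b)], []) | x b. x \<in> X}"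

definition large :: "('a, 'b) monoid_scheme \<Rightarrow> bool" where
  "large G \<longleftrightarrow> (\<exists>H. subgroup H G \<and> finite (rcosets\<^bsub>G\<^esub> H) \<and>
     (\<exists>\<phi>. \<phi> \<in> epi (G\<lparr>carrier := H\<rparr>) (free_group {0, 1 :: nat})))"


section \<open>Graphs of groups\<close>

text \<open>Graphs are in the sense of Serre: \<open>arcs \<Gamma>\<close> consists of the oriented edges, \<open>arev e\<close> is \<open>e\<close> with
  the opposite orientation and \<open>tail \<Gamma> e\<close> is the origin of \<open>e\<close>. Loops and multiple edges are allowed;
  a loop contributes two arcs. \<open>bidirected_digraph\<close> requires \<open>arev\<close> to be the identity outside
  \<open>arcs \<Gamma>\<close> and, being an involution without fixed points on \<open>arcs \<Gamma>\<close>, excludes inversions.\<close>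

definition rev_subgraph ::
    "('v, 'e) pre_digraph \<Rightarrow> ('e \<Rightarrow> 'e) \<Rightarrow> ('v, 'e) pre_digraph \<Rightarrow> bool" where
  "rev_subgraph \<Gamma> arev P \<longleftrightarrow> subgraph P \<Gamma> \<and> (\<forall>e \<in> arcs P. arev e \<in> arcs P)"

text \<open>The library's \<open>spanning_tree\<close> concerns directed cycles, so that \<open>[e, arev e]\<close> would already
  count as a cycle. That is the only backtracking to be excepted, as a cycle repeats no vertex.\<close>

definition maximal_tree ::
    "('v, 'e) pre_digraph \<Rightarrow> ('e \<Rightarrow> 'e) \<Rightarrow> ('v, 'e) pre_digraph \<Rightarrow> bool" where
  "maximal_tree \<Gamma> arev T \<longleftrightarrow>
     rev_subgraph \<Gamma> arev T \<and> spanning T \<Gamma> \<and> Digraph_Component.connected T \<and>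
     (\<forall>p. pre_digraph.cycle T p \<longrightarrow> (\<exists>e. p = [e, arev e]))"

locale graph_of_groups = bidirected_digraph \<Gamma> arev
  for \<Gamma> :: "('v, 'e) pre_digraph" and arev :: "'e \<Rightarrow> 'e" +
  fixes GV :: "'v \<Rightarrow> ('g, 'x) monoid_scheme"
    and GE :: "'e \<Rightarrow> ('h, 'y) monoid_scheme"
    and inc :: "'e \<Rightarrow> 'h \<Rightarrow> 'g"
  assumes connected: "Digraph_Component.connected \<Gamma>"
    and group_GV: "v \<in> verts \<Gamma> \<Longrightarrow> group (GV v)"
    and group_GE: "e \<in> arcs \<Gamma> \<Longrightarrow> group (GE e)"
    and GE_arev: "e \<in> arcs \<Gamma> \<Longrightarrow> GE (arev e) = GE e"
    and inc_mon: "e \<in> arcs \<Gamma> \<Longrightarrow> inc e \<in> mon (GE e) (GV (tail \<Gamma> e))"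

text \<open>The fundamental group relative to a maximal tree \<open>T\<close>; its isomorphism class does not depend
  on \<open>T\<close>. The generators are the elements of the vertex groups and a stable letter for each
  oriented edge.\<close>

definition fundamental_group ::
    "('v, 'e) pre_digraph \<Rightarrow> ('e \<Rightarrow> 'e) \<Rightarrow> ('v \<Rightarrow> ('g, 'x) monoid_scheme) \<Rightarrow>
     ('e \<Rightarrow> ('h, 'y) monoid_scheme) \<Rightarrow> ('e \<Rightarrow> 'h \<Rightarrow> 'g) \<Rightarrow> ('v, 'e) pre_digraph \<Rightarrow>
     ('v \<times> 'g + 'e) list set monoid" where
  "fundamental_group \<Gamma> arev GV GE inc T = presented
     ((SIGMA v : verts \<Gamma>. carrier (GV v)) <+> arcs \<Gamma>)
     ({([Inl (v, g), Inl (v, h)], [Inl (v, g \<otimes>\<^bsub>GV v\<^esub> h)]) | v g h.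
         v \<in> verts \<Gamma> \<and> g \<in> carrier (GV v) \<and> h \<in> carrier (GV v)} \<union>
      {([Inl (v, \<one>\<^bsub>GV v\<^esub>)], []) | v. v \<in> verts \<Gamma>} \<union>
      {([Inr e, Inr (arev e)], []) | e. e \<in> arcs \<Gamma>} \<union>
      {([Inr e, Inl (head \<Gamma> e, inc (arev e) x), Inr (arev e)], [Inl (tail \<Gamma> e, inc e x)]) | e x.
         e \<in> arcs \<Gamma> \<and> x \<in> carrier (GE e)} \<union>
      {([Inr e], []) | e. e \<in> arcs T})"


section \<open>Labelled graphs and GBS groups\<close>

locale labelled_graph = bidirected_digraph \<Gamma> arev + fin_digraph \<Gamma>
  for \<Gamma> :: "('v, 'e) pre_digraph" and arev :: "'e \<Rightarrow> 'e" +
  fixes lab :: "'e \<Rightarrow> int"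
  assumes lab_nonzero: "e \<in> arcs \<Gamma> \<Longrightarrow> lab e \<noteq> 0"

lemma labelled_graph_imp_graph_of_groups:
  assumes "labelled_graph \<Gamma> arev lab" and "Digraph_Component.connected \<Gamma>"
  shows "graph_of_groups \<Gamma> arev (\<lambda>_. integer_group) (\<lambda>_. integer_group) (\<lambda>e n. lab e * n)"
proof -
  interpret labelled_graph \<Gamma> arev lab by fact
  have "(\<lambda>n. lab e * n) \<in> mon integer_group integer_group" if "e \<in> arcs \<Gamma>" for e
    using lab_nonzero[OF that] by (auto simp: mon_def hom_def inj_on_def distrib_left)
  then show ?thesis
    using assms(2)
    by (intro graph_of_groups.intro graph_of_groups_axioms.intro bidirected_digraph) simp_all
qed

definition represents ::
    "('v, 'e) pre_digraph \<Rightarrow> ('e \<Rightarrow> 'e) \<Rightarrow> ('e \<Rightarrow> int) \<Rightarrow> ('a, 'b) monoid_scheme \<Rightarrow> bool" where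
  "represents \<Gamma> arev lab G \<longleftrightarrow>
     labelled_graph \<Gamma> arev lab \<and> Digraph_Component.connected \<Gamma> \<and>
     (\<exists>T. maximal_tree \<Gamma> arev T \<and>
        G \<cong> fundamental_group \<Gamma> arev (\<lambda>_. integer_group) (\<lambda>_. integer_group) (\<lambda>e n. lab e * n) T)"

text \<open>Labelled graphs being finite, it is no restriction to take natural numbers as vertices and
  oriented edges.\<close>

definition GBS_group :: "('a, 'b) monoid_scheme \<Rightarrow> bool" where
  "GBS_group G \<longleftrightarrow> group G \<and>
     (\<exists>(\<Gamma> :: (nat, nat) pre_digraph) arev lab. represents \<Gamma> arev lab G)"

text \<open>\<open>Digraph_Component.connected\<close> includes non-emptiness.\<close>

definition p_plateau ::
    "nat \<Rightarrow> ('v, 'e) pre_digraph \<Rightarrow> ('e \<Rightarrow> 'e) \<Rightarrow> ('e \<Rightarrow> int) \<Rightarrow> ('v, 'e) pre_digraph \<Rightarrow> bool" where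
  "p_plateau p \<Gamma> arev lab P \<longleftrightarrow>
     rev_subgraph \<Gamma> arev P \<and> Digraph_Component.connected P \<and>
     (\<forall>e \<in> arcs \<Gamma>. tail \<Gamma> e \<in> verts P \<longrightarrow> (int p dvd lab e \<longleftrightarrow> e \<notin> arcs P))"

definition plateau ::
    "('v, 'e) pre_digraph \<Rightarrow> ('e \<Rightarrow> 'e) \<Rightarrow> ('e \<Rightarrow> int) \<Rightarrow> ('v, 'e) pre_digraph \<Rightarrow> bool" where
  "plateau \<Gamma> arev lab P \<longleftrightarrow> (\<exists>p :: nat. prime p \<and> p_plateau p \<Gamma> arev lab P)"

definition proper_plateau ::
    "('v, 'e) pre_digraph \<Rightarrow> ('e \<Rightarrow> 'e) \<Rightarrow> ('e \<Rightarrow> int) \<Rightarrow> ('v, 'e) pre_digraph \<Rightarrow> bool" where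
  "proper_plateau \<Gamma> arev lab P \<longleftrightarrow> plateau \<Gamma> arev lab P \<and> P \<noteq> \<Gamma>"


section \<open>The geometric realization of a graph\<close>

text \<open>For \<open>U \<subseteq> topspace X // R\<close>, the preimage of \<open>U\<close> under the projection is \<open>\<Union>U\<close>.\<close>

definition quotient_topology :: "'a topology \<Rightarrow> ('a \<times> 'a) set \<Rightarrow> 'a set topology" where
  "quotient_topology X R = topology (\<lambda>U. U \<subseteq> topspace X // R \<and> openin X (\<Union>U))"

lemma openin_quotient_topology:
  assumes "equiv (topspace X) R"
  shows "openin (quotient_topology X R) U \<longleftrightarrow> U \<subseteq> topspace X // R \<and> openin X (\<Union>U)"
proof -
  have 1: "\<Union>(S \<inter> T) = \<Union>S \<inter> \<Union>T" if "S \<subseteq> topspace X // R" "T \<subseteq> topspace X // R" for S T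
    using that quotient_disj[OF assms] by blast
  have 2: "\<Union>(\<Union>K) = (\<Union>S\<in>K. \<Union>S)" for K :: "'a set set set"
    by blast
  have "istopology (\<lambda>U. U \<subseteq> topspace X // R \<and> openin X (\<Union>U))"
    unfolding istopology_def
  proof (intro conjI allI impI)
    fix S T
    assume "S \<subseteq> topspace X // R \<and> openin X (\<Union>S)" "T \<subseteq> topspace X // R \<and> openin X (\<Union>T)"
    then show "S \<inter> T \<subseteq> topspace X // R" "openin X (\<Union>(S \<inter> T))"
      by (auto simp: 1)
  next
    fix K
    assume K: "\<forall>S\<in>K. S \<subseteq> topspace X // R \<and> openin X (\<Union>S)"
    then show "\<Union>K \<subseteq> topspace X // R"
      by blast
    show "openin X (\<Union>(\<Union>K))"
      unfolding 2 by (rule openin_Union) (use K in blast)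
  qed
  then show ?thesis
    by (simp add: quotient_topology_def)
qed

definition graph_cells :: "('v, 'e) pre_digraph \<Rightarrow> (('v + 'e) \<times> real) topology" where
  "graph_cells \<Gamma> = sum_topology
     (case_sum (\<lambda>_. top_of_set {0}) (\<lambda>_. top_of_set {0..1})) (verts \<Gamma> <+> arcs \<Gamma>)"

definition graph_gluing ::
    "('v, 'e) pre_digraph \<Rightarrow> ('e \<Rightarrow> 'e) \<Rightarrow> ((('v + 'e) \<times> real) \<times> (('v + 'e) \<times> real)) set" where
  "graph_gluing \<Gamma> arev =
     {((Inr e, 0), (Inl (tail \<Gamma> e), 0)) | e. e \<in> arcs \<Gamma>} \<union>
     {((Inr e, t), (Inr (arev e), 1 - t)) | e t. e \<in> arcs \<Gamma> \<and> t \<in> {0..1}}"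

text \<open>Intersecting with the square turns the generated equivalence relation on the whole type into
  one on the space.\<close>

definition realization ::
    "('v, 'e) pre_digraph \<Rightarrow> ('e \<Rightarrow> 'e) \<Rightarrow> (('v + 'e) \<times> real) set topology" where
  "realization \<Gamma> arev = quotient_topology (graph_cells \<Gamma>)
     ((graph_gluing \<Gamma> arev \<union> (graph_gluing \<Gamma> arev)\<inverse>)\<^sup>* \<inter>
      topspace (graph_cells \<Gamma>) \<times> topspace (graph_cells \<Gamma>))"

definition homeomorphic_to_circle :: "('v, 'e) pre_digraph \<Rightarrow> ('e \<Rightarrow> 'e) \<Rightarrow> bool" where
  "homeomorphic_to_circle \<Gamma> arev \<longleftrightarrow>
     realization \<Gamma> arev homeomorphic_space top_of_set (sphere (0 :: complex) 1)"

end

theory Submission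
  imports
    Defs
    "HOL-Algebra.Bij"
    "HOL-Algebra.Multiplicative_Group"
    "HOL-Computational_Algebra.Primes"
begin

text \<open>Largeness of \<open>G\<close> is detected by homomorphisms to a virtually free group in which two finite
  groups generate a large subgroup: sending vertex generators to powers of suitable elements solves
  the relations along a growing tree, and the solvability is governed by the labels which are not
  units. If the graph has two independent cycles, a non-unit label off its only cycle, a proper
  plateau on this cycle, or sufficiently many non-units when it is a tree, then such a homomorphism
  exists. What remains are cyclic groups, the group of the Klein bottle (a loop with labels \<open>1\<close>
  and \<open>-1\<close>) and circles without proper plateau, up to collapsing edges with a unit label.

  Conversely, let a circle carry no proper plateau, and consider an action of \<open>G\<close> on a finite set. A
  prime dividing the order of a vertex generator divides no label, since the vertices where its
  valuation is maximal form plateaus. So all vertex generators generate the same normal cyclic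
  subgroup of the image, which is therefore metabelian; but a large group has finite quotients
  that are not, coming from the symmetric group on four points.\<close>

section \<open>Presented groups\<close>

text \<open>The free product of two finite groups A and B is never built. The kernel of its map onto
  A x B is free on commutators [a, b], and the image of G only has to reach two of them. So G is
  made to permute \<open>A \<times> B \<times> F2\<close> in a way that commutes with right
  translation in \<open>F2\<close>: the stabilizer of a point of A x B has finite index, and the
  third coordinate maps it to \<open>F2\<close>. This needs one non-trivial element of A and two of
  B, hence the orders 2 and 3 that recur below. Vertex generators go to powers, so each edge
  relation becomes an equation between exponents. A tree is stored as the list of its arcs in the
  order of growth, and the equations are solved one new vertex at a time. A label other than 1 and
  -1 at the new vertex leaves freedom there: if the old exponents are 0 and the new one is k, the
  equation holds modulo k times the label, and k is not 0 for this modulus. Topology enters through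
  two facts only: a circle falls apart when two points are removed, so at most one edge lies outside
  a maximal tree, and the standard cycle with n edges is a circle.\<close>

definition word_val :: "('g, 'm) monoid_scheme \<Rightarrow> ('x \<Rightarrow> 'g) \<Rightarrow> 'x list \<Rightarrow> 'g" where
  "word_val H f w = foldr (\<lambda>a y. f a \<otimes>\<^bsub>H\<^esub> y) w \<one>\<^bsub>H\<^esub>"

lemma word_val_simps [simp]:
  "word_val H f [] = \<one>\<^bsub>H\<^esub>"
  "word_val H f (a # w) = f a \<otimes>\<^bsub>H\<^esub> word_val H f w"
  by (simp_all add: word_val_def)

lemma (in monoid) word_val_closed [simp]:
  "f \<in> A \<rightarrow> carrier G \<Longrightarrow> w \<in> lists A \<Longrightarrow> word_val G f w \<in> carrier G"
  by (induction w) auto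

lemma (in monoid) word_val_append:
  "f \<in> A \<rightarrow> carrier G \<Longrightarrow> u \<in> lists A \<Longrightarrow> v \<in> lists A \<Longrightarrow>
    word_val G f (u @ v) = word_val G f u \<otimes> word_val G f v"
proof (induction u)
  case (Cons a u)
  then have "f a \<in> carrier G" "word_val G f u \<in> carrier G" "word_val G f v \<in> carrier G"
    by auto
  with Cons show ?case
    by (simp add: m_assoc)
qed simp

lemma pres_cong_lists: "(u, v) \<in> pres_cong A R \<Longrightarrow> u \<in> lists A \<and> v \<in> lists A"
  by (induction rule: pres_cong.induct) auto

lemma equiv_pres_cong: "equiv (lists A) (pres_cong A R)"
proof (rule equivI)
  show "pres_cong A R \<subseteq> lists A \<times> lists A"
    using pres_cong_lists[of _ _ A R] by auto
  show "refl_on (lists A) (pres_cong A R)"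
    by (auto intro!: refl_onI pres_cong.refl)
  show "sym (pres_cong A R)"
    by (auto intro: symI pres_cong.sym)
  show "trans (pres_cong A R)"
    by (auto intro: transI pres_cong.trans)
qed

lemma pres_cong_context:
  assumes "(u, v) \<in> pres_cong A R" "x \<in> lists A" "y \<in> lists A"
  shows "(x @ u @ y, x @ v @ y) \<in> pres_cong A R"
  using assms
proof (induction arbitrary: x y rule: pres_cong.induct)
  case (rel l r u v)
  have "((x @ u) @ l @ (v @ y), (x @ u) @ r @ (v @ y)) \<in> pres_cong A R"
    using rel by (intro pres_cong.rel) auto
  then show ?case by simp
next
  case (refl u)
  then show ?case by (intro pres_cong.refl) auto
next
  case (sym u v)
  then show ?case by (blast intro: pres_cong.sym)
next
  case (trans u v w)
  then show ?case by (blast intro: pres_cong.trans)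
qed

lemma pres_cong_append:
  assumes "(u, u') \<in> pres_cong A R" "(v, v') \<in> pres_cong A R"
  shows "(u @ v, u' @ v') \<in> pres_cong A R"
proof -
  have l: "u \<in> lists A" "u' \<in> lists A" "v \<in> lists A" "v' \<in> lists A"
    using assms pres_cong_lists by blast+
  have "(u @ v, u' @ v) \<in> pres_cong A R" "(u' @ v, u' @ v') \<in> pres_cong A R"
    using pres_cong_context[OF assms(1), of "[]" v] pres_cong_context[OF assms(2), of u' "[]"] l
    by simp_all
  then show ?thesis by (rule pres_cong.trans)
qed

definition word_class :: "'x set \<Rightarrow> ('x list \<times> 'x list) set \<Rightarrow> 'x list \<Rightarrow> 'x list set" where
  "word_class A R w = pres_cong A R `` {w}"

lemma word_class_eq_iff:
  "u \<in> lists A \<Longrightarrow> v \<in> lists A \<Longrightarrow> word_class A R u = word_class A R v \<longleftrightarrow> (u, v) \<in> pres_cong A R"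
  unfolding word_class_def by (rule eq_equiv_class_iff[OF equiv_pres_cong])

lemma word_class_rel:
  assumes "(l, r) \<in> R" "l \<in> lists A" "r \<in> lists A"
  shows "word_class A R l = word_class A R r"
  using pres_cong.rel[OF assms, of "[]" "[]"] assms by (simp add: word_class_eq_iff)

lemma word_class_carrier [simp]:
  "w \<in> lists A \<Longrightarrow> word_class A R w \<in> carrier (presented A R)"
  by (simp add: presented_def word_class_def quotientI)

lemma presented_carrierE:
  assumes "X \<in> carrier (presented A R)"
  obtains w where "w \<in> lists A" "X = word_class A R w"
  using assms that by (auto simp: presented_def word_class_def elim!: quotientE)

lemma one_presented: "\<one>\<^bsub>presented A R\<^esub> = word_class A R []"
  by (simp add: presented_def word_class_def)

text \<open>The product of \<open>presented\<close> is a union over all pairs of representatives; by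
  the congruence property all members of this union are the same class.\<close>

lemma mult_word_class:
  assumes u: "u \<in> lists A" and v: "v \<in> lists A"
  shows "word_class A R u \<otimes>\<^bsub>presented A R\<^esub> word_class A R v = word_class A R (u @ v)"
proof -
  have 1: "word_class A R (x @ y) = word_class A R (u @ v)"
    if "x \<in> word_class A R u" "y \<in> word_class A R v" for x y
  proof -
    have "(u @ v, x @ y) \<in> pres_cong A R"
      using that by (intro pres_cong_append) (simp_all add: word_class_def)
    then show ?thesis
      using equiv_class_eq[OF equiv_pres_cong] unfolding word_class_def by metis
  qed
  have 2: "u \<in> word_class A R u" "v \<in> word_class A R v"
    using u v by (simp_all add: word_class_def pres_cong.refl)
  have "(\<Union>x\<in>word_class A R u. \<Union>y\<in>word_class A R v. word_class A R (x @ y)) =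
      (\<Union>x\<in>word_class A R u. \<Union>y\<in>word_class A R v. word_class A R (u @ v))"
    by (rule SUP_cong[OF HOL.refl], rule SUP_cong[OF HOL.refl], rule 1)
  also have "\<dots> = word_class A R (u @ v)"
    using 2 by auto
  finally show ?thesis
    by (simp add: presented_def word_class_def)
qed

text \<open>Left inverses of the letters are enough: \<open>groupI\<close> asks for left inverses
  only, and the one of \<open>a # u\<close> is the one of \<open>u\<close> followed by the one of
  \<open>a\<close>.\<close>

lemma group_presented:
  assumes inv: "\<And>a. a \<in> A \<Longrightarrow> \<exists>w\<in>lists A. word_class A R (w @ [a]) = word_class A R []"
  shows "group (presented A R)"
proof (rule groupI)
  show "\<one>\<^bsub>presented A R\<^esub> \<in> carrier (presented A R)"
    by (simp add: one_presented)
next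
  fix X Y assume "X \<in> carrier (presented A R)" "Y \<in> carrier (presented A R)"
  then show "X \<otimes>\<^bsub>presented A R\<^esub> Y \<in> carrier (presented A R)"
    by (elim presented_carrierE) (simp add: mult_word_class)
next
  fix X Y Z
  assume "X \<in> carrier (presented A R)" "Y \<in> carrier (presented A R)" "Z \<in> carrier (presented A R)"
  then show "X \<otimes>\<^bsub>presented A R\<^esub> Y \<otimes>\<^bsub>presented A R\<^esub> Z = X \<otimes>\<^bsub>presented A R\<^esub> (Y \<otimes>\<^bsub>presented A R\<^esub> Z)"
    by (elim presented_carrierE) (simp add: mult_word_class)
next
  fix X assume "X \<in> carrier (presented A R)"
  then obtain u where u: "u \<in> lists A" "X = word_class A R u"
    by (metis presented_carrierE)
  then show "\<one>\<^bsub>presented A R\<^esub> \<otimes>\<^bsub>presented A R\<^esub> X = X"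
    by (simp add: mult_word_class one_presented)
  have "\<exists>w\<in>lists A. word_class A R (w @ u) = word_class A R []"
    using u(1)
  proof (induction u)
    case Nil
    then show ?case by (intro bexI[of _ "[]"]) auto
  next
    case (Cons a u)
    then have a: "a \<in> A" "u \<in> lists A" by auto
    with Cons obtain w where w: "w \<in> lists A" "word_class A R (w @ u) = word_class A R []"
      by auto
    obtain b where b: "b \<in> lists A" "word_class A R (b @ [a]) = word_class A R []"
      using inv a by blast
    have "(w @ (b @ [a]) @ u, w @ [] @ u) \<in> pres_cong A R"
      using a b w by (intro pres_cong_context) (auto simp: word_class_eq_iff)
    then have "word_class A R ((w @ b) @ a # u) = word_class A R (w @ u)"
      using a b w by (subst word_class_eq_iff) auto
    then show ?case
      using w b by (intro bexI[of _ "w @ b"]) auto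
  qed
  then show "\<exists>Y\<in>carrier (presented A R). Y \<otimes>\<^bsub>presented A R\<^esub> X = \<one>\<^bsub>presented A R\<^esub>"
  proof
    fix w assume "w \<in> lists A" "word_class A R (w @ u) = word_class A R []"
    then show ?thesis
      using u by (intro bexI[of _ "word_class A R w"]) (simp_all add: mult_word_class one_presented)
  qed
qed

text \<open>Von Dyck's theorem. A caller may assume that both sides of a relation are words over
  \<open>A\<close>, because \<open>pres_cong\<close> applies no other relations.\<close>

lemma presented_hom:
  assumes H: "group H" and f: "f \<in> A \<rightarrow> carrier H"
    and R: "\<And>l r. (l, r) \<in> R \<Longrightarrow> l \<in> lists A \<Longrightarrow> r \<in> lists A \<Longrightarrow> word_val H f l = word_val H f r"
  obtains \<phi> where "\<phi> \<in> hom (presented A R) H"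
    "\<And>w. w \<in> lists A \<Longrightarrow> \<phi> (word_class A R w) = word_val H f w"
proof -
  interpret H: group H by fact
  have cong: "word_val H f u = word_val H f v" if "(u, v) \<in> pres_cong A R" for u v
    using that
  proof (induction rule: pres_cong.induct)
    case (rel l r u v)
    with R[of l r] show ?case
      by (simp add: H.word_val_append[OF f] del: in_lists_conv_set)
  qed simp_all
  \<comment> \<open>A class goes to the value of an arbitrary representative; \<open>cong\<close>
    makes the choice irrelevant.\<close>
  define \<phi> where "\<phi> X = word_val H f (SOME w. w \<in> lists A \<and> X = word_class A R w)" for X
  have \<phi>: "\<phi> (word_class A R w) = word_val H f w" if w: "w \<in> lists A" for w
  proof -
    have "\<exists>w'. w' \<in> lists A \<and> word_class A R w = word_class A R w'"
      using w by blast
    then obtain w' where w': "w' \<in> lists A" "word_class A R w = word_class A R w'"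
      and \<phi>w: "\<phi> (word_class A R w) = word_val H f w'"
      unfolding \<phi>_def by (metis (mono_tags, lifting) someI_ex)
    have "(w, w') \<in> pres_cong A R"
      using w w' by (simp add: word_class_eq_iff del: in_lists_conv_set)
    then show ?thesis
      by (simp add: \<phi>w cong)
  qed
  have "\<phi> \<in> hom (presented A R) H"
  proof (rule homI)
    fix X assume "X \<in> carrier (presented A R)"
    then show "\<phi> X \<in> carrier H"
      using f \<phi> by (elim presented_carrierE) simp
  next
    fix X Y assume "X \<in> carrier (presented A R)" "Y \<in> carrier (presented A R)"
    then obtain u v where uv: "u \<in> lists A" "X = word_class A R u" "v \<in> lists A" "Y = word_class A R v"
      by (elim presented_carrierE)
    then show "\<phi> (X \<otimes>\<^bsub>presented A R\<^esub> Y) = \<phi> X \<otimes>\<^bsub>H\<^esub> \<phi> Y"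
      using \<phi>[of u] \<phi>[of v] \<phi>[of "u @ v"] by (simp add: mult_word_class H.word_val_append[OF f])
  qed
  then show thesis
    using \<phi> by (rule that)
qed

lemma presented_generated:
  assumes "group (presented A R)" "subgroup K (presented A R)"
    and "\<And>a. a \<in> A \<Longrightarrow> word_class A R [a] \<in> K"
  shows "K = carrier (presented A R)"
proof
  interpret subgroup K "presented A R" by fact
  show "K \<subseteq> carrier (presented A R)"
    by (rule subset)
  have "word_class A R w \<in> K" if "w \<in> lists A" for w
    using that
  proof (induction w)
    case Nil
    then show ?case using one_closed by (simp add: one_presented)
  next
    case (Cons a w)
    then have "word_class A R [a] \<otimes>\<^bsub>presented A R\<^esub> word_class A R w \<in> K"
      using assms(3) by (intro m_closed) auto
    then show ?case
      using Cons by (simp add: mult_word_class)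
  qed
  then show "carrier (presented A R) \<subseteq> K"
    by (metis presented_carrierE subsetI)
qed

section \<open>The free group of rank two and large groups\<close>

abbreviation "free_letters X \<equiv> X \<times> (UNIV :: bool set)"

definition "free_rels X = {([(x, b), (x, \<not> b)], []) | x b. x \<in> X}"

lemma free_group_eq: "free_group X = presented (free_letters X) (free_rels X)"
  by (simp add: free_group_def free_rels_def)

lemma free_cancel:
  assumes "x \<in> X"
  shows "word_class (free_letters X) (free_rels X) [(x, b), (x, \<not> b)] = word_class (free_letters X) (free_rels X) []"
  using assms by (intro word_class_rel) (auto simp: free_rels_def)

definition fg_gen :: "nat \<Rightarrow> (nat \<times> bool) list set" where
  "fg_gen x = word_class (free_letters {0, 1}) (free_rels {0, 1}) [(x, True)]"

lemma group_free_group: "group (free_group X)"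
  unfolding free_group_eq
proof (rule group_presented)
  fix a assume "a \<in> free_letters X"
  then obtain x b where a: "a = (x, b)" "x \<in> X" by (cases a) simp
  then show "\<exists>w\<in>lists (free_letters X). word_class (free_letters X) (free_rels X) (w @ [a]) =
      word_class (free_letters X) (free_rels X) []"
    using free_cancel[of x X "\<not> b"] by (intro bexI[of _ "[(x, \<not> b)]"]) simp_all
qed

lemma fg_gen_carrier: "x \<in> {0, 1} \<Longrightarrow> fg_gen x \<in> carrier (free_group {0, 1})"
  unfolding fg_gen_def free_group_eq by (rule word_class_carrier) simp

lemma free_group_generated:
  assumes K: "subgroup K (free_group {0, 1 :: nat})" and gens: "fg_gen 0 \<in> K" "fg_gen 1 \<in> K"
  shows "K = carrier (free_group {0, 1})"
proof -
  define X where "X = {0, 1 :: nat}"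
  let ?c = "word_class (free_letters X) (free_rels X)"
  interpret F: group "presented (free_letters X) (free_rels X)"
    using group_free_group[of X] by (simp add: free_group_eq)
  have K': "subgroup K (presented (free_letters X) (free_rels X))"
    using K by (simp add: free_group_eq X_def)
  have True_mem: "?c [(x, True)] \<in> K" if "x \<in> X" for x
    using that gens unfolding X_def fg_gen_def by (elim insertE emptyE) simp_all
  have False_mem: "?c [(x, False)] \<in> K" if x: "x \<in> X" for x
  proof -
    have "?c [(x, False)] \<otimes>\<^bsub>presented (free_letters X) (free_rels X)\<^esub> ?c [(x, True)] =
        \<one>\<^bsub>presented (free_letters X) (free_rels X)\<^esub>"
      using x free_cancel[OF x, of False] by (simp add: mult_word_class one_presented)
    then have "?c [(x, False)] = inv\<^bsub>presented (free_letters X) (free_rels X)\<^esub> ?c [(x, True)]"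
      by (rule F.inv_equality[symmetric]) (use x in simp_all)
    then show ?thesis
      using True_mem[OF x] subgroup.m_inv_closed[OF K'] by simp
  qed
  have "K = carrier (presented (free_letters X) (free_rels X))"
  proof (rule presented_generated[OF F.is_group K'])
    fix a assume "a \<in> free_letters X"
    then obtain x s where "a = (x, s)" "x \<in> X" by (cases a) simp
    then show "?c [a] \<in> K"
      using True_mem False_mem by (cases s) simp_all
  qed
  then show ?thesis
    by (simp add: free_group_eq X_def)
qed

lemma free_group_hom:
  assumes H: "group H" and ab: "a \<in> carrier H" "b \<in> carrier H"
  obtains \<phi> where "\<phi> \<in> hom (free_group {0, 1 :: nat}) H" "\<phi> (fg_gen 0) = a" "\<phi> (fg_gen 1) = b"
proof -
  define X where "X = {0, 1 :: nat}"
  interpret H: group H by fact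
  define f where "f = (\<lambda>(x :: nat, s). let c = if x = 0 then a else b in if s then c else inv\<^bsub>H\<^esub> c)"
  have f: "f \<in> free_letters X \<rightarrow> carrier H"
    using ab by (simp add: f_def Let_def Pi_def)
  have rel: "word_val H f l = word_val H f r" if "(l, r) \<in> free_rels X" for l r
    using that ab by (auto simp: free_rels_def f_def Let_def)
  obtain \<phi> where \<phi>: "\<phi> \<in> hom (presented (free_letters X) (free_rels X)) H"
    and val: "\<And>w. w \<in> lists (free_letters X) \<Longrightarrow> \<phi> (word_class (free_letters X) (free_rels X) w) = word_val H f w"
    using presented_hom[OF H f, of "free_rels X"] rel by metis
  have "\<phi> (fg_gen 0) = a" "\<phi> (fg_gen 1) = b"
    using ab val[of "[(0, True)]"] val[of "[(1, True)]"] by (simp_all add: fg_gen_def f_def X_def)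
  then show thesis
    using \<phi> by (intro that[of \<phi>]) (simp_all add: free_group_eq X_def)
qed

text \<open>Pull everything back along the isomorphism \<open>h\<close>. Taking direct images of
  cosets is injective, so the preimage of a subgroup of finite index has finite index.\<close>

lemma large_iso:
  assumes G: "group G" and K: "group K" and iso: "G \<cong> K" and "large K"
  shows "large G"
proof -
  interpret G: group G by fact
  interpret K: group K by fact
  obtain h where h: "h \<in> iso G K"
    using iso by (auto simp: is_iso_def)
  then have hom: "h \<in> hom G K" and bij: "bij_betw h (carrier G) (carrier K)"
    by (auto simp: iso_def)
  interpret h: group_hom G K h
    by (simp add: G K hom group_hom.intro group_hom_axioms.intro)
  obtain H \<phi> where H: "subgroup H K" "finite (rcosets\<^bsub>K\<^esub> H)"
    and \<phi>: "\<phi> \<in> epi (K\<lparr>carrier := H\<rparr>) (free_group {0, 1 :: nat})"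
    using \<open>large K\<close> by (auto simp: large_def)
  interpret H: subgroup H K by fact
  let ?H' = "{g \<in> carrier G. h g \<in> H}"
  have H': "subgroup ?H' G"
    by (rule subgroup.intro) (auto simp: H.m_closed H.m_inv_closed)
  have img: "h ` ?H' = H"
    using bij H.subset by (auto simp: bij_betw_def)
  have cos: "h ` (?H' #>\<^bsub>G\<^esub> g) = H #>\<^bsub>K\<^esub> h g" if "g \<in> carrier G" for g
  proof -
    have "h ` (?H' #>\<^bsub>G\<^esub> g) = (\<lambda>y. y \<otimes>\<^bsub>K\<^esub> h g) ` h ` ?H'"
      using that by (force simp: r_coset_def)
    then show ?thesis
      unfolding img by (auto simp: r_coset_def)
  qed
  have "inj_on (\<lambda>C. h ` C) (rcosets\<^bsub>G\<^esub> ?H')"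
    by (rule inj_on_subset[OF inj_on_image_Pow[of h "carrier G"]])
      (use bij G.rcosets_part_G[OF H'] in \<open>auto simp: bij_betw_def\<close>)
  moreover have "(\<lambda>C. h ` C) ` (rcosets\<^bsub>G\<^esub> ?H') \<subseteq> rcosets\<^bsub>K\<^esub> H"
  proof
    fix C assume "C \<in> (\<lambda>C. h ` C) ` (rcosets\<^bsub>G\<^esub> ?H')"
    then obtain g where "g \<in> carrier G" "C = h ` (?H' #>\<^bsub>G\<^esub> g)"
      by (auto simp: RCOSETS_def)
    then show "C \<in> rcosets\<^bsub>K\<^esub> H"
      using cos K.rcosetsI[OF H.subset] by simp
  qed
  ultimately have "finite (rcosets\<^bsub>G\<^esub> ?H')"
    using H(2) by (rule inj_on_finite)
  moreover have "\<phi> \<circ> h \<in> epi (G\<lparr>carrier := ?H'\<rparr>) (free_group {0, 1 :: nat})"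
  proof -
    have "(\<phi> \<circ> h) ` ?H' = \<phi> ` H"
      by (simp only: image_comp[symmetric] img)
    then have "(\<phi> \<circ> h) ` carrier (G\<lparr>carrier := ?H'\<rparr>) = carrier (free_group {0, 1 :: nat})"
      using \<phi> by (simp add: epi_def)
    moreover have "h \<in> hom (G\<lparr>carrier := ?H'\<rparr>) (K\<lparr>carrier := H\<rparr>)"
      by (rule homI) auto
    then have "\<phi> \<circ> h \<in> hom (G\<lparr>carrier := ?H'\<rparr>) (free_group {0, 1 :: nat})"
      by (rule hom_compose) (use \<phi> in \<open>simp add: epi_def\<close>)
    ultimately show ?thesis by (simp add: epi_def)
  qed
  ultimately show ?thesis
    unfolding large_def using H' by (intro exI[of _ ?H'] exI[of _ "\<phi> \<circ> h"] conjI)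
qed

section \<open>Comparison of homomorphisms\<close>

lemma iso_of_inverse_homs:
  assumes "\<phi> \<in> hom G H" "\<psi> \<in> hom H G"
    and "\<And>x. x \<in> carrier G \<Longrightarrow> \<psi> (\<phi> x) = x" "\<And>y. y \<in> carrier H \<Longrightarrow> \<phi> (\<psi> y) = y"
  shows "G \<cong> H"
proof -
  have "bij_betw \<phi> (carrier G) (carrier H)"
  proof (rule bij_betwI[of _ _ _ \<psi>])
    show "\<phi> \<in> carrier G \<rightarrow> carrier H" "\<psi> \<in> carrier H \<rightarrow> carrier G"
      using assms(1,2) by (simp_all add: hom_def)
  qed (fact assms)+
  then show ?thesis
    using isoI[OF assms(1)] unfolding is_iso_def by blast
qed

text \<open>Together with a generation lemma this shows that homomorphisms which agree on generators
  are equal.\<close>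

lemma (in group) subgroup_equalizer:
  assumes "group H" "\<phi> \<in> hom G H" "\<psi> \<in> hom G H"
  shows "subgroup {x \<in> carrier G. \<phi> x = \<psi> x} G"
proof (rule subgroup.intro)
  show "x \<otimes> y \<in> {x \<in> carrier G. \<phi> x = \<psi> x}"
    if "x \<in> {x \<in> carrier G. \<phi> x = \<psi> x}" "y \<in> {x \<in> carrier G. \<phi> x = \<psi> x}" for x y
    using that hom_mult[OF assms(2)] hom_mult[OF assms(3)] by simp
  show "inv x \<in> {x \<in> carrier G. \<phi> x = \<psi> x}" if "x \<in> {x \<in> carrier G. \<phi> x = \<psi> x}" for x
    using that group_hom.hom_inv[of G H \<phi> x] group_hom.hom_inv[of G H \<psi> x] assms
    by (simp add: group_hom_def group_hom_axioms_def)
  show "\<one> \<in> {x \<in> carrier G. \<phi> x = \<psi> x}"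
    using hom_one[OF assms(2)] hom_one[OF assms(3)] assms(1) by simp
qed auto

section \<open>A criterion for largeness\<close>

definition F2 :: "(nat \<times> bool) list set monoid" where
  "F2 = free_group {0, 1}"

lemma group_F2: "group F2"
  by (simp add: F2_def group_free_group)

lemma fg_gen_F2 [simp]: "fg_gen 0 \<in> carrier F2" "fg_gen 1 \<in> carrier F2" "fg_gen (Suc 0) \<in> carrier F2"
  using fg_gen_carrier[of 0] fg_gen_carrier[of 1] by (simp_all add: F2_def)

lemma largeI:
  assumes "subgroup H G" "finite (rcosets\<^bsub>G\<^esub> H)" "\<phi> \<in> epi (G\<lparr>carrier := H\<rparr>) F2"
  shows "large G"
  using assms by (auto simp: large_def F2_def)

text \<open>\<open>\<sigma>\<close> is an action on a finite set and \<open>\<kappa>\<close> a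
  cocycle over it with values in \<open>F2\<close>. On the stabilizer of \<open>\<omega>\<close>,
  which has finite index, the cocycle is a homomorphism, and \<open>g0\<close> and \<open>g1\<close>
  make it onto.\<close>

lemma large_by_cocycle:
  fixes G (structure)
  assumes G: "group G" and fin: "finite \<Omega>" and base: "\<omega> \<in> \<Omega>"
    and \<sigma>: "\<And>g x. g \<in> carrier G \<Longrightarrow> x \<in> \<Omega> \<Longrightarrow> \<sigma> g x \<in> \<Omega>"
    and \<sigma>_mult: "\<And>g h x. g \<in> carrier G \<Longrightarrow> h \<in> carrier G \<Longrightarrow> x \<in> \<Omega> \<Longrightarrow> \<sigma> (g \<otimes> h) x = \<sigma> g (\<sigma> h x)"
    and \<sigma>_one: "\<And>x. x \<in> \<Omega> \<Longrightarrow> \<sigma> \<one> x = x"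
    and \<kappa>: "\<And>g x. g \<in> carrier G \<Longrightarrow> x \<in> \<Omega> \<Longrightarrow> \<kappa> g x \<in> carrier F2"
    and \<kappa>_mult: "\<And>g h x. g \<in> carrier G \<Longrightarrow> h \<in> carrier G \<Longrightarrow> x \<in> \<Omega> \<Longrightarrow>
        \<kappa> (g \<otimes> h) x = \<kappa> g (\<sigma> h x) \<otimes>\<^bsub>F2\<^esub> \<kappa> h x"
    and g0: "g0 \<in> carrier G" "\<sigma> g0 \<omega> = \<omega>" "\<kappa> g0 \<omega> = fg_gen 0"
    and g1: "g1 \<in> carrier G" "\<sigma> g1 \<omega> = \<omega>" "\<kappa> g1 \<omega> = fg_gen 1"
  shows "large G"
proof -
  interpret G: group G by fact
  define H where "H = {g \<in> carrier G. \<sigma> g \<omega> = \<omega>}"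
  have inv_\<sigma>: "\<sigma> (inv g) (\<sigma> g x) = x" "\<sigma> g (\<sigma> (inv g) x) = x" if "g \<in> carrier G" "x \<in> \<Omega>" for g x
    using that \<sigma>_mult[of "inv g" g x] \<sigma>_mult[of g "inv g" x] \<sigma>_one[of x] by simp_all
  have H: "subgroup H G"
  proof (rule subgroup.intro)
    show "H \<subseteq> carrier G" "\<one> \<in> H"
      using \<sigma>_one[OF base] by (simp_all add: H_def subset_iff)
    show "x \<otimes> y \<in> H" if "x \<in> H" "y \<in> H" for x y
      using that \<sigma>_mult[of x y \<omega>] base by (simp add: H_def)
    show "inv x \<in> H" if "x \<in> H" for x
      using that inv_\<sigma>(1)[of x \<omega>] base by (simp add: H_def)
  qed
  \<comment> \<open>A right coset of the stabilizer is a fibre of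
    \<open>g \<mapsto> \<sigma> (inv g) \<omega>\<close>, whence the inverses; so there are at most
    as many cosets as points of \<open>\<Omega>\<close>.\<close>
  have "H #> g = {k \<in> carrier G. \<sigma> (inv k) \<omega> = \<sigma> (inv g) \<omega>}" if g: "g \<in> carrier G" for g
  proof (intro equalityI subsetI)
    fix k assume "k \<in> H #> g"
    then obtain h where h: "h \<in> H" "k = h \<otimes> g"
      unfolding r_coset_def by blast
    then have "h \<in> carrier G" "\<sigma> (inv h) \<omega> = \<omega>"
      using subgroup.m_inv_closed[OF H h(1)] by (simp_all add: H_def)
    then show "k \<in> {k \<in> carrier G. \<sigma> (inv k) \<omega> = \<sigma> (inv g) \<omega>}"
      using g base \<sigma>_mult[of "inv g" "inv h" \<omega>] by (simp add: h(2) G.inv_mult_group)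
  next
    fix k assume "k \<in> {k \<in> carrier G. \<sigma> (inv k) \<omega> = \<sigma> (inv g) \<omega>}"
    then have k: "k \<in> carrier G" "\<sigma> (inv k) \<omega> = \<sigma> (inv g) \<omega>" by simp_all
    have "\<sigma> (k \<otimes> inv g) \<omega> = \<omega>"
      using g k \<sigma>_mult[of k "inv g" \<omega>] inv_\<sigma>(2)[of k \<omega>] base by simp
    then have "k \<otimes> inv g \<in> H"
      using g k by (simp add: H_def)
    moreover have "k = (k \<otimes> inv g) \<otimes> g"
      using g k by (simp add: G.m_assoc)
    ultimately show "k \<in> H #> g"
      unfolding r_coset_def by blast
  qed
  then have "rcosets H \<subseteq> (\<lambda>x. {k \<in> carrier G. \<sigma> (inv k) \<omega> = x}) ` \<Omega>"
    using \<sigma>[OF G.inv_closed base] by (auto simp: RCOSETS_def)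
  then have fin_cosets: "finite (rcosets H)"
    using fin by (rule finite_surj[rotated])
  have hom: "(\<lambda>g. \<kappa> g \<omega>) \<in> hom (G\<lparr>carrier := H\<rparr>) F2"
  proof (rule homI)
    fix x y assume "x \<in> carrier (G\<lparr>carrier := H\<rparr>)" "y \<in> carrier (G\<lparr>carrier := H\<rparr>)"
    then show "\<kappa> (x \<otimes>\<^bsub>G\<lparr>carrier := H\<rparr>\<^esub> y) \<omega> = \<kappa> x \<omega> \<otimes>\<^bsub>F2\<^esub> \<kappa> y \<omega>"
      using \<kappa>_mult[of x y \<omega>] base by (simp add: H_def)
  next
    fix x assume "x \<in> carrier (G\<lparr>carrier := H\<rparr>)"
    then show "\<kappa> x \<omega> \<in> carrier F2"
      using \<kappa>[of x \<omega>] base by (simp add: H_def)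
  qed
  interpret h: group_hom "G\<lparr>carrier := H\<rparr>" F2 "\<lambda>g. \<kappa> g \<omega>"
    using hom G.subgroup_imp_group[OF H] group_F2
    by (intro group_hom.intro group_hom_axioms.intro)
  have "(\<lambda>g. \<kappa> g \<omega>) ` carrier (G\<lparr>carrier := H\<rparr>) = carrier F2"
  unfolding F2_def
  proof (rule free_group_generated[OF h.img_is_subgroup[unfolded F2_def]])
    show "fg_gen 0 \<in> (\<lambda>g. \<kappa> g \<omega>) ` carrier (G\<lparr>carrier := H\<rparr>)"
      using g0 by (intro image_eqI[of _ _ g0]) (simp_all add: H_def)
    show "fg_gen 1 \<in> (\<lambda>g. \<kappa> g \<omega>) ` carrier (G\<lparr>carrier := H\<rparr>)"
      using g1 by (intro image_eqI[of _ _ g1]) (simp_all add: H_def)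
  qed
  then have "(\<lambda>g. \<kappa> g \<omega>) \<in> epi (G\<lparr>carrier := H\<rparr>) F2"
    using hom by (simp add: epi_def)
  with H fin_cosets show ?thesis
    by (rule largeI)
qed

text \<open>A virtually free substitute for the free product of \<open>A\<close> and \<open>B\<close>: both groups act on
  \<open>A \<times> B \<times> F\<^sub>2\<close>, the group \<open>B\<close> by translation and \<open>A\<close> by translation conjugated
  by \<open>(x, y, z) \<mapsto> (x, y, twist x y \<cdot> z)\<close>.\<close>

locale free_product_action = A: group A + B: group B
  for A :: "('a, 'm) monoid_scheme" and B :: "('b, 'n) monoid_scheme" +
  fixes a :: 'a and b b' :: 'b
  assumes finite_A: "finite (carrier A)" and finite_B: "finite (carrier B)"
    and a: "a \<in> carrier A" "a \<noteq> \<one>\<^bsub>A\<^esub>"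
    and b: "b \<in> carrier B" "b \<noteq> \<one>\<^bsub>B\<^esub>"
    and b': "b' \<in> carrier B" "b' \<noteq> \<one>\<^bsub>B\<^esub>" "b' \<noteq> b"
begin

sublocale F: group F2 by (rule group_F2)

text \<open>Trivial if \<open>x\<close> or \<open>y\<close> is the unit, so that only the corner
  \<open>(a, b)\<close> or \<open>(a, b')\<close> of a commutator square contributes. The inverses
  make the contribution \<open>fg_gen 0\<close> or \<open>fg_gen 1\<close> itself.\<close>

definition twist :: "'a \<Rightarrow> 'b \<Rightarrow> (nat \<times> bool) list set" where
  "twist x y = (if x = a \<and> y = b then inv\<^bsub>F2\<^esub> fg_gen 0
     else if x = a \<and> y = b' then inv\<^bsub>F2\<^esub> fg_gen 1 else \<one>\<^bsub>F2\<^esub>)"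

definition space :: "('a \<times> 'b \<times> (nat \<times> bool) list set) set" where
  "space = carrier A \<times> carrier B \<times> carrier F2"

text \<open>The permutations that commute with right translation of the third coordinate, that is, a
  wreath product of \<open>F2\<close> by the symmetric group of \<open>A \<times> B\<close>.
  Equivariance is stated as a comparison with the value at third coordinate one.\<close>

definition W :: "('a \<times> 'b \<times> (nat \<times> bool) list set \<Rightarrow> 'a \<times> 'b \<times> (nat \<times> bool) list set) monoid" where
  "W = BijGroup space\<lparr>carrier := {f \<in> Bij space. \<forall>x\<in>carrier A. \<forall>y\<in>carrier B. \<forall>z\<in>carrier F2.
     \<forall>x' y' z'. f (x, y, \<one>\<^bsub>F2\<^esub>) = (x', y', z') \<longrightarrow> f (x, y, z) = (x', y', z' \<otimes>\<^bsub>F2\<^esub> z)}\<rparr>"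

definition iA :: "'a \<Rightarrow> 'a \<times> 'b \<times> (nat \<times> bool) list set \<Rightarrow> 'a \<times> 'b \<times> (nat \<times> bool) list set" where
  "iA k = restrict (\<lambda>(x, y, z). (k \<otimes>\<^bsub>A\<^esub> x, y,
     twist (k \<otimes>\<^bsub>A\<^esub> x) y \<otimes>\<^bsub>F2\<^esub> inv\<^bsub>F2\<^esub> twist x y \<otimes>\<^bsub>F2\<^esub> z)) space"

definition iB :: "'b \<Rightarrow> 'a \<times> 'b \<times> (nat \<times> bool) list set \<Rightarrow> 'a \<times> 'b \<times> (nat \<times> bool) list set" where
  "iB k = restrict (\<lambda>(x, y, z). (x, k \<otimes>\<^bsub>B\<^esub> y, z)) space"

lemma twist_closed [simp]: "twist x y \<in> carrier F2"
  by (simp add: twist_def)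

lemma W_apply:
  assumes "f \<in> carrier W" "x \<in> carrier A" "y \<in> carrier B" "z \<in> carrier F2"
    and "f (x, y, \<one>\<^bsub>F2\<^esub>) = (x', y', z')"
  shows "f (x, y, z) = (x', y', z' \<otimes>\<^bsub>F2\<^esub> z)"
  using assms by (simp add: W_def)

lemma W_Bij: "f \<in> carrier W \<Longrightarrow> f \<in> Bij space"
  by (simp add: W_def)

lemma W_space: "f \<in> carrier W \<Longrightarrow> s \<in> space \<Longrightarrow> f s \<in> space"
  using Bij_imp_funcset[OF W_Bij] by blast

lemma W_mult: "f \<in> carrier W \<Longrightarrow> g \<in> carrier W \<Longrightarrow> s \<in> space \<Longrightarrow> (f \<otimes>\<^bsub>W\<^esub> g) s = f (g s)"
  by (simp add: W_def BijGroup_def compose_def)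

lemma W_one: "s \<in> space \<Longrightarrow> \<one>\<^bsub>W\<^esub> s = s"
  by (simp add: W_def BijGroup_def)

lemma group_W: "group W"
proof -
  interpret Bij: group "BijGroup space" by (rule group_BijGroup)
  have mem: "f \<in> carrier W" if "f \<in> Bij space"
    and "\<And>x y z x' y' z'. x \<in> carrier A \<Longrightarrow> y \<in> carrier B \<Longrightarrow> z \<in> carrier F2 \<Longrightarrow>
      f (x, y, \<one>\<^bsub>F2\<^esub>) = (x', y', z') \<Longrightarrow> f (x, y, z) = (x', y', z' \<otimes>\<^bsub>F2\<^esub> z)" for f
    using that by (simp add: W_def)
  have "subgroup (carrier W) (BijGroup space)"
  proof (rule subgroup.intro)
    show "carrier W \<subseteq> carrier (BijGroup space)"
      by (auto simp: W_def BijGroup_def)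
    show "\<one>\<^bsub>BijGroup space\<^esub> \<in> carrier W"
      by (rule mem) (auto simp: BijGroup_def id_Bij space_def)
  next
    fix f g assume fg: "f \<in> carrier W" "g \<in> carrier W"
    have eq: "f \<otimes>\<^bsub>BijGroup space\<^esub> g = compose space f g"
      using fg by (simp add: BijGroup_def W_Bij)
    show "f \<otimes>\<^bsub>BijGroup space\<^esub> g \<in> carrier W"
      unfolding eq
    proof (rule mem)
      show "compose space f g \<in> Bij space"
        using fg by (simp add: compose_Bij W_Bij)
      fix x y z x' y' z'
      assume s: "x \<in> carrier A" "y \<in> carrier B" "z \<in> carrier F2"
        and *: "compose space f g (x, y, \<one>\<^bsub>F2\<^esub>) = (x', y', z')"
      obtain u v w where g: "g (x, y, \<one>\<^bsub>F2\<^esub>) = (u, v, w)" by (metis prod_cases3)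
      have sp: "(x, y, \<one>\<^bsub>F2\<^esub>) \<in> space" "(x, y, z) \<in> space"
        using s by (simp_all add: space_def)
      then have uvw: "u \<in> carrier A" "v \<in> carrier B" "w \<in> carrier F2"
        using W_space[OF fg(2) sp(1)] g by (simp_all add: space_def)
      obtain u' v' w' where f: "f (u, v, \<one>\<^bsub>F2\<^esub>) = (u', v', w')" by (metis prod_cases3)
      have w': "w' \<in> carrier F2"
        using W_space[OF fg(1), of "(u, v, \<one>\<^bsub>F2\<^esub>)"] uvw f by (simp add: space_def)
      have "(x', y', z') = (u', v', w' \<otimes>\<^bsub>F2\<^esub> w)"
        using * sp(1) g W_apply[OF fg(1) uvw f] by (simp add: compose_def)
      moreover have "compose space f g (x, y, z) = (u', v', w' \<otimes>\<^bsub>F2\<^esub> (w \<otimes>\<^bsub>F2\<^esub> z))"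
        using sp(2) W_apply[OF fg(2) s g] W_apply[OF fg(1) uvw(1,2) _ f, of "w \<otimes>\<^bsub>F2\<^esub> z"] uvw s
        by (simp add: compose_def)
      ultimately show "compose space f g (x, y, z) = (x', y', z' \<otimes>\<^bsub>F2\<^esub> z)"
        using uvw w' s by (simp add: F.m_assoc)
    qed
  next
    fix f assume f: "f \<in> carrier W"
    have eq: "inv\<^bsub>BijGroup space\<^esub> f = restrict (inv_into space f) space"
      by (rule inv_BijGroup[OF W_Bij[OF f]])
    have bij: "bij_betw f space space"
      using W_Bij[OF f] by (simp add: Bij_def)
    show "inv\<^bsub>BijGroup space\<^esub> f \<in> carrier W"
      unfolding eq
    proof (rule mem)
      show "restrict (inv_into space f) space \<in> Bij space"
        by (rule restrict_inv_into_Bij[OF W_Bij[OF f]])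
      fix x y z x' y' z'
      assume s: "x \<in> carrier A" "y \<in> carrier B" "z \<in> carrier F2"
        and *: "restrict (inv_into space f) space (x, y, \<one>\<^bsub>F2\<^esub>) = (x', y', z')"
      have sp: "(x, y, \<one>\<^bsub>F2\<^esub>) \<in> space" "(x, y, z) \<in> space"
        using s by (simp_all add: space_def)
      then have inv1: "inv_into space f (x, y, \<one>\<^bsub>F2\<^esub>) = (x', y', z')"
        using * by simp
      have sp': "(x', y', z') \<in> space"
        using Bij_inv_into_mem[OF W_Bij[OF f] sp(1)] inv1 by simp
      have f1: "f (x', y', z') = (x, y, \<one>\<^bsub>F2\<^esub>)"
        using bij_betw_inv_into_right[OF bij sp(1)] inv1 by simp
      obtain u v w where fu: "f (x', y', \<one>\<^bsub>F2\<^esub>) = (u, v, w)" by (metis prod_cases3)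
      have c: "x' \<in> carrier A" "y' \<in> carrier B" "z' \<in> carrier F2"
        using sp' by (simp_all add: space_def)
      have w: "w \<in> carrier F2"
        using W_space[OF f, of "(x', y', \<one>\<^bsub>F2\<^esub>)"] fu c by (simp add: space_def)
      have 1: "u = x" "v = y" "w \<otimes>\<^bsub>F2\<^esub> z' = \<one>\<^bsub>F2\<^esub>"
        using W_apply[OF f c fu] f1 by simp_all
      have "f (x', y', z' \<otimes>\<^bsub>F2\<^esub> z) = (x, y, w \<otimes>\<^bsub>F2\<^esub> (z' \<otimes>\<^bsub>F2\<^esub> z))"
        using W_apply[OF f c(1,2) _ fu, of "z' \<otimes>\<^bsub>F2\<^esub> z"] c s 1 by simp
      also have "w \<otimes>\<^bsub>F2\<^esub> (z' \<otimes>\<^bsub>F2\<^esub> z) = z"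
        using 1 c s w by (simp flip: F.m_assoc)
      finally have "inv_into space f (x, y, z) = (x', y', z' \<otimes>\<^bsub>F2\<^esub> z)"
        using c s bij by (intro inv_into_f_eq) (simp_all add: space_def bij_betw_def)
      then show "restrict (inv_into space f) space (x, y, z) = (x', y', z' \<otimes>\<^bsub>F2\<^esub> z)"
        using sp by simp
    qed
  qed
  then have "group ((BijGroup space)\<lparr>carrier := carrier W\<rparr>)"
    by (rule Bij.subgroup_imp_group)
  then show ?thesis by (simp add: W_def)
qed

sublocale W: group W by (rule group_W)

text \<open>Bijectivity of \<open>f k\<close> comes for free from the action laws, since
  \<open>f (inv k)\<close> is an inverse map.\<close>

lemma W_hom:
  assumes K: "group K"
    and ext: "\<And>k. k \<in> carrier K \<Longrightarrow> f k \<in> extensional space"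
    and sp: "\<And>k s. k \<in> carrier K \<Longrightarrow> s \<in> space \<Longrightarrow> f k s \<in> space"
    and mult: "\<And>k l s. k \<in> carrier K \<Longrightarrow> l \<in> carrier K \<Longrightarrow> s \<in> space \<Longrightarrow> f (k \<otimes>\<^bsub>K\<^esub> l) s = f k (f l s)"
    and one: "\<And>s. s \<in> space \<Longrightarrow> f \<one>\<^bsub>K\<^esub> s = s"
    and eqv: "\<And>k x y z x' y' z'. k \<in> carrier K \<Longrightarrow> x \<in> carrier A \<Longrightarrow> y \<in> carrier B \<Longrightarrow> z \<in> carrier F2 \<Longrightarrow>
      f k (x, y, \<one>\<^bsub>F2\<^esub>) = (x', y', z') \<Longrightarrow> f k (x, y, z) = (x', y', z' \<otimes>\<^bsub>F2\<^esub> z)"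
  shows "f \<in> hom K W"
proof -
  interpret K: group K by fact
  have bij: "f k \<in> Bij space" if k: "k \<in> carrier K" for k
  proof -
    have "bij_betw (f k) space space"
    proof (rule bij_betwI[of _ _ _ "f (inv\<^bsub>K\<^esub> k)"])
      show "f k \<in> space \<rightarrow> space" "f (inv\<^bsub>K\<^esub> k) \<in> space \<rightarrow> space"
        using sp k by simp_all
      show "f (inv\<^bsub>K\<^esub> k) (f k s) = s" "f k (f (inv\<^bsub>K\<^esub> k) s) = s" if "s \<in> space" for s
        using that k mult[of "inv\<^bsub>K\<^esub> k" k s] mult[of k "inv\<^bsub>K\<^esub> k" s] one by simp_all
    qed
    then show ?thesis using ext[OF k] by (simp add: Bij_def)
  qed
  show ?thesis
  proof (rule homI)
    show "f k \<in> carrier W" if "k \<in> carrier K" for k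
      using bij[OF that] eqv[OF that] by (simp add: W_def)
    fix k l assume kl: "k \<in> carrier K" "l \<in> carrier K"
    have "f (k \<otimes>\<^bsub>K\<^esub> l) = compose space (f k) (f l)"
    proof (rule extensionalityI[of _ space])
      show "f (k \<otimes>\<^bsub>K\<^esub> l) \<in> extensional space"
        using ext kl by simp
      show "compose space (f k) (f l) \<in> extensional space"
        by (rule compose_extensional)
      show "f (k \<otimes>\<^bsub>K\<^esub> l) s = compose space (f k) (f l) s" if "s \<in> space" for s
        using mult[OF kl that] that by (simp add: compose_def)
    qed
    then show "f (k \<otimes>\<^bsub>K\<^esub> l) = f k \<otimes>\<^bsub>W\<^esub> f l"
      using bij kl by (simp add: W_def BijGroup_def)
  qed
qed

lemma iA_apply: "x \<in> carrier A \<Longrightarrow> y \<in> carrier B \<Longrightarrow> z \<in> carrier F2 \<Longrightarrow> iA k (x, y, z) =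
    (k \<otimes>\<^bsub>A\<^esub> x, y, twist (k \<otimes>\<^bsub>A\<^esub> x) y \<otimes>\<^bsub>F2\<^esub> inv\<^bsub>F2\<^esub> twist x y \<otimes>\<^bsub>F2\<^esub> z)"
  by (simp add: iA_def space_def)

lemma iB_apply: "x \<in> carrier A \<Longrightarrow> y \<in> carrier B \<Longrightarrow> z \<in> carrier F2 \<Longrightarrow>
    iB k (x, y, z) = (x, k \<otimes>\<^bsub>B\<^esub> y, z)"
  by (simp add: iB_def space_def)

lemma iA_hom: "iA \<in> hom A W"
proof (rule W_hom)
  show "group A" by (rule A.is_group)
  show "iA k \<in> extensional space" for k
    by (simp add: iA_def)
  show "iA k s \<in> space" if "k \<in> carrier A" "s \<in> space" for k s
    using that by (cases s) (simp add: space_def iA_apply)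
  show "iA (k \<otimes>\<^bsub>A\<^esub> l) s = iA k (iA l s)" if kl: "k \<in> carrier A" "l \<in> carrier A" and "s \<in> space" for k l s
  proof -
    obtain x y z where s: "s = (x, y, z)" "x \<in> carrier A" "y \<in> carrier B" "z \<in> carrier F2"
      using \<open>s \<in> space\<close> by (cases s) (simp add: space_def)
    \<comment> \<open>The twist factors of two successive translations telescope.\<close>
    have "inv\<^bsub>F2\<^esub> twist (l \<otimes>\<^bsub>A\<^esub> x) y \<otimes>\<^bsub>F2\<^esub> (twist (l \<otimes>\<^bsub>A\<^esub> x) y \<otimes>\<^bsub>F2\<^esub> w) = w" if "w \<in> carrier F2" for w
      using that by (simp flip: F.m_assoc)
    then show ?thesis
      using s kl by (simp add: iA_apply A.m_assoc F.m_assoc)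
  qed
  show "iA \<one>\<^bsub>A\<^esub> s = s" if "s \<in> space" for s
    using that by (cases s) (simp add: space_def iA_apply)
  show "iA k (x, y, z) = (x', y', z' \<otimes>\<^bsub>F2\<^esub> z)"
    if "k \<in> carrier A" "x \<in> carrier A" "y \<in> carrier B" "z \<in> carrier F2" "iA k (x, y, \<one>\<^bsub>F2\<^esub>) = (x', y', z')" for k x y z x' y' z'
    using that by (auto simp: iA_apply)
qed

lemma iB_hom: "iB \<in> hom B W"
proof (rule W_hom)
  show "group B" by (rule B.is_group)
  show "iB k \<in> extensional space" for k
    by (simp add: iB_def)
  show "iB k s \<in> space" if "k \<in> carrier B" "s \<in> space" for k s
    using that by (cases s) (simp add: space_def iB_apply)
  show "iB (k \<otimes>\<^bsub>B\<^esub> l) s = iB k (iB l s)" if "k \<in> carrier B" "l \<in> carrier B" "s \<in> space" for k l s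
    using that by (cases s) (simp add: space_def iB_apply B.m_assoc)
  show "iB \<one>\<^bsub>B\<^esub> s = s" if "s \<in> space" for s
    using that by (cases s) (simp add: space_def iB_apply)
  show "iB k (x, y, z) = (x', y', z' \<otimes>\<^bsub>F2\<^esub> z)"
    if "k \<in> carrier B" "x \<in> carrier A" "y \<in> carrier B" "z \<in> carrier F2" "iB k (x, y, \<one>\<^bsub>F2\<^esub>) = (x', y', z')" for k x y z x' y' z'
    using that by (auto simp: iB_apply)
qed

sublocale iA: group_hom A W iA
  by unfold_locales (rule iA_hom)

sublocale iB: group_hom B W iB
  by unfold_locales (rule iB_hom)

text \<open>The base point runs round the square \<open>(1, 1)\<close>, \<open>(a, 1)\<close>,
  \<open>(a, c)\<close>, \<open>(1, c)\<close>. The twist is trivial at all corners but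
  \<open>(a, c)\<close>, and leaving this corner by \<open>iA\<close> contributes its
  inverse.\<close>

lemma commutator_apply:
  assumes c: "c \<in> carrier B" "c \<noteq> \<one>\<^bsub>B\<^esub>"
  shows "(iB (inv\<^bsub>B\<^esub> c) \<otimes>\<^bsub>W\<^esub> (iA (inv\<^bsub>A\<^esub> a) \<otimes>\<^bsub>W\<^esub> (iB c \<otimes>\<^bsub>W\<^esub> iA a))) (\<one>\<^bsub>A\<^esub>, \<one>\<^bsub>B\<^esub>, \<one>\<^bsub>F2\<^esub>) =
    (\<one>\<^bsub>A\<^esub>, \<one>\<^bsub>B\<^esub>, inv\<^bsub>F2\<^esub> twist a c)"
proof -
  have tw: "twist x \<one>\<^bsub>B\<^esub> = \<one>\<^bsub>F2\<^esub>" "twist \<one>\<^bsub>A\<^esub> y = \<one>\<^bsub>F2\<^esub>" for x y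
    using a b b' by (auto simp: twist_def)
  have sp: "(x, y, z) \<in> space \<longleftrightarrow> x \<in> carrier A \<and> y \<in> carrier B \<and> z \<in> carrier F2" for x y z
    by (simp add: space_def)
  show ?thesis
    using a(1) c(1) by (simp add: W_mult sp iA_apply iB_apply tw del: iA.hom_inv iB.hom_inv)
qed

text \<open>The image of \<open>(x, y, 1)\<close>, read coordinatewise, yields an action on the
  finite set \<open>A \<times> B\<close> and a cocycle with values in \<open>F2\<close>. The
  commutators of \<open>a\<close> with \<open>b\<close> and with \<open>b'\<close> fix the base
  point and hit the two free generators.\<close>

lemma large_of_hom:
  assumes G: "group G" and \<phi>: "\<phi> \<in> hom G W"
    and im: "iA a \<in> \<phi> ` carrier G" "iB b \<in> \<phi> ` carrier G" "iB b' \<in> \<phi> ` carrier G"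
  shows "large G"
proof -
  interpret \<phi>: group_hom G W \<phi>
    using G \<phi> by (intro group_hom.intro group_hom_axioms.intro group_W)
  define \<sigma> where "\<sigma> g = (\<lambda>(x, y). case \<phi> g (x, y, \<one>\<^bsub>F2\<^esub>) of (x', y', z') \<Rightarrow> (x', y'))" for g
  define \<kappa> where "\<kappa> g = (\<lambda>(x, y). case \<phi> g (x, y, \<one>\<^bsub>F2\<^esub>) of (x', y', z') \<Rightarrow> z')" for g
  have \<phi>_split: "\<phi> g (x, y, \<one>\<^bsub>F2\<^esub>) = (fst (\<sigma> g (x, y)), snd (\<sigma> g (x, y)), \<kappa> g (x, y))" for g x y
    by (simp add: \<sigma>_def \<kappa>_def split: prod.split)
  have closed: "\<sigma> g (x, y) \<in> carrier A \<times> carrier B" "\<kappa> g (x, y) \<in> carrier F2"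
    if "g \<in> carrier G" "x \<in> carrier A" "y \<in> carrier B" for g x y
  proof -
    have "\<phi> g (x, y, \<one>\<^bsub>F2\<^esub>) \<in> space"
      by (rule W_space) (use that in \<open>simp_all add: space_def\<close>)
    then show "\<sigma> g (x, y) \<in> carrier A \<times> carrier B" "\<kappa> g (x, y) \<in> carrier F2"
      by (simp_all add: \<phi>_split space_def mem_Times_iff)
  qed
  have mult: "\<sigma> (g \<otimes>\<^bsub>G\<^esub> h) (x, y) = \<sigma> g (\<sigma> h (x, y)) \<and> \<kappa> (g \<otimes>\<^bsub>G\<^esub> h) (x, y) = \<kappa> g (\<sigma> h (x, y)) \<otimes>\<^bsub>F2\<^esub> \<kappa> h (x, y)"
    if gh: "g \<in> carrier G" "h \<in> carrier G" and xy: "x \<in> carrier A" "y \<in> carrier B" for g h x y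
  proof -
    obtain u v where uv: "\<sigma> h (x, y) = (u, v)" by (cases "\<sigma> h (x, y)")
    have c: "u \<in> carrier A" "v \<in> carrier B" "\<kappa> h (x, y) \<in> carrier F2"
      using closed[OF gh(2) xy] uv by simp_all
    have "\<phi> (g \<otimes>\<^bsub>G\<^esub> h) (x, y, \<one>\<^bsub>F2\<^esub>) = \<phi> g (\<phi> h (x, y, \<one>\<^bsub>F2\<^esub>))"
      using gh xy by (simp add: W_mult space_def)
    also have "\<dots> = \<phi> g (u, v, \<kappa> h (x, y))"
      by (simp add: \<phi>_split uv)
    also have "\<dots> = (fst (\<sigma> g (u, v)), snd (\<sigma> g (u, v)), \<kappa> g (u, v) \<otimes>\<^bsub>F2\<^esub> \<kappa> h (x, y))"
      by (rule W_apply) (use gh c \<phi>_split[of g u v] in simp_all)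
    finally show ?thesis
      by (simp add: \<phi>_split uv prod_eq_iff)
  qed
  have one: "\<sigma> \<one>\<^bsub>G\<^esub> (x, y) = (x, y)" if "x \<in> carrier A" "y \<in> carrier B" for x y
    using that by (simp add: \<sigma>_def W_one space_def)
  have wit: "\<exists>g\<in>carrier G. \<sigma> g (\<one>\<^bsub>A\<^esub>, \<one>\<^bsub>B\<^esub>) = (\<one>\<^bsub>A\<^esub>, \<one>\<^bsub>B\<^esub>) \<and> \<kappa> g (\<one>\<^bsub>A\<^esub>, \<one>\<^bsub>B\<^esub>) = inv\<^bsub>F2\<^esub> twist a c"
    if c: "c \<in> carrier B" "c \<noteq> \<one>\<^bsub>B\<^esub>" and im_c: "iB c \<in> \<phi> ` carrier G" for c
  proof -
    obtain g where g: "g \<in> carrier G" "\<phi> g = iA a"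
      using im(1) by (metis image_iff)
    obtain h where h: "h \<in> carrier G" "\<phi> h = iB c"
      using im_c by (metis image_iff)
    let ?k = "inv\<^bsub>G\<^esub> h \<otimes>\<^bsub>G\<^esub> (inv\<^bsub>G\<^esub> g \<otimes>\<^bsub>G\<^esub> (h \<otimes>\<^bsub>G\<^esub> g))"
    have "\<phi> ?k = iB (inv\<^bsub>B\<^esub> c) \<otimes>\<^bsub>W\<^esub> (iA (inv\<^bsub>A\<^esub> a) \<otimes>\<^bsub>W\<^esub> (iB c \<otimes>\<^bsub>W\<^esub> iA a))"
      using g h c a(1) by (simp add: iA.hom_inv iB.hom_inv)
    then have "\<phi> ?k (\<one>\<^bsub>A\<^esub>, \<one>\<^bsub>B\<^esub>, \<one>\<^bsub>F2\<^esub>) = (\<one>\<^bsub>A\<^esub>, \<one>\<^bsub>B\<^esub>, inv\<^bsub>F2\<^esub> twist a c)"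
      by (simp only: commutator_apply[OF c])
    then have "\<sigma> ?k (\<one>\<^bsub>A\<^esub>, \<one>\<^bsub>B\<^esub>) = (\<one>\<^bsub>A\<^esub>, \<one>\<^bsub>B\<^esub>) \<and> \<kappa> ?k (\<one>\<^bsub>A\<^esub>, \<one>\<^bsub>B\<^esub>) = inv\<^bsub>F2\<^esub> twist a c"
      by (simp only: \<sigma>_def \<kappa>_def prod.case)
    moreover have "?k \<in> carrier G"
      using g h by simp
    ultimately show ?thesis by blast
  qed
  have tw: "inv\<^bsub>F2\<^esub> twist a b = fg_gen 0" "inv\<^bsub>F2\<^esub> twist a b' = fg_gen 1"
    using b b' by (simp_all add: twist_def)
  obtain g0 where g0: "g0 \<in> carrier G" "\<sigma> g0 (\<one>\<^bsub>A\<^esub>, \<one>\<^bsub>B\<^esub>) = (\<one>\<^bsub>A\<^esub>, \<one>\<^bsub>B\<^esub>)" "\<kappa> g0 (\<one>\<^bsub>A\<^esub>, \<one>\<^bsub>B\<^esub>) = fg_gen 0"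
    using wit[of b] b im(2) tw(1) by auto
  obtain g1 where g1: "g1 \<in> carrier G" "\<sigma> g1 (\<one>\<^bsub>A\<^esub>, \<one>\<^bsub>B\<^esub>) = (\<one>\<^bsub>A\<^esub>, \<one>\<^bsub>B\<^esub>)" "\<kappa> g1 (\<one>\<^bsub>A\<^esub>, \<one>\<^bsub>B\<^esub>) = fg_gen 1"
    using wit[of b'] b' im(3) tw(2) by auto
  show ?thesis
  proof (rule large_by_cocycle[of G "carrier A \<times> carrier B" "(\<one>\<^bsub>A\<^esub>, \<one>\<^bsub>B\<^esub>)" \<sigma> \<kappa> g0 g1])
    show "\<sigma> (g \<otimes>\<^bsub>G\<^esub> h) x = \<sigma> g (\<sigma> h x)" "\<kappa> (g \<otimes>\<^bsub>G\<^esub> h) x = \<kappa> g (\<sigma> h x) \<otimes>\<^bsub>F2\<^esub> \<kappa> h x"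
      if "g \<in> carrier G" "h \<in> carrier G" "x \<in> carrier A \<times> carrier B" for g h x
      using that mult[of g h "fst x" "snd x"] by (simp_all add: mem_Times_iff)
    show "\<sigma> g x \<in> carrier A \<times> carrier B" "\<kappa> g x \<in> carrier F2"
      if "g \<in> carrier G" "x \<in> carrier A \<times> carrier B" for g x
      using that closed[of g "fst x" "snd x"] by (simp_all add: mem_Times_iff)
    show "\<sigma> \<one>\<^bsub>G\<^esub> x = x" if "x \<in> carrier A \<times> carrier B" for x
      using that one[of "fst x" "snd x"] by (simp add: mem_Times_iff)
  qed (use G finite_A finite_B g0 g1 in simp_all)
qed

end

section \<open>Presentations of GBS groups\<close>

abbreviation gbs ::
    "('v, 'e) pre_digraph \<Rightarrow> ('e \<Rightarrow> 'e) \<Rightarrow> ('e \<Rightarrow> int) \<Rightarrow> ('v, 'e) pre_digraph \<Rightarrow> ('v \<times> int + 'e) list set monoid" where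
  "gbs \<Gamma> arev lab T \<equiv>
     fundamental_group \<Gamma> arev (\<lambda>_. integer_group) (\<lambda>_. integer_group) (\<lambda>e n. lab e * n) T"

definition gbs_letters :: "('v, 'e) pre_digraph \<Rightarrow> ('v \<times> int + 'e) set" where
  "gbs_letters \<Gamma> = (verts \<Gamma> \<times> UNIV) <+> arcs \<Gamma>"

definition gbs_rels ::
    "('v, 'e) pre_digraph \<Rightarrow> ('e \<Rightarrow> 'e) \<Rightarrow> ('e \<Rightarrow> int) \<Rightarrow> ('v, 'e) pre_digraph \<Rightarrow>
     (('v \<times> int + 'e) list \<times> ('v \<times> int + 'e) list) set" where
  "gbs_rels \<Gamma> arev lab T =
     {([Inl (v, g), Inl (v, h)], [Inl (v, g + h)]) | v g h. v \<in> verts \<Gamma>} \<union>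
     {([Inl (v, 0)], []) | v. v \<in> verts \<Gamma>} \<union>
     {([Inr e, Inr (arev e)], []) | e. e \<in> arcs \<Gamma>} \<union>
     {([Inr e, Inl (head \<Gamma> e, lab (arev e) * x), Inr (arev e)], [Inl (tail \<Gamma> e, lab e * x)]) | e x.
        e \<in> arcs \<Gamma>} \<union>
     {([Inr e], []) | e. e \<in> arcs T}"

lemma gbs_eq: "gbs \<Gamma> arev lab T = presented (gbs_letters \<Gamma>) (gbs_rels \<Gamma> arev lab T)"
  by (simp add: fundamental_group_def gbs_letters_def gbs_rels_def)

abbreviation gbs_class where
  "gbs_class \<Gamma> arev lab T \<equiv> word_class (gbs_letters \<Gamma>) (gbs_rels \<Gamma> arev lab T)"

definition vertex_gen where
  "vertex_gen \<Gamma> arev lab T v = gbs_class \<Gamma> arev lab T [Inl (v, 1)]"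

definition stable_letter where
  "stable_letter \<Gamma> arev lab T e = gbs_class \<Gamma> arev lab T [Inr e]"

text \<open>What the images of the vertex generators and of the stable letters must satisfy to
  define a homomorphism. Edge relations are in the commuted form and only for the generator of the
  edge group; the other elements of the edge group follow by taking powers.\<close>

definition gbs_images ::
    "('g, 'm) monoid_scheme \<Rightarrow> ('v, 'e) pre_digraph \<Rightarrow> ('e \<Rightarrow> 'e) \<Rightarrow> ('e \<Rightarrow> int) \<Rightarrow> ('v, 'e) pre_digraph \<Rightarrow>
     ('v \<Rightarrow> 'g) \<Rightarrow> ('e \<Rightarrow> 'g) \<Rightarrow> bool" where
  "gbs_images H \<Gamma> arev lab T X \<sigma> \<longleftrightarrow>
     (\<forall>v\<in>verts \<Gamma>. X v \<in> carrier H) \<and>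
     (\<forall>e\<in>arcs \<Gamma>. \<sigma> e \<in> carrier H \<and> \<sigma> e \<otimes>\<^bsub>H\<^esub> \<sigma> (arev e) = \<one>\<^bsub>H\<^esub> \<and>
        \<sigma> e \<otimes>\<^bsub>H\<^esub> X (head \<Gamma> e) [^]\<^bsub>H\<^esub> lab (arev e) = X (tail \<Gamma> e) [^]\<^bsub>H\<^esub> lab e \<otimes>\<^bsub>H\<^esub> \<sigma> e) \<and>
     (\<forall>e\<in>arcs T. \<sigma> e = \<one>\<^bsub>H\<^esub>)"

locale gbs_presentation = bidirected_digraph \<Gamma> arev
  for \<Gamma> :: "('v, 'e) pre_digraph" and arev :: "'e \<Rightarrow> 'e" +
  fixes lab :: "'e \<Rightarrow> int" and T :: "('v, 'e) pre_digraph"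
  assumes arcs_T: "arcs T \<subseteq> arcs \<Gamma>"
begin

abbreviation "G \<equiv> gbs \<Gamma> arev lab T"
abbreviation "cls \<equiv> gbs_class \<Gamma> arev lab T"
abbreviation "gv \<equiv> vertex_gen \<Gamma> arev lab T"
abbreviation "ge \<equiv> stable_letter \<Gamma> arev lab T"

lemma Inl_letter [simp]: "Inl (v, k) \<in> gbs_letters \<Gamma> \<longleftrightarrow> v \<in> verts \<Gamma>"
  and Inr_letter [simp]: "Inr e \<in> gbs_letters \<Gamma> \<longleftrightarrow> e \<in> arcs \<Gamma>"
  by (auto simp: gbs_letters_def)

lemma cls_vertex_mult: "v \<in> verts \<Gamma> \<Longrightarrow> cls [Inl (v, g), Inl (v, h)] = cls [Inl (v, g + h)]"
  by (rule word_class_rel) (auto simp: gbs_rels_def)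

lemma cls_vertex_zero: "v \<in> verts \<Gamma> \<Longrightarrow> cls [Inl (v, 0)] = cls []"
  by (rule word_class_rel) (auto simp: gbs_rels_def)

lemma cls_edge_inverse: "e \<in> arcs \<Gamma> \<Longrightarrow> cls [Inr e, Inr (arev e)] = cls []"
  by (rule word_class_rel) (auto simp: gbs_rels_def)

lemma cls_edge_conj: "e \<in> arcs \<Gamma> \<Longrightarrow>
    cls [Inr e, Inl (head \<Gamma> e, lab (arev e) * x), Inr (arev e)] = cls [Inl (tail \<Gamma> e, lab e * x)]"
  by (rule word_class_rel) (auto simp: gbs_rels_def)

lemma cls_tree: "e \<in> arcs T \<Longrightarrow> cls [Inr e] = cls []"
  using arcs_T by (intro word_class_rel) (auto simp: gbs_rels_def)

lemma group_G: "group G"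
  unfolding gbs_eq
proof (rule group_presented)
  fix a assume a: "a \<in> gbs_letters \<Gamma>"
  show "\<exists>w\<in>lists (gbs_letters \<Gamma>). cls (w @ [a]) = cls []"
  proof (cases a)
    case (Inl p)
    then obtain v k where a': "a = Inl (v, k)" "v \<in> verts \<Gamma>"
      using a by (cases p) simp
    then have "cls [Inl (v, - k), Inl (v, k)] = cls []"
      using cls_vertex_mult[of v "- k" k] cls_vertex_zero[of v] by simp
    then show ?thesis
      using a' by (intro bexI[of _ "[Inl (v, - k)]"]) simp_all
  next
    case (Inr e)
    then have e: "e \<in> arcs \<Gamma>" using a by simp
    then have "cls [Inr (arev e), Inr e] = cls []"
      using cls_edge_inverse[of "arev e"] by simp
    then show ?thesis
      using Inr e by (intro bexI[of _ "[Inr (arev e)]"]) simp_all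
  qed
qed

sublocale G: group G by (rule group_G)

lemma mult_cls: "u \<in> lists (gbs_letters \<Gamma>) \<Longrightarrow> v \<in> lists (gbs_letters \<Gamma>) \<Longrightarrow> cls u \<otimes>\<^bsub>G\<^esub> cls v = cls (u @ v)"
  unfolding gbs_eq by (rule mult_word_class)

lemma one_cls: "\<one>\<^bsub>G\<^esub> = cls []"
  unfolding gbs_eq by (rule one_presented)

lemma cls_carrier: "w \<in> lists (gbs_letters \<Gamma>) \<Longrightarrow> cls w \<in> carrier G"
  unfolding gbs_eq by (rule word_class_carrier)

lemma gv_carrier [simp]: "v \<in> verts \<Gamma> \<Longrightarrow> gv v \<in> carrier G"
  unfolding vertex_gen_def by (rule cls_carrier) simp

lemma ge_carrier [simp]: "e \<in> arcs \<Gamma> \<Longrightarrow> ge e \<in> carrier G"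
  unfolding stable_letter_def by (rule cls_carrier) simp

lemma cls_vertex:
  assumes v: "v \<in> verts \<Gamma>"
  shows "cls [Inl (v, k)] = gv v [^]\<^bsub>G\<^esub> k"
proof -
  have "(\<lambda>k. cls [Inl (v, k)]) \<in> hom integer_group G"
  proof (rule homI)
    fix k l :: int
    show "cls [Inl (v, k)] \<in> carrier G"
      using v by (intro cls_carrier) simp
    show "cls [Inl (v, k \<otimes>\<^bsub>integer_group\<^esub> l)] = cls [Inl (v, k)] \<otimes>\<^bsub>G\<^esub> cls [Inl (v, l)]"
      using v by (simp add: mult_cls cls_vertex_mult)
  qed
  then have "cls [Inl (v, 1 [^]\<^bsub>integer_group\<^esub> k)] = cls [Inl (v, 1)] [^]\<^bsub>G\<^esub> k"
    by (rule hom_int_pow) (simp_all add: group_G)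
  then show ?thesis
    by (simp add: vertex_gen_def)
qed

lemma gbs_images_G: "gbs_images G \<Gamma> arev lab T gv ge"
proof -
  have "ge e \<otimes>\<^bsub>G\<^esub> ge (arev e) = \<one>\<^bsub>G\<^esub>" if "e \<in> arcs \<Gamma>" for e
    using that by (simp add: stable_letter_def mult_cls one_cls cls_edge_inverse)
  moreover have "ge e \<otimes>\<^bsub>G\<^esub> gv (head \<Gamma> e) [^]\<^bsub>G\<^esub> lab (arev e) = gv (tail \<Gamma> e) [^]\<^bsub>G\<^esub> lab e \<otimes>\<^bsub>G\<^esub> ge e"
    if e: "e \<in> arcs \<Gamma>" for e
  proof -
    have "gv (tail \<Gamma> e) [^]\<^bsub>G\<^esub> lab e \<otimes>\<^bsub>G\<^esub> ge e = cls [Inl (tail \<Gamma> e, lab e * 1)] \<otimes>\<^bsub>G\<^esub> cls [Inr e]"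
      using e by (simp add: cls_vertex stable_letter_def)
    also have "\<dots> = cls [Inr e, Inl (head \<Gamma> e, lab (arev e) * 1), Inr (arev e)] \<otimes>\<^bsub>G\<^esub> cls [Inr e]"
      using e by (simp only: cls_edge_conj)
    also have "\<dots> = cls [Inr e, Inl (head \<Gamma> e, lab (arev e) * 1)] \<otimes>\<^bsub>G\<^esub> cls [Inr (arev e), Inr (arev (arev e))]"
      using e by (simp add: mult_cls)
    also have "\<dots> = cls [Inr e, Inl (head \<Gamma> e, lab (arev e) * 1)] \<otimes>\<^bsub>G\<^esub> cls []"
      using e by (simp only: cls_edge_inverse arev_in_arcs)
    also have "\<dots> = cls [Inr e] \<otimes>\<^bsub>G\<^esub> cls [Inl (head \<Gamma> e, lab (arev e) * 1)]"
      using e by (simp add: mult_cls)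
    also have "\<dots> = ge e \<otimes>\<^bsub>G\<^esub> gv (head \<Gamma> e) [^]\<^bsub>G\<^esub> lab (arev e)"
      using e by (simp add: cls_vertex stable_letter_def)
    finally show ?thesis by simp
  qed
  moreover have "ge e = \<one>\<^bsub>G\<^esub>" if "e \<in> arcs T" for e
    using that by (simp add: stable_letter_def one_cls cls_tree)
  ultimately show ?thesis
    unfolding gbs_images_def by (simp add: gv_carrier ge_carrier)
qed

lemma G_generated:
  assumes K: "subgroup K G" and v: "\<And>v. v \<in> verts \<Gamma> \<Longrightarrow> gv v \<in> K"
    and e: "\<And>e. e \<in> arcs \<Gamma> \<Longrightarrow> ge e \<in> K"
  shows "K = carrier G"
  using group_G K unfolding gbs_eq
proof (rule presented_generated)
  fix a assume a: "a \<in> gbs_letters \<Gamma>"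
  show "cls [a] \<in> K"
  proof (cases a)
    case (Inl p)
    then obtain v k where a': "a = Inl (v, k)" "v \<in> verts \<Gamma>"
      using a by (cases p) simp
    then show ?thesis
      using v G.subgroup_int_pow_closed[OF K] by (simp add: cls_vertex)
  next
    case (Inr x)
    then show ?thesis
      using a e by (simp add: stable_letter_def)
  qed
qed

text \<open>Conjugation by \<open>\<sigma> e\<close> is an endomorphism of \<open>H\<close>, so that
  the edge relation for the exponents \<open>lab e\<close> and \<open>lab (arev e)\<close> implies
  it for all their multiples by \<open>x\<close>.\<close>

lemma gbs_hom:
  assumes H: "group H" and im: "gbs_images H \<Gamma> arev lab T X \<sigma>"
  obtains \<phi> where "\<phi> \<in> hom G H" "\<And>v. v \<in> verts \<Gamma> \<Longrightarrow> \<phi> (gv v) = X v"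
    "\<And>e. e \<in> arcs \<Gamma> \<Longrightarrow> \<phi> (ge e) = \<sigma> e"
proof -
  interpret H: group H by fact
  have X: "X v \<in> carrier H" if "v \<in> verts \<Gamma>" for v
    using im that by (simp add: gbs_images_def)
  have \<sigma>: "\<sigma> e \<in> carrier H" "\<sigma> e \<otimes>\<^bsub>H\<^esub> \<sigma> (arev e) = \<one>\<^bsub>H\<^esub>"
      "\<sigma> e \<otimes>\<^bsub>H\<^esub> X (head \<Gamma> e) [^]\<^bsub>H\<^esub> lab (arev e) = X (tail \<Gamma> e) [^]\<^bsub>H\<^esub> lab e \<otimes>\<^bsub>H\<^esub> \<sigma> e"
    if "e \<in> arcs \<Gamma>" for e
    using im that by (simp_all add: gbs_images_def)
  have \<sigma>T: "\<sigma> e = \<one>\<^bsub>H\<^esub>" if "e \<in> arcs T" for e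
    using im that by (simp add: gbs_images_def)
  define f where "f = case_sum (\<lambda>(v, k :: int). X v [^]\<^bsub>H\<^esub> k) \<sigma>"
  have f: "f \<in> gbs_letters \<Gamma> \<rightarrow> carrier H"
    using X \<sigma>(1) by (auto simp: f_def gbs_letters_def)
  have conj: "\<sigma> e \<otimes>\<^bsub>H\<^esub> (X (head \<Gamma> e) [^]\<^bsub>H\<^esub> (lab (arev e) * x) \<otimes>\<^bsub>H\<^esub> \<sigma> (arev e)) = X (tail \<Gamma> e) [^]\<^bsub>H\<^esub> (lab e * x)"
    if e: "e \<in> arcs \<Gamma>" for e x
  proof -
    let ?c = "\<lambda>g. \<sigma> e \<otimes>\<^bsub>H\<^esub> g \<otimes>\<^bsub>H\<^esub> \<sigma> (arev e)"
    have inv: "\<sigma> (arev e) = inv\<^bsub>H\<^esub> \<sigma> e"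
      using H.inv_equality[of "\<sigma> (arev e)" "\<sigma> e"] \<sigma>(1)[OF e] \<sigma>(1)[of "arev e"] \<sigma>(2)[of "arev e"] e by simp
    have "?c \<in> hom H H"
    proof (rule homI)
      fix g h assume gh: "g \<in> carrier H" "h \<in> carrier H"
      have "inv\<^bsub>H\<^esub> \<sigma> e \<otimes>\<^bsub>H\<^esub> (\<sigma> e \<otimes>\<^bsub>H\<^esub> w) = w" if "w \<in> carrier H" for w
        using that \<sigma>(1)[OF e] by (simp flip: H.m_assoc)
      then show "?c (g \<otimes>\<^bsub>H\<^esub> h) = ?c g \<otimes>\<^bsub>H\<^esub> ?c h"
        using gh \<sigma>(1)[OF e] by (simp add: inv H.m_assoc)
    qed (use \<sigma>(1)[OF e] in \<open>simp add: inv\<close>)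
    then have "?c ((X (head \<Gamma> e) [^]\<^bsub>H\<^esub> lab (arev e)) [^]\<^bsub>H\<^esub> x) = ?c (X (head \<Gamma> e) [^]\<^bsub>H\<^esub> lab (arev e)) [^]\<^bsub>H\<^esub> x"
      using X[of "head \<Gamma> e"] e by (intro hom_int_pow) (simp_all add: H.is_group)
    also have "?c (X (head \<Gamma> e) [^]\<^bsub>H\<^esub> lab (arev e)) = X (tail \<Gamma> e) [^]\<^bsub>H\<^esub> lab e"
      using \<sigma>(3)[OF e] \<sigma>(1)[OF e] X[of "tail \<Gamma> e"] e by (simp add: inv H.m_assoc)
    finally show ?thesis
      using X[of "head \<Gamma> e"] X[of "tail \<Gamma> e"] \<sigma>(1)[OF e] e by (simp add: H.int_pow_pow H.m_assoc inv)
  qed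
  have rel: "word_val H f l = word_val H f r" if lr: "(l, r) \<in> gbs_rels \<Gamma> arev lab T" for l r
  proof -
    consider v g h where "v \<in> verts \<Gamma>" "l = [Inl (v, g), Inl (v, h)]" "r = [Inl (v, g + h)]"
      | v where "v \<in> verts \<Gamma>" "l = [Inl (v, 0)]" "r = []"
      | e where "e \<in> arcs \<Gamma>" "l = [Inr e, Inr (arev e)]" "r = []"
      | e x where "e \<in> arcs \<Gamma>" "l = [Inr e, Inl (head \<Gamma> e, lab (arev e) * x), Inr (arev e)]"
          "r = [Inl (tail \<Gamma> e, lab e * x)]"
      | e where "e \<in> arcs T" "l = [Inr e]" "r = []"
      using lr unfolding gbs_rels_def by blast
    then show ?thesis
    proof cases
      case 1
      then show ?thesis using X[of v] by (simp add: f_def H.int_pow_mult)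
    next
      case 2
      then show ?thesis by (simp add: f_def)
    next
      case 3
      then show ?thesis using \<sigma>[of e] \<sigma>(1)[of "arev e"] by (simp add: f_def)
    next
      case 4
      then show ?thesis
        using conj[of e x] \<sigma>(1)[of "arev e"] X[of "tail \<Gamma> e"] by (simp add: f_def)
    next
      case 5
      then show ?thesis using \<sigma>T by (simp add: f_def)
    qed
  qed
  obtain \<phi> where \<phi>: "\<phi> \<in> hom (presented (gbs_letters \<Gamma>) (gbs_rels \<Gamma> arev lab T)) H"
    and val: "\<And>w. w \<in> lists (gbs_letters \<Gamma>) \<Longrightarrow> \<phi> (cls w) = word_val H f w"
    using presented_hom[OF H f, of "gbs_rels \<Gamma> arev lab T"] rel by metis
  have "\<phi> \<in> hom G H"
    using \<phi> by (simp only: gbs_eq)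
  moreover have "\<phi> (gv v) = X v" if "v \<in> verts \<Gamma>" for v
    using that val[of "[Inl (v, 1)]"] X[of v] by (simp add: vertex_gen_def f_def)
  moreover have "\<phi> (ge e) = \<sigma> e" if "e \<in> arcs \<Gamma>" for e
    using that val[of "[Inr e]"] \<sigma>(1)[of e] by (simp add: stable_letter_def f_def)
  ultimately show thesis
    by (rule that)
qed

lemma hom_eqI:
  assumes "group H" "\<phi> \<in> hom G H" "\<psi> \<in> hom G H"
    and v: "\<And>v. v \<in> verts \<Gamma> \<Longrightarrow> \<phi> (gv v) = \<psi> (gv v)" and e: "\<And>e. e \<in> arcs \<Gamma> \<Longrightarrow> \<phi> (ge e) = \<psi> (ge e)"
    and x: "x \<in> carrier G"
  shows "\<phi> x = \<psi> x"
proof -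
  have "{x \<in> carrier G. \<phi> x = \<psi> x} = carrier G"
    using assms(1-3) by (intro G_generated G.subgroup_equalizer) (simp_all add: v e)
  then show ?thesis using x by blast
qed

end

lemma gbs_presentation_of_maximal_tree:
  assumes "labelled_graph \<Gamma> arev lab" "maximal_tree \<Gamma> arev T"
  shows "gbs_presentation \<Gamma> arev T"
proof -
  interpret labelled_graph \<Gamma> arev lab by fact
  show ?thesis
    using assms(2) by unfold_locales (auto simp: maximal_tree_def rev_subgraph_def subgraph_def)
qed

text \<open>The two homomorphisms exist only inside the proof, so the last premise speaks of all
  \<open>\<phi>\<close> and \<open>\<psi>\<close> with the prescribed values. What it asks is that
  the composites fix the generators.\<close>

lemma (in gbs_presentation) iso_gbs:
  assumes P': "gbs_presentation \<Gamma>' arev' T'"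
    and X: "gbs_images (gbs \<Gamma>' arev' lab' T') \<Gamma> arev lab T X \<sigma>"
    and X': "gbs_images G \<Gamma>' arev' lab' T' X' \<sigma>'"
    and \<phi>\<psi>: "\<And>\<phi> \<psi>. \<lbrakk>\<phi> \<in> hom G (gbs \<Gamma>' arev' lab' T'); \<psi> \<in> hom (gbs \<Gamma>' arev' lab' T') G;
       \<And>v. v \<in> verts \<Gamma> \<Longrightarrow> \<phi> (gv v) = X v; \<And>e. e \<in> arcs \<Gamma> \<Longrightarrow> \<phi> (ge e) = \<sigma> e;
       \<And>v. v \<in> verts \<Gamma>' \<Longrightarrow> \<psi> (vertex_gen \<Gamma>' arev' lab' T' v) = X' v;
       \<And>e. e \<in> arcs \<Gamma>' \<Longrightarrow> \<psi> (stable_letter \<Gamma>' arev' lab' T' e) = \<sigma>' e\<rbrakk> \<Longrightarrow>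
      (\<forall>v\<in>verts \<Gamma>. \<psi> (X v) = gv v) \<and> (\<forall>e\<in>arcs \<Gamma>. \<psi> (\<sigma> e) = ge e) \<and>
      (\<forall>v\<in>verts \<Gamma>'. \<phi> (X' v) = vertex_gen \<Gamma>' arev' lab' T' v) \<and>
      (\<forall>e\<in>arcs \<Gamma>'. \<phi> (\<sigma>' e) = stable_letter \<Gamma>' arev' lab' T' e)"
  shows "G \<cong> gbs \<Gamma>' arev' lab' T'"
proof -
  interpret P': gbs_presentation \<Gamma>' arev' lab' T' by (rule P')
  obtain \<phi> where \<phi>: "\<phi> \<in> hom G P'.G" "\<And>v. v \<in> verts \<Gamma> \<Longrightarrow> \<phi> (gv v) = X v"
    "\<And>e. e \<in> arcs \<Gamma> \<Longrightarrow> \<phi> (ge e) = \<sigma> e"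
    using gbs_hom[OF P'.group_G X] by metis
  obtain \<psi> where \<psi>: "\<psi> \<in> hom P'.G G" "\<And>v. v \<in> verts \<Gamma>' \<Longrightarrow> \<psi> (P'.gv v) = X' v"
    "\<And>e. e \<in> arcs \<Gamma>' \<Longrightarrow> \<psi> (P'.ge e) = \<sigma>' e"
    using P'.gbs_hom[OF group_G X'] by metis
  note eqs = \<phi>\<psi>[OF \<phi>(1) \<psi>(1) \<phi>(2,3) \<psi>(2,3)]
  show ?thesis
  proof (rule iso_of_inverse_homs[OF \<phi>(1) \<psi>(1)])
    fix x assume x: "x \<in> carrier G"
    have "(\<psi> \<circ> \<phi>) x = (\<lambda>x. x) x"
      by (rule hom_eqI[OF group_G hom_compose[OF \<phi>(1) \<psi>(1)] _ _ _ x])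
        (use eqs \<phi>(2,3) in \<open>simp_all add: hom_def\<close>)
    then show "\<psi> (\<phi> x) = x" by simp
  next
    fix y assume y: "y \<in> carrier P'.G"
    have "(\<phi> \<circ> \<psi>) y = (\<lambda>x. x) y"
      by (rule P'.hom_eqI[OF P'.group_G hom_compose[OF \<psi>(1) \<phi>(1)] _ _ _ y])
        (use eqs \<psi>(2,3) in \<open>simp_all add: hom_def\<close>)
    then show "\<phi> (\<psi> y) = y" by simp
  qed
qed

section \<open>Growing trees\<close>

text \<open>Arcs point towards the root: the tail of each arc is the new vertex.\<close>

fun grows :: "('v, 'e) pre_digraph \<Rightarrow> 'v set \<Rightarrow> 'e list \<Rightarrow> bool" where
  "grows \<Gamma> S [] = True"
| "grows \<Gamma> S (e # L) = (head \<Gamma> e \<in> S \<and> tail \<Gamma> e \<notin> S \<and> grows \<Gamma> (insert (tail \<Gamma> e) S) L)"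

lemma grows_append:
  "grows \<Gamma> S (L @ M) \<longleftrightarrow> grows \<Gamma> S L \<and> grows \<Gamma> (S \<union> tail \<Gamma> ` set L) M"
  by (induction L arbitrary: S) auto

lemma grows_tail_notin: "grows \<Gamma> S L \<Longrightarrow> e \<in> set L \<Longrightarrow> tail \<Gamma> e \<notin> S"
  by (induction L arbitrary: S) auto

lemma grows_head_in: "grows \<Gamma> S L \<Longrightarrow> e \<in> set L \<Longrightarrow> head \<Gamma> e \<in> S \<union> tail \<Gamma> ` set L"
proof (induction L arbitrary: S)
  case (Cons a L)
  then show ?case
    using Cons.IH[of "insert (tail \<Gamma> a) S"] by auto
qed simp

lemma grows_mono: "grows \<Gamma> S L \<Longrightarrow> S \<subseteq> S' \<Longrightarrow> tail \<Gamma> ` set L \<inter> S' = {} \<Longrightarrow> grows \<Gamma> S' L"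
proof (induction L arbitrary: S S')
  case (Cons e L)
  have "tail \<Gamma> ` set L \<inter> insert (tail \<Gamma> e) S' = {}"
    using Cons.prems grows_tail_notin[of \<Gamma> "insert (tail \<Gamma> e) S" L] by fastforce
  with Cons show ?case
    using Cons.IH[of "insert (tail \<Gamma> e) S" "insert (tail \<Gamma> e) S'"] by auto
qed simp

lemma grows_distinct: "grows \<Gamma> S L \<Longrightarrow> distinct (map (tail \<Gamma>) L)"
proof (induction L arbitrary: S)
  case (Cons e L)
  then show ?case
    using grows_tail_notin[of \<Gamma> "insert (tail \<Gamma> e) S" L] by fastforce
qed simp

text \<open>Recursion along a tree: the tail of each arc is new, so its value may be chosen to
  satisfy \<open>Q\<close> against the value already fixed at the head, and no earlier choice is
  disturbed.\<close>

lemma grows_extend: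
  fixes X :: "'v \<Rightarrow> 'g"
  assumes "grows \<Gamma> S L" and "\<And>v. v \<in> S \<Longrightarrow> X v \<in> Y"
    and "\<And>e y. e \<in> set L \<Longrightarrow> y \<in> Y \<Longrightarrow> \<exists>z\<in>Y. Q e z y"
  obtains X' where "\<And>v. v \<in> S \<Longrightarrow> X' v = X v" "\<And>v. v \<in> S \<union> tail \<Gamma> ` set L \<Longrightarrow> X' v \<in> Y"
    "\<And>e. e \<in> set L \<Longrightarrow> Q e (X' (tail \<Gamma> e)) (X' (head \<Gamma> e))"
  using assms
proof (induction L arbitrary: S X thesis)
  case Nil
  then show ?case by auto
next
  case (Cons e L)
  have e: "head \<Gamma> e \<in> S" "tail \<Gamma> e \<notin> S" and L: "grows \<Gamma> (insert (tail \<Gamma> e) S) L"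
    using Cons.prems(2) by simp_all
  obtain z where z: "z \<in> Y" "Q e z (X (head \<Gamma> e))"
    using Cons.prems(4)[of e "X (head \<Gamma> e)"] Cons.prems(3)[OF e(1)] by auto
  let ?X = "X(tail \<Gamma> e := z)"
  obtain X' where X': "\<And>v. v \<in> insert (tail \<Gamma> e) S \<Longrightarrow> X' v = ?X v"
    "\<And>v. v \<in> insert (tail \<Gamma> e) S \<union> tail \<Gamma> ` set L \<Longrightarrow> X' v \<in> Y"
    "\<And>e. e \<in> set L \<Longrightarrow> Q e (X' (tail \<Gamma> e)) (X' (head \<Gamma> e))"
    by (rule Cons.IH[OF _ L, of ?X]) (use Cons.prems(3,4) z in auto)
  show ?case
  proof (rule Cons.prems(1)[of X'])
    show "X' v = X v" if "v \<in> S" for v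
      using X'(1)[of v] that e by auto
    show "X' v \<in> Y" if "v \<in> S \<union> tail \<Gamma> ` set (e # L)" for v
      using X'(2)[of v] that by auto
    show "Q a (X' (tail \<Gamma> a)) (X' (head \<Gamma> a))" if "a \<in> set (e # L)" for a
    proof (cases "a \<in> set L")
      case False
      then have "a = e" using that by simp
      then show ?thesis
        using X'(1)[of "tail \<Gamma> e"] X'(1)[of "head \<Gamma> e"] e z by auto
    qed (rule X'(3))
  qed
qed

text \<open>Over the rationals the values at the new vertices are determined by those on
  \<open>S\<close>; the common factor \<open>k\<close> clears the denominators.\<close>

lemma grows_extend_int:
  fixes u :: "'v \<Rightarrow> int" and lab :: "'e \<Rightarrow> int"
  assumes "grows \<Gamma> S L" and "\<And>e. e \<in> set L \<Longrightarrow> lab e \<noteq> 0"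
  obtains k u' where "k > 0" "\<And>v. v \<in> S \<Longrightarrow> u' v = k * u v"
    "\<And>e. e \<in> set L \<Longrightarrow> lab e * u' (tail \<Gamma> e) = lab (arev e) * u' (head \<Gamma> e)"
  using assms
proof (induction L arbitrary: S u thesis)
  case Nil
  show ?case by (rule Nil.prems(1)[of 1 u]) simp_all
next
  case (Cons e L)
  have e: "head \<Gamma> e \<in> S" "tail \<Gamma> e \<notin> S" and L: "grows \<Gamma> (insert (tail \<Gamma> e) S) L" and l: "lab e \<noteq> 0"
    using Cons.prems(2,3) by simp_all
  \<comment> \<open>The old values are scaled by the absolute value of \<open>lab e\<close> to keep
    the factor \<open>k\<close> positive; the sign goes into the new value.\<close>
  let ?u = "(\<lambda>v. \<bar>lab e\<bar> * u v)(tail \<Gamma> e := sgn (lab e) * lab (arev e) * u (head \<Gamma> e))"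
  obtain k u' where k: "k > 0" "\<And>v. v \<in> insert (tail \<Gamma> e) S \<Longrightarrow> u' v = k * ?u v"
    "\<And>e. e \<in> set L \<Longrightarrow> lab e * u' (tail \<Gamma> e) = lab (arev e) * u' (head \<Gamma> e)"
    by (rule Cons.IH[OF _ L, of ?u]) (use Cons.prems(3) in auto)
  show ?case
  proof (rule Cons.prems(1)[of "k * \<bar>lab e\<bar>" u'])
    show "k * \<bar>lab e\<bar> > 0" using k(1) l by simp
    show "u' v = k * \<bar>lab e\<bar> * u v" if "v \<in> S" for v
      using k(2)[of v] that e by (auto simp: mult.assoc)
    show "lab a * u' (tail \<Gamma> a) = lab (arev a) * u' (head \<Gamma> a)" if "a \<in> set (e # L)" for a
    proof (cases "a \<in> set L")
      case False
      then have "a = e" using that by simp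
      moreover have "lab e * (k * (sgn (lab e) * lab (arev e) * u (head \<Gamma> e))) =
          lab (arev e) * (k * (\<bar>lab e\<bar> * u (head \<Gamma> e)))"
        by (simp add: abs_sgn ac_simps)
      ultimately show ?thesis
        using k(2)[of "tail \<Gamma> e"] k(2)[of "head \<Gamma> e"] e by auto
    qed (rule k(3))
  qed
qed

text \<open>A unit label at the new vertex makes its generator a power of the generator at the head.
  Following the arcs down to \<open>S\<close> ends at \<open>\<rho> v\<close>, and
  \<open>k v\<close> is the exponent collected on the way.\<close>

lemma grows_unit:
  fixes lab :: "'e \<Rightarrow> int"
  assumes "grows \<Gamma> S L" and "\<And>e. e \<in> set L \<Longrightarrow> \<bar>lab e\<bar> = 1"
  obtains \<rho> :: "'v \<Rightarrow> 'v" and k :: "'v \<Rightarrow> int" where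
    "\<And>v. v \<in> S \<Longrightarrow> \<rho> v = v \<and> k v = 1" "\<And>v. v \<in> S \<union> tail \<Gamma> ` set L \<Longrightarrow> \<rho> v \<in> S"
    "\<And>e. e \<in> set L \<Longrightarrow> \<rho> (tail \<Gamma> e) = \<rho> (head \<Gamma> e) \<and> lab e * k (tail \<Gamma> e) = lab (arev e) * k (head \<Gamma> e)"
proof -
  obtain X :: "'v \<Rightarrow> 'v \<times> int" where X: "\<And>v. v \<in> S \<Longrightarrow> X v = (v, 1)"
    "\<And>v. v \<in> S \<union> tail \<Gamma> ` set L \<Longrightarrow> X v \<in> S \<times> UNIV"
    "\<And>e. e \<in> set L \<Longrightarrow> fst (X (tail \<Gamma> e)) = fst (X (head \<Gamma> e)) \<and>
       lab e * snd (X (tail \<Gamma> e)) = lab (arev e) * snd (X (head \<Gamma> e))"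
  proof (rule grows_extend[OF assms(1), where X = "\<lambda>v. (v, 1 :: int)" and Y = "S \<times> UNIV" and
        Q = "\<lambda>e z y. fst z = fst y \<and> lab e * snd z = lab (arev e) * snd y"])
    fix e and y :: "'v \<times> int"
    assume "e \<in> set L" and y: "y \<in> S \<times> UNIV"
    then have "lab e * lab e = 1"
      using assms(2) by (metis abs_mult_self_eq mult_1)
    \<comment> \<open>A unit is its own inverse, so division by \<open>lab e\<close> is
      multiplication by it.\<close>
    then have "lab e * (lab e * (lab (arev e) * snd y)) = lab (arev e) * snd y"
      by (simp flip: mult.assoc)
    then show "\<exists>z\<in>S \<times> UNIV. fst z = fst y \<and> lab e * snd z = lab (arev e) * snd y"
      using y by (intro bexI[of _ "(fst y, lab e * (lab (arev e) * snd y))"]) (auto simp: mem_Times_iff)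
  qed auto
  show thesis
    by (rule that[of "fst \<circ> X" "snd \<circ> X"]) (use X in \<open>auto simp: mem_Times_iff\<close>)
qed

text \<open>The last arc of the list hangs a leaf on the rest. A new root in the rest is handled by
  induction; if the leaf is to be the root, its arc is reversed and comes before everything
  else.\<close>

lemma reroot:
  assumes \<Gamma>: "bidirected_digraph \<Gamma> arev" and L: "grows \<Gamma> {r} L" "set L \<subseteq> arcs \<Gamma>"
    and w: "w \<in> insert r (tail \<Gamma> ` set L)"
  obtains L' where "grows \<Gamma> {w} L'" "set L' \<subseteq> arcs \<Gamma>"
    "set L' \<union> arev ` set L' = set L \<union> arev ` set L"
    "insert w (tail \<Gamma> ` set L') = insert r (tail \<Gamma> ` set L)"
  using L w
proof (induction L arbitrary: w thesis rule: rev_induct)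
  case Nil
  show ?case by (rule Nil.prems(1)[of "[]"]) (use Nil.prems(4) in simp_all)
next
  case (snoc e L)
  interpret bidirected_digraph \<Gamma> arev by (rule \<Gamma>)
  have L: "grows \<Gamma> {r} L" "set L \<subseteq> arcs \<Gamma>" and e: "e \<in> arcs \<Gamma>"
    "head \<Gamma> e \<in> insert r (tail \<Gamma> ` set L)" "tail \<Gamma> e \<notin> insert r (tail \<Gamma> ` set L)"
    using snoc.prems(2,3) by (simp_all add: grows_append)
  show ?case
  proof (cases "w = tail \<Gamma> e")
    case False
    then have "w \<in> insert r (tail \<Gamma> ` set L)"
      using snoc.prems(4) by auto
    from snoc.IH[OF _ L this] obtain L' where L': "grows \<Gamma> {w} L'" "set L' \<subseteq> arcs \<Gamma>"
      "set L' \<union> arev ` set L' = set L \<union> arev ` set L"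
      "insert w (tail \<Gamma> ` set L') = insert r (tail \<Gamma> ` set L)"
      by metis
    show ?thesis
    proof (rule snoc.prems(1)[of "L' @ [e]"])
      show "grows \<Gamma> {w} (L' @ [e])"
        using L'(1,4) e by (simp add: grows_append)
      show "set (L' @ [e]) \<subseteq> arcs \<Gamma>"
        using L'(2) e by simp
      show "set (L' @ [e]) \<union> arev ` set (L' @ [e]) = set (L @ [e]) \<union> arev ` set (L @ [e])"
        using L'(3) by (simp add: insert_commute Un_commute)
      show "insert w (tail \<Gamma> ` set (L' @ [e])) = insert r (tail \<Gamma> ` set (L @ [e]))"
        using L'(4) by (simp, metis insert_commute)
    qed
  next
    case True
    \<comment> \<open>The rest is re-rooted at the neighbour of the leaf, where the reversed arc
      will be attached.\<close>
    obtain L' where L': "grows \<Gamma> {head \<Gamma> e} L'" "set L' \<subseteq> arcs \<Gamma>"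
      "set L' \<union> arev ` set L' = set L \<union> arev ` set L"
      "insert (head \<Gamma> e) (tail \<Gamma> ` set L') = insert r (tail \<Gamma> ` set L)"
      by (rule snoc.IH[OF _ L e(2)])
    have w: "w \<notin> insert (head \<Gamma> e) (tail \<Gamma> ` set L')"
      using L'(4) e(3) True by simp
    show ?thesis
    proof (rule snoc.prems(1)[of "arev e # L'"])
      have "grows \<Gamma> {head \<Gamma> e, w} L'"
      proof (rule grows_mono[OF L'(1)])
        have "tail \<Gamma> x \<noteq> head \<Gamma> e" if "x \<in> set L'" for x
          using grows_tail_notin[OF L'(1) that] by simp
        then show "tail \<Gamma> ` set L' \<inter> {head \<Gamma> e, w} = {}"
          using w by fastforce
      qed simp
      then show "grows \<Gamma> {w} (arev e # L')"
        using w True e by (auto simp: insert_commute)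
      show "set (arev e # L') \<subseteq> arcs \<Gamma>"
        using L'(2) e by simp
      show "set (arev e # L') \<union> arev ` set (arev e # L') = set (L @ [e]) \<union> arev ` set (L @ [e])"
        using L'(3) by (simp add: insert_commute Un_commute)
      show "insert w (tail \<Gamma> ` set (arev e # L')) = insert r (tail \<Gamma> ` set (L @ [e]))"
        using L'(4) e True by auto
    qed
  qed
qed

text \<open>Arcs are traversed from head to tail, since arcs of a growing list point to the root and
  paths are to lead away from it.\<close>

fun is_path :: "('v, 'e) pre_digraph \<Rightarrow> 'v \<Rightarrow> 'e list \<Rightarrow> 'v \<Rightarrow> bool" where
  "is_path \<Gamma> u [] w = (u = w)"
| "is_path \<Gamma> u (e # P) w = (head \<Gamma> e = u \<and> is_path \<Gamma> (tail \<Gamma> e) P w)"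

lemma is_path_append: "is_path \<Gamma> u (P @ Q) w \<longleftrightarrow> (\<exists>v. is_path \<Gamma> u P v \<and> is_path \<Gamma> v Q w)"
  by (induction P arbitrary: u) auto

text \<open>The order of growth can be changed so that the path from the root to \<open>w\<close>
  comes first; the arcs of \<open>H\<close> then grow the trees hanging off this path.\<close>

lemma split_path:
  assumes "grows \<Gamma> {u} L" "w \<in> insert u (tail \<Gamma> ` set L)"
  obtains P H where "is_path \<Gamma> u P w" "grows \<Gamma> {u} (P @ H)" "set P \<union> set H = set L"
  using assms
proof (induction L arbitrary: w thesis rule: rev_induct)
  case Nil
  show ?case by (rule Nil.prems(1)[of "[]" "[]"]) (use Nil.prems(3) in simp_all)
next
  case (snoc e L)
  have L: "grows \<Gamma> {u} L" and e: "head \<Gamma> e \<in> insert u (tail \<Gamma> ` set L)" "tail \<Gamma> e \<notin> insert u (tail \<Gamma> ` set L)"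
    using snoc.prems(2) by (simp_all add: grows_append)
  show ?case
  proof (cases "w = tail \<Gamma> e")
    case False
    then have "w \<in> insert u (tail \<Gamma> ` set L)"
      using snoc.prems(3) by auto
    from snoc.IH[OF _ L this] obtain P H where PH: "is_path \<Gamma> u P w" "grows \<Gamma> {u} (P @ H)" "set P \<union> set H = set L"
      by metis
    have "tail \<Gamma> ` set (P @ H) = tail \<Gamma> ` set L"
      using PH(3) by simp
    then have "grows \<Gamma> {u} ((P @ H) @ [e])"
      using PH(2) e by (subst grows_append) simp
    then show ?thesis
      using PH by (intro snoc.prems(1)[of P "H @ [e]"]) auto
  next
    case True
    obtain P H where PH: "is_path \<Gamma> u P (head \<Gamma> e)" "grows \<Gamma> {u} (P @ H)" "set P \<union> set H = set L"
      by (rule snoc.IH[OF _ L e(1)])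
    have tl: "tail \<Gamma> ` set P \<union> tail \<Gamma> ` set H = tail \<Gamma> ` set L"
      using PH(3) by blast
    have P: "grows \<Gamma> {u} P" and H: "grows \<Gamma> ({u} \<union> tail \<Gamma> ` set P) H"
      using PH(2) by (simp_all add: grows_append)
    have hd: "head \<Gamma> e \<in> insert u (tail \<Gamma> ` set P)"
      using PH(1)
    proof (cases P rule: rev_cases)
      case (snoc Q f)
      then show ?thesis using PH(1) by (auto simp: is_path_append)
    qed simp
    \<comment> \<open>The new leaf may be attached before \<open>H\<close> is grown, because no arc
      of \<open>H\<close> has the same tail.\<close>
    have "grows \<Gamma> ({u} \<union> tail \<Gamma> ` set (P @ [e])) H"
    proof (rule grows_mono[OF H])
      have "tail \<Gamma> x \<notin> {u} \<union> tail \<Gamma> ` set P" "tail \<Gamma> x \<noteq> tail \<Gamma> e" if "x \<in> set H" for x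
      proof -
        have "tail \<Gamma> x \<in> tail \<Gamma> ` set L"
          using that tl by blast
        then show "tail \<Gamma> x \<notin> {u} \<union> tail \<Gamma> ` set P" "tail \<Gamma> x \<noteq> tail \<Gamma> e"
          using grows_tail_notin[OF H that] e by auto
      qed
      then show "tail \<Gamma> ` set H \<inter> ({u} \<union> tail \<Gamma> ` set (P @ [e])) = {}"
        by fastforce
    qed auto
    then have "grows \<Gamma> {u} ((P @ [e]) @ H)"
      using P hd e tl by (simp add: grows_append) blast
    then show ?thesis
      using PH True by (intro snoc.prems(1)[of "P @ [e]" H]) (auto simp: is_path_append)
  qed
qed

section \<open>Maximal trees\<close>

lemma grows_finite_max:
  assumes fin: "finite V" and S: "S \<subseteq> V" "S \<noteq> {}"
    and step: "\<And>S'. S \<subseteq> S' \<Longrightarrow> S' \<subset> V \<Longrightarrow> \<exists>e\<in>E. head \<Gamma> e \<in> S' \<and> tail \<Gamma> e \<in> V - S'"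
  obtains L where "grows \<Gamma> S L" "set L \<subseteq> E" "S \<union> tail \<Gamma> ` set L = V"
  using S step
proof (induction "card (V - S)" arbitrary: S thesis)
  case 0
  then have "S = V" using fin by auto
  then show ?case by (intro "0.prems"(1)[of "[]"]) simp_all
next
  case (Suc n)
  have "S \<noteq> V"
    using Suc.hyps(2) by auto
  then obtain e where e: "e \<in> E" "head \<Gamma> e \<in> S" "tail \<Gamma> e \<in> V - S"
    using Suc.prems(4)[of S] Suc.prems(2) by blast
  have "V - insert (tail \<Gamma> e) S = (V - S) - {tail \<Gamma> e}" by blast
  then have "n = card (V - insert (tail \<Gamma> e) S)"
    using Suc.hyps(2) e(3) fin by (metis card_Diff_singleton diff_Suc_1)
  then obtain L where L: "grows \<Gamma> (insert (tail \<Gamma> e) S) L" "set L \<subseteq> E"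
      "insert (tail \<Gamma> e) S \<union> tail \<Gamma> ` set L = V"
  proof (rule Suc.hyps(1))
    show "insert (tail \<Gamma> e) S \<subseteq> V" "insert (tail \<Gamma> e) S \<noteq> {}"
      using Suc.prems(2) e by auto
    show "\<exists>e\<in>E. head \<Gamma> e \<in> S' \<and> tail \<Gamma> e \<in> V - S'" if "insert (tail \<Gamma> e) S \<subseteq> S'" "S' \<subset> V" for S'
      using Suc.prems(4)[of S'] that by blast
  qed blast
  show ?case
    by (rule Suc.prems(1)[of "e # L"]) (use L e in auto)
qed

text \<open>If no such arc existed, \<open>S\<close> would be closed under adjacency in the
  symmetric closure, and connectedness would make it the whole vertex set.\<close>

lemma connected_step:
  assumes "Digraph_Component.connected T" "wf_digraph T" and rev: "\<And>e. e \<in> arcs T \<Longrightarrow> arev e \<in> arcs T"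
    and tail: "\<And>e. e \<in> arcs T \<Longrightarrow> tail T (arev e) = head T e \<and> head T (arev e) = tail T e"
    and S: "S \<noteq> {}" "S \<subset> verts T"
  shows "\<exists>e\<in>arcs T. head T e \<in> S \<and> tail T e \<in> verts T - S"
proof (rule ccontr)
  assume no: "\<not> ?thesis"
  interpret wf_digraph T by fact
  obtain u v where uv: "u \<in> S" "v \<in> verts T" "v \<notin> S"
    using S by blast
  have step: "y \<in> S" if xy: "(x, y) \<in> parcs (mk_symmetric T)" "x \<in> S" for x y
  proof -
    obtain e where e: "e \<in> arcs T" "(x, y) = (tail T e, head T e) \<or> (x, y) = (head T e, tail T e)"
      using xy(1) unfolding parcs_mk_symmetric by blast
    then show ?thesis
      using no rev[OF e(1)] tail[OF e(1)] xy(2) wellformed[OF e(1)] by fastforce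
  qed
  have "u \<rightarrow>\<^sup>*\<^bsub>with_proj (mk_symmetric T)\<^esub> v"
    using assms(1) uv S(2) by (auto simp: Digraph_Component.connected_def strongly_connected_def)
  then have "(u, v) \<in> rtrancl_on (verts T) (parcs (mk_symmetric T))"
    by (simp add: reachable_def)
  then have "v \<in> S"
    by (induction rule: rtrancl_on_induct) (use uv step in auto)
  with uv show False by blast
qed

text \<open>Connectedness of a tree as a principle of saturation: a set that no arc of the list
  enters or leaves contains all vertices or none. Equality of attributes of vertices is spread along
  trees in this form.\<close>

lemma grows_connected:
  assumes "grows \<Gamma> {r} L" "\<And>e. e \<in> set L \<Longrightarrow> tail \<Gamma> e \<in> S \<longleftrightarrow> head \<Gamma> e \<in> S"
    and "v \<in> insert r (tail \<Gamma> ` set L)"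
  shows "v \<in> S \<longleftrightarrow> r \<in> S"
  using assms
proof (induction L arbitrary: v rule: rev_induct)
  case (snoc e L)
  have L: "grows \<Gamma> {r} L" and e: "head \<Gamma> e \<in> insert r (tail \<Gamma> ` set L)"
    using snoc.prems(1) by (simp_all add: grows_append)
  have IH: "x \<in> S \<longleftrightarrow> r \<in> S" if "x \<in> insert r (tail \<Gamma> ` set L)" for x
    using snoc.IH[OF L _ that] snoc.prems(2) by simp
  show ?case
  proof (cases "v = tail \<Gamma> e")
    case True
    then show ?thesis using snoc.prems(2)[of e] IH[OF e] by simp
  next
    case False
    then show ?thesis using IH[of v] snoc.prems(3) by auto
  qed
qed simp

lemma (in wf_digraph) cycle_of_apath:
  assumes "f \<in> arcs G" "apath (head G f) p (tail G f)"
  shows "cycle (f # p)"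
  unfolding cycle_def
proof (intro exI[of _ "tail G f"] conjI)
  show "awalk (tail G f) (f # p) (tail G f)"
    using assms by (simp add: awalk_Cons_iff apath_def)
  show "distinct (tl (awalk_verts (tail G f) (f # p)))"
    using assms by (simp add: apath_def)
qed simp

text \<open>Greedy growth inside \<open>T\<close> reaches every vertex. A further arc of
  \<open>T\<close> would close a path of the grown tree to a cycle, and the only cycles allowed are
  backtracks.\<close>

lemma maximal_tree_grows:
  assumes \<Gamma>: "bidirected_digraph \<Gamma> arev" "finite (verts \<Gamma>)" and T: "maximal_tree \<Gamma> arev T"
    and r: "r \<in> verts \<Gamma>"
  obtains L where "grows \<Gamma> {r} L" "set L \<subseteq> arcs \<Gamma>" "insert r (tail \<Gamma> ` set L) = verts \<Gamma>"
    "arcs T = set L \<union> arev ` set L"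
proof -
  interpret bidirected_digraph \<Gamma> arev by fact
  have T': "arcs T \<subseteq> arcs \<Gamma>" "verts T = verts \<Gamma>" "wf_digraph T" "tail T = tail \<Gamma>" "head T = head \<Gamma>"
    "\<And>e. e \<in> arcs T \<Longrightarrow> arev e \<in> arcs T" "Digraph_Component.connected T"
    "\<And>p. pre_digraph.cycle T p \<Longrightarrow> \<exists>e. p = [e, arev e]"
    using T by (simp_all add: maximal_tree_def rev_subgraph_def spanning_def subgraph_def compatible_def)
  interpret T: wf_digraph T by (rule T')
  have step: "\<exists>e\<in>arcs T. head \<Gamma> e \<in> S \<and> tail \<Gamma> e \<in> verts \<Gamma> - S" if "{r} \<subseteq> S" "S \<subset> verts \<Gamma>" for S
  proof -
    have "\<exists>e\<in>arcs T. head T e \<in> S \<and> tail T e \<in> verts T - S"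
    proof (rule connected_step[of T arev])
      show "tail T (arev e) = head T e \<and> head T (arev e) = tail T e" if "e \<in> arcs T" for e
        using T'(1) that by (simp add: T' subset_iff)
    qed (use that T' in auto)
    then show ?thesis by (simp only: T')
  qed
  obtain L where L: "grows \<Gamma> {r} L" "set L \<subseteq> arcs T" "{r} \<union> tail \<Gamma> ` set L = verts \<Gamma>"
    using grows_finite_max[OF \<Gamma>(2), of "{r}" "arcs T" \<Gamma>] r step by auto
  let ?E = "set L \<union> arev ` set L"
  have E: "?E \<subseteq> arcs T" "\<And>e. e \<in> ?E \<Longrightarrow> arev e \<in> ?E"
    using L(2) T'(6) by auto
  have "f \<in> ?E" if f: "f \<in> arcs T" for f
  proof (rule ccontr)
    assume nf: "f \<notin> ?E"
    \<comment> \<open>The graph of the grown arcs only, so that paths in it are known to avoid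
      \<open>f\<close> and its reverse.\<close>
    define D where "D = T\<lparr>arcs := ?E\<rparr>"
    have D: "verts D = verts \<Gamma>" "arcs D = ?E" "tail D = tail \<Gamma>" "head D = head \<Gamma>"
      by (simp_all add: D_def T')
    interpret D: wf_digraph D
      using E(1) T'(1) by unfold_locales (auto simp: D)
    let ?S = "{v. \<exists>p. D.awalk (head \<Gamma> f) p v}"
    have adj: "head \<Gamma> e \<in> ?S" if e: "e \<in> ?E" "tail \<Gamma> e \<in> ?S" for e
    proof -
      obtain p where "D.awalk (head \<Gamma> f) p (tail \<Gamma> e)" using e(2) by blast
      moreover have "e \<in> arcs D" "head D e \<in> verts D"
        using e(1) D D.head_in_verts by simp_all
      ultimately have "D.awalk (head \<Gamma> f) (p @ [e]) (head \<Gamma> e)"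
        using D by (simp add: D.awalk_append_iff D.awalk_simps)
      then show ?thesis by blast
    qed
    have iff: "tail \<Gamma> e \<in> ?S \<longleftrightarrow> head \<Gamma> e \<in> ?S" if "e \<in> set L" for e
    proof -
      have "e \<in> arcs \<Gamma>" using that L(2) T'(1) by blast
      then show ?thesis
        using adj[of e] adj[of "arev e"] that by auto
    qed
    have V: "head \<Gamma> f \<in> verts \<Gamma>" "tail \<Gamma> f \<in> verts \<Gamma>"
      using f T'(1) by auto
    have "head \<Gamma> f \<in> ?S"
      using V D by (auto intro!: exI[of _ "[]"] simp: D.awalk_Nil_iff)
    moreover have "head \<Gamma> f \<in> ?S \<longleftrightarrow> r \<in> ?S" "tail \<Gamma> f \<in> ?S \<longleftrightarrow> r \<in> ?S"
      using L(3) V by (intro grows_connected[OF L(1) iff]; simp)+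
    ultimately have "tail \<Gamma> f \<in> ?S" by blast
    then obtain p where "D.awalk (head \<Gamma> f) p (tail \<Gamma> f)" by blast
    then have p: "D.apath (head \<Gamma> f) (D.awalk_to_apath p) (tail \<Gamma> f)"
      by (rule D.apath_awalk_to_apath)
    define q where "q = D.awalk_to_apath p"
    have q: "D.apath (head \<Gamma> f) q (tail \<Gamma> f)"
      using p by (simp add: q_def)
    have comp: "compatible D T"
      by (simp add: compatible_def D T')
    have "set q \<subseteq> arcs T"
      using q E(1) unfolding D.apath_def D.awalk_def D by (meson subset_trans)
    then have "T.apath (head T f) q (tail T f)"
      using q E(1) compatible_cas[OF comp] compatible_awalk_verts[OF comp]
      by (simp add: D.apath_def T.apath_def D.awalk_def T.awalk_def D T')
    \<comment> \<open>The path \<open>q\<close> runs inside \<open>?E\<close>, which is closed under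
      \<open>arev\<close> and misses \<open>f\<close>; so \<open>f # q\<close> cannot be
      \<open>[f, arev f]\<close>.\<close>
    then have "T.cycle (f # q)"
      using f by (intro T.cycle_of_apath)
    then obtain e where "f # q = [e, arev e]"
      using T'(8) by blast
    then have "arev f \<in> set q" by auto
    then have "arev f \<in> ?E"
      using q D by (auto simp: D.apath_def D.awalk_def)
    then show False
      using E(2)[of "arev f"] nf by simp
  qed
  then have "arcs T = ?E"
    using E(1) by blast
  moreover have "set L \<subseteq> arcs \<Gamma>" "insert r (tail \<Gamma> ` set L) = verts \<Gamma>"
    using L T'(1) by auto
  ultimately show thesis
    using that L(1) by blast
qed

section \<open>Absence of cycles in grown trees\<close>

lemma (in pre_digraph) tl_awalk_verts: "cas u p v \<Longrightarrow> awalk_verts u p = u # map (head G) p"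
  by (induction p arbitrary: u) auto

lemma (in pre_digraph) cas_nth:
  "cas u p v \<Longrightarrow> i < length p \<Longrightarrow> tail G (p ! i) = (if i = 0 then u else head G (p ! (i - 1)))"
proof (induction p arbitrary: u i)
  case (Cons e p)
  then show ?case
    using Cons.IH[of "head G e" "i - 1"] by (cases i) auto
qed simp

lemma (in pre_digraph) cas_last: "cas u p v \<Longrightarrow> p \<noteq> [] \<Longrightarrow> head G (last p) = v"
proof (induction p arbitrary: u)
  case (Cons e p)
  then show ?case by (cases "p = []") auto
qed simp

text \<open>At a highest vertex a cycle arrives and leaves along the same edge, since only one arc
  of \<open>L\<close> starts there. As a cycle repeats no vertex, this backtrack is all of
  it.\<close>

lemma grows_no_cycle:
  assumes \<Gamma>: "bidirected_digraph \<Gamma> arev" and L: "grows \<Gamma> {r} L" "set L \<subseteq> arcs \<Gamma>"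
    and T: "tail T = tail \<Gamma>" "head T = head \<Gamma>" "arcs T = set L \<union> arev ` set L"
    and p: "pre_digraph.cycle T p"
  shows "\<exists>e. p = [e, arev e]"
proof -
  interpret bidirected_digraph \<Gamma> arev by fact
  interpret T: pre_digraph T .
  \<comment> \<open>A height function: each new leaf gets one more than its head, and no earlier arc
    touches the leaf.\<close>
  have "\<exists>idx :: 'a \<Rightarrow> nat. \<forall>e\<in>set L. idx (head \<Gamma> e) < idx (tail \<Gamma> e)"
    using L(1)
  proof (induction L rule: rev_induct)
    case (snoc e L)
    then obtain idx :: "'a \<Rightarrow> nat" where idx: "\<forall>e\<in>set L. idx (head \<Gamma> e) < idx (tail \<Gamma> e)"
      by (auto simp: grows_append)
    have e: "head \<Gamma> e \<in> insert r (tail \<Gamma> ` set L)" "tail \<Gamma> e \<notin> insert r (tail \<Gamma> ` set L)"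
      and L: "grows \<Gamma> {r} L"
      using snoc.prems by (simp_all add: grows_append)
    have "head \<Gamma> a \<noteq> tail \<Gamma> e" "tail \<Gamma> a \<noteq> tail \<Gamma> e" if "a \<in> set L" for a
    proof -
      have "head \<Gamma> a \<in> insert r (tail \<Gamma> ` set L)" "tail \<Gamma> a \<in> insert r (tail \<Gamma> ` set L)"
        using grows_head_in[OF L that] that by auto
      then show "head \<Gamma> a \<noteq> tail \<Gamma> e" "tail \<Gamma> a \<noteq> tail \<Gamma> e"
        using e(2) by metis+
    qed
    then have "\<forall>a\<in>set (L @ [e]). (idx(tail \<Gamma> e := Suc (idx (head \<Gamma> e)))) (head \<Gamma> a)
        < (idx(tail \<Gamma> e := Suc (idx (head \<Gamma> e)))) (tail \<Gamma> a)"
      using idx e by auto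
    then show ?case by blast
  qed simp
  then obtain idx :: "'a \<Rightarrow> nat" where idx: "\<And>e. e \<in> set L \<Longrightarrow> idx (head \<Gamma> e) < idx (tail \<Gamma> e)"
    by blast
  obtain u where u: "T.awalk u p u" "distinct (tl (T.awalk_verts u p))" "p \<noteq> []"
    using p by (auto simp: T.cycle_def)
  have cas: "T.cas u p u" and parcs: "set p \<subseteq> set L \<union> arev ` set L"
    using u(1) by (simp_all add: T.awalk_def T)
  have dist: "distinct (map (head \<Gamma>) p)"
    using u(2) T.tl_awalk_verts[OF cas] by (simp add: T)
  define n where "n = length p"
  have n: "n > 0" using u(3) by (simp add: n_def)
  \<comment> \<open>Positions on the cycle are cyclic: the arc before \<open>p ! 0\<close> is the
    last one.\<close>
  let ?prev = "\<lambda>i. if i = 0 then n - 1 else i - 1"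
  have tail: "tail \<Gamma> (p ! i) = head \<Gamma> (p ! ?prev i)" if "i < n" for i
    using T.cas_nth[OF cas, of i] T.cas_last[OF cas u(3)] that u(3)
    by (simp add: T n_def last_conv_nth)
  define M where "M = Max ((\<lambda>j. idx (head \<Gamma> (p ! j))) ` {..<n})"
  have "M \<in> (\<lambda>j. idx (head \<Gamma> (p ! j))) ` {..<n}"
    unfolding M_def using n by (intro Max_in) auto
  then obtain i where i: "i < n" "M = idx (head \<Gamma> (p ! i))"
    by auto
  have max: "idx (head \<Gamma> (p ! j)) \<le> idx (head \<Gamma> (p ! i))" if "j < n" for j
    unfolding i(2)[symmetric] M_def using that by (intro Max_ge) auto
  define j where "j = (if Suc i = n then 0 else Suc i)"
  have j: "j < n" "?prev j = i"
    using i(1) n by (auto simp: j_def)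
  have pi: "p ! i \<in> set L \<union> arev ` set L" "p ! j \<in> set L \<union> arev ` set L"
    using subsetD[OF parcs nth_mem[of _ p]] i(1) j(1) by (simp_all add: n_def)
  \<comment> \<open>Arcs of \<open>L\<close> go down, and the head of \<open>p ! i\<close> is
    highest; so \<open>p ! i\<close> goes up and its successor \<open>p ! j\<close> goes
    down.\<close>
  have "p ! i \<notin> set L"
  proof
    assume "p ! i \<in> set L"
    moreover have "?prev i < n"
      using i(1) by (cases i) simp_all
    ultimately show False
      using idx[of "p ! i"] tail[OF i(1)] max[of "?prev i"] by simp
  qed
  then obtain e where e: "e \<in> set L" "p ! i = arev e"
    using pi by blast
  have ea: "e \<in> arcs \<Gamma>" using e L(2) by blast
  have tj: "tail \<Gamma> (p ! j) = tail \<Gamma> e"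
    using tail[OF j(1)] j(2) e ea by simp
  have "p ! j \<in> set L"
  proof (rule ccontr)
    assume "p ! j \<notin> set L"
    then obtain f where f: "f \<in> set L" "p ! j = arev f"
      using pi by blast
    then have "f \<in> arcs \<Gamma>" using L(2) by blast
    then have "idx (tail \<Gamma> (p ! j)) < idx (head \<Gamma> (p ! j))"
      using idx[OF f(1)] f by simp
    then show False
      using tail[OF j(1)] j max[of j] by simp
  qed
  \<comment> \<open>Both \<open>p ! j\<close> and \<open>e\<close> belong to \<open>L\<close> and
    start at the highest vertex, and tails of \<open>L\<close> are distinct.\<close>
  then have pj: "p ! j = e"
    using grows_distinct[OF L(1)] e(1) tj by (auto simp: distinct_map inj_on_def)
  have "i \<noteq> j"
    using e(2) pj arev_neq[OF ea] by auto
  have "head \<Gamma> (p ! j) = head \<Gamma> (p ! ?prev i)"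
    using pj e(2) tail[OF i(1)] ea by simp
  \<comment> \<open>Heads along the cycle are distinct. So \<open>j\<close> both follows and
    precedes \<open>i\<close>, which forces length two.\<close>
  then have "j = ?prev i"
    using nth_eq_iff_index_eq[OF dist, of j "?prev i"] i(1) j(1) by (simp add: n_def)
  then have "n = 2"
    using j i(1) \<open>i \<noteq> j\<close> by (auto simp: j_def split: if_splits)
  then obtain x y where xy: "p = [x, y]"
    by (auto simp: n_def length_Suc_conv numeral_2_eq_2)
  have "i = 0 \<and> j = 1 \<or> i = 1 \<and> j = 0"
    using i(1) j \<open>i \<noteq> j\<close> \<open>n = 2\<close> by (auto simp: j_def split: if_splits)
  then have "y = arev x"
    using e(2) pj xy by auto
  then show ?thesis using xy by blast
qed

text \<open>For connectedness, the set of vertices reachable from \<open>u\<close> is saturated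
  under the arcs of \<open>L\<close>, so it contains all vertices once it contains one.\<close>

lemma grows_maximal_tree:
  assumes \<Gamma>: "bidirected_digraph \<Gamma> arev" and L: "grows \<Gamma> {r} L" "set L \<subseteq> arcs \<Gamma>"
    "insert r (tail \<Gamma> ` set L) = verts \<Gamma>" and T: "T = \<Gamma>\<lparr>arcs := set L \<union> arev ` set L\<rparr>"
  shows "maximal_tree \<Gamma> arev T"
proof -
  interpret bidirected_digraph \<Gamma> arev by fact
  have E: "set L \<union> arev ` set L \<subseteq> arcs \<Gamma>"
    using L(2) by auto
  have T': "verts T = verts \<Gamma>" "arcs T = set L \<union> arev ` set L" "tail T = tail \<Gamma>" "head T = head \<Gamma>"
    by (simp_all add: T)
  interpret T: wf_digraph T
    using E by unfold_locales (auto simp: T')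
  have sub: "subgraph T \<Gamma>"
    using E T.wf_digraph wf_digraph by (simp add: subgraph_def compatible_def T')
  have "Digraph_Component.connected T"
    unfolding Digraph_Component.connected_def
  proof (rule strongly_connectedI)
    show "verts (with_proj (mk_symmetric T)) \<noteq> {}"
      using L(3) by (auto simp: T')
    fix u v assume uv: "u \<in> verts (with_proj (mk_symmetric T))" "v \<in> verts (with_proj (mk_symmetric T))"
    let ?S = "{v. u \<rightarrow>\<^sup>*\<^bsub>with_proj (mk_symmetric T)\<^esub> v}"
    interpret M: pair_wf_digraph "mk_symmetric T" ..
    have "tail \<Gamma> e \<in> ?S \<longleftrightarrow> head \<Gamma> e \<in> ?S" if "e \<in> set L" for e
    proof -
      have "e \<in> arcs T" using that by (simp add: T')
      then have "(tail \<Gamma> e, head \<Gamma> e) \<in> parcs (mk_symmetric T)" "(head \<Gamma> e, tail \<Gamma> e) \<in> parcs (mk_symmetric T)"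
        by (auto simp: parcs_mk_symmetric T')
      then have "tail \<Gamma> e \<rightarrow>\<^bsub>with_proj (mk_symmetric T)\<^esub> head \<Gamma> e" "head \<Gamma> e \<rightarrow>\<^bsub>with_proj (mk_symmetric T)\<^esub> tail \<Gamma> e"
        by auto
      then show ?thesis
        using M.reachable_adj_trans[of u "tail \<Gamma> e" "head \<Gamma> e"] M.reachable_adj_trans[of u "head \<Gamma> e" "tail \<Gamma> e"] by auto
    qed
    then have iff: "x \<in> ?S \<longleftrightarrow> r \<in> ?S" if "x \<in> verts \<Gamma>" for x
    proof (rule grows_connected[OF L(1)])
      show "x \<in> insert r (tail \<Gamma> ` set L)" using that L(3) by simp
    qed
    have "u \<in> ?S"
      using uv(1) by (simp add: M.reachable_refl)
    then show "u \<rightarrow>\<^sup>*\<^bsub>with_proj (mk_symmetric T)\<^esub> v"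
      using iff[of u] iff[of v] uv by (simp add: T')
  qed
  moreover have "rev_subgraph \<Gamma> arev T"
    using sub by (auto simp: rev_subgraph_def T')
  moreover have "spanning T \<Gamma>"
    using sub by (simp add: spanning_def T')
  moreover have "\<forall>p. pre_digraph.cycle T p \<longrightarrow> (\<exists>e. p = [e, arev e])"
    by (intro allI impI grows_no_cycle[OF \<Gamma> L(1,2) T'(3,4,2)])
  ultimately show ?thesis
    by (simp add: maximal_tree_def)
qed

section \<open>The standard cycle\<close>

text \<open>The edge from \<open>i\<close> to \<open>i + 1\<close> modulo \<open>n\<close> is the
  pair of arcs \<open>2 * i\<close> (forward) and \<open>2 * i + 1\<close> (backward). This also
  covers one vertex with a loop and two vertices with a double edge.\<close>

definition cycle_graph :: "nat \<Rightarrow> (nat, nat) pre_digraph" where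
  "cycle_graph n = \<lparr>verts = {..<n}, arcs = {..<2 * n},
     tail = (\<lambda>e. if even e then e div 2 else Suc (e div 2) mod n),
     head = (\<lambda>e. if even e then Suc (e div 2) mod n else e div 2)\<rparr>"

definition cycle_rev :: "nat \<Rightarrow> nat \<Rightarrow> nat" where
  "cycle_rev n e = (if e < 2 * n then if even e then e + 1 else e - 1 else e)"

text \<open>Omits the edge from \<open>n - 1\<close> back to \<open>0\<close>, whose arcs are the
  two largest numbers.\<close>

definition cycle_tree :: "nat \<Rightarrow> (nat, nat) pre_digraph" where
  "cycle_tree n = (cycle_graph n)\<lparr>arcs := {..<2 * (n - 1)}\<rparr>"

lemma cycle_graph_simps [simp]:
  "verts (cycle_graph n) = {..<n}" "arcs (cycle_graph n) = {..<2 * n}"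
  "tail (cycle_graph n) (2 * i) = i" "head (cycle_graph n) (2 * i) = Suc i mod n"
  "tail (cycle_graph n) (Suc (2 * i)) = Suc i mod n" "head (cycle_graph n) (Suc (2 * i)) = i"
  by (simp_all add: cycle_graph_def)

lemma cycle_rev_simps [simp]:
  "i < n \<Longrightarrow> cycle_rev n (2 * i) = Suc (2 * i)" "i < n \<Longrightarrow> cycle_rev n (Suc (2 * i)) = 2 * i"
  by (simp_all add: cycle_rev_def)

lemma cycle_arc_cases:
  assumes "e < 2 * n"
  obtains i where "i < n" "e = 2 * i" | i where "i < n" "e = Suc (2 * i)"
  using assms by (cases "even e") (auto elim!: evenE oddE)

lemma bidirected_cycle_graph:
  assumes "n > 0"
  shows "bidirected_digraph (cycle_graph n) (cycle_rev n)"
proof -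
  interpret wf_digraph "cycle_graph n"
  proof
    fix e assume "e \<in> arcs (cycle_graph n)"
    then have "e < 2 * n" by simp
    then show "tail (cycle_graph n) e \<in> verts (cycle_graph n)" "head (cycle_graph n) e \<in> verts (cycle_graph n)"
      using assms by (cases e rule: cycle_arc_cases[of _ n]; simp)+
  qed
  show ?thesis
  proof (rule bidirected_digraphI)
    fix e
    show "e \<notin> arcs (cycle_graph n) \<Longrightarrow> cycle_rev n e = e"
      by (simp add: cycle_rev_def)
    assume "e \<in> arcs (cycle_graph n)"
    then have "e < 2 * n" by simp
    then show "cycle_rev n e \<noteq> e" "cycle_rev n (cycle_rev n e) = e"
      "tail (cycle_graph n) (cycle_rev n e) = head (cycle_graph n) e"
      by (cases e rule: cycle_arc_cases[of _ n]; simp)+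
  qed
qed

lemma arcs_cycle_tree:
  "arcs (cycle_tree n) = set (map (\<lambda>i. Suc (2 * i)) [0..<n - 1]) \<union> cycle_rev n ` set (map (\<lambda>i. Suc (2 * i)) [0..<n - 1])"
proof -
  have "{..<2 * (n - 1)} = (\<lambda>i. Suc (2 * i)) ` {..<n - 1} \<union> (\<lambda>i. 2 * i) ` {..<n - 1}"
  proof (intro equalityI subsetI)
    fix e assume "e \<in> {..<2 * (n - 1)}"
    then have "e < 2 * (n - 1)" by simp
    then show "e \<in> (\<lambda>i. Suc (2 * i)) ` {..<n - 1} \<union> (\<lambda>i. 2 * i) ` {..<n - 1}"
      by (cases e rule: cycle_arc_cases[of _ "n - 1"]) auto
  qed auto
  moreover have "cycle_rev n ` (\<lambda>i. Suc (2 * i)) ` {..<n - 1} = (\<lambda>i. 2 * i) ` {..<n - 1}"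
    unfolding image_image by (rule image_cong) auto
  ultimately show ?thesis
    by (simp add: cycle_tree_def atLeast0LessThan)
qed

text \<open>The tree grows from \<open>0\<close> along the odd arcs, which are the ones pointing
  back to the root.\<close>

lemma maximal_tree_cycle_graph:
  assumes "n > 0"
  shows "maximal_tree (cycle_graph n) (cycle_rev n) (cycle_tree n)"
proof (rule grows_maximal_tree[OF bidirected_cycle_graph[OF assms], of 0 "map (\<lambda>i. Suc (2 * i)) [0..<n - 1]"])
  have "m < n \<Longrightarrow> grows (cycle_graph n) {0} (map (\<lambda>i. Suc (2 * i)) [0..<m]) \<and>
      insert 0 (tail (cycle_graph n) ` set (map (\<lambda>i. Suc (2 * i)) [0..<m])) = {..m}" for m
  proof (induction m)
    case (Suc m)
    then have IH: "grows (cycle_graph n) {0} (map (\<lambda>i. Suc (2 * i)) [0..<m])"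
      "insert 0 (tail (cycle_graph n) ` set (map (\<lambda>i. Suc (2 * i)) [0..<m])) = {..m}" by simp_all
    have *: "map (\<lambda>i. Suc (2 * i)) [0..<Suc m] = map (\<lambda>i. Suc (2 * i)) [0..<m] @ [Suc (2 * m)]"
      by simp
    have un: "{0} \<union> A = insert 0 A" for A :: "nat set" by simp
    have t: "tail (cycle_graph n) (Suc (2 * m)) = Suc m"
      using Suc.prems by simp
    show ?case
      unfolding * grows_append un IH(2)
      using IH t by (simp add: atMost_Suc) (metis insert_commute)
  qed simp
  from this[of "n - 1"] assms show "grows (cycle_graph n) {0} (map (\<lambda>i. Suc (2 * i)) [0..<n - 1])"
    "insert 0 (tail (cycle_graph n) ` set (map (\<lambda>i. Suc (2 * i)) [0..<n - 1])) = verts (cycle_graph n)"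
    by auto
  show "set (map (\<lambda>i. Suc (2 * i)) [0..<n - 1]) \<subseteq> arcs (cycle_graph n)"
    by auto
  show "cycle_tree n = (cycle_graph n)\<lparr>arcs := set (map (\<lambda>i. Suc (2 * i)) [0..<n - 1]) \<union>
      cycle_rev n ` set (map (\<lambda>i. Suc (2 * i)) [0..<n - 1])\<rparr>"
    unfolding arcs_cycle_tree[symmetric] by (simp add: cycle_tree_def)
qed

lemma labelled_cycle_graph:
  assumes "n > 0" "\<And>e. e < 2 * n \<Longrightarrow> lab e \<noteq> 0"
  shows "labelled_graph (cycle_graph n) (cycle_rev n) lab"
proof -
  interpret bidirected_digraph "cycle_graph n" "cycle_rev n"
    by (rule bidirected_cycle_graph[OF assms(1)])
  show ?thesis
    using assms by unfold_locales auto
qed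

lemma maximal_tree_connected:
  assumes "maximal_tree \<Gamma> arev T"
  shows "Digraph_Component.connected \<Gamma>"
proof -
  have T: "subgraph T \<Gamma>" "verts T = verts \<Gamma>" "Digraph_Component.connected T"
    using assms by (simp_all add: maximal_tree_def spanning_def rev_subgraph_def)
  have "parcs (mk_symmetric T) \<subseteq> parcs (mk_symmetric \<Gamma>)"
    using T(1) by (auto simp: parcs_mk_symmetric subgraph_def compatible_def)
  then have "u \<rightarrow>\<^sup>*\<^bsub>with_proj (mk_symmetric T)\<^esub> v \<Longrightarrow> u \<rightarrow>\<^sup>*\<^bsub>with_proj (mk_symmetric \<Gamma>)\<^esub> v" for u v
    unfolding reachable_def using T(2) by (auto intro: rtrancl_on_mono)
  then show ?thesis
    using T(2,3) by (simp add: Digraph_Component.connected_def strongly_connected_def)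
qed

section \<open>Realizations\<close>

lemma continuous_map_from_sum_topology:
  assumes "\<And>i. i \<in> I \<Longrightarrow> continuous_map (X i) Y (\<lambda>x. f (i, x))"
  shows "continuous_map (sum_topology X I) Y f"
  unfolding continuous_map_def
proof (intro conjI allI impI)
  show "f \<in> topspace (sum_topology X I) \<rightarrow> topspace Y"
    using assms by (auto simp: continuous_map_def Pi_iff)
  fix U assume U: "openin Y U"
  have "openin (X i) {x. (i, x) \<in> {x \<in> topspace (sum_topology X I). f x \<in> U}}" if "i \<in> I" for i
  proof -
    have "openin (X i) {x \<in> topspace (X i). f (i, x) \<in> U}"
      using assms[OF that] U by (rule openin_continuous_map_preimage)
    then show ?thesis using that by simp
  qed
  then show "openin (sum_topology X I) {x \<in> topspace (sum_topology X I). f x \<in> U}"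
    by (auto simp: openin_sum_topology)
qed

lemma continuous_map_into_sum_topology:
  assumes "i \<in> I"
  shows "continuous_map (X i) (sum_topology X I) (\<lambda>x. (i, x))"
  unfolding continuous_map_def
proof (intro conjI allI impI)
  show "(\<lambda>x. (i, x)) \<in> topspace (X i) \<rightarrow> topspace (sum_topology X I)"
    using assms by auto
  fix U assume "openin (sum_topology X I) U"
  then have "openin (X i) {x. (i, x) \<in> U}" "U \<subseteq> Sigma I (topspace \<circ> X)"
    using assms by (auto simp: openin_sum_topology)
  moreover have "{x \<in> topspace (X i). (i, x) \<in> U} = {x. (i, x) \<in> U}"
    using calculation(2) by auto
  ultimately show "openin (X i) {x \<in> topspace (X i). (i, x) \<in> U}"
    by simp
qed

lemma compact_space_sum_topology:
  assumes "finite I" "\<And>i. i \<in> I \<Longrightarrow> compact_space (X i)"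
  shows "compact_space (sum_topology X I)"
proof -
  have eq: "topspace (sum_topology X I) = (\<Union>i\<in>I. (\<lambda>x. (i, x)) ` topspace (X i))"
    by auto
  have "compactin (sum_topology X I) ((\<lambda>x. (i, x)) ` topspace (X i))" if "i \<in> I" for i
    using assms(2)[OF that]
    by (intro image_compactin[OF _ continuous_map_into_sum_topology[OF that, of X]]) (simp add: compact_space_def)
  then have "compactin (sum_topology X I) (\<Union>i\<in>I. (\<lambda>x. (i, x)) ` topspace (X i))"
    using assms(1) by (intro compactin_Union) auto
  then show ?thesis
    by (simp only: compact_space_def eq)
qed

section \<open>The realization as a quotient of its cells\<close>

locale graph_realization = bidirected_digraph \<Gamma> arev
  for \<Gamma> :: "('v, 'e) pre_digraph" and arev :: "'e \<Rightarrow> 'e"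
begin

abbreviation "cells \<equiv> graph_cells \<Gamma>"
abbreviation "X \<equiv> realization \<Gamma> arev"

definition glue :: "((('v + 'e) \<times> real) \<times> (('v + 'e) \<times> real)) set" where
  "glue = (graph_gluing \<Gamma> arev \<union> (graph_gluing \<Gamma> arev)\<inverse>)\<^sup>* \<inter> topspace cells \<times> topspace cells"

definition q :: "('v + 'e) \<times> real \<Rightarrow> (('v + 'e) \<times> real) set" where
  "q x = glue `` {x}"

lemma topspace_cells:
  "x \<in> topspace cells \<longleftrightarrow> (\<exists>v\<in>verts \<Gamma>. x = (Inl v, 0)) \<or> (\<exists>e\<in>arcs \<Gamma>. \<exists>t\<in>{0..1}. x = (Inr e, t))"
  by (cases x) (auto simp: graph_cells_def split: sum.splits)

lemma vertex_cell [simp]: "(Inl v, t) \<in> topspace cells \<longleftrightarrow> v \<in> verts \<Gamma> \<and> t = 0"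
  and edge_cell [simp]: "(Inr e, t) \<in> topspace cells \<longleftrightarrow> e \<in> arcs \<Gamma> \<and> 0 \<le> t \<and> t \<le> 1"
  by (auto simp: topspace_cells)

lemma equiv_glue: "equiv (topspace cells) glue"
proof (rule equivI)
  let ?G = "graph_gluing \<Gamma> arev \<union> (graph_gluing \<Gamma> arev)\<inverse>"
  show "glue \<subseteq> topspace cells \<times> topspace cells"
    by (auto simp: glue_def)
  show "refl_on (topspace cells) glue"
    by (auto simp: glue_def refl_on_def)
  have "sym ?G"
    by (auto simp: sym_def)
  then have "sym (?G\<^sup>*)"
    by (rule sym_rtrancl)
  then show "sym glue"
    by (auto simp: glue_def sym_def)
  show "trans glue"
    by (auto simp: glue_def trans_def intro: rtrancl_trans)
qed

lemma q_eq_iff: "x \<in> topspace cells \<Longrightarrow> y \<in> topspace cells \<Longrightarrow> q x = q y \<longleftrightarrow> (x, y) \<in> glue"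
  unfolding q_def by (rule eq_equiv_class_iff[OF equiv_glue])

lemma openin_X: "openin X U \<longleftrightarrow> U \<subseteq> topspace cells // glue \<and> openin cells (\<Union>U)"
  unfolding realization_def glue_def[symmetric] by (rule openin_quotient_topology[OF equiv_glue])

lemma Union_classes: "\<Union>(topspace cells // glue) = topspace cells"
  by (rule Union_quotient[OF equiv_glue])

lemma topspace_X: "topspace X = q ` topspace cells"
proof -
  have "openin X (topspace cells // glue)"
    unfolding openin_X Union_classes by simp
  then have "topspace X = topspace cells // glue"
    using openin_X[of "topspace X"] by (metis openin_subset openin_topspace subset_antisym)
  then show ?thesis
    by (auto simp: quotient_def q_def)
qed

lemma topspace_X_quotient: "topspace X = topspace cells // glue"
  unfolding topspace_X by (auto simp: quotient_def q_def)

lemma Union_subset_X: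
  assumes "U \<subseteq> topspace X"
  shows "\<Union>U = {x \<in> topspace cells. q x \<in> U}"
proof (intro equalityI subsetI)
  fix x assume "x \<in> \<Union>U"
  then obtain C where C: "C \<in> U" "x \<in> C" by blast
  then obtain y where y: "y \<in> topspace cells" "C = q y"
    using assms by (auto simp: topspace_X)
  then have "(y, x) \<in> glue"
    using C by (simp add: q_def)
  then have "x \<in> topspace cells" "q x = q y"
    using y(1) q_eq_iff[of y x] by (auto simp: glue_def)
  then show "x \<in> {x \<in> topspace cells. q x \<in> U}"
    using C y by simp
next
  fix x assume "x \<in> {x \<in> topspace cells. q x \<in> U}"
  moreover from this have "x \<in> q x"
    by (simp add: q_def glue_def)
  ultimately show "x \<in> \<Union>U" by blast
qed

lemma continuous_q: "continuous_map cells X q"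
  unfolding continuous_map_def
proof (intro conjI allI impI)
  show "q \<in> topspace cells \<rightarrow> topspace X"
    by (auto simp: topspace_X)
  fix U assume "openin X U"
  then show "openin cells {x \<in> topspace cells. q x \<in> U}"
    using Union_subset_X[of U] openin_X[of U] openin_subset[of X U] by simp
qed

lemma continuous_from_X:
  assumes "continuous_map cells Y (F \<circ> q)"
  shows "continuous_map X Y F"
  unfolding continuous_map_def
proof (intro conjI allI impI)
  show "F \<in> topspace X \<rightarrow> topspace Y"
    using assms by (auto simp: topspace_X continuous_map_def)
  fix U assume U: "openin Y U"
  let ?V = "{x \<in> topspace X. F x \<in> U}"
  have "\<Union>?V = {x \<in> topspace cells. q x \<in> ?V}"
    by (rule Union_subset_X) blast
  also have "\<dots> = {x \<in> topspace cells. (F \<circ> q) x \<in> U}"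
    by (auto simp: topspace_X)
  finally have "openin cells (\<Union>?V)"
    using openin_continuous_map_preimage[OF assms U] by simp
  then show "openin X ?V"
    by (auto simp: openin_X topspace_X_quotient)
qed

lemma glue_step:
  assumes "(x, y) \<in> graph_gluing \<Gamma> arev" "x \<in> topspace cells" "y \<in> topspace cells"
  shows "q x = q y"
  using assms by (subst q_eq_iff) (auto simp: glue_def)

lemma q_tail: "e \<in> arcs \<Gamma> \<Longrightarrow> q (Inr e, 0) = q (Inl (tail \<Gamma> e), 0)"
  by (rule glue_step) (auto simp: graph_gluing_def)

lemma q_rev: "e \<in> arcs \<Gamma> \<Longrightarrow> 0 \<le> t \<Longrightarrow> t \<le> 1 \<Longrightarrow> q (Inr e, t) = q (Inr (arev e), 1 - t)"
  by (rule glue_step) (auto simp: graph_gluing_def)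

lemma q_head: "e \<in> arcs \<Gamma> \<Longrightarrow> q (Inr e, 1) = q (Inl (head \<Gamma> e), 0)"
  using q_rev[of e 1] q_tail[of "arev e"] by simp

text \<open>The gluing relation is accessible only as a closure; invariants of a single gluing step
  are what separates its classes.\<close>

lemma glue_invariant:
  assumes "\<And>x y. (x, y) \<in> graph_gluing \<Gamma> arev \<Longrightarrow> f x = f y" and "(x, y) \<in> glue"
  shows "f x = f y"
proof -
  have "(x, y) \<in> (graph_gluing \<Gamma> arev \<union> (graph_gluing \<Gamma> arev)\<inverse>)\<^sup>*"
    using assms(2) by (simp add: glue_def)
  then show ?thesis
    by (induction rule: rtrancl_induct) (use assms(1) in auto)
qed

text \<open>The two midpoints form a saturated set: \<open>1 / 2\<close> is fixed by
  \<open>t \<mapsto> 1 - t\<close> and is not the end of a cell.\<close>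

lemma midpoint_glue:
  assumes "(x, (Inr a, 1 / 2)) \<in> glue"
  shows "x = (Inr a, 1 / 2) \<or> x = (Inr (arev a), 1 / 2)"
proof -
  define Z :: "(('v + 'e) \<times> real) set" where "Z = {(Inr a, 1 / 2), (Inr (arev a), 1 / 2)}"
  have "(x \<in> Z) = ((Inr a, 1 / 2) \<in> Z)"
  proof (rule glue_invariant[of "\<lambda>x. x \<in> Z", OF _ assms])
    fix x y assume "(x, y) \<in> graph_gluing \<Gamma> arev"
    then consider e where "x = (Inr e, 0)" "y = (Inl (tail \<Gamma> e), 0)"
      | e t where "x = (Inr e, t)" "y = (Inr (arev e), 1 - t)"
      by (auto simp: graph_gluing_def)
    then show "(x \<in> Z) = (y \<in> Z)"
    proof cases
      case 2
      have "arev e = a \<longleftrightarrow> e = arev a" "arev e = arev a \<longleftrightarrow> e = a"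
        by (metis arev_arev)+
      with 2 show ?thesis by (auto simp: Z_def)
    qed (simp add: Z_def)
  qed
  then show ?thesis by (simp add: Z_def)
qed

lemma continuous_edge:
  assumes "e \<in> arcs \<Gamma>"
  shows "continuous_map (top_of_set {0..1}) X (\<lambda>t. q (Inr e, t))"
proof -
  have "continuous_map (top_of_set {0..1}) cells (\<lambda>t. (Inr e, t))"
    using continuous_map_into_sum_topology[OF InrI[OF assms],
        of "case_sum (\<lambda>_. top_of_set {0 :: real}) (\<lambda>_. top_of_set {0..1})" "verts \<Gamma>"]
    by (simp add: graph_cells_def)
  from continuous_map_compose[OF this continuous_q] show ?thesis
    by (simp add: comp_def)
qed

lemma connectedin_edge:
  assumes "e \<in> arcs \<Gamma>" "J \<subseteq> {0..1}" "topological_space_class.connected J"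
  shows "connectedin X ((\<lambda>t. q (Inr e, t)) ` J)"
  using continuous_edge[OF assms(1)]
  by (rule connectedin_continuous_map_image) (use assms in \<open>simp add: connectedin_subtopology\<close>)

text \<open>The removed points lie on edges off the tree. So the tree stays connected, every other
  edge is attached to it as a whole, and each half of a cut edge is attached to it at one
  end.\<close>

lemma connectedin_two_midpoints_removed:
  assumes L: "grows \<Gamma> {r} L" "set L \<subseteq> arcs \<Gamma>" "insert r (tail \<Gamma> ` set L) = verts \<Gamma>"
    and a: "a \<in> arcs \<Gamma>" "a \<notin> set L" "arev a \<notin> set L"
    and b: "b \<in> arcs \<Gamma>" "b \<notin> set L" "arev b \<notin> set L"
  shows "connectedin X (topspace X - {q (Inr a, 1 / 2), q (Inr b, 1 / 2)})"
proof -
  define U where "U = topspace X - {q (Inr a, 1 / 2), q (Inr b, 1 / 2)}"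
  have U: "q x \<in> U" if x: "x \<in> topspace cells"
    "x \<notin> {(Inr a, 1 / 2), (Inr (arev a), 1 / 2), (Inr b, 1 / 2), (Inr (arev b), 1 / 2)}" for x
  proof -
    have "q x \<noteq> q (Inr a, 1 / 2)" "q x \<noteq> q (Inr b, 1 / 2)"
      using x a(1) b(1) q_eq_iff[OF x(1), of "(Inr a, 1 / 2)"] q_eq_iff[OF x(1), of "(Inr b, 1 / 2)"]
        midpoint_glue[of x a] midpoint_glue[of x b] by auto
    then show ?thesis
      using x(1) by (simp add: U_def topspace_X)
  qed
  let ?c = "connected_component_of (subtopology X U)"
  have seg: "?c (q (Inr e, s)) (q (Inr e, t))"
    if e: "e \<in> arcs \<Gamma>" "J \<subseteq> {0..1}" "topological_space_class.connected J" "s \<in> J" "t \<in> J"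
      and J: "\<And>t. t \<in> J \<Longrightarrow> t = 1 / 2 \<Longrightarrow> e \<notin> {a, arev a, b, arev b}" for e J s t
  proof -
    have "q (Inr e, t) \<in> U" if "t \<in> J" for t
      using that e(1,2) J[OF that] by (intro U) auto
    then have "connectedin (subtopology X U) ((\<lambda>t. q (Inr e, t)) ` J)"
      using connectedin_edge[OF e(1-3)] by (auto simp: connectedin_subtopology)
    then show ?thesis
      unfolding connected_component_of_def using e(4,5) by blast
  qed
  have sym: "?c y x" if "?c x y" for x y
    using that by (simp add: connected_component_of_sym)
  have trans: "?c x z" if "?c x y" "?c y z" for x y z
    using that by (rule connected_component_of_trans)
  define p where "p v = q (Inl v, 0)" for v
  have tree: "?c (p (tail \<Gamma> e)) (p (head \<Gamma> e))" if e: "e \<in> set L" for e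
  proof -
    have ea: "e \<in> arcs \<Gamma>" using e L(2) by blast
    have ne: "e \<notin> {a, arev a, b, arev b}"
      using e a b by auto
    have "?c (q (Inr e, 0)) (q (Inr e, 1))"
      by (rule seg[OF ea, of "{0..1}"]) (use ne in auto)
    then show ?thesis
      using q_tail[OF ea] q_head[OF ea] by (simp add: p_def)
  qed
  have rU: "p r \<in> U"
    unfolding p_def using L(3) by (intro U) auto
  have vert: "?c (p r) (p v)" if v: "v \<in> verts \<Gamma>" for v
  proof -
    have "v \<in> {v. ?c (p r) (p v)} \<longleftrightarrow> r \<in> {v. ?c (p r) (p v)}"
    proof (rule grows_connected[OF L(1)])
      fix e assume "e \<in> set L"
      from trans[OF _ tree[OF this]] trans[OF _ sym[OF tree[OF this]]] show "tail \<Gamma> e \<in> {v. ?c (p r) (p v)} \<longleftrightarrow> head \<Gamma> e \<in> {v. ?c (p r) (p v)}"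
        by auto
    qed (use v L(3) in simp)
    moreover have "?c (p r) (p r)"
      using rU by (simp add: connected_component_of_refl U_def)
    ultimately show ?thesis by simp
  qed
  \<comment> \<open>Before its midpoint an arc is joined to its tail; points beyond the midpoint are
    treated on the reversed arc.\<close>
  have half: "?c (p r) (q (Inr e, t))" if e: "e \<in> arcs \<Gamma>" "0 \<le> t" "t < 1 / 2" for e t
  proof -
    have "?c (q (Inr e, 0)) (q (Inr e, t))"
      by (rule seg[OF e(1), of "{0..<1 / 2}"]) (use e in auto)
    then show ?thesis
      using trans[OF vert[of "tail \<Gamma> e"]] e(1) q_tail[OF e(1)] by (simp add: p_def)
  qed
  have all: "?c (p r) x" if x: "x \<in> U" for x
  proof -
    obtain y where y: "y \<in> topspace cells" "x = q y"
      using x by (auto simp: U_def topspace_X)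
    then consider v where "v \<in> verts \<Gamma>" "y = (Inl v, 0)" | e t where "e \<in> arcs \<Gamma>" "0 \<le> t" "t \<le> 1" "y = (Inr e, t)"
      unfolding topspace_cells by auto
    then show ?thesis
    proof cases
      case 1
      then show ?thesis using vert y by (simp add: p_def)
    next
      case 2
      consider "t < 1 / 2" | "t > 1 / 2" | "t = 1 / 2" by linarith
      then show ?thesis
      proof cases
        case 1
        then show ?thesis using half[OF 2(1,2)] y(2) 2(4) by simp
      next
        case 2
        then show ?thesis
          using half[of "arev e" "1 - t"] y(2) \<open>y = (Inr e, t)\<close> \<open>e \<in> arcs \<Gamma>\<close> \<open>0 \<le> t\<close> \<open>t \<le> 1\<close> q_rev[of e t] by simp
      next
        case 3
        \<comment> \<open>A midpoint that was not removed lies on neither of the cut edges, so its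
          whole edge is at hand.\<close>
        have ne: "e \<notin> {a, arev a, b, arev b}"
        proof
          assume "e \<in> {a, arev a, b, arev b}"
          moreover have "q (Inr (arev a), 1 / 2) = q (Inr a, 1 / 2)" "q (Inr (arev b), 1 / 2) = q (Inr b, 1 / 2)"
            using q_rev[of a "1 / 2"] q_rev[of b "1 / 2"] a(1) b(1) by simp_all
          ultimately have "x \<in> {q (Inr a, 1 / 2), q (Inr b, 1 / 2)}"
            using y(2) 2(4) 3 by auto
          then show False using x by (simp add: U_def)
        qed
        have "?c (q (Inr e, 0)) (q (Inr e, t))"
          by (rule seg[OF 2(1), of "{0..1}"]) (use 2 ne in auto)
        then show ?thesis
          using trans[OF vert[of "tail \<Gamma> e"]] 2(1,4) q_tail[OF 2(1)] y(2) by (simp add: p_def)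
      qed
    qed
  qed
  have sub: "U \<subseteq> topspace X"
    by (simp add: U_def)
  have "?c x y" if "x \<in> U" "y \<in> U" for x y
    using trans[OF sym[OF all[OF that(1)]] all[OF that(2)]] .
  then have "connected_space (subtopology X U)"
    using sub by (simp add: connected_space_iff_connected_component inf.absorb2)
  then show ?thesis
    using sub by (simp add: connectedin_def U_def)
qed

end

text \<open>\<open>f\<close> is the oriented distance from the line through \<open>a\<close> and
  \<open>b\<close>, up to scale. On the circle it vanishes at \<open>a\<close> and \<open>b\<close>
  only, yet it takes both signs.\<close>

lemma circle_minus_two_points:
  fixes a b :: complex
  assumes "norm a = 1" "norm b = 1" "a \<noteq> b"
  shows "\<not> topological_space_class.connected (sphere 0 1 - {a, b})"
proof
  assume conn: "topological_space_class.connected (sphere 0 1 - {a, b})"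
  define w1 w2 where "w1 = Re b - Re a" and "w2 = Im b - Im a"
  define N D where "N = w1\<^sup>2 + w2\<^sup>2" and "D = Re a * w1 + Im a * w2"
  define f where "f z = (Im z - Im a) * w1 - (Re z - Re a) * w2" for z
  have ab: "(Re a)\<^sup>2 + (Im a)\<^sup>2 = 1" "(Re b)\<^sup>2 + (Im b)\<^sup>2 = 1"
    using assms by (simp_all add: cmod_def)
  have N: "N > 0"
    using assms(3) by (auto simp: N_def w1_def w2_def sum_power2_gt_zero_iff complex_eq_iff)
  \<comment> \<open>\<open>(w1, w2)\<close> is the chord \<open>b - a\<close>, \<open>N\<close> its
    squared length and \<open>D\<close> its scalar product with \<open>a\<close>; so the squared
    norm of \<open>b\<close> exceeds that of \<open>a\<close> by \<open>N + 2 * D\<close>.\<close>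
  have "N + 2 * D = (Re b)\<^sup>2 + (Im b)\<^sup>2 - ((Re a)\<^sup>2 + (Im a)\<^sup>2)"
    by (simp add: N_def D_def w1_def w2_def power2_eq_square algebra_simps)
  then have ND: "N = - 2 * D"
    using ab by simp
  \<comment> \<open>With \<open>z - a\<close> equal to \<open>s\<close> times the chord, lying on
    the circle means \<open>s * (s - 1) * N = 0\<close>.\<close>
  have on_line: "z = a \<or> z = b" if z: "norm z = 1" "f z = 0" for z
  proof -
    define x y where "x = Re z - Re a" and "y = Im z - Im a"
    define s where "s = (x * w1 + y * w2) / N"
    have yx: "y * w1 = x * w2"
      using z(2) by (simp add: f_def x_def y_def)
    have "x * N = w1 * (x * w1) + (x * w2) * w2" "y * N = (y * w1) * w1 + w2 * (y * w2)"
      by (simp_all add: N_def power2_eq_square algebra_simps)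
    then have "x * N = w1 * (x * w1) + (y * w1) * w2" "y * N = (x * w2) * w1 + w2 * (y * w2)"
      by (simp_all only: yx)
    then have "x * N = w1 * (x * w1 + y * w2)" "y * N = w2 * (x * w1 + y * w2)"
      by (simp_all add: algebra_simps)
    then have xy: "x = s * w1" "y = s * w2"
      using N by (simp_all add: s_def field_simps)
    have "(Re z)\<^sup>2 + (Im z)\<^sup>2 = 1"
      using z(1) by (simp add: cmod_def)
    moreover have "(Re z)\<^sup>2 + (Im z)\<^sup>2 = (Re a)\<^sup>2 + (Im a)\<^sup>2 + 2 * (Re a * x + Im a * y) + (x\<^sup>2 + y\<^sup>2)"
      by (simp add: x_def y_def power2_eq_square algebra_simps)
    ultimately have "2 * (Re a * x + Im a * y) + (x\<^sup>2 + y\<^sup>2) = 0"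
      using ab(1) by linarith
    moreover have "Re a * x + Im a * y = s * D" "x\<^sup>2 + y\<^sup>2 = s\<^sup>2 * N"
      by (simp_all add: xy D_def N_def power2_eq_square algebra_simps)
    ultimately have "2 * (s * D) + s\<^sup>2 * N = 0"
      by (simp only:)
    moreover have "s * N = - 2 * (s * D)"
      by (simp add: ND)
    moreover have "s * (s - 1) * N = s\<^sup>2 * N - s * N"
      by (simp add: power2_eq_square algebra_simps)
    ultimately have "s * (s - 1) * N = 0"
      by linarith
    then have "s = 0 \<or> s = 1" using N by simp
    then show ?thesis
      using xy by (auto simp: x_def y_def w1_def w2_def complex_eq_iff)
  qed
  \<comment> \<open>The cross product of \<open>a\<close> with the chord. Lagrange's identity and
    \<open>D \<noteq> 0\<close> make its absolute value strictly smaller than the length of the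
    chord.\<close>
  define E where "E = Re a * w2 - Im a * w1"
  have "E\<^sup>2 + D\<^sup>2 = ((Re a)\<^sup>2 + (Im a)\<^sup>2) * N"
    by (simp add: E_def D_def N_def power2_eq_square algebra_simps)
  then have "E\<^sup>2 + D\<^sup>2 = N"
    using ab by simp
  moreover have "D\<^sup>2 > 0" using N ND by simp
  ultimately have "E\<^sup>2 < N" by linarith
  then have "E\<^sup>2 < (sqrt N)\<^sup>2"
    using N by simp
  then have "\<bar>E\<bar>\<^sup>2 < (sqrt N)\<^sup>2"
    by simp
  then have E: "\<bar>E\<bar> < sqrt N"
    by (rule power2_less_imp_less) (use N in simp)
  \<comment> \<open>A unit normal of the chord: \<open>f\<close> is \<open>sqrt N + E\<close> at
    \<open>u\<close> and \<open>- sqrt N + E\<close> at \<open>- u\<close>.\<close>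
  define u where "u = Complex (- w2 / sqrt N) (w1 / sqrt N)"
  have NN: "w2\<^sup>2 + w1\<^sup>2 = N" "w1 * w1 + w2 * w2 = N" "(sqrt N)\<^sup>2 = N"
    using N by (simp_all add: N_def power2_eq_square)
  have "(w2 / sqrt N)\<^sup>2 + (w1 / sqrt N)\<^sup>2 = (w2\<^sup>2 + w1\<^sup>2) / (sqrt N)\<^sup>2"
    by (simp only: power_divide add_divide_distrib)
  then have "(w2 / sqrt N)\<^sup>2 + (w1 / sqrt N)\<^sup>2 = 1"
    using N by (simp only: NN) simp
  then have u: "norm u = 1"
    by (simp add: u_def cmod_def)
  have "w1 * w1 / sqrt N + w2 * w2 / sqrt N = N / sqrt N"
    by (simp only: NN flip: add_divide_distrib)
  also have "\<dots> = sqrt N"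
    using N by (simp add: real_div_sqrt)
  finally have "f u = sqrt N + E" "f (- u) = - sqrt N + E"
    by (simp_all add: f_def u_def E_def algebra_simps)
  then have fu: "f u > 0" "f (- u) < 0"
    using E by linarith+
  have fab: "f a = 0" "f b = 0"
    by (simp_all add: f_def w1_def w2_def)
  have "u \<in> sphere 0 1 - {a, b}" "- u \<in> sphere 0 1 - {a, b}"
    using u fu fab by auto
  then have "f u \<in> f ` (sphere 0 1 - {a, b})" "f (- u) \<in> f ` (sphere 0 1 - {a, b})"
    by blast+
  moreover have "topological_space_class.connected (f ` (sphere 0 1 - {a, b}))"
    unfolding f_def by (intro connected_continuous_image conn continuous_intros)
  ultimately have "0 \<in> f ` (sphere 0 1 - {a, b})"
    using fu connectedD_interval[of "f ` (sphere 0 1 - {a, b})" "f (- u)" "f u" 0] by simp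
  then obtain z where "z \<in> sphere 0 1 - {a, b}" "0 = f z"
    by (elim imageE)
  then show False
    using on_line[of z] by simp
qed

text \<open>With two different edges outside the tree, removing their midpoints would leave the
  realization connected, whereas two points always cut a circle.\<close>

lemma circle_arcs_outside_tree:
  assumes \<Gamma>: "bidirected_digraph \<Gamma> arev" "finite (verts \<Gamma>)" and T: "maximal_tree \<Gamma> arev T"
    and circle: "homeomorphic_to_circle \<Gamma> arev"
    and a: "a \<in> arcs \<Gamma> - arcs T" and b: "b \<in> arcs \<Gamma> - arcs T"
  shows "b = a \<or> b = arev a"
proof (rule ccontr)
  assume ne: "\<not> ?thesis"
  interpret graph_realization \<Gamma> arev
    by (simp add: graph_realization_def \<Gamma>)
  define r where "r = tail \<Gamma> a"
  have r: "r \<in> verts \<Gamma>"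
    unfolding r_def using a by (intro tail_in_verts) simp
  obtain L where L: "grows \<Gamma> {r} L" "set L \<subseteq> arcs \<Gamma>" "insert r (tail \<Gamma> ` set L) = verts \<Gamma>"
    "arcs T = set L \<union> arev ` set L"
    by (rule maximal_tree_grows[OF \<Gamma> T r])
  have notin: "e \<notin> set L" "arev e \<notin> set L" if "e \<in> arcs \<Gamma> - arcs T" for e
  proof -
    show "e \<notin> set L" using that L(4) by blast
    show "arev e \<notin> set L"
    proof
      assume "arev e \<in> set L"
      then have "arev (arev e) \<in> arev ` set L" by (rule imageI)
      then show False using that L(4) by simp
    qed
  qed
  let ?a = "q (Inr a, 1 / 2)" and ?b = "q (Inr b, 1 / 2)"
  have conn: "connectedin X (topspace X - {?a, ?b})"
    using a b notin[OF a] notin[OF b] by (intro connectedin_two_midpoints_removed[OF L(1-3)]) simp_all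
  have mem: "?a \<in> topspace X" "?b \<in> topspace X"
    using a b by (auto simp: topspace_X)
  have "?a \<noteq> ?b"
  proof
    assume "?a = ?b"
    then have "((Inr a, 1 / 2), (Inr b, 1 / 2)) \<in> glue"
      using a b by (simp add: q_eq_iff)
    then have "a = b \<or> a = arev b"
      using midpoint_glue by blast
    then show False using ne by auto
  qed
  obtain h where h: "homeomorphic_map X (top_of_set (sphere (0 :: complex) 1)) h"
    using circle by (auto simp: homeomorphic_to_circle_def homeomorphic_space homeomorphic_map_maps)
  then have inj: "inj_on h (topspace X)" and surj: "h ` topspace X = sphere 0 1"
    by (auto simp: homeomorphic_eq_everything_map)
  have "connectedin (top_of_set (sphere 0 1)) (h ` (topspace X - {?a, ?b}))"
    using homeomorphic_map_connectedness[OF h, of "topspace X - {?a, ?b}"] conn by simp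
  moreover have "h ` (topspace X - {?a, ?b}) = sphere 0 1 - {h ?a, h ?b}"
    using inj_on_image_set_diff[OF inj, of "topspace X" "{?a, ?b}"] mem surj by simp
  ultimately have "topological_space_class.connected (sphere 0 1 - {h ?a, h ?b})"
    by (simp add: connectedin_subtopology)
  moreover have "h ?a \<in> sphere 0 1" "h ?b \<in> sphere 0 1" "h ?a \<noteq> h ?b"
    using mem surj inj \<open>?a \<noteq> ?b\<close> by (auto simp: inj_on_def)
  ultimately show False
    using circle_minus_two_points[of "h ?a" "h ?b"] by simp
qed

text \<open>Edge \<open>i\<close> is wound around the arc of the circle from the \<open>i\<close>-th
  to the next \<open>n\<close>-th root of unity. A continuous bijection from a compact space to a
  Hausdorff space is a homeomorphism, so only injectivity and surjectivity are left.\<close>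

lemma circle_cycle_graph:
  assumes n: "n > 0"
  shows "homeomorphic_to_circle (cycle_graph n) (cycle_rev n)"
proof -
  interpret graph_realization "cycle_graph n" "cycle_rev n"
    using bidirected_cycle_graph[OF n] by (simp add: graph_realization_def)
  define \<theta> where "\<theta> x = cis (2 * pi * x / real n)" for x
  define f :: "(nat + nat) \<times> real \<Rightarrow> complex" where
    "f = (\<lambda>(c, t). case c of Inl v \<Rightarrow> \<theta> (real v)
       | Inr e \<Rightarrow> \<theta> (if even e then real (e div 2) + t else real (e div 2) + 1 - t))"
  have f_simps: "f (Inl v, t) = \<theta> (real v)" "f (Inr (2 * i), t) = \<theta> (real i + t)"
    "f (Inr (Suc (2 * i)), t) = \<theta> (real i + 1 - t)" for v i t
    by (simp_all add: f_def)
  have \<theta>_mod: "\<theta> (real (Suc i mod n)) = \<theta> (real i + 1)" if "i < n" for i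
  proof (cases "Suc i = n")
    case True
    then have "real i + 1 = real n" by linarith
    then have "\<theta> (real i + 1) = \<theta> (real n)" by (simp only:)
    then show ?thesis using True n by (simp add: \<theta>_def)
  next
    case False
    then show ?thesis using that by (simp add: add.commute)
  qed
  have f_glue: "f x = f y" if xy: "(x, y) \<in> graph_gluing (cycle_graph n) (cycle_rev n)" for x y
  proof -
    consider e where "e < 2 * n" "x = (Inr e, 0)" "y = (Inl (tail (cycle_graph n) e), 0)"
      | e t where "e < 2 * n" "x = (Inr e, t)" "y = (Inr (cycle_rev n e), 1 - t)"
      using xy by (auto simp: graph_gluing_def)
    then show ?thesis
    proof cases
      case (1 e)
      from 1(1) show ?thesis
        by (cases e rule: cycle_arc_cases[of _ n]) (use 1 \<theta>_mod in \<open>simp_all add: f_simps\<close>)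
    next
      case (2 e t)
      from 2(1) show ?thesis
        by (cases e rule: cycle_arc_cases[of _ n]) (use 2 in \<open>simp_all add: f_simps add_diff_eq\<close>)
    qed
  qed
  \<comment> \<open>Normal form of a point: an even arc with a parameter in the half-open interval,
    parameter 1 being the start of the next edge. Injectivity is read off from it.\<close>
  have norm_f: "\<exists>i<n. \<exists>t. 0 \<le> t \<and> t < 1 \<and> q x = q (Inr (2 * i), t)" if x: "x \<in> topspace cells" for x
  proof -
    have v: "\<exists>i<n. \<exists>t. 0 \<le> t \<and> t < 1 \<and> q (Inl v, 0) = q (Inr (2 * i), t)" if "v < n" for v
      using that q_tail[of "2 * v"] by (intro exI[of _ v] conjI exI[of _ "0 :: real"]) simp_all
    have e: "\<exists>i<n. \<exists>t. 0 \<le> t \<and> t < 1 \<and> q (Inr (2 * j), s) = q (Inr (2 * i), t)"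
      if "j < n" "0 \<le> s" "s \<le> 1" for j s
    proof (cases "s = 1")
      case True
      then show ?thesis using q_head[of "2 * j"] v[of "Suc j mod n"] that n by simp
    next
      case False
      then show ?thesis using that by (intro exI[of _ j] conjI exI[of _ s]) simp_all
    qed
    consider v where "v < n" "x = (Inl v, 0)" | e t where "e < 2 * n" "0 \<le> t" "t \<le> 1" "x = (Inr e, t)"
      using x unfolding topspace_cells by auto
    then show ?thesis
    proof cases
      case 1
      then show ?thesis using v by simp
    next
      case (2 e t)
      from 2(1) show ?thesis
      proof (cases e rule: cycle_arc_cases[of _ n])
        case (1 i)
        then show ?thesis using e[of i t] 2 by simp
      next
        case a: (2 i)
        then show ?thesis using e[of i "1 - t"] q_rev[of e t] 2 by simp
      qed
    qed
  qed
  have \<theta>_inj: "x = y" if "0 \<le> x" "x < real n" "0 \<le> y" "y < real n" "\<theta> x = \<theta> y" for x y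
  proof -
    let ?x = "2 * pi * x / real n" and ?y = "2 * pi * y / real n"
    have "sin ?x = sin ?y \<and> cos ?x = cos ?y"
      using that(5) by (simp add: \<theta>_def complex_eq_iff)
    then obtain k :: int where k: "?x = ?y + 2 * pi * k"
      using sin_cos_eq_iff by blast
    then have "2 * pi * x = 2 * pi * (y + k * real n)"
      using n by (simp add: field_simps)
    then have xy: "x = y + k * real n" by simp
    have "\<bar>k\<bar> < 1"
    proof (rule ccontr)
      assume "\<not> ?thesis"
      then have "1 * real n \<le> \<bar>real_of_int k\<bar> * real n"
        by (intro mult_right_mono) linarith+
      then have "real n \<le> \<bar>k * real n\<bar>" by (simp add: abs_mult)
      then show False using xy that by linarith
    qed
    then show ?thesis using xy by simp
  qed
  define F where "F C = f (SOME x. x \<in> topspace cells \<and> q x = C)" for C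
  have F: "F (q x) = f x" if x: "x \<in> topspace cells" for x
  proof -
    have "\<exists>y. y \<in> topspace cells \<and> q y = q x" using x by blast
    then obtain y where y: "y \<in> topspace cells" "q y = q x" "F (q x) = f y"
      unfolding F_def by (metis (mono_tags, lifting) someI_ex)
    then have "(y, x) \<in> glue" using x by (simp add: q_eq_iff)
    then show ?thesis using glue_invariant[OF f_glue] y by simp
  qed
  have "continuous_map cells (top_of_set (sphere 0 1)) f"
    unfolding graph_cells_def
  proof (rule continuous_map_from_sum_topology)
    fix c assume "c \<in> verts (cycle_graph n) <+> arcs (cycle_graph n)"
    show "continuous_map (case_sum (\<lambda>_. top_of_set {0 :: real}) (\<lambda>_. top_of_set {0..1}) c) (top_of_set (sphere 0 1)) (\<lambda>x. f (c, x))"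
    proof (cases c)
      case (Inl v)
      then show ?thesis by (simp add: f_def \<theta>_def)
    next
      case (Inr e)
      have "continuous_on {0..1} (\<lambda>t. \<theta> (real (e div 2) + t))" "continuous_on {0..1} (\<lambda>t. \<theta> (real (e div 2) + 1 - t))"
        unfolding \<theta>_def cis_conv_exp using n by (intro continuous_intros; simp)+
      then show ?thesis
        using Inr by (cases "even e") (simp_all add: f_def \<theta>_def)
    qed
  qed
  moreover have "f x = (F \<circ> q) x" if "x \<in> topspace cells" for x
    using F[OF that] by simp
  ultimately have "continuous_map cells (top_of_set (sphere 0 1)) (F \<circ> q)"
    by (rule continuous_map_eq)
  then have cont: "continuous_map X (top_of_set (sphere 0 1)) F"
    by (rule continuous_from_X)
  have "compact_space cells"
    unfolding graph_cells_def
    by (rule compact_space_sum_topology) (auto simp: compact_space_subtopology split: sum.splits)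
  then have compact: "compact_space X"
    using image_compactin[OF _ continuous_q] by (simp add: compact_space_def topspace_X)
  have inj: "inj_on F (topspace X)"
  proof (rule inj_onI)
    fix C D assume CD: "C \<in> topspace X" "D \<in> topspace X" "F C = F D"
    obtain i s where i: "i < n" "0 \<le> s" "s < 1" "C = q (Inr (2 * i), s)"
    proof -
      obtain x where "x \<in> topspace cells" "C = q x"
        using CD(1) unfolding topspace_X by blast
      with norm_f[of x] show thesis
        using that by blast
    qed
    obtain j t where j: "j < n" "0 \<le> t" "t < 1" "D = q (Inr (2 * j), t)"
    proof -
      obtain x where "x \<in> topspace cells" "D = q x"
        using CD(2) unfolding topspace_X by blast
      with norm_f[of x] show thesis
        using that by blast
    qed
    have "\<theta> (real i + s) = \<theta> (real j + t)"
      using CD(3) i j F[of "(Inr (2 * i), s)"] F[of "(Inr (2 * j), t)"] by (simp add: f_simps)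
    then have eq: "real i + s = real j + t"
      using i j by (intro \<theta>_inj) linarith+
    then have "i = j" using i j by linarith
    moreover from this have "s = t" using eq by simp
    ultimately show "C = D" using i(4) j(4) by simp
  qed
  have surj: "F ` topspace X = sphere 0 1"
  proof (intro equalityI subsetI)
    fix z assume "z \<in> F ` topspace X"
    then show "z \<in> sphere 0 1"
      using cont by (auto simp: continuous_map_def)
  next
    fix z :: complex assume "z \<in> sphere 0 1"
    then have "(Re z)\<^sup>2 + (Im z)\<^sup>2 = 1" by (simp add: cmod_def)
    then obtain s where s: "0 \<le> s" "s < 2 * pi" "Re z = cos s" "Im z = sin s"
      using sincos_total_2pi by metis
    \<comment> \<open>The angle measured in edges; its integer part is the number of the
      edge.\<close>
    define x where "x = s * real n / (2 * pi)"
    have x: "0 \<le> x" "x < real n" "\<theta> x = z"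
      using s n by (auto simp: x_def \<theta>_def complex_eq_iff divide_simps)
    define i where "i = nat \<lfloor>x\<rfloor>"
    have i: "real i \<le> x" "x < real i + 1" "i < n"
      using x by (auto simp: i_def nat_less_iff floor_less_iff)
    then have c: "(Inr (2 * i), x - real i) \<in> topspace cells"
      by simp
    then have "F (q (Inr (2 * i), x - real i)) = z"
      using F[OF c] x(3) by (simp add: f_simps)
    then show "z \<in> F ` topspace X"
      using c by (auto simp: topspace_X)
  qed
  have "homeomorphic_map X (top_of_set (sphere 0 1)) F"
    using cont compact surj inj
    by (intro continuous_imp_homeomorphic_map) (simp_all add: Hausdorff_space_subtopology)
  then show ?thesis
    by (auto simp: homeomorphic_to_circle_def homeomorphic_space_def homeomorphic_map_maps)
qed

section \<open>Large groups have non-metabelian finite quotients\<close>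

definition commutator :: "('a, 'm) monoid_scheme \<Rightarrow> 'a \<Rightarrow> 'a \<Rightarrow> 'a" where
  "commutator G x y = x \<otimes>\<^bsub>G\<^esub> y \<otimes>\<^bsub>G\<^esub> inv\<^bsub>G\<^esub> x \<otimes>\<^bsub>G\<^esub> inv\<^bsub>G\<^esub> y"

lemma (in group) commutator_closed [simp]:
  "x \<in> carrier G \<Longrightarrow> y \<in> carrier G \<Longrightarrow> commutator G x y \<in> carrier G"
  by (simp add: commutator_def)

lemma (in group) commutator_eq:
  assumes "x \<in> carrier G" "y \<in> carrier G"
  shows "commutator G x y = (x \<otimes> y) \<otimes> inv (y \<otimes> x)"
  using assms by (simp add: commutator_def inv_mult_group m_assoc)

lemma (in group) commutator_eq_one:
  assumes "x \<in> carrier G" "y \<in> carrier G"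
  shows "commutator G x y = \<one> \<longleftrightarrow> x \<otimes> y = y \<otimes> x"
  using assms by (simp add: commutator_eq inv_solve_right')

lemma (in group_hom) hom_commutator:
  assumes "x \<in> carrier G" "y \<in> carrier G"
  shows "h (commutator G x y) = commutator H (h x) (h y)"
  using assms by (simp add: commutator_def)

section \<open>Finite permutation groups\<close>

lemma carrier_BijGroup: "carrier (BijGroup S) = Bij S"
  by (simp add: BijGroup_def)

lemma BijGroup_apply:
  "f \<in> Bij S \<Longrightarrow> g \<in> Bij S \<Longrightarrow> x \<in> S \<Longrightarrow> (f \<otimes>\<^bsub>BijGroup S\<^esub> g) x = f (g x)"
  by (simp add: BijGroup_def compose_def)

lemma finite_BijGroup: "finite S \<Longrightarrow> finite (carrier (BijGroup S))"
  unfolding carrier_BijGroup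
  by (rule finite_subset[OF _ finite_PiE[of S "\<lambda>_. S"]]) (auto simp: Bij_def PiE_def bij_betw_def)

lemma Bij_eqI: "f \<in> Bij S \<Longrightarrow> g \<in> Bij S \<Longrightarrow> (\<And>x. x \<in> S \<Longrightarrow> f x = g x) \<Longrightarrow> f = g"
  by (rule extensionalityI[of _ S]) (simp_all add: Bij_def)

text \<open>Right cosets are permuted by \<open>C \<mapsto> C #> inv g\<close>, the inverse making
  this a left action. An element acting trivially fixes the coset \<open>K\<close> and so belongs to
  \<open>K\<close>.\<close>

lemma finite_index_action:
  fixes G (structure)
  assumes G: "group G" and K: "subgroup K G" and fin: "finite (rcosets K)"
  obtains \<pi> where "\<pi> \<in> hom G (BijGroup (rcosets K))" "\<And>g. g \<in> carrier G \<Longrightarrow> \<pi> g = \<one>\<^bsub>BijGroup (rcosets K)\<^esub> \<Longrightarrow> g \<in> K"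
proof -
  interpret G: group G by fact
  let ?S = "rcosets K"
  define \<pi> where "\<pi> g = restrict (\<lambda>C. C #> inv g) ?S" for g
  have sub: "C \<subseteq> carrier G" if "C \<in> ?S" for C
    using G.rcosets_part_G[OF K] that by blast
  have closed: "C #> g \<in> ?S" if C: "C \<in> ?S" and g: "g \<in> carrier G" for C g
  proof -
    obtain x where x: "x \<in> carrier G" "C = K #> x"
      using C by (auto simp: RCOSETS_def)
    then have "C #> g = K #> (x \<otimes> g)"
      using g by (simp add: G.coset_mult_assoc subgroup.subset[OF K])
    then show ?thesis
      using x g by (simp add: G.rcosetsI subgroup.subset[OF K])
  qed
  have bij: "\<pi> g \<in> Bij ?S" if g: "g \<in> carrier G" for g
  proof -
    have "bij_betw (\<pi> g) ?S ?S"
    proof (rule bij_betwI[of _ _ _ "\<lambda>C. C #> g"])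
      show "\<pi> g \<in> ?S \<rightarrow> ?S" "(\<lambda>C. C #> g) \<in> ?S \<rightarrow> ?S"
        using closed g by (simp_all add: \<pi>_def)
      show "\<pi> g C #> g = C" "\<pi> g (C #> g) = C" if "C \<in> ?S" for C
        using that g closed[OF that g] sub[OF that] by (simp_all add: \<pi>_def G.coset_mult_assoc G.coset_mult_one)
    qed
    then show ?thesis
      by (simp add: Bij_def \<pi>_def)
  qed
  have "\<pi> \<in> hom G (BijGroup ?S)"
  proof (rule homI)
    show "\<pi> g \<in> carrier (BijGroup ?S)" if "g \<in> carrier G" for g
      using bij[OF that] by (simp add: carrier_BijGroup)
    fix g h assume gh: "g \<in> carrier G" "h \<in> carrier G"
    have m: "\<pi> g \<otimes>\<^bsub>BijGroup ?S\<^esub> \<pi> h \<in> Bij ?S"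
      using bij gh group.is_monoid[OF group_BijGroup[of ?S]] monoid.m_closed[of "BijGroup ?S" "\<pi> g" "\<pi> h"]
      by (simp add: carrier_BijGroup)
    show "\<pi> (g \<otimes> h) = \<pi> g \<otimes>\<^bsub>BijGroup ?S\<^esub> \<pi> h"
    proof (rule Bij_eqI[OF _ m])
      show "\<pi> (g \<otimes> h) \<in> Bij ?S" using bij gh by simp
      fix C assume C: "C \<in> ?S"
      show "\<pi> (g \<otimes> h) C = (\<pi> g \<otimes>\<^bsub>BijGroup ?S\<^esub> \<pi> h) C"
        using C gh bij closed[OF C, of "inv h"] sub[OF C]
        by (simp add: BijGroup_apply) (simp add: \<pi>_def G.inv_mult_group G.coset_mult_assoc)
    qed
  qed
  moreover have "g \<in> K" if g: "g \<in> carrier G" "\<pi> g = \<one>\<^bsub>BijGroup ?S\<^esub>" for g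
  proof -
    have K': "K \<in> ?S"
      using G.rcosetsI[OF subgroup.subset[OF K] G.one_closed] by (simp add: G.coset_mult_one subgroup.subset[OF K])
    have "K #> inv g = K"
      using fun_cong[OF g(2), of K] K' by (simp add: \<pi>_def BijGroup_def)
    then have "inv g \<in> K"
      using g K by (metis G.coset_join1 G.inv_closed)
    then show ?thesis
      using subgroup.m_inv_closed[OF K, of "inv g"] g by simp
  qed
  ultimately show thesis by (rule that)
qed

text \<open>The coset of \<open>g\<close> modulo the kernel is determined by its coset modulo
  \<open>H\<close> and by the value of \<open>\<Theta>\<close> on the part of \<open>g\<close>
  inside \<open>H\<close>, measured from a chosen representative: finitely many data.\<close>

lemma finite_index_kernel:
  fixes G (structure)
  assumes G: "group G" and H: "subgroup H G" "finite (rcosets H)"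
    and Q: "group Q" "finite (carrier Q)" and \<Theta>: "\<Theta> \<in> hom (G\<lparr>carrier := H\<rparr>) Q"
  shows "subgroup {h \<in> H. \<Theta> h = \<one>\<^bsub>Q\<^esub>} G" "finite (rcosets {h \<in> H. \<Theta> h = \<one>\<^bsub>Q\<^esub>})"
proof -
  interpret G: group G by fact
  interpret Q: group Q by fact
  interpret H: subgroup H G by fact
  interpret \<Theta>: group_hom "G\<lparr>carrier := H\<rparr>" Q \<Theta>
    using G.subgroup_imp_group[OF H(1)] Q(1) \<Theta> by (simp add: group_hom_def group_hom_axioms_def)
  let ?K = "{h \<in> H. \<Theta> h = \<one>\<^bsub>Q\<^esub>}"
  have \<Theta>_mult: "\<Theta> (x \<otimes> y) = \<Theta> x \<otimes>\<^bsub>Q\<^esub> \<Theta> y" if "x \<in> H" "y \<in> H" for x y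
    using \<Theta>.hom_mult[of x y] that by simp
  have \<Theta>_inv: "\<Theta> (inv x) = inv\<^bsub>Q\<^esub> \<Theta> x" if "x \<in> H" for x
    using \<Theta>.hom_inv[of x] that G.m_inv_consistent[OF H(1) that] by simp
  have \<Theta>_closed: "\<Theta> x \<in> carrier Q" if "x \<in> H" for x
    using \<Theta>.hom_closed[of x] that by simp
  show K: "subgroup ?K G"
  proof (rule subgroup.intro)
    show "?K \<subseteq> carrier G" using H.subset by blast
    show "x \<otimes> y \<in> ?K" if "x \<in> ?K" "y \<in> ?K" for x y
      using that by (simp add: \<Theta>_mult H.m_closed)
    show "\<one> \<in> ?K"
      using \<Theta>.hom_one by simp
    show "inv x \<in> ?K" if "x \<in> ?K" for x
      using that by (simp add: \<Theta>_inv H.m_inv_closed)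
  qed
  define rep where "rep C = (SOME x. x \<in> C)" for C :: "'a set"
  have rep: "rep (H #> g) \<in> carrier G" "g \<otimes> inv rep (H #> g) \<in> H" if g: "g \<in> carrier G" for g
  proof -
    have "g \<in> H #> g" using G.rcos_self[OF g H(1)] .
    then have "rep (H #> g) \<in> H #> g" unfolding rep_def by (rule someI)
    then obtain h where h: "h \<in> H" "rep (H #> g) = h \<otimes> g"
      unfolding r_coset_def by blast
    then show c: "rep (H #> g) \<in> carrier G" using g by simp
    have "g \<otimes> inv rep (H #> g) = inv h"
      using h g H.subset by (simp add: G.inv_mult_group flip: G.m_assoc)
    then show "g \<otimes> inv rep (H #> g) \<in> H" using h by simp
  qed
  \<comment> \<open>These are the data; elements with equal data differ by an element of the
    kernel.\<close>
  define m where "m g = (H #> g, \<Theta> (g \<otimes> inv rep (H #> g)))" for g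
  have m_eq: "?K #> g = ?K #> g'" if g: "g \<in> carrier G" "g' \<in> carrier G" "m g = m g'" for g g'
  proof -
    let ?r = "rep (H #> g)"
    have eq1: "H #> g' = H #> g"
      using g(3) by (simp add: m_def)
    have eq: "H #> g' = H #> g" "\<Theta> (g \<otimes> inv ?r) = \<Theta> (g' \<otimes> inv ?r)"
      using g(3) unfolding m_def eq1 by simp_all
    have mem: "g \<otimes> inv ?r \<in> H" "g' \<otimes> inv ?r \<in> H" "?r \<in> carrier G"
      using rep[OF g(1)] rep[OF g(2)] eq(1) by simp_all
    have "(g \<otimes> inv ?r) \<otimes> inv (g' \<otimes> inv ?r) = g \<otimes> inv ?r \<otimes> (?r \<otimes> inv g')"
      using g mem by (simp add: G.inv_mult_group)
    also have "\<dots> = g \<otimes> (inv ?r \<otimes> ?r) \<otimes> inv g'"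
      using g mem(3) by (simp only: G.m_assoc G.inv_closed G.m_closed)
    also have "\<dots> = g \<otimes> inv g'"
      using g mem(3) by simp
    finally have e: "g \<otimes> inv g' = (g \<otimes> inv ?r) \<otimes> inv (g' \<otimes> inv ?r)" by simp
    have "g \<otimes> inv g' \<in> ?K"
      unfolding e using mem eq(2) by (simp add: \<Theta>_mult \<Theta>_inv \<Theta>_closed)
    then have "?K #> (g \<otimes> inv g') = ?K"
      using g K by (intro G.coset_join2) simp_all
    moreover have "r_coset G (r_coset G ?K (g \<otimes> inv g')) g' = ?K #> g"
      using g subgroup.subset[OF K] by (simp add: G.coset_mult_assoc G.m_assoc)
    ultimately show ?thesis by simp
  qed
  have "m ` carrier G \<subseteq> (rcosets H) \<times> carrier Q"
  proof (rule image_subsetI)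
    fix g assume g: "g \<in> carrier G"
    show "m g \<in> (rcosets H) \<times> carrier Q"
      using \<Theta>_closed[OF rep(2)[OF g]] G.rcosetsI[OF H.subset g] by (simp add: m_def)
  qed
  then have fin_m: "finite (m ` carrier G)"
    by (rule finite_subset[OF _ finite_cartesian_product[OF H(2) Q(2)]])
  have "rcosets ?K \<subseteq> (\<lambda>p. ?K #> (SOME g. g \<in> carrier G \<and> m g = p)) ` m ` carrier G"
  proof
    fix C assume "C \<in> rcosets ?K"
    then obtain g where g: "g \<in> carrier G" "C = ?K #> g"
      by (auto simp: RCOSETS_def)
    let ?g = "SOME g'. g' \<in> carrier G \<and> m g' = m g"
    have "?g \<in> carrier G \<and> m ?g = m g"
      by (rule someI[of _ g]) (use g in simp)
    then have "?K #> ?g = ?K #> g"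
      using m_eq[of ?g g] g(1) by blast
    then have "C = (\<lambda>p. ?K #> (SOME g. g \<in> carrier G \<and> m g = p)) (m g)"
      using g(2) by simp
    then show "C \<in> (\<lambda>p. ?K #> (SOME g. g \<in> carrier G \<and> m g = p)) ` m ` carrier G"
      using g(1) by blast
  qed
  then show "finite (rcosets ?K)"
    by (rule finite_subset[OF _ finite_imageI[OF fin_m]])
qed

text \<open>\<open>a\<close>, \<open>b\<close>, \<open>c\<close> are the transpositions of
  neighbours among 0, 1, 2, 3 and \<open>y\<close> is the 4-cycle that conjugates each of them to
  the next. Writing \<open>b\<close> and \<open>c\<close> through \<open>a\<close> and
  \<open>y\<close> allows lifting them to the free group on two generators.\<close>

lemma symmetric_group_4_not_metabelian:
  obtains a b c y where "a \<in> carrier (BijGroup {..<4 :: nat})" "y \<in> carrier (BijGroup {..<4 :: nat})"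
    "b = y \<otimes>\<^bsub>BijGroup {..<4}\<^esub> a \<otimes>\<^bsub>BijGroup {..<4}\<^esub> inv\<^bsub>BijGroup {..<4}\<^esub> y"
    "c = y \<otimes>\<^bsub>BijGroup {..<4}\<^esub> b \<otimes>\<^bsub>BijGroup {..<4}\<^esub> inv\<^bsub>BijGroup {..<4}\<^esub> y"
    "commutator (BijGroup {..<4}) (commutator (BijGroup {..<4}) a b) (commutator (BijGroup {..<4}) b c) \<noteq>
       \<one>\<^bsub>BijGroup {..<4}\<^esub>"
proof -
  let ?S = "{..<4 :: nat}" and ?B = "BijGroup {..<4 :: nat}"
  interpret B: group ?B by (rule group_BijGroup)
  have four: "x \<in> ?S \<longleftrightarrow> x = 0 \<or> x = 1 \<or> x = 2 \<or> x = 3" for x by auto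
  define a where "a = restrict (\<lambda>x. if x = 0 then 1 else if x = 1 then 0 else x) ?S"
  define b where "b = restrict (\<lambda>x. if x = 1 then 2 else if x = 2 then 1 else x) ?S"
  define c where "c = restrict (\<lambda>x. if x = 2 then 3 else if x = 3 then 2 else x) ?S"
  define y where "y = restrict (\<lambda>x. if x = 3 then 0 else x + 1) ?S"
  have inv_bij: "f \<in> Bij ?S" if "f \<in> extensional ?S" "\<And>x. x \<in> ?S \<Longrightarrow> f x \<in> ?S \<and> f (f x) = x" for f
    using that bij_betwI[of f ?S ?S f] by (simp add: Bij_def)
  have a: "a \<in> Bij ?S" by (rule inv_bij) (auto simp: a_def four)
  have b: "b \<in> Bij ?S" by (rule inv_bij) (auto simp: b_def four)
  have c: "c \<in> Bij ?S" by (rule inv_bij) (auto simp: c_def four)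
  have "bij_betw y ?S ?S"
    by (rule bij_betwI[of _ _ _ "\<lambda>x. if x = 0 then 3 else x - 1"]) (auto simp: y_def)
  then have y: "y \<in> Bij ?S" by (simp add: Bij_def y_def)
  have m: "f \<otimes>\<^bsub>?B\<^esub> g \<in> Bij ?S" if "f \<in> Bij ?S" "g \<in> Bij ?S" for f g
    using that B.m_closed[of f g] by (simp add: carrier_BijGroup)
  have self_inv: "inv\<^bsub>?B\<^esub> f = f" if f: "f \<in> Bij ?S" "\<And>x. x \<in> ?S \<Longrightarrow> f x \<in> ?S \<and> f (f x) = x" for f
  proof (rule B.inv_equality)
    show "f \<otimes>\<^bsub>?B\<^esub> f = \<one>\<^bsub>?B\<^esub>"
    proof (rule Bij_eqI[OF m[OF f(1,1)]])
      show "\<one>\<^bsub>?B\<^esub> \<in> Bij ?S" using B.one_closed by (simp add: carrier_BijGroup)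
      show "(f \<otimes>\<^bsub>?B\<^esub> f) x = \<one>\<^bsub>?B\<^esub> x" if "x \<in> ?S" for x
        using f(2)[OF that] f(1) that by (simp add: BijGroup_apply) (simp add: BijGroup_def)
    qed
  qed (use f in \<open>simp_all add: carrier_BijGroup\<close>)
  have ia: "inv\<^bsub>?B\<^esub> a = a" by (rule self_inv[OF a]) (auto simp: a_def four)
  have ib: "inv\<^bsub>?B\<^esub> b = b" by (rule self_inv[OF b]) (auto simp: b_def four)
  have ic: "inv\<^bsub>?B\<^esub> c = c" by (rule self_inv[OF c]) (auto simp: c_def four)
  have "y \<otimes>\<^bsub>?B\<^esub> a = b \<otimes>\<^bsub>?B\<^esub> y"
    by (rule Bij_eqI[OF m[OF y a] m[OF b y]]) (simp add: BijGroup_apply a b y, auto simp: a_def b_def y_def four)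
  then have b': "y \<otimes>\<^bsub>?B\<^esub> a \<otimes>\<^bsub>?B\<^esub> inv\<^bsub>?B\<^esub> y = b"
    using a[folded carrier_BijGroup] b[folded carrier_BijGroup] y[folded carrier_BijGroup]
    by (simp add: B.m_assoc)
  have "y \<otimes>\<^bsub>?B\<^esub> b = c \<otimes>\<^bsub>?B\<^esub> y"
    by (rule Bij_eqI[OF m[OF y b] m[OF c y]]) (simp add: BijGroup_apply b c y, auto simp: b_def c_def y_def four)
  then have c': "y \<otimes>\<^bsub>?B\<^esub> b \<otimes>\<^bsub>?B\<^esub> inv\<^bsub>?B\<^esub> y = c"
    using b[folded carrier_BijGroup] c[folded carrier_BijGroup] y[folded carrier_BijGroup]
    by (simp add: B.m_assoc)
  define s t where "s = commutator ?B a b" and "t = commutator ?B b c"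
  have st: "s \<in> Bij ?S" "t \<in> Bij ?S"
    using B.commutator_closed[of a b] B.commutator_closed[of b c] a b c by (simp_all add: s_def t_def carrier_BijGroup)
  have s_apply: "s x = a (b (a (b x)))" and t_apply: "t x = b (c (b (c x)))" if "x \<in> ?S" for x
  proof -
    have "b x \<in> ?S" "c x \<in> ?S" "a (b x) \<in> ?S" "b (c x) \<in> ?S" "b (a (b x)) \<in> ?S" "c (b (c x)) \<in> ?S"
      using that by (auto simp: a_def b_def c_def four)
    then show "s x = a (b (a (b x)))" "t x = b (c (b (c x)))"
      using that a b c m by (simp_all add: s_def t_def commutator_def ia ib ic BijGroup_apply)
  qed
  \<comment> \<open>It is enough to look at 0: \<open>s\<close> after \<open>t\<close> takes it to
    2, \<open>t\<close> after \<open>s\<close> takes it to 1.\<close>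
  have "s 0 = 2" "t 0 = 0" "t 2 = 1"
    using s_apply[of 0] t_apply[of 0] t_apply[of 2] by (simp_all add: a_def b_def c_def)
  then have "(s \<otimes>\<^bsub>?B\<^esub> t) 0 = 2" "(t \<otimes>\<^bsub>?B\<^esub> s) 0 = 1"
    using st by (simp_all add: BijGroup_apply)
  then have "s \<otimes>\<^bsub>?B\<^esub> t \<noteq> t \<otimes>\<^bsub>?B\<^esub> s" by auto
  then have ne: "commutator ?B s t \<noteq> \<one>\<^bsub>?B\<^esub>"
    using st by (subst B.commutator_eq_one) (simp_all add: carrier_BijGroup)
  show thesis
    using a[folded carrier_BijGroup] y[folded carrier_BijGroup] b'[symmetric] c'[symmetric]
      ne[unfolded s_def t_def] by (rule that)
qed

text \<open>The map to the symmetric group is defined on \<open>H\<close> only. Its kernel has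
  finite index in \<open>G\<close>, and the action of \<open>G\<close> on the cosets of the kernel
  is a finite image of \<open>G\<close> itself in which the iterated commutator survives.\<close>

lemma large_not_metabelian:
  fixes G :: "('a, 'm) monoid_scheme" (structure)
  assumes G: "group G" and "large G"
  obtains X :: "'a set set" and \<pi> g1 g2 g3 g4 where "finite X" "\<pi> \<in> hom G (BijGroup X)"
    "g1 \<in> carrier G" "g2 \<in> carrier G" "g3 \<in> carrier G" "g4 \<in> carrier G"
    "\<pi> (commutator G (commutator G g1 g2) (commutator G g3 g4)) \<noteq> \<one>\<^bsub>BijGroup X\<^esub>"
proof -
  interpret G: group G by fact
  obtain H \<phi> where H: "subgroup H G" "finite (rcosets H)"
    and \<phi>: "\<phi> \<in> epi (G\<lparr>carrier := H\<rparr>) (free_group {0, 1 :: nat})"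
    using \<open>large G\<close> by (auto simp: large_def)
  interpret H: subgroup H G by fact
  let ?B = "BijGroup {..<4 :: nat}"
  interpret B: group ?B by (rule group_BijGroup)
  obtain a b c y where ay: "a \<in> carrier ?B" "y \<in> carrier ?B"
    and bc: "b = y \<otimes>\<^bsub>?B\<^esub> a \<otimes>\<^bsub>?B\<^esub> inv\<^bsub>?B\<^esub> y" "c = y \<otimes>\<^bsub>?B\<^esub> b \<otimes>\<^bsub>?B\<^esub> inv\<^bsub>?B\<^esub> y"
    and ne: "commutator ?B (commutator ?B a b) (commutator ?B b c) \<noteq> \<one>\<^bsub>?B\<^esub>"
    by (rule symmetric_group_4_not_metabelian)
  obtain \<psi> where \<psi>: "\<psi> \<in> hom (free_group {0, 1 :: nat}) ?B" "\<psi> (fg_gen 0) = a" "\<psi> (fg_gen 1) = y"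
    by (rule free_group_hom[OF group_BijGroup ay])
  define \<Theta> where "\<Theta> = \<psi> \<circ> \<phi>"
  have \<phi>': "\<phi> \<in> hom (G\<lparr>carrier := H\<rparr>) (free_group {0, 1 :: nat})" "\<phi> ` H = carrier (free_group {0, 1 :: nat})"
    using \<phi> by (simp_all add: epi_def)
  have \<Theta>: "\<Theta> \<in> hom (G\<lparr>carrier := H\<rparr>) ?B"
    unfolding \<Theta>_def by (rule hom_compose[OF \<phi>'(1) \<psi>(1)])
  interpret \<Theta>: group_hom "G\<lparr>carrier := H\<rparr>" ?B \<Theta>
    using G.subgroup_imp_group[OF H(1)] \<Theta> by (simp add: group_hom_def group_hom_axioms_def group_BijGroup)
  have "fg_gen 0 \<in> \<phi> ` H" "fg_gen 1 \<in> \<phi> ` H"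
    unfolding \<phi>'(2) by (rule fg_gen_carrier; simp)+
  then obtain ha hy where h0: "ha \<in> H" "hy \<in> H" "fg_gen 0 = \<phi> ha" "fg_gen 1 = \<phi> hy"
    by (elim imageE)
  have h: "ha \<in> H" "hy \<in> H" "\<Theta> ha = a" "\<Theta> hy = y"
    using h0 \<psi>(2,3) by (simp_all only: \<Theta>_def comp_apply)
  define hb where "hb = hy \<otimes> ha \<otimes> inv hy"
  define hc where "hc = hy \<otimes> hb \<otimes> inv hy"
  have hbc: "hb \<in> H" "hc \<in> H"
    using h by (simp_all add: hb_def hc_def)
  have inv_H: "inv\<^bsub>G\<lparr>carrier := H\<rparr>\<^esub> x = inv x" if "x \<in> H" for x
    using G.m_inv_consistent[OF H(1) that] .
  have \<Theta>_mult: "\<Theta> (u \<otimes> v) = \<Theta> u \<otimes>\<^bsub>?B\<^esub> \<Theta> v" if "u \<in> H" "v \<in> H" for u v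
    using \<Theta>.hom_mult[of u v] that by simp
  have \<Theta>_inv: "\<Theta> (inv u) = inv\<^bsub>?B\<^esub> \<Theta> u" if "u \<in> H" for u
    using \<Theta>.hom_inv[of u] that inv_H[OF that] by simp
  have comm_H: "commutator G u v \<in> H" "\<Theta> (commutator G u v) = commutator ?B (\<Theta> u) (\<Theta> v)" if "u \<in> H" "v \<in> H" for u v
    using that by (simp_all add: commutator_def \<Theta>_mult \<Theta>_inv)
  have \<Theta>b: "\<Theta> hb = b"
    using h by (simp add: hb_def bc(1) \<Theta>_mult \<Theta>_inv)
  have \<Theta>c: "\<Theta> hc = c"
    using h hbc \<Theta>b by (simp add: hc_def bc(2) \<Theta>_mult \<Theta>_inv)
  let ?w = "commutator G (commutator G ha hb) (commutator G hb hc)"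
  have w: "\<Theta> ?w \<noteq> \<one>\<^bsub>?B\<^esub>"
    using ne h hbc by (simp add: comm_H \<Theta>b \<Theta>c)
  let ?K = "{h \<in> H. \<Theta> h = \<one>\<^bsub>?B\<^esub>}"
  note K = finite_index_kernel[OF G H group_BijGroup finite_BijGroup[OF finite_lessThan] \<Theta>]
  have mem: "ha \<in> carrier G" "hb \<in> carrier G" "hc \<in> carrier G"
    using h hbc H.subset by blast+
  show thesis
  proof (rule finite_index_action[OF G K])
    fix \<pi> assume \<pi>: "\<pi> \<in> hom G (BijGroup (rcosets ?K))"
      "\<And>g. g \<in> carrier G \<Longrightarrow> \<pi> g = \<one>\<^bsub>BijGroup (rcosets ?K)\<^esub> \<Longrightarrow> g \<in> ?K"
    have "\<pi> ?w \<noteq> \<one>\<^bsub>BijGroup (rcosets ?K)\<^esub>"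
    proof
      assume "\<pi> ?w = \<one>\<^bsub>BijGroup (rcosets ?K)\<^esub>"
      then have "?w \<in> ?K"
        by (rule \<pi>(2)[rotated]) (use mem in simp)
      then show False
        using w by simp
    qed
    then show thesis
      by (rule that[OF K(2) \<pi>(1) mem(1,2,2,3)])
  qed
qed

section \<open>Graphs without proper plateaus\<close>

lemma (in group) ord_int_pow:
  assumes "x \<in> carrier G" "k \<noteq> 0"
  shows "ord (x [^] (k :: int)) = ord x div gcd (ord x) (nat \<bar>k\<bar>)"
proof -
  define m where "m = nat \<bar>k\<bar>"
  have m: "m \<noteq> 0" "k = int m \<or> k = - int m"
    using assms(2) by (auto simp: m_def)
  have "ord (x [^] k) = ord (x [^] m)"
    using m(2) assms(1) by (auto simp: int_pow_int int_pow_neg_int)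
  then show ?thesis
    using ord_pow_gen[OF assms(1), of m] m(1) by (simp add: m_def)
qed

lemma (in group) ord_conjugate:
  assumes c: "s \<in> carrier G" "y \<in> carrier G" "z \<in> carrier G" and eq: "s \<otimes> y = z \<otimes> s"
  shows "ord y = ord z"
proof -
  have pow: "s \<otimes> y [^] n = z [^] n \<otimes> s" for n :: nat
  proof (induction n)
    case (Suc n)
    have "s \<otimes> y [^] Suc n = (s \<otimes> y [^] n) \<otimes> y"
      using c by (simp add: m_assoc)
    also have "\<dots> = z [^] n \<otimes> (s \<otimes> y)"
      using c by (simp add: Suc.IH m_assoc)
    also have "\<dots> = z [^] Suc n \<otimes> s"
      using c by (simp add: eq m_assoc)
    finally show ?case .
  qed (use c in simp)
  have "y [^] n = \<one> \<longleftrightarrow> z [^] n = \<one>" for n :: nat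
  proof
    assume "y [^] n = \<one>"
    then have "z [^] n \<otimes> s = \<one> \<otimes> s"
      using pow[of n] c by simp
    then show "z [^] n = \<one>"
      using c by (simp add: r_cancel_one)
  next
    assume "z [^] n = \<one>"
    then have "s \<otimes> y [^] n = s \<otimes> \<one>"
      using pow[of n] c by simp
    then show "y [^] n = \<one>"
      using c by simp
  qed
  then show ?thesis
    using c by (simp add: ord_unique pow_eq_id)
qed

text \<open>The vertices at which the order of the vertex group has maximal \<open>p\<close>-adic valuation
  spread along the edges whose label is prime to \<open>p\<close>, so that their components are plateaus.\<close>

lemma plateau_of_orders:
  fixes \<Gamma> :: "('v, 'e) pre_digraph" and n :: "'v \<Rightarrow> nat"
  assumes \<Gamma>: "labelled_graph \<Gamma> arev lab" and p: "prime p"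
    and n: "\<And>v. v \<in> verts \<Gamma> \<Longrightarrow> n v > 0"
    and eq: "\<And>e. e \<in> arcs \<Gamma> \<Longrightarrow> n (tail \<Gamma> e) div gcd (n (tail \<Gamma> e)) (nat \<bar>lab e\<bar>) =
       n (head \<Gamma> e) div gcd (n (head \<Gamma> e)) (nat \<bar>lab (arev e)\<bar>)"
    and u: "u \<in> verts \<Gamma>" "p dvd n u"
  shows "\<exists>P. p_plateau p \<Gamma> arev lab P \<and> (\<forall>e\<in>arcs P. \<not> int p dvd lab e)"
proof -
  interpret labelled_graph \<Gamma> arev lab by fact
  define val where "val v = multiplicity p (n v)" for v
  define M where "M = Max (val ` verts \<Gamma>)"
  have "M \<in> val ` verts \<Gamma>"
    unfolding M_def using u by (intro Max_in) auto
  then obtain v0 where v0: "v0 \<in> verts \<Gamma>" "val v0 = M" by auto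
  have le_M: "val v \<le> M" if "v \<in> verts \<Gamma>" for v
    unfolding M_def using that by (intro Max_ge) auto
  have "val u > 0"
    using u n[OF u(1)] p by (simp add: val_def prime_multiplicity_gt_zero_iff)
  then have M: "M > 0"
    using le_M[OF u(1)] by simp
  have split: "val v = multiplicity p (n v div gcd (n v) k) + multiplicity p (gcd (n v) k)"
    if "v \<in> verts \<Gamma>" for v k
  proof -
    have "n v = (n v div gcd (n v) k) * gcd (n v) k" by simp
    moreover have "n v div gcd (n v) k \<noteq> 0" "gcd (n v) k \<noteq> 0"
      using n[OF that] by (auto simp: dvd_div_eq_0_iff)
    ultimately show ?thesis
      unfolding val_def using p by (metis prime_elem_multiplicity_mult_distrib prime_imp_prime_elem)
  qed
  \<comment> \<open>Arcs that leave a vertex of maximal valuation with a label prime to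
    \<open>p\<close>. The plateau will be a component of the graph they form.\<close>
  define E where "E = {e \<in> arcs \<Gamma>. val (tail \<Gamma> e) = M \<and> \<not> int p dvd lab e}"
  have abs_dvd: "p dvd nat \<bar>k\<bar> \<longleftrightarrow> int p dvd k" for k
    by (simp add: nat_abs_dvd_iff flip: int_dvd_int_iff)
  have E: "val (head \<Gamma> e) = M \<and> arev e \<in> E" if "e \<in> E" for e
  proof -
    have e: "e \<in> arcs \<Gamma>" "val (tail \<Gamma> e) = M" "\<not> p dvd nat \<bar>lab e\<bar>"
      using that by (simp_all add: E_def abs_dvd)
    then have ht: "tail \<Gamma> e \<in> verts \<Gamma>" "head \<Gamma> e \<in> verts \<Gamma>" by auto
    define k l where "k = nat \<bar>lab e\<bar>" and "l = nat \<bar>lab (arev e)\<bar>"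
    let ?t = "n (tail \<Gamma> e)" and ?h = "n (head \<Gamma> e)"
    have eq': "?t div gcd ?t k = ?h div gcd ?h l"
      unfolding k_def l_def by (rule eq[OF e(1)])
    have "\<not> p dvd gcd ?t k"
      using e(3) unfolding k_def by (meson dvd_trans gcd_dvd2)
    then have "multiplicity p (?t div gcd ?t k) = M"
      using split[OF ht(1), of k] e(2) by (simp add: not_dvd_imp_multiplicity_0)
    then have "val (head \<Gamma> e) = M + multiplicity p (gcd ?h l)"
      using split[OF ht(2), of l] eq' by simp
    \<comment> \<open>The valuation at the head is \<open>M\<close> plus a non-negative term;
      maximality kills this term, which also makes the label of the reversed arc prime to
      \<open>p\<close>.\<close>
    then have h: "val (head \<Gamma> e) = M" "multiplicity p (gcd ?h l) = 0"
      using le_M[OF ht(2)] by simp_all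
    have "p dvd ?h"
    proof (rule ccontr)
      assume "\<not> p dvd ?h"
      then have "multiplicity p ?h = 0" by (rule not_dvd_imp_multiplicity_0)
      then show False using h(1) M by (simp add: val_def)
    qed
    moreover have "\<not> p dvd gcd ?h l"
      using h(2) n[OF ht(2)] p multiplicity_eq_zero_iff[of "gcd ?h l" p] prime_gt_1_nat[OF p] by auto
    ultimately have "\<not> p dvd l"
      by (meson gcd_greatest)
    then have "\<not> int p dvd lab (arev e)"
      by (simp add: l_def abs_dvd)
    then show ?thesis
      using h(1) e(1) by (simp add: E_def)
  qed
  define Rel where "Rel = {(tail \<Gamma> e, head \<Gamma> e) | e. e \<in> E}"
  define R where "R = {v. (v0, v) \<in> Rel\<^sup>*}"
  have R: "v \<in> verts \<Gamma> \<and> val v = M" if "v \<in> R" for v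
  proof -
    have "(v0, v) \<in> Rel\<^sup>*" using that by (simp add: R_def)
    then show ?thesis
    proof (induction rule: rtrancl_induct)
      case (step y z)
      then obtain e where "e \<in> E" "z = head \<Gamma> e" by (auto simp: Rel_def)
      then show ?case using E[of e] by (auto simp: E_def)
    qed (use v0 in simp)
  qed
  have R_head: "head \<Gamma> e \<in> R" if "e \<in> E" "tail \<Gamma> e \<in> R" for e
  proof -
    have "(tail \<Gamma> e, head \<Gamma> e) \<in> Rel" using that(1) by (auto simp: Rel_def)
    then show ?thesis using that(2) by (simp add: R_def)
  qed
  define P where "P = \<Gamma>\<lparr>verts := R, arcs := {e \<in> E. tail \<Gamma> e \<in> R}\<rparr>"
  have P: "verts P = R" "arcs P = {e \<in> E. tail \<Gamma> e \<in> R}" "tail P = tail \<Gamma>" "head P = head \<Gamma>"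
    by (simp_all add: P_def)
  interpret P: wf_digraph P
    by unfold_locales (auto simp: P R_head)
  have EA: "E \<subseteq> arcs \<Gamma>" by (auto simp: E_def)
  have rev: "rev_subgraph \<Gamma> arev P"
    unfolding rev_subgraph_def
  proof (intro conjI ballI)
    show "subgraph P \<Gamma>"
      using R EA P.wf_digraph wf_digraph by (auto simp: subgraph_def compatible_def P)
    fix e assume "e \<in> arcs P"
    then have e: "e \<in> E" "tail \<Gamma> e \<in> R" by (simp_all add: P)
    then have "tail \<Gamma> (arev e) = head \<Gamma> e"
      using EA by (intro tail_arev) blast
    then show "arev e \<in> arcs P"
      using E[OF e(1)] R_head[OF e] by (simp add: P)
  qed
  have "Digraph_Component.connected P"
    unfolding Digraph_Component.connected_def
  proof (rule strongly_connectedI)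
    show "verts (with_proj (mk_symmetric P)) \<noteq> {}"
      by (auto simp: P R_def)
    interpret S: pair_wf_digraph "mk_symmetric P" ..
    have reach: "v0 \<rightarrow>\<^sup>*\<^bsub>with_proj (mk_symmetric P)\<^esub> v \<and> v \<rightarrow>\<^sup>*\<^bsub>with_proj (mk_symmetric P)\<^esub> v0" if "v \<in> R" for v
    proof -
      have "(v0, v) \<in> Rel\<^sup>*" using that by (simp add: R_def)
      then show ?thesis
      proof (induction rule: rtrancl_induct)
        case base
        have "v0 \<in> verts (with_proj (mk_symmetric P))" by (simp add: P R_def)
        then show ?case by (simp add: S.reachable_refl)
      next
        case (step y z)
        then obtain e where e: "e \<in> E" "y = tail \<Gamma> e" "z = head \<Gamma> e" by (auto simp: Rel_def)
        have "e \<in> arcs P"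
          using e step.hyps(1) by (simp add: P R_def)
        then have "(y, z) \<in> parcs (mk_symmetric P)" "(z, y) \<in> parcs (mk_symmetric P)"
          using e by (auto simp: parcs_mk_symmetric P)
        then have "y \<rightarrow>\<^bsub>with_proj (mk_symmetric P)\<^esub> z" "z \<rightarrow>\<^bsub>with_proj (mk_symmetric P)\<^esub> y"
          by auto
        then show ?case
          using step.IH S.reachable_adj_trans[of v0 y z] S.adj_reachable_trans[of z y v0] by simp
      qed
    qed
    fix u v assume "u \<in> verts (with_proj (mk_symmetric P))" "v \<in> verts (with_proj (mk_symmetric P))"
    then have "u \<in> R" "v \<in> R" by (simp_all add: P)
    then show "u \<rightarrow>\<^sup>*\<^bsub>with_proj (mk_symmetric P)\<^esub> v"
      using reach[of u] reach[of v] S.reachable_trans[of u v0 v] by simp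
  qed
  \<comment> \<open>All vertices of \<open>P\<close> have maximal valuation, so membership of an arc
    in \<open>E\<close> is just the condition on its label.\<close>
  moreover have "int p dvd lab e \<longleftrightarrow> e \<notin> arcs P" if "e \<in> arcs \<Gamma>" "tail \<Gamma> e \<in> verts P" for e
    using that R[of "tail \<Gamma> e"] by (auto simp: P E_def)
  ultimately have "p_plateau p \<Gamma> arev lab P"
    using rev by (simp add: p_plateau_def)
  moreover have "\<forall>e\<in>arcs P. \<not> int p dvd lab e"
    by (simp add: P E_def)
  ultimately show ?thesis by blast
qed

text \<open>A common prime \<open>p\<close> of an order and a label yields a plateau whose arcs have
  labels prime to \<open>p\<close>. It must be the whole graph, which contains the arc whose label
  \<open>p\<close> divides.\<close>

lemma coprime_of_no_proper_plateau:
  fixes n :: "'v \<Rightarrow> nat"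
  assumes "labelled_graph \<Gamma> arev lab" "\<not> (\<exists>P. proper_plateau \<Gamma> arev lab P)"
    and "\<And>v. v \<in> verts \<Gamma> \<Longrightarrow> n v > 0"
    and "\<And>e. e \<in> arcs \<Gamma> \<Longrightarrow> n (tail \<Gamma> e) div gcd (n (tail \<Gamma> e)) (nat \<bar>lab e\<bar>) =
       n (head \<Gamma> e) div gcd (n (head \<Gamma> e)) (nat \<bar>lab (arev e)\<bar>)"
    and v: "v \<in> verts \<Gamma>" and e: "e \<in> arcs \<Gamma>"
  shows "coprime (int (n v)) (lab e)"
proof (rule ccontr)
  assume "\<not> ?thesis"
  then have "nat (gcd (int (n v)) (lab e)) \<noteq> 1"
    by (simp add: coprime_iff_gcd_eq_1 nat_eq_iff)
  then obtain p where p: "prime p" "p dvd nat (gcd (int (n v)) (lab e))"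
    using prime_factor_nat by blast
  then have "int p dvd gcd (int (n v)) (lab e)"
    by (metis gcd_ge_0_int int_dvd_int_iff nat_0_le)
  then have pd: "p dvd n v" "int p dvd lab e"
    by simp_all
  obtain P where P: "p_plateau p \<Gamma> arev lab P" "\<forall>e\<in>arcs P. \<not> int p dvd lab e"
    using plateau_of_orders[OF assms(1) p(1) assms(3,4) v pd(1)] by auto
  then have "P = \<Gamma>"
    using assms(2) p(1) by (auto simp: proper_plateau_def plateau_def)
  then show False using P(2) pd(2) e by blast
qed

section \<open>Finite images without proper plateaus\<close>

lemma (in group) power_of_coprime_power:
  assumes x: "x \<in> carrier G" and "coprime (int (ord x)) k"
  obtains l :: int where "x = (x [^] k) [^] l"
proof -
  obtain u l where "u * int (ord x) + l * k = 1"
    using assms(2) by (metis bezout_int coprime_imp_gcd_eq_1)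
  then have "1 - k * l = int (ord x) * u"
    by (simp add: algebra_simps)
  then have "x [^] (k * l) = x [^] (1 :: int)"
    by (simp only: int_pow_eq[OF x]) simp
  then show thesis
    using x by (intro that[of l]) (simp add: int_pow_pow)
qed

lemma gbs_images_hom:
  assumes \<Gamma>: "bidirected_digraph \<Gamma> arev" and GH: "group G" "group H" and im: "gbs_images G \<Gamma> arev lab T X \<sigma>"
    and \<phi>: "\<phi> \<in> hom G H" and T: "arcs T \<subseteq> arcs \<Gamma>"
  shows "gbs_images H \<Gamma> arev lab T (\<lambda>v. \<phi> (X v)) (\<lambda>e. \<phi> (\<sigma> e))"
proof -
  interpret bidirected_digraph \<Gamma> arev by fact
  interpret \<phi>: group_hom G H \<phi>
    using GH \<phi> by (simp add: group_hom_def group_hom_axioms_def)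
  have X: "X v \<in> carrier G" if "v \<in> verts \<Gamma>" for v
    using im that by (simp add: gbs_images_def)
  have \<sigma>: "\<sigma> e \<in> carrier G" "\<sigma> e \<otimes>\<^bsub>G\<^esub> \<sigma> (arev e) = \<one>\<^bsub>G\<^esub>"
    "\<sigma> e \<otimes>\<^bsub>G\<^esub> X (head \<Gamma> e) [^]\<^bsub>G\<^esub> lab (arev e) = X (tail \<Gamma> e) [^]\<^bsub>G\<^esub> lab e \<otimes>\<^bsub>G\<^esub> \<sigma> e"
    if "e \<in> arcs \<Gamma>" for e
    using im that by (simp_all add: gbs_images_def)
  have "\<phi> (\<sigma> e) \<otimes>\<^bsub>H\<^esub> \<phi> (\<sigma> (arev e)) = \<one>\<^bsub>H\<^esub>" if e: "e \<in> arcs \<Gamma>" for e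
    using arg_cong[OF \<sigma>(2)[OF e], of \<phi>] \<sigma>(1)[OF e] \<sigma>(1)[of "arev e"] e by simp
  moreover have "\<phi> (\<sigma> e) \<otimes>\<^bsub>H\<^esub> \<phi> (X (head \<Gamma> e)) [^]\<^bsub>H\<^esub> lab (arev e) = \<phi> (X (tail \<Gamma> e)) [^]\<^bsub>H\<^esub> lab e \<otimes>\<^bsub>H\<^esub> \<phi> (\<sigma> e)"
    if e: "e \<in> arcs \<Gamma>" for e
    using arg_cong[OF \<sigma>(3)[OF e], of \<phi>] \<sigma>(1)[OF e] X[of "head \<Gamma> e"] X[of "tail \<Gamma> e"] e
    by (simp add: \<phi>.hom_int_pow)
  moreover have "\<phi> (\<sigma> e) = \<one>\<^bsub>H\<^esub>" if "e \<in> arcs T" for e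
    using im that by (simp add: gbs_images_def)
  ultimately show ?thesis
    using X \<sigma>(1) by (simp add: gbs_images_def)
qed

text \<open>\<open>C\<close> is normal in \<open>D\<close> with cyclic quotient. Instead of forming
  the quotient, both \<open>x \<otimes> y\<close> and \<open>y \<otimes> x\<close> are written as an
  element of \<open>C\<close> times the same power of \<open>\<tau>\<close>.\<close>

lemma (in group) commutator_cyclic_by_cyclic:
  assumes C: "subgroup C G" and \<tau>: "\<tau> \<in> carrier G"
    and norm: "\<And>c. c \<in> C \<Longrightarrow> \<tau> \<otimes> c \<otimes> inv \<tau> \<in> C" "\<And>c. c \<in> C \<Longrightarrow> inv \<tau> \<otimes> c \<otimes> \<tau> \<in> C"
  defines "D \<equiv> {c \<otimes> \<tau> [^] k | c (k :: int). c \<in> C}"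
  shows "subgroup D G" "\<And>x y. x \<in> D \<Longrightarrow> y \<in> D \<Longrightarrow> commutator G x y \<in> C"
proof -
  interpret C: subgroup C G by fact
  have sub: "c \<in> carrier G" if "c \<in> C" for c
    using that C.subset by blast
  have conj_nat: "\<tau> [^] n \<otimes> c \<otimes> inv (\<tau> [^] n) \<in> C \<and> inv (\<tau> [^] n) \<otimes> c \<otimes> \<tau> [^] n \<in> C" if "c \<in> C" for n :: nat and c
    using that
  proof (induction n arbitrary: c)
    case 0
    then show ?case using sub by simp
  next
    case (Suc n)
    have p: "\<tau> [^] Suc n = \<tau> [^] n \<otimes> \<tau>" by simp
    have "\<tau> [^] n \<otimes> (\<tau> \<otimes> c \<otimes> inv \<tau>) \<otimes> inv (\<tau> [^] n) \<in> C"
      using Suc.IH[OF norm(1)[OF Suc.prems]] by simp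
    moreover have "inv \<tau> \<otimes> (inv (\<tau> [^] n) \<otimes> c \<otimes> \<tau> [^] n) \<otimes> \<tau> \<in> C"
      using norm(2) Suc.IH[OF Suc.prems] by blast
    ultimately show ?case
      unfolding p using \<tau> sub[OF Suc.prems] by (simp add: inv_mult_group m_assoc)
  qed
  have conj: "\<tau> [^] k \<otimes> c \<otimes> inv (\<tau> [^] k) \<in> C" if "c \<in> C" for c and k :: int
  proof (cases k rule: int_cases2)
    case (nonneg n)
    then show ?thesis using conj_nat[OF that, of n] by (simp add: int_pow_int)
  next
    case (nonpos n)
    then show ?thesis using conj_nat[OF that, of n] \<tau> by (simp add: int_pow_neg_int)
  qed
  \<comment> \<open>Powers of \<open>\<tau>\<close> are moved to the right at the cost of
    conjugating \<open>d\<close>.\<close>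
  have mult: "(c \<otimes> \<tau> [^] k) \<otimes> (d \<otimes> \<tau> [^] l) = (c \<otimes> (\<tau> [^] k \<otimes> d \<otimes> inv (\<tau> [^] k))) \<otimes> \<tau> [^] (k + l)"
    if "c \<in> C" "d \<in> C" for c d and k l :: int
  proof -
    have "inv (\<tau> [^] k) \<otimes> \<tau> [^] (k + l) = \<tau> [^] l"
      using \<tau> by (simp add: int_pow_mult flip: m_assoc)
    then show ?thesis
      using sub[OF that(1)] sub[OF that(2)] \<tau> by (simp add: m_assoc)
  qed
  show "subgroup D G"
  proof (rule subgroup.intro)
    show "D \<subseteq> carrier G"
      using sub \<tau> by (auto simp: D_def)
    show "\<one> \<in> D"
      unfolding D_def using C.one_closed by (intro CollectI exI[of _ \<one>] exI[of _ "0 :: int"]) simp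
    show "x \<otimes> y \<in> D" if xy: "x \<in> D" "y \<in> D" for x y
    proof -
      obtain c k d l where x: "x = c \<otimes> \<tau> [^] (k :: int)" "c \<in> C" and y: "y = d \<otimes> \<tau> [^] (l :: int)" "d \<in> C"
        using xy by (auto simp: D_def)
      have "c \<otimes> (\<tau> [^] k \<otimes> d \<otimes> inv (\<tau> [^] k)) \<in> C"
        using x(2) conj[OF y(2)] by (rule C.m_closed)
      then show ?thesis
        unfolding D_def x(1) y(1) mult[OF x(2) y(2)] by blast
    qed
    show "inv x \<in> D" if xD: "x \<in> D" for x
    proof -
      obtain c k where x: "x = c \<otimes> \<tau> [^] (k :: int)" "c \<in> C"
        using xD by (auto simp: D_def)
      have "inv x = (\<tau> [^] (- k) \<otimes> inv c \<otimes> inv (\<tau> [^] (- k))) \<otimes> \<tau> [^] (- k)"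
        using x sub[OF x(2)] \<tau> by (simp add: inv_mult_group m_assoc int_pow_neg)
      moreover have "\<tau> [^] (- k) \<otimes> inv c \<otimes> inv (\<tau> [^] (- k)) \<in> C"
        by (rule conj[OF C.m_inv_closed[OF x(2)]])
      ultimately show ?thesis
        unfolding D_def by blast
    qed
  qed
  fix x y assume xy: "x \<in> D" "y \<in> D"
  obtain c k d l where x: "x = c \<otimes> \<tau> [^] (k :: int)" "c \<in> C" and y: "y = d \<otimes> \<tau> [^] (l :: int)" "d \<in> C"
    using xy by (auto simp: D_def)
  define c1 c2 where "c1 = c \<otimes> (\<tau> [^] k \<otimes> d \<otimes> inv (\<tau> [^] k))" and "c2 = d \<otimes> (\<tau> [^] l \<otimes> c \<otimes> inv (\<tau> [^] l))"
  have c12: "c1 \<in> C" "c2 \<in> C"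
    unfolding c1_def c2_def using x(2) y(2) conj by (auto intro: C.m_closed)
  have "x \<otimes> y = c1 \<otimes> \<tau> [^] (k + l)" "y \<otimes> x = c2 \<otimes> \<tau> [^] (k + l)"
    unfolding x(1) y(1) c1_def c2_def mult[OF x(2) y(2)] mult[OF y(2) x(2)] by (simp_all add: add.commute)
  moreover have "x \<in> carrier G" "y \<in> carrier G"
    using x y sub[OF x(2)] sub[OF y(2)] \<tau> by simp_all
  ultimately have "commutator G x y = (c1 \<otimes> \<tau> [^] (k + l)) \<otimes> inv (c2 \<otimes> \<tau> [^] (k + l))"
    by (simp add: commutator_eq)
  also have "\<dots> = c1 \<otimes> (\<tau> [^] (k + l) \<otimes> (inv (\<tau> [^] (k + l)) \<otimes> inv c2))"
    using sub[OF c12(1)] sub[OF c12(2)] \<tau> by (simp only: inv_mult_group m_assoc int_pow_closed inv_closed m_closed)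
  also have "\<tau> [^] (k + l) \<otimes> (inv (\<tau> [^] (k + l)) \<otimes> inv c2) = inv c2"
    using sub[OF c12(2)] \<tau> by (simp flip: m_assoc)
  finally show "commutator G x y \<in> C"
    using c12 by simp
qed

lemma (in group) subgroup_powers:
  assumes "x \<in> carrier G"
  shows "subgroup (range (\<lambda>k :: int. x [^] k)) G"
proof (rule subgroup.intro)
  show "range (\<lambda>k :: int. x [^] k) \<subseteq> carrier G"
    using assms by auto
  show "\<one> \<in> range (\<lambda>k :: int. x [^] k)"
    using int_pow_0 by (metis rangeI)
  show "a \<otimes> b \<in> range (\<lambda>k :: int. x [^] k)" if "a \<in> range (\<lambda>k :: int. x [^] k)" "b \<in> range (\<lambda>k :: int. x [^] k)" for a b
    using that assms by (auto simp flip: int_pow_mult)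
  show "inv a \<in> range (\<lambda>k :: int. x [^] k)" if "a \<in> range (\<lambda>k :: int. x [^] k)" for a
    using that assms by (auto simp flip: int_pow_neg)
qed

text \<open>As the orders are prime to all labels, raising vertex generators to labels does not
  shrink their cyclic groups \<open>C v\<close>. The edge relations then say that stable letters
  conjugate these groups into one another, those of the tree being trivial, and the single edge left
  provides the element \<open>\<tau>\<close>.\<close>

theorem no_proper_plateau_not_large:
  fixes \<Gamma> :: "('v, 'e) pre_digraph"
  assumes \<Gamma>: "labelled_graph \<Gamma> arev lab" and T: "maximal_tree \<Gamma> arev T"
    and one: "\<And>a b. a \<in> arcs \<Gamma> - arcs T \<Longrightarrow> b \<in> arcs \<Gamma> - arcs T \<Longrightarrow> b = a \<or> b = arev a"
    and np: "\<not> (\<exists>P. proper_plateau \<Gamma> arev lab P)"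
  shows "\<not> large (gbs \<Gamma> arev lab T)"
proof
  assume large: "large (gbs \<Gamma> arev lab T)"
  interpret labelled_graph \<Gamma> arev lab by fact
  interpret FG: gbs_presentation \<Gamma> arev lab T
    by (rule gbs_presentation_of_maximal_tree[OF \<Gamma> T])
  obtain Y :: "('v \<times> int + 'e) list set set set" and \<pi> g1 g2 g3 g4 where Y: "finite Y" and \<pi>: "\<pi> \<in> hom FG.G (BijGroup Y)"
    and g: "g1 \<in> carrier FG.G" "g2 \<in> carrier FG.G" "g3 \<in> carrier FG.G" "g4 \<in> carrier FG.G"
    and ne: "\<pi> (commutator FG.G (commutator FG.G g1 g2) (commutator FG.G g3 g4)) \<noteq> \<one>\<^bsub>BijGroup Y\<^esub>"
    by (rule large_not_metabelian[OF FG.group_G large])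
  define S where "S = BijGroup Y"
  interpret S: group S
    unfolding S_def by (rule group_BijGroup)
  have finS: "finite (carrier S)"
    unfolding S_def by (rule finite_BijGroup[OF Y])
  interpret \<pi>: group_hom FG.G S \<pi>
    using \<pi> FG.group_G S.is_group by (simp add: group_hom_def group_hom_axioms_def S_def)
  define X where "X = (\<lambda>v. \<pi> (FG.gv v))"
  define \<sigma> where "\<sigma> = (\<lambda>e. \<pi> (FG.ge e))"
  have im: "gbs_images S \<Gamma> arev lab T X \<sigma>"
    using gbs_images_hom[OF bidirected_digraph FG.group_G S.is_group FG.gbs_images_G \<pi>.homh FG.arcs_T]
    by (simp only: X_def \<sigma>_def)
  have X: "X v \<in> carrier S" if "v \<in> verts \<Gamma>" for v
    using im that by (simp add: gbs_images_def)
  have \<sigma>: "\<sigma> e \<in> carrier S" "\<sigma> e \<otimes>\<^bsub>S\<^esub> \<sigma> (arev e) = \<one>\<^bsub>S\<^esub>"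
    "\<sigma> e \<otimes>\<^bsub>S\<^esub> X (head \<Gamma> e) [^]\<^bsub>S\<^esub> lab (arev e) = X (tail \<Gamma> e) [^]\<^bsub>S\<^esub> lab e \<otimes>\<^bsub>S\<^esub> \<sigma> e"
    if "e \<in> arcs \<Gamma>" for e
    using im that by (simp_all add: gbs_images_def)
  have \<sigma>T: "\<sigma> e = \<one>\<^bsub>S\<^esub>" if "e \<in> arcs T" for e
    using im that by (simp add: gbs_images_def)
  have coprime: "coprime (int (S.ord (X v))) (lab e)" if ve: "v \<in> verts \<Gamma>" "e \<in> arcs \<Gamma>" for v e
  proof (rule coprime_of_no_proper_plateau[OF \<Gamma> np _ _ ve])
    show "S.ord (X v) > 0" if "v \<in> verts \<Gamma>" for v
      using S.ord_ge_1[OF finS X[OF that]] by simp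
    fix e assume e: "e \<in> arcs \<Gamma>"
    have l: "lab e \<noteq> 0" "lab (arev e) \<noteq> 0"
      using lab_nonzero e by simp_all
    have "S.ord (X (head \<Gamma> e) [^]\<^bsub>S\<^esub> lab (arev e)) = S.ord (X (tail \<Gamma> e) [^]\<^bsub>S\<^esub> lab e)"
      by (rule S.ord_conjugate[OF \<sigma>(1)[OF e] _ _ \<sigma>(3)[OF e]]) (use X e in simp_all)
    then show "S.ord (X (tail \<Gamma> e)) div gcd (S.ord (X (tail \<Gamma> e))) (nat \<bar>lab e\<bar>) =
        S.ord (X (head \<Gamma> e)) div gcd (S.ord (X (head \<Gamma> e))) (nat \<bar>lab (arev e)\<bar>)"
      using S.ord_int_pow[OF X[of "tail \<Gamma> e"] l(1)] S.ord_int_pow[OF X[of "head \<Gamma> e"] l(2)] e by simp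
  qed
  define C where "C v = range (\<lambda>k :: int. X v [^]\<^bsub>S\<^esub> k)" for v
  have C: "subgroup (C v) S" if "v \<in> verts \<Gamma>" for v
    unfolding C_def by (rule S.subgroup_powers[OF X[OF that]])
  have C_least: "C v \<subseteq> K" if "subgroup K S" "X v \<in> K" for v K
    unfolding C_def using S.subgroup_int_pow_closed[OF that] by auto
  \<comment> \<open>Coprimality makes the generator at the head a power of its own power with
    exponent \<open>lab (arev e)\<close>, and the edge relation conjugates the latter into
    \<open>C (tail \<Gamma> e)\<close>.\<close>
  have conj_mem: "\<sigma> e \<otimes>\<^bsub>S\<^esub> X (head \<Gamma> e) \<otimes>\<^bsub>S\<^esub> inv\<^bsub>S\<^esub> \<sigma> e \<in> C (tail \<Gamma> e)" if e: "e \<in> arcs \<Gamma>" for e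
  proof -
    have ht: "head \<Gamma> e \<in> verts \<Gamma>" "tail \<Gamma> e \<in> verts \<Gamma>" using e by auto
    let ?y = "X (head \<Gamma> e)" and ?a = "lab (arev e)"
    obtain l where l: "?y = (?y [^]\<^bsub>S\<^esub> ?a) [^]\<^bsub>S\<^esub> (l :: int)"
      using S.power_of_coprime_power[OF X[OF ht(1)] coprime[OF ht(1), of "arev e"]] e by auto
    have hom: "(\<lambda>x. \<sigma> e \<otimes>\<^bsub>S\<^esub> x \<otimes>\<^bsub>S\<^esub> inv\<^bsub>S\<^esub> \<sigma> e) \<in> hom S S"
    proof (rule homI)
      fix x y assume xy: "x \<in> carrier S" "y \<in> carrier S"
      have "inv\<^bsub>S\<^esub> \<sigma> e \<otimes>\<^bsub>S\<^esub> (\<sigma> e \<otimes>\<^bsub>S\<^esub> w) = w" if "w \<in> carrier S" for w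
        using that \<sigma>(1)[OF e] by (simp flip: S.m_assoc)
      then show "\<sigma> e \<otimes>\<^bsub>S\<^esub> (x \<otimes>\<^bsub>S\<^esub> y) \<otimes>\<^bsub>S\<^esub> inv\<^bsub>S\<^esub> \<sigma> e = \<sigma> e \<otimes>\<^bsub>S\<^esub> x \<otimes>\<^bsub>S\<^esub> inv\<^bsub>S\<^esub> \<sigma> e \<otimes>\<^bsub>S\<^esub> (\<sigma> e \<otimes>\<^bsub>S\<^esub> y \<otimes>\<^bsub>S\<^esub> inv\<^bsub>S\<^esub> \<sigma> e)"
        using xy \<sigma>(1)[OF e] by (simp add: S.m_assoc)
    qed (use \<sigma>(1)[OF e] in simp)
    have base: "\<sigma> e \<otimes>\<^bsub>S\<^esub> (?y [^]\<^bsub>S\<^esub> ?a) \<otimes>\<^bsub>S\<^esub> inv\<^bsub>S\<^esub> \<sigma> e = X (tail \<Gamma> e) [^]\<^bsub>S\<^esub> lab e"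
      using \<sigma>(1)[OF e] X[OF ht(2)] by (simp add: \<sigma>(3)[OF e] S.m_assoc)
    have "\<sigma> e \<otimes>\<^bsub>S\<^esub> ((?y [^]\<^bsub>S\<^esub> ?a) [^]\<^bsub>S\<^esub> l) \<otimes>\<^bsub>S\<^esub> inv\<^bsub>S\<^esub> \<sigma> e = (X (tail \<Gamma> e) [^]\<^bsub>S\<^esub> lab e) [^]\<^bsub>S\<^esub> l"
      using hom_int_pow[OF hom _ S.is_group S.is_group, of "?y [^]\<^bsub>S\<^esub> ?a" l] X[OF ht(1)] by (simp add: base)
    then show ?thesis
      using l X[OF ht(2)] by (simp add: C_def S.int_pow_pow)
  qed
  obtain r L where r: "r \<in> verts \<Gamma>" and L: "grows \<Gamma> {r} L" "set L \<subseteq> arcs \<Gamma>" "insert r (tail \<Gamma> ` set L) = verts \<Gamma>"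
    "arcs T = set L \<union> arev ` set L"
  proof -
    have "verts \<Gamma> \<noteq> {}"
      using maximal_tree_connected[OF T] by (simp add: Digraph_Component.connected_def strongly_connected_def)
    then obtain r where r: "r \<in> verts \<Gamma>" by blast
    show thesis
      by (rule maximal_tree_grows[OF bidirected_digraph _ T r]) (use r that in simp_all)
  qed
  have sub_T: "C (head \<Gamma> e) \<subseteq> C (tail \<Gamma> e)" if e: "e \<in> arcs T" for e
  proof -
    have ea: "e \<in> arcs \<Gamma>" using e FG.arcs_T by blast
    then have ht: "head \<Gamma> e \<in> verts \<Gamma>" "tail \<Gamma> e \<in> verts \<Gamma>" by auto
    have "X (head \<Gamma> e) \<in> C (tail \<Gamma> e)"
      using conj_mem[OF ea] X[OF ht(1)] by (simp add: \<sigma>T[OF e])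
    then show ?thesis
      by (rule C_least[OF C[OF ht(2)]])
  qed
  \<comment> \<open>Both orientations of a tree edge give inclusions, hence equality, which spreads
    along the tree.\<close>
  have C_eq: "C v = C r" if v: "v \<in> verts \<Gamma>" for v
  proof -
    have "v \<in> {v. C v = C r} \<longleftrightarrow> r \<in> {v. C v = C r}"
    proof (rule grows_connected[OF L(1)])
      fix e assume "e \<in> set L"
      then have "e \<in> arcs T" "arev e \<in> arcs T" "e \<in> arcs \<Gamma>"
        using L(2,4) by auto
      then have "C (head \<Gamma> e) = C (tail \<Gamma> e)"
        using sub_T[of e] sub_T[of "arev e"] by auto
      then show "tail \<Gamma> e \<in> {v. C v = C r} \<longleftrightarrow> head \<Gamma> e \<in> {v. C v = C r}"
        by simp
    qed (use v L(3) in simp)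
    then show ?thesis by simp
  qed
  have conj_C: "\<sigma> e \<otimes>\<^bsub>S\<^esub> c \<otimes>\<^bsub>S\<^esub> inv\<^bsub>S\<^esub> \<sigma> e \<in> C r" if e: "e \<in> arcs \<Gamma>" and c: "c \<in> C r" for e c
  proof -
    have ht: "head \<Gamma> e \<in> verts \<Gamma>" "tail \<Gamma> e \<in> verts \<Gamma>" using e by auto
    let ?K = "{c \<in> carrier S. \<sigma> e \<otimes>\<^bsub>S\<^esub> c \<otimes>\<^bsub>S\<^esub> inv\<^bsub>S\<^esub> \<sigma> e \<in> C r}"
    interpret Cr: subgroup "C r" S by (rule C[OF r])
    have "subgroup ?K S"
    proof (rule subgroup.intro)
      show "x \<otimes>\<^bsub>S\<^esub> y \<in> ?K" if "x \<in> ?K" "y \<in> ?K" for x y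
      proof -
        have xy: "x \<in> carrier S" "y \<in> carrier S" using that by simp_all
        have "inv\<^bsub>S\<^esub> \<sigma> e \<otimes>\<^bsub>S\<^esub> (\<sigma> e \<otimes>\<^bsub>S\<^esub> w) = w" if "w \<in> carrier S" for w
          using that \<sigma>(1)[OF e] by (simp flip: S.m_assoc)
        then have "\<sigma> e \<otimes>\<^bsub>S\<^esub> (x \<otimes>\<^bsub>S\<^esub> y) \<otimes>\<^bsub>S\<^esub> inv\<^bsub>S\<^esub> \<sigma> e = (\<sigma> e \<otimes>\<^bsub>S\<^esub> x \<otimes>\<^bsub>S\<^esub> inv\<^bsub>S\<^esub> \<sigma> e) \<otimes>\<^bsub>S\<^esub> (\<sigma> e \<otimes>\<^bsub>S\<^esub> y \<otimes>\<^bsub>S\<^esub> inv\<^bsub>S\<^esub> \<sigma> e)"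
          using xy \<sigma>(1)[OF e] by (simp add: S.m_assoc)
        then show ?thesis
          using that by (simp add: Cr.m_closed)
      qed
      show "inv\<^bsub>S\<^esub> x \<in> ?K" if "x \<in> ?K" for x
      proof -
        have x: "x \<in> carrier S" "\<sigma> e \<otimes>\<^bsub>S\<^esub> x \<otimes>\<^bsub>S\<^esub> inv\<^bsub>S\<^esub> \<sigma> e \<in> C r" using that by simp_all
        then have "inv\<^bsub>S\<^esub> (\<sigma> e \<otimes>\<^bsub>S\<^esub> x \<otimes>\<^bsub>S\<^esub> inv\<^bsub>S\<^esub> \<sigma> e) \<in> C r"
          by (intro Cr.m_inv_closed)
        moreover have "inv\<^bsub>S\<^esub> (\<sigma> e \<otimes>\<^bsub>S\<^esub> x \<otimes>\<^bsub>S\<^esub> inv\<^bsub>S\<^esub> \<sigma> e) = \<sigma> e \<otimes>\<^bsub>S\<^esub> inv\<^bsub>S\<^esub> x \<otimes>\<^bsub>S\<^esub> inv\<^bsub>S\<^esub> \<sigma> e"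
          using x(1) \<sigma>(1)[OF e] by (simp add: S.inv_mult_group S.m_assoc)
        ultimately show ?thesis using x(1) by simp
      qed
    qed (use \<sigma>(1)[OF e] in auto)
    moreover have "X (head \<Gamma> e) \<in> ?K"
      using conj_mem[OF e] C_eq[OF ht(2)] X[OF ht(1)] by simp
    ultimately have "C (head \<Gamma> e) \<subseteq> ?K"
      by (rule C_least)
    then show ?thesis
      using c C_eq[OF ht(1)] by blast
  qed
  \<comment> \<open>The image of the only stable letter outside the tree, or the unit if there is
    none.\<close>
  obtain \<tau> where \<tau>: "\<tau> \<in> carrier S" "\<And>c. c \<in> C r \<Longrightarrow> \<tau> \<otimes>\<^bsub>S\<^esub> c \<otimes>\<^bsub>S\<^esub> inv\<^bsub>S\<^esub> \<tau> \<in> C r"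
    "\<And>c. c \<in> C r \<Longrightarrow> inv\<^bsub>S\<^esub> \<tau> \<otimes>\<^bsub>S\<^esub> c \<otimes>\<^bsub>S\<^esub> \<tau> \<in> C r"
    "\<And>e. e \<in> arcs \<Gamma> \<Longrightarrow> \<sigma> e \<in> {\<one>\<^bsub>S\<^esub>, \<tau>, inv\<^bsub>S\<^esub> \<tau>}"
  proof (cases "arcs \<Gamma> - arcs T = {}")
    case True
    show ?thesis
    proof (rule that[of "\<one>\<^bsub>S\<^esub>"])
      show "\<one>\<^bsub>S\<^esub> \<otimes>\<^bsub>S\<^esub> c \<otimes>\<^bsub>S\<^esub> inv\<^bsub>S\<^esub> \<one>\<^bsub>S\<^esub> \<in> C r" "inv\<^bsub>S\<^esub> \<one>\<^bsub>S\<^esub> \<otimes>\<^bsub>S\<^esub> c \<otimes>\<^bsub>S\<^esub> \<one>\<^bsub>S\<^esub> \<in> C r" if "c \<in> C r" for c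
        using that subgroup.subset[OF C[OF r]] by auto
      show "\<sigma> e \<in> {\<one>\<^bsub>S\<^esub>, \<one>\<^bsub>S\<^esub>, inv\<^bsub>S\<^esub> \<one>\<^bsub>S\<^esub>}" if "e \<in> arcs \<Gamma>" for e
        using that True \<sigma>T[of e] by blast
    qed simp
  next
    case False
    then obtain a where a: "a \<in> arcs \<Gamma> - arcs T" by blast
    then have aa: "a \<in> arcs \<Gamma>" "arev a \<in> arcs \<Gamma>" by auto
    have inv: "\<sigma> (arev a) = inv\<^bsub>S\<^esub> \<sigma> a"
      using S.inv_equality[of "\<sigma> (arev a)" "\<sigma> a"] \<sigma>(2)[OF aa(2)] \<sigma>(1) aa by simp
    show ?thesis
    proof (rule that[of "\<sigma> a"])
      show "\<sigma> a \<in> carrier S" by (rule \<sigma>(1)[OF aa(1)])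
      show "\<sigma> a \<otimes>\<^bsub>S\<^esub> c \<otimes>\<^bsub>S\<^esub> inv\<^bsub>S\<^esub> \<sigma> a \<in> C r" if "c \<in> C r" for c
        by (rule conj_C[OF aa(1) that])
      show "inv\<^bsub>S\<^esub> \<sigma> a \<otimes>\<^bsub>S\<^esub> c \<otimes>\<^bsub>S\<^esub> \<sigma> a \<in> C r" if "c \<in> C r" for c
        using conj_C[OF aa(2) that] \<sigma>(1)[OF aa(1)] by (simp add: inv)
      show "\<sigma> e \<in> {\<one>\<^bsub>S\<^esub>, \<sigma> a, inv\<^bsub>S\<^esub> \<sigma> a}" if "e \<in> arcs \<Gamma>" for e
      proof (cases "e \<in> arcs T")
        case True
        then show ?thesis using \<sigma>T by simp
      next
        case False
        then have "e = a \<or> e = arev a" using that one[OF a, of e] by blast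
        then show ?thesis using inv by auto
      qed
    qed
  qed
  define D where "D = {c \<otimes>\<^bsub>S\<^esub> \<tau> [^]\<^bsub>S\<^esub> k | c (k :: int). c \<in> C r}"
  have D: "subgroup D S" and D_comm: "\<And>x y. x \<in> D \<Longrightarrow> y \<in> D \<Longrightarrow> commutator S x y \<in> C r"
    using S.commutator_cyclic_by_cyclic[OF C[OF r] \<tau>(1-3)] unfolding D_def by blast+
  have one_C: "\<one>\<^bsub>S\<^esub> \<in> C r"
    using subgroup.one_closed[OF C[OF r]] .
  have \<tau>D: "\<tau> \<in> D"
    unfolding D_def using one_C \<tau>(1) by (intro CollectI exI[of _ "\<one>\<^bsub>S\<^esub>"] exI[of _ "1 :: int"]) simp
  have "{g \<in> carrier FG.G. \<pi> g \<in> D} = carrier FG.G"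
  proof (rule FG.G_generated)
    show "subgroup {g \<in> carrier FG.G. \<pi> g \<in> D} FG.G"
      using D by (intro subgroup.intro) (auto simp: subgroup.m_closed subgroup.m_inv_closed subgroup.one_closed)
    show "FG.gv v \<in> {g \<in> carrier FG.G. \<pi> g \<in> D}" if v: "v \<in> verts \<Gamma>" for v
    proof -
      have "X v = X v [^]\<^bsub>S\<^esub> (1 :: int)" using X[OF v] by simp
      then have "X v \<in> C v" unfolding C_def by (rule range_eqI)
      then have "X v \<in> C r" by (simp only: C_eq[OF v])
      then have "X v \<in> D"
        unfolding D_def using X[OF v] by (intro CollectI exI[of _ "X v"] exI[of _ "0 :: int"]) simp
      then show ?thesis using v by (simp add: X_def)
    qed
    show "FG.ge e \<in> {g \<in> carrier FG.G. \<pi> g \<in> D}" if e: "e \<in> arcs \<Gamma>" for e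
    proof -
      have "\<sigma> e \<in> D"
        using \<tau>(4)[OF e] \<tau>D subgroup.m_inv_closed[OF D \<tau>D] subgroup.one_closed[OF D] by auto
      then show ?thesis using e by (simp add: \<sigma>_def)
    qed
  qed
  then have gD: "\<pi> g \<in> D" if "g \<in> carrier FG.G" for g
    using that by blast
  have "commutator S (\<pi> g1) (\<pi> g2) \<in> C r" "commutator S (\<pi> g3) (\<pi> g4) \<in> C r"
    using D_comm gD g by blast+
  then obtain k l :: int where kl: "commutator S (\<pi> g1) (\<pi> g2) = X r [^]\<^bsub>S\<^esub> k" "commutator S (\<pi> g3) (\<pi> g4) = X r [^]\<^bsub>S\<^esub> l"
    by (auto simp: C_def)
  \<comment> \<open>Both commutators lie in the cyclic group \<open>C r\<close>, so they commute,
    against \<open>ne\<close>.\<close>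
  have "commutator S (X r [^]\<^bsub>S\<^esub> k) (X r [^]\<^bsub>S\<^esub> l) = \<one>\<^bsub>S\<^esub>"
    using X[OF r] by (simp add: S.commutator_eq_one add.commute flip: S.int_pow_mult)
  then have "\<pi> (commutator FG.G (commutator FG.G g1 g2) (commutator FG.G g3 g4)) = \<one>\<^bsub>S\<^esub>"
    using g kl by (simp add: \<pi>.hom_commutator)
  then show False using ne by (simp add: S_def)
qed

section \<open>Maps to free products\<close>

lemma (in group) int_pow_cong:
  assumes x: "x \<in> carrier G" "x [^] q = \<one>" and "q dvd i - j"
  shows "x [^] (i :: int) = x [^] (j :: int)"
proof -
  obtain l where "i - j = q * l" using assms(3) by (elim dvdE)
  then have "i = q * l + j" by simp
  then show ?thesis
    using x by (simp add: int_pow_mult flip: int_pow_pow)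
qed

text \<open>\<open>L\<close> and \<open>N\<close> hold one orientation of each edge in the tree and
  outside it. The relations of the opposite arcs follow by taking inverses, so a caller checks only
  half of \<open>gbs_images\<close>.\<close>

lemma gbs_images_of_arcs:
  assumes H: "group H" and \<Gamma>: "bidirected_digraph \<Gamma> arev"
    and X: "\<And>v. v \<in> verts \<Gamma> \<Longrightarrow> X v \<in> carrier H"
    and T: "arcs T \<subseteq> arcs \<Gamma>" "arcs T = set L \<union> arev ` set L"
    and tree: "\<And>e. e \<in> set L \<Longrightarrow> X (tail \<Gamma> e) [^]\<^bsub>H\<^esub> lab e = X (head \<Gamma> e) [^]\<^bsub>H\<^esub> lab (arev e)"
    and N: "arcs \<Gamma> - arcs T = N \<union> arev ` N" "\<And>e. e \<in> N \<Longrightarrow> arev e \<notin> N"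
    and t: "\<And>e. e \<in> N \<Longrightarrow> t e \<in> carrier H \<and>
      t e \<otimes>\<^bsub>H\<^esub> X (head \<Gamma> e) [^]\<^bsub>H\<^esub> lab (arev e) = X (tail \<Gamma> e) [^]\<^bsub>H\<^esub> lab e \<otimes>\<^bsub>H\<^esub> t e"
  shows "gbs_images H \<Gamma> arev lab T X
    (\<lambda>e. if e \<in> N then t e else if arev e \<in> N then inv\<^bsub>H\<^esub> t (arev e) else \<one>\<^bsub>H\<^esub>)"
    (is "gbs_images _ _ _ _ _ _ ?s")
proof -
  interpret H: group H by fact
  interpret bidirected_digraph \<Gamma> arev by fact
  have NA: "N \<subseteq> arcs \<Gamma> - arcs T" "arev ` N \<subseteq> arcs \<Gamma> - arcs T" using N(1) by blast+
  have TN: "e \<notin> N" "arev e \<notin> N" if "e \<in> arcs T" for e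
  proof -
    show "e \<notin> N" using that NA by blast
    show "arev e \<notin> N"
    proof
      assume "arev e \<in> N"
      then have "arev (arev e) \<in> arcs \<Gamma> - arcs T" using NA by blast
      then show False using that T(1) by auto
    qed
  qed
  have s_carrier: "?s e \<in> carrier H" for e
    using t[of e] t[of "arev e"] by auto
  have rel: "?s e \<otimes>\<^bsub>H\<^esub> ?s (arev e) = \<one>\<^bsub>H\<^esub> \<and>
      ?s e \<otimes>\<^bsub>H\<^esub> X (head \<Gamma> e) [^]\<^bsub>H\<^esub> lab (arev e) = X (tail \<Gamma> e) [^]\<^bsub>H\<^esub> lab e \<otimes>\<^bsub>H\<^esub> ?s e"
    if e: "e \<in> arcs \<Gamma>" for e
  proof -
    have ht: "X (head \<Gamma> e) \<in> carrier H" "X (tail \<Gamma> e) \<in> carrier H"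
      using X e by auto
    consider (tree) "e \<in> arcs T" | (pos) "e \<in> N" | (neg) "arev e \<in> N"
      using N(1) e arev_arev[of e] by fastforce
    then show ?thesis
    proof cases
      case T': tree
      then have "e \<in> set L \<or> arev e \<in> set L" using assms(5) e by fastforce
      then have "X (tail \<Gamma> e) [^]\<^bsub>H\<^esub> lab e = X (head \<Gamma> e) [^]\<^bsub>H\<^esub> lab (arev e)"
        using tree[of e] tree[of "arev e"] e by auto
      then show ?thesis using TN[OF T'] e ht by simp
    next
      case N': pos
      then show ?thesis
        using N(2)[OF N'] t[OF N'] e by simp
    next
      case N': neg
      let ?t = "t (arev e)" and ?x = "X (head \<Gamma> e) [^]\<^bsub>H\<^esub> lab (arev e)" and ?y = "X (tail \<Gamma> e) [^]\<^bsub>H\<^esub> lab e"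
      have tc: "?t \<in> carrier H" and eq: "?t \<otimes>\<^bsub>H\<^esub> ?y = ?x \<otimes>\<^bsub>H\<^esub> ?t"
        using t[OF N'] e by simp_all
      have "inv\<^bsub>H\<^esub> ?t \<otimes>\<^bsub>H\<^esub> ?x = inv\<^bsub>H\<^esub> ?t \<otimes>\<^bsub>H\<^esub> (?x \<otimes>\<^bsub>H\<^esub> ?t) \<otimes>\<^bsub>H\<^esub> inv\<^bsub>H\<^esub> ?t"
        using tc ht by (simp add: H.m_assoc)
      also have "\<dots> = ?y \<otimes>\<^bsub>H\<^esub> inv\<^bsub>H\<^esub> ?t"
        using tc ht by (simp flip: eq H.m_assoc)
      finally show ?thesis
        using N' N(2)[OF N'] e tc by auto
    qed
  qed
  have "?s e = \<one>\<^bsub>H\<^esub>" if "e \<in> arcs T" for e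
    using TN[OF that] by simp
  then show ?thesis
    unfolding gbs_images_def using X s_carrier rel by blast
qed

text \<open>Instance of \<open>free_product_action\<close> for the cyclic group of order
  \<open>q\<close> and the product of those of orders \<open>M1\<close> and \<open>M2\<close>. The
  obtained facts hide it: powers of \<open>\<alpha>\<close>, \<open>\<beta>1\<close>,
  \<open>\<beta>2\<close> are all that remains, and largeness follows when the images generate one
  non-trivial element of the first factor and two of the second.\<close>

lemma large_of_images:
  fixes \<Gamma> :: "('v, 'e) pre_digraph" and q M1 M2 :: nat and a i1 i2 j1 j2 :: int
  assumes FG: "gbs_presentation \<Gamma> arev T" and pos: "q > 0" "M1 > 0" "M2 > 0"
    and a: "\<not> int q dvd a" and i: "\<not> (int M1 dvd i1 \<and> int M2 dvd i2)"
    and j: "\<not> (int M1 dvd j1 \<and> int M2 dvd j2)" "\<not> (int M1 dvd i1 - j1 \<and> int M2 dvd i2 - j2)"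
  obtains W :: "(int \<times> (int \<times> int) \<times> (nat \<times> bool) list set \<Rightarrow> int \<times> (int \<times> int) \<times> (nat \<times> bool) list set) monoid"
    and \<alpha> \<beta>1 \<beta>2
  where "group W" "\<alpha> \<in> carrier W" "\<beta>1 \<in> carrier W" "\<beta>2 \<in> carrier W"
    "\<alpha> [^]\<^bsub>W\<^esub> int q = \<one>\<^bsub>W\<^esub>" "\<beta>1 [^]\<^bsub>W\<^esub> int M1 = \<one>\<^bsub>W\<^esub>" "\<beta>2 [^]\<^bsub>W\<^esub> int M2 = \<one>\<^bsub>W\<^esub>"
    "\<And>(i :: int) (j :: int). \<beta>1 [^]\<^bsub>W\<^esub> i \<otimes>\<^bsub>W\<^esub> \<beta>2 [^]\<^bsub>W\<^esub> j = \<beta>2 [^]\<^bsub>W\<^esub> j \<otimes>\<^bsub>W\<^esub> \<beta>1 [^]\<^bsub>W\<^esub> i"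
    "\<And>X \<sigma>. gbs_images W \<Gamma> arev lab T X \<sigma> \<Longrightarrow>
       (\<And>K. subgroup K W \<Longrightarrow> (\<And>v. v \<in> verts \<Gamma> \<Longrightarrow> X v \<in> K) \<Longrightarrow> (\<And>e. e \<in> arcs \<Gamma> \<Longrightarrow> \<sigma> e \<in> K) \<Longrightarrow>
          \<alpha> [^]\<^bsub>W\<^esub> a \<in> K \<and> \<beta>1 [^]\<^bsub>W\<^esub> i1 \<otimes>\<^bsub>W\<^esub> \<beta>2 [^]\<^bsub>W\<^esub> i2 \<in> K \<and> \<beta>1 [^]\<^bsub>W\<^esub> j1 \<otimes>\<^bsub>W\<^esub> \<beta>2 [^]\<^bsub>W\<^esub> j2 \<in> K) \<Longrightarrow>
       large (gbs \<Gamma> arev lab T)"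
proof -
  let ?A = "integer_mod_group q" and ?B = "integer_mod_group M1 \<times>\<times> integer_mod_group M2"
  have B: "group ?B" by (intro DirProd_group) simp_all
  have md: "x mod int m = y mod int m \<longleftrightarrow> int m dvd x - y" for x y m
    by (rule mod_eq_dvd_iff)
  interpret P: free_product_action ?A ?B "a mod int q" "(i1 mod int M1, i2 mod int M2)" "(j1 mod int M1, j2 mod int M2)"
  proof (intro free_product_action.intro free_product_action_axioms.intro)
    show "group ?A" by simp
    show "group ?B" by (rule B)
    show "finite (carrier ?A)" "finite (carrier ?B)"
      using pos by (simp_all add: carrier_integer_mod_group)
    show "a mod int q \<in> carrier ?A" "(i1 mod int M1, i2 mod int M2) \<in> carrier ?B" "(j1 mod int M1, j2 mod int M2) \<in> carrier ?B"
      using pos by (simp_all add: carrier_integer_mod_group)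
    show "a mod int q \<noteq> \<one>\<^bsub>?A\<^esub>" "(i1 mod int M1, i2 mod int M2) \<noteq> \<one>\<^bsub>?B\<^esub>" "(j1 mod int M1, j2 mod int M2) \<noteq> \<one>\<^bsub>?B\<^esub>"
      using a i j by (auto simp: mod_eq_0_iff_dvd)
    show "(j1 mod int M1, j2 mod int M2) \<noteq> (i1 mod int M1, i2 mod int M2)"
      using j(2) by (metis md prod.inject)
  qed
  let ?b1 = "(1 mod int M1, 0)" and ?b2 = "(0, 1 mod int M2)"
  have B_c: "(x mod int M1, y mod int M2) \<in> carrier ?B" for x y
    using pos by (simp add: carrier_integer_mod_group)
  have b_c: "?b1 \<in> carrier ?B" "?b2 \<in> carrier ?B"
    using B_c[of 1 0] B_c[of 0 1] by simp_all
  have a_c: "x mod int q \<in> carrier ?A" for x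
    using pos by (simp add: carrier_integer_mod_group)
  have pow_a: "P.iA (1 mod int q) [^]\<^bsub>P.W\<^esub> k = P.iA (k mod int q)" for k :: int
    using P.iA.hom_int_pow[OF a_c[of 1], of k] by (simp add: int_pow_integer_mod_group mod_mult_right_eq)
  have h1: "(\<lambda>x. (x, 0)) \<in> hom (integer_mod_group M1) ?B" and h2: "(\<lambda>x. (0, x)) \<in> hom (integer_mod_group M2) ?B"
    by (auto simp: hom_def)
  have one_c: "1 mod int M1 \<in> carrier (integer_mod_group M1)" "1 mod int M2 \<in> carrier (integer_mod_group M2)"
    using pos by (simp_all add: carrier_integer_mod_group)
  have pow_b: "P.iB ?b1 [^]\<^bsub>P.W\<^esub> k = P.iB (k mod int M1, 0)" "P.iB ?b2 [^]\<^bsub>P.W\<^esub> k = P.iB (0, k mod int M2)" for k :: int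
    using hom_int_pow[OF h1 one_c(1) group_integer_mod_group B, of k] hom_int_pow[OF h2 one_c(2) group_integer_mod_group B, of k]
      P.iB.hom_int_pow[OF b_c(1), of k] P.iB.hom_int_pow[OF b_c(2), of k]
    by (simp_all add: int_pow_integer_mod_group mod_mult_right_eq)
  have prod: "P.iB (x mod int M1, 0) \<otimes>\<^bsub>P.W\<^esub> P.iB (0, y mod int M2) = P.iB (x mod int M1, y mod int M2)"
    "P.iB (0, y mod int M2) \<otimes>\<^bsub>P.W\<^esub> P.iB (x mod int M1, 0) = P.iB (x mod int M1, y mod int M2)" for x y
    using P.iB.hom_mult[of "(x mod int M1, 0)" "(0, y mod int M2)"] P.iB.hom_mult[of "(0, y mod int M2)" "(x mod int M1, 0)"]
      B_c[of x 0] B_c[of 0 y] by simp_all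
  show thesis
  proof (rule that[of P.W "P.iA (1 mod int q)" "P.iB ?b1" "P.iB ?b2"])
    show "group P.W" by (rule P.group_W)
    show "P.iA (1 mod int q) \<in> carrier P.W" by (rule P.iA.hom_closed[OF a_c])
    show "P.iB ?b1 \<in> carrier P.W" "P.iB ?b2 \<in> carrier P.W"
      by (rule P.iB.hom_closed[OF b_c(1)], rule P.iB.hom_closed[OF b_c(2)])
    show "P.iA (1 mod int q) [^]\<^bsub>P.W\<^esub> int q = \<one>\<^bsub>P.W\<^esub>"
      unfolding pow_a using P.iA.hom_one by simp
    show "P.iB ?b1 [^]\<^bsub>P.W\<^esub> int M1 = \<one>\<^bsub>P.W\<^esub>" "P.iB ?b2 [^]\<^bsub>P.W\<^esub> int M2 = \<one>\<^bsub>P.W\<^esub>"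
      unfolding pow_b using P.iB.hom_one by simp_all
    show "P.iB ?b1 [^]\<^bsub>P.W\<^esub> i \<otimes>\<^bsub>P.W\<^esub> P.iB ?b2 [^]\<^bsub>P.W\<^esub> j =
        P.iB ?b2 [^]\<^bsub>P.W\<^esub> j \<otimes>\<^bsub>P.W\<^esub> P.iB ?b1 [^]\<^bsub>P.W\<^esub> i" for i :: int and j :: int
      unfolding pow_b prod ..
    fix X \<sigma>
    assume im: "gbs_images P.W \<Gamma> arev lab T X \<sigma>"
      and gen: "\<And>K. subgroup K P.W \<Longrightarrow> (\<And>v. v \<in> verts \<Gamma> \<Longrightarrow> X v \<in> K) \<Longrightarrow> (\<And>e. e \<in> arcs \<Gamma> \<Longrightarrow> \<sigma> e \<in> K) \<Longrightarrow>
        P.iA (1 mod int q) [^]\<^bsub>P.W\<^esub> a \<in> K \<and>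
        P.iB ?b1 [^]\<^bsub>P.W\<^esub> i1 \<otimes>\<^bsub>P.W\<^esub> P.iB ?b2 [^]\<^bsub>P.W\<^esub> i2 \<in> K \<and>
        P.iB ?b1 [^]\<^bsub>P.W\<^esub> j1 \<otimes>\<^bsub>P.W\<^esub> P.iB ?b2 [^]\<^bsub>P.W\<^esub> j2 \<in> K"
    interpret FG: gbs_presentation \<Gamma> arev lab T by fact
    obtain \<phi> where \<phi>: "\<phi> \<in> hom FG.G P.W" "\<And>v. v \<in> verts \<Gamma> \<Longrightarrow> \<phi> (FG.gv v) = X v" "\<And>e. e \<in> arcs \<Gamma> \<Longrightarrow> \<phi> (FG.ge e) = \<sigma> e"
      using FG.gbs_hom[OF P.group_W im] by blast
    interpret \<phi>: group_hom FG.G P.W \<phi>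
      using \<phi>(1) P.group_W FG.group_G by (simp add: group_hom_def group_hom_axioms_def)
    have "subgroup (\<phi> ` carrier FG.G) P.W"
      by (rule \<phi>.img_is_subgroup)
    moreover have "X v \<in> \<phi> ` carrier FG.G" if "v \<in> verts \<Gamma>" for v
      unfolding \<phi>(2)[OF that, symmetric] by (rule imageI[OF FG.gv_carrier[OF that]])
    moreover have "\<sigma> e \<in> \<phi> ` carrier FG.G" if "e \<in> arcs \<Gamma>" for e
      unfolding \<phi>(3)[OF that, symmetric] by (rule imageI[OF FG.ge_carrier[OF that]])
    ultimately have mem: "P.iA (a mod int q) \<in> \<phi> ` carrier FG.G" "P.iB (i1 mod int M1, i2 mod int M2) \<in> \<phi> ` carrier FG.G"
      "P.iB (j1 mod int M1, j2 mod int M2) \<in> \<phi> ` carrier FG.G"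
      using gen[of "\<phi> ` carrier FG.G"] unfolding pow_a pow_b prod by simp_all
    show "large FG.G"
      by (rule P.large_of_hom[OF FG.group_G \<phi>(1) mem])
  qed
qed

text \<open>\<open>M2 = 1\<close> makes the second factor cyclic. Its two elements are
  \<open>\<beta>\<close> and its square, non-trivial and distinct because
  \<open>r \<ge> 3\<close>.\<close>

corollary large_of_cyclic_images:
  fixes \<Gamma> :: "('v, 'e) pre_digraph" and q r :: nat and a :: int
  assumes FG: "gbs_presentation \<Gamma> arev T" and q: "q > 0" "\<not> int q dvd a" and r: "r \<ge> 3"
  obtains W :: "(int \<times> (int \<times> int) \<times> (nat \<times> bool) list set \<Rightarrow> int \<times> (int \<times> int) \<times> (nat \<times> bool) list set) monoid"
    and \<alpha> \<beta>
  where "group W" "\<alpha> \<in> carrier W" "\<beta> \<in> carrier W" "\<alpha> [^]\<^bsub>W\<^esub> int q = \<one>\<^bsub>W\<^esub>" "\<beta> [^]\<^bsub>W\<^esub> int r = \<one>\<^bsub>W\<^esub>"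
    "\<And>X \<sigma>. gbs_images W \<Gamma> arev lab T X \<sigma> \<Longrightarrow>
       (\<And>K. subgroup K W \<Longrightarrow> (\<And>v. v \<in> verts \<Gamma> \<Longrightarrow> X v \<in> K) \<Longrightarrow> (\<And>e. e \<in> arcs \<Gamma> \<Longrightarrow> \<sigma> e \<in> K) \<Longrightarrow>
          \<alpha> [^]\<^bsub>W\<^esub> a \<in> K \<and> \<beta> \<in> K) \<Longrightarrow>
       large (gbs \<Gamma> arev lab T)"
proof -
  have nd: "\<not> int r dvd 1" "\<not> int r dvd 2" "\<not> int r dvd 1 - 2"
    using r by (auto dest: zdvd_imp_le)
  show thesis
  proof (rule large_of_images[OF FG, where lab = lab, of q r 1 a 1 0 2 0], goal_cases)
    case (8 W \<alpha> \<beta> \<gamma>)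
    interpret W: group W by (rule 8(1))
    have pw: "\<beta> [^]\<^bsub>W\<^esub> k \<otimes>\<^bsub>W\<^esub> \<gamma> [^]\<^bsub>W\<^esub> (0 :: int) = \<beta> [^]\<^bsub>W\<^esub> k" "\<beta> [^]\<^bsub>W\<^esub> (1 :: int) = \<beta>" for k :: int
      using 8(3,4) by simp_all
    show thesis
    proof (rule that[OF 8(1-3,5,6)])
      fix X \<sigma>
      assume im: "gbs_images W \<Gamma> arev lab T X \<sigma>"
        and gen: "\<And>K. subgroup K W \<Longrightarrow> (\<And>v. v \<in> verts \<Gamma> \<Longrightarrow> X v \<in> K) \<Longrightarrow> (\<And>e. e \<in> arcs \<Gamma> \<Longrightarrow> \<sigma> e \<in> K) \<Longrightarrow>
          \<alpha> [^]\<^bsub>W\<^esub> a \<in> K \<and> \<beta> \<in> K"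
      show "large (gbs \<Gamma> arev lab T)"
      proof (rule 8(9)[OF im])
        fix K assume K: "subgroup K W" "\<And>v. v \<in> verts \<Gamma> \<Longrightarrow> X v \<in> K" "\<And>e. e \<in> arcs \<Gamma> \<Longrightarrow> \<sigma> e \<in> K"
        have "\<alpha> [^]\<^bsub>W\<^esub> a \<in> K" "\<beta> \<in> K"
          using gen[OF K] by simp_all
        then show "\<alpha> [^]\<^bsub>W\<^esub> a \<in> K \<and> \<beta> [^]\<^bsub>W\<^esub> (1 :: int) \<otimes>\<^bsub>W\<^esub> \<gamma> [^]\<^bsub>W\<^esub> (0 :: int) \<in> K \<and>
            \<beta> [^]\<^bsub>W\<^esub> (2 :: int) \<otimes>\<^bsub>W\<^esub> \<gamma> [^]\<^bsub>W\<^esub> (0 :: int) \<in> K"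
          unfolding pw(1) using W.subgroup_int_pow_closed[OF K(1)] 8(3) by simp
      qed
    qed
  qed (use q r nd in simp_all)
qed

text \<open>The exponent is 0 before \<open>g\<close>, is \<open>k\<close> at the tail of
  \<open>g\<close>, and is carried on exactly afterwards. Only the equation of \<open>g\<close>
  fails, by \<open>lab g * k\<close>, which dies modulo \<open>int k * \<bar>lab g\<bar>\<close>;
  when \<open>lab g\<close> is not a unit, \<open>k\<close> survives this modulus.\<close>

lemma grows_nonunit:
  fixes lab :: "'e \<Rightarrow> int"
  assumes L: "grows \<Gamma> S (L1 @ g # L2)" and l: "\<And>e. e \<in> set (L1 @ g # L2) \<Longrightarrow> lab e \<noteq> 0"
  obtains k :: nat and u where "k > 0" "\<And>v. v \<in> S \<union> tail \<Gamma> ` set L1 \<Longrightarrow> u v = 0" "u (tail \<Gamma> g) = int k"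
    "\<And>e. e \<in> set (L1 @ g # L2) \<Longrightarrow> int k * \<bar>lab g\<bar> dvd lab e * u (tail \<Gamma> e) - lab (arev e) * u (head \<Gamma> e)"
proof -
  let ?S = "S \<union> tail \<Gamma> ` set L1"
  have L1: "grows \<Gamma> S L1" and g: "head \<Gamma> g \<in> ?S" "tail \<Gamma> g \<notin> ?S" and L2: "grows \<Gamma> (insert (tail \<Gamma> g) ?S) L2"
    using L by (simp_all add: grows_append)
  obtain k u where k: "k > 0" and u: "\<And>v. v \<in> insert (tail \<Gamma> g) ?S \<Longrightarrow> u v = k * (if v = tail \<Gamma> g then 1 else 0)"
    and rel: "\<And>e. e \<in> set L2 \<Longrightarrow> lab e * u (tail \<Gamma> e) = lab (arev e) * u (head \<Gamma> e)"
    by (rule grows_extend_int[OF L2, where lab = lab and u = "\<lambda>v. if v = tail \<Gamma> g then 1 else 0" and arev = arev])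
      (use l in auto)
  have u0: "u v = 0" if "v \<in> ?S" for v
    using u[of v] that g(2) by auto
  have ug: "u (tail \<Gamma> g) = k"
    using u[of "tail \<Gamma> g"] by simp
  show thesis
  proof (rule that[of "nat k" u])
    show "nat k > 0" "u (tail \<Gamma> g) = int (nat k)"
      using k ug by simp_all
    show "u v = 0" if "v \<in> ?S" for v by (rule u0[OF that])
    fix e assume "e \<in> set (L1 @ g # L2)"
    then consider (before) "e \<in> set L1" | (at) "e = g" | (after) "e \<in> set L2" by auto
    then show "int (nat k) * \<bar>lab g\<bar> dvd lab e * u (tail \<Gamma> e) - lab (arev e) * u (head \<Gamma> e)"
    proof cases
      case before
      then have "u (tail \<Gamma> e) = 0" "u (head \<Gamma> e) = 0"
        using grows_head_in[OF L1 before] by (auto intro: u0)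
      then show ?thesis by simp
    next
      case at
      then show ?thesis
        using u0[OF g(1)] ug k by (simp add: mult.commute)
    next
      case after
      then show ?thesis using rel by simp
    qed
  qed
qed

lemma not_mult_abs_dvd: "\<bar>l\<bar> \<noteq> 1 \<Longrightarrow> k > 0 \<Longrightarrow> \<not> int k * \<bar>l\<bar> dvd int k" for l :: int
  using dvd_mult_cancel_left[of "int k" "\<bar>l\<bar>" 1] by simp

text \<open>The vertex generators die, and the two stable letters are free to go to generators of
  cyclic groups of orders 2 and 3.\<close>

lemma large_two_loops:
  assumes \<Gamma>: "labelled_graph \<Gamma> arev lab" and T: "maximal_tree \<Gamma> arev T"
    and e: "e1 \<in> arcs \<Gamma> - arcs T" "e2 \<in> arcs \<Gamma> - arcs T" "e2 \<noteq> e1" "e2 \<noteq> arev e1"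
  shows "large (gbs \<Gamma> arev lab T)"
proof -
  interpret labelled_graph \<Gamma> arev lab by fact
  interpret FG: gbs_presentation \<Gamma> arev lab T
    by (rule gbs_presentation_of_maximal_tree[OF \<Gamma> T])
  have Trev: "arev a \<in> arcs T" if "a \<in> arcs T" for a
    using T that by (simp add: maximal_tree_def rev_subgraph_def)
  have nT: "arev a \<notin> arcs T" if "a \<in> arcs \<Gamma> - arcs T" for a
    using Trev[of "arev a"] that by auto
  show ?thesis
  proof (rule large_of_cyclic_images[OF FG.gbs_presentation_axioms, where q = 2 and r = 3 and a = 1 and lab = lab], goal_cases)
    case (4 W \<alpha> \<beta>)
    interpret W: group W by (rule 4(1))
    note c = 4(2,3)
    define \<sigma> where "\<sigma> a = (if a = e1 then \<alpha> else if a = arev e1 then inv\<^bsub>W\<^esub> \<alpha> else if a = e2 then \<beta>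
      else if a = arev e2 then inv\<^bsub>W\<^esub> \<beta> else \<one>\<^bsub>W\<^esub>)" for a
    have ne: "arev e1 \<noteq> e1" "arev e2 \<noteq> e2" "arev e2 \<noteq> e1" "arev e2 \<noteq> arev e1" "arev (arev e1) = e1" "arev (arev e2) = e2"
    proof -
      show "arev e1 \<noteq> e1" "arev e2 \<noteq> e2"
        using e arev_neq[of e1] arev_neq[of e2] by auto
      show aa: "arev (arev e1) = e1" "arev (arev e2) = e2" by simp_all
      show "arev e2 \<noteq> e1" "arev e2 \<noteq> arev e1"
        using aa e(3,4) by metis+
    qed
    have \<sigma>c: "\<sigma> a \<in> carrier W" for a
      using c by (simp add: \<sigma>_def)
    have \<sigma>v: "\<sigma> e1 = \<alpha>" "\<sigma> e2 = \<beta>" "\<sigma> (arev e1) = inv\<^bsub>W\<^esub> \<alpha>" "\<sigma> (arev e2) = inv\<^bsub>W\<^esub> \<beta>"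
      using e ne by (auto simp: \<sigma>_def)
    have inv: "\<sigma> a \<otimes>\<^bsub>W\<^esub> \<sigma> (arev a) = \<one>\<^bsub>W\<^esub>" for a
    proof (cases "a \<in> {e1, e2, arev e1, arev e2}")
      case True
      then show ?thesis using \<sigma>v ne c by auto
    next
      case False
      moreover have "arev a \<notin> {e1, e2, arev e1, arev e2}"
        using False ne by (metis arev_arev insert_iff singletonD)
      ultimately show ?thesis by (simp add: \<sigma>_def)
    qed
    have "\<sigma> a = \<one>\<^bsub>W\<^esub>" if "a \<in> arcs T" for a
      using that e nT[OF e(1)] nT[OF e(2)] by (auto simp: \<sigma>_def)
    then have im: "gbs_images W \<Gamma> arev lab T (\<lambda>_. \<one>\<^bsub>W\<^esub>) \<sigma>"
      using \<sigma>c inv by (simp add: gbs_images_def)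
    show ?case
    proof (rule 4(6)[OF im])
      fix K assume K: "\<And>a. a \<in> arcs \<Gamma> \<Longrightarrow> \<sigma> a \<in> K"
      show "\<alpha> [^]\<^bsub>W\<^esub> (1 :: int) \<in> K \<and> \<beta> \<in> K"
        using K[of e1] K[of e2] e c \<sigma>v by simp
    qed
  qed simp_all
qed

text \<open>The cycle is closed before \<open>g\<close> grows, so its vertices have exponent 0. The
  stable letter is then unconstrained and goes to \<open>\<beta>\<close>, while
  \<open>tail \<Gamma> g\<close> goes to a non-trivial power of \<open>\<alpha>\<close>.\<close>

lemma large_hanging_nonunit:
  assumes \<Gamma>: "labelled_graph \<Gamma> arev lab" and T: "maximal_tree \<Gamma> arev T"
    and N: "arcs \<Gamma> - arcs T = {\<epsilon>, arev \<epsilon>}"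
    and L: "grows \<Gamma> {head \<Gamma> \<epsilon>} (L1 @ g # L2)" "arcs T = set (L1 @ g # L2) \<union> arev ` set (L1 @ g # L2)"
      "insert (head \<Gamma> \<epsilon>) (tail \<Gamma> ` set (L1 @ g # L2)) = verts \<Gamma>"
    and w: "tail \<Gamma> \<epsilon> \<in> insert (head \<Gamma> \<epsilon>) (tail \<Gamma> ` set L1)" and g: "\<bar>lab g\<bar> \<noteq> 1"
  shows "large (gbs \<Gamma> arev lab T)"
proof -
  interpret labelled_graph \<Gamma> arev lab by fact
  interpret FG: gbs_presentation \<Gamma> arev lab T
    by (rule gbs_presentation_of_maximal_tree[OF \<Gamma> T])
  have LA: "set (L1 @ g # L2) \<subseteq> arcs \<Gamma>"
    using L(2) FG.arcs_T by blast
  obtain k u where k: "k > 0" and u0: "\<And>v. v \<in> {head \<Gamma> \<epsilon>} \<union> tail \<Gamma> ` set L1 \<Longrightarrow> u v = 0" and ug: "u (tail \<Gamma> g) = int k"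
    and rel: "\<And>e. e \<in> set (L1 @ g # L2) \<Longrightarrow> int k * \<bar>lab g\<bar> dvd lab e * u (tail \<Gamma> e) - lab (arev e) * u (head \<Gamma> e)"
    by (rule grows_nonunit[OF L(1), where lab = lab and arev = arev]) (use LA lab_nonzero in blast)+
  define q where "q = k * nat \<bar>lab g\<bar>"
  have q: "int q = int k * \<bar>lab g\<bar>" by (simp add: q_def)
  have "lab g \<noteq> 0" using LA lab_nonzero by simp
  then have "q > 0" "\<not> int q dvd int k"
    using k not_mult_abs_dvd[OF g k] by (simp_all add: q_def)
  then show ?thesis
  proof (rule large_of_cyclic_images[OF FG.gbs_presentation_axioms, where r = 3 and lab = lab], goal_cases)
    case (2 W \<alpha> \<beta>)
    interpret W: group W by (rule 2(1))
    let ?X = "\<lambda>v. \<alpha> [^]\<^bsub>W\<^esub> u v"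
    let ?s = "\<lambda>e. if e \<in> {\<epsilon>} then \<beta> else if arev e \<in> {\<epsilon>} then inv\<^bsub>W\<^esub> \<beta> else \<one>\<^bsub>W\<^esub>"
    have \<epsilon>: "\<epsilon> \<in> arcs \<Gamma>" using N by blast
    have im: "gbs_images W \<Gamma> arev lab T ?X ?s"
    proof (rule gbs_images_of_arcs[OF 2(1) bidirected_digraph _ FG.arcs_T L(2)])
      show "?X v \<in> carrier W" for v using 2(2) by simp
      show "arcs \<Gamma> - arcs T = {\<epsilon>} \<union> arev ` {\<epsilon>}" using N by auto
      show "arev e \<notin> {\<epsilon>}" if "e \<in> {\<epsilon>}" for e
        using that arev_neq[OF \<epsilon>] by simp
      fix e
      show "?X (tail \<Gamma> e) [^]\<^bsub>W\<^esub> lab e = ?X (head \<Gamma> e) [^]\<^bsub>W\<^esub> lab (arev e)" if "e \<in> set (L1 @ g # L2)"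
        using W.int_pow_cong[OF 2(2,4), of "u (tail \<Gamma> e) * lab e" "u (head \<Gamma> e) * lab (arev e)"] rel[OF that] 2(2)
        by (simp add: q W.int_pow_pow mult.commute)
      have "u (head \<Gamma> \<epsilon>) = 0" "u (tail \<Gamma> \<epsilon>) = 0"
        using w by (auto intro: u0)
      then show "\<beta> \<in> carrier W \<and> \<beta> \<otimes>\<^bsub>W\<^esub> ?X (head \<Gamma> e) [^]\<^bsub>W\<^esub> lab (arev e) = ?X (tail \<Gamma> e) [^]\<^bsub>W\<^esub> lab e \<otimes>\<^bsub>W\<^esub> \<beta>" if "e \<in> {\<epsilon>}"
        using that 2(3) by simp
    qed
    show ?case
    proof (rule 2(6)[OF im])
      fix K assume K: "\<And>v. v \<in> verts \<Gamma> \<Longrightarrow> ?X v \<in> K" "\<And>a. a \<in> arcs \<Gamma> \<Longrightarrow> ?s a \<in> K"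
      have "tail \<Gamma> g \<in> verts \<Gamma>" using LA by simp
      then show "\<alpha> [^]\<^bsub>W\<^esub> int k \<in> K \<and> \<beta> \<in> K"
        using K(1)[of "tail \<Gamma> g"] K(2)[OF \<epsilon>] ug by simp
    qed
  qed simp
qed

section \<open>Cycles with a proper plateau\<close>

lemma (in group) int_pow_conj:
  assumes "t \<in> carrier G" "x \<in> carrier G"
  shows "(t \<otimes> x \<otimes> inv t) [^] (k :: int) = t \<otimes> x [^] k \<otimes> inv t"
proof -
  have "(\<lambda>x. t \<otimes> x \<otimes> inv t) \<in> hom G G"
  proof (rule homI)
    fix x y assume xy: "x \<in> carrier G" "y \<in> carrier G"
    have "inv t \<otimes> (t \<otimes> w) = w" if "w \<in> carrier G" for w
      using that assms(1) by (simp flip: m_assoc)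
    then show "t \<otimes> (x \<otimes> y) \<otimes> inv t = t \<otimes> x \<otimes> inv t \<otimes> (t \<otimes> y \<otimes> inv t)"
      using xy assms(1) by (simp add: m_assoc)
  qed (use assms(1) in simp)
  from hom_int_pow[OF this assms(2) is_group is_group] show ?thesis by simp
qed

lemma arcs_cycle_tree_compl:
  assumes "n > 0"
  shows "arcs (cycle_graph n) - arcs (cycle_tree n) = {2 * (n - 1), Suc (2 * (n - 1))}"
  using assms by (auto simp: cycle_tree_def)

text \<open>\<open>V\<close> and \<open>A\<close> mark the vertices and edges of a plateau. Modulo
  \<open>p\<close>, both labels of a plateau edge are invertible and carry the exponent on, and at
  any other edge both terms vanish. The walk starts after the missing edge \<open>i0\<close>, so
  nothing has to close up.\<close>

lemma plateau_exponents:
  fixes n :: nat and l l' :: "nat \<Rightarrow> int"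
  assumes p: "prime (p :: nat)" and i0: "i0 < n" "\<not> A i0"
    and A: "\<And>i. i < n \<Longrightarrow> A i \<Longrightarrow> V i \<and> V (Suc i mod n)"
    and l: "\<And>i. i < n \<Longrightarrow> V i \<Longrightarrow> int p dvd l i \<longleftrightarrow> \<not> A i"
    and l': "\<And>i. i < n \<Longrightarrow> V (Suc i mod n) \<Longrightarrow> int p dvd l' i \<longleftrightarrow> \<not> A i"
  obtains u :: "nat \<Rightarrow> int" where "\<And>v. v < n \<Longrightarrow> int p dvd u v \<longleftrightarrow> \<not> V v"
    "\<And>i. i < n \<Longrightarrow> i \<noteq> i0 \<Longrightarrow> int p dvd l i * u i - l' i * u (Suc i mod n)"
proof -
  \<comment> \<open>Vertices in cyclic order from the far end of the edge \<open>i0\<close>;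
    \<open>d\<close> below is the inverse enumeration.\<close>
  define c where "c j = (Suc i0 + j) mod n" for j
  have c_less: "c j < n" for j
    using i0(1) by (simp add: c_def)
  have c_Suc: "c (Suc j) = Suc (c j) mod n" for j
    by (simp add: c_def mod_Suc_eq)
  have pp: "prime (int p)" using p by simp
  have "\<exists>f. \<forall>j. (int p dvd f j \<longleftrightarrow> \<not> V (c j)) \<and> int p dvd l (c j) * f j - l' (c j) * f (Suc j)"
  proof (rule dependent_nat_choice)
    show "\<exists>x. int p dvd x \<longleftrightarrow> \<not> V (c 0)"
      by (rule exI[of _ "if V (c 0) then 1 else 0"]) (use prime_gt_1_nat[OF p] in simp)
    fix x j assume x: "int p dvd x \<longleftrightarrow> \<not> V (c j)"
    let ?i = "c j"
    show "\<exists>y. (int p dvd y \<longleftrightarrow> \<not> V (c (Suc j))) \<and> int p dvd l ?i * x - l' ?i * y"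
    proof (cases "A ?i")
      case True
      then have V: "V ?i" "V (c (Suc j))"
        using A[OF c_less] by (simp_all add: c_Suc)
      then have nd: "\<not> int p dvd l ?i" "\<not> int p dvd l' ?i" "\<not> int p dvd x"
        using l[OF c_less] l'[OF c_less] True x by (simp_all add: c_Suc)
      then have "coprime (l' ?i) (int p)"
        using prime_imp_coprime[OF pp nd(2)] by (metis coprime_commute)
      \<comment> \<open>\<open>s\<close> inverts \<open>l' ?i\<close> modulo \<open>p\<close>, so
        \<open>s * l ?i * x\<close> is the exponent at the next vertex.\<close>
      then obtain s t where st: "s * l' ?i + t * int p = 1"
        using bezout_int[of "l' ?i" "int p"] by (auto simp: coprime_iff_gcd_eq_1)
      have "l ?i * x - l' ?i * (s * l ?i * x) = (s * l' ?i + t * int p) * (l ?i * x) - l' ?i * (s * l ?i * x)"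
        by (simp add: st)
      also have "\<dots> = int p * (t * l ?i * x)"
        by (simp add: algebra_simps)
      finally have rel: "int p dvd l ?i * x - l' ?i * (s * l ?i * x)" by simp
      have "\<not> int p dvd s * l ?i * x"
      proof
        assume "int p dvd s * l ?i * x"
        then have d: "int p dvd l' ?i * (s * l ?i * x)" by (rule dvd_mult)
        have "int p dvd l ?i * x" using dvd_add[OF rel d] by simp
        then show False using nd prime_dvd_mult_iff[OF pp] by blast
      qed
      then show ?thesis using rel V by blast
    next
      case False
      have "int p dvd l ?i * x"
        using l[OF c_less, of j] x False by (cases "V ?i") auto
      moreover have "int p dvd l' ?i * (if V (c (Suc j)) then 1 else 0)"
        using l'[OF c_less, of j] False by (simp add: c_Suc)
      ultimately show ?thesis
        using prime_gt_1_nat[OF p] by (intro exI[of _ "if V (c (Suc j)) then 1 else 0"]) auto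
    qed
  qed
  then obtain f where f: "\<And>j. int p dvd f j \<longleftrightarrow> \<not> V (c j)" "\<And>j. int p dvd l (c j) * f j - l' (c j) * f (Suc j)"
    by blast
  define d where "d i = (i + (n - Suc i0)) mod n" for i
  have d_less: "d i < n" for i
    using i0(1) by (simp add: d_def)
  have cd: "c (d i) = i" if "i < n" for i
  proof -
    have "c (d i) = (Suc i0 + (i + (n - Suc i0))) mod n"
      by (simp only: c_def d_def mod_add_right_eq)
    also have "Suc i0 + (i + (n - Suc i0)) = i + n" using i0(1) by simp
    finally show ?thesis using that by simp
  qed
  have dc: "d (c j) = j" if "j < n" for j
  proof -
    have "d (c j) = (Suc i0 + j + (n - Suc i0)) mod n"
      by (simp only: c_def d_def mod_add_left_eq)
    also have "Suc i0 + j + (n - Suc i0) = j + n" using i0(1) by simp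
    finally show ?thesis using that by simp
  qed
  show thesis
  proof (rule that[of "\<lambda>v. f (d v)"])
    show "int p dvd f (d v) \<longleftrightarrow> \<not> V v" if "v < n" for v
      using f(1)[of "d v"] by (simp add: cd[OF that])
    fix i assume i: "i < n" "i \<noteq> i0"
    have "d i \<noteq> n - 1"
    proof
      assume "d i = n - 1"
      then have "i = c (n - 1)" using cd[OF i(1)] by simp
      also have "c (n - 1) = (i0 + n) mod n"
        using i0(1) by (simp add: c_def)
      finally show False using i i0(1) by simp
    qed
    then have "Suc (d i) < n" using d_less[of i] by simp
    then have "d (Suc i mod n) = Suc (d i)"
      using dc[of "Suc (d i)"] by (simp add: c_Suc cd[OF i(1)])
    then show "int p dvd l i * f (d i) - l' i * f (d (Suc i mod n))"
      using f(2)[of "d i"] by (simp add: cd[OF i(1)])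
  qed
qed

text \<open>Vertices go to conjugates of powers of \<open>\<alpha>\<close>, with exponents prime to
  \<open>p\<close> on the plateau only. At the missing edge both sides of the relation vanish, so
  everything beyond it may be conjugated by \<open>\<beta>\<close>, which becomes the image of the
  stable letter.\<close>

lemma large_cycle_with_plateau:
  assumes n: "n > 0" and \<Gamma>: "labelled_graph (cycle_graph n) (cycle_rev n) lab"
    and plateau: "proper_plateau (cycle_graph n) (cycle_rev n) lab P"
  shows "large (gbs (cycle_graph n) (cycle_rev n) lab (cycle_tree n))"
proof -
  let ?\<Gamma> = "cycle_graph n" and ?rev = "cycle_rev n" and ?T = "cycle_tree n"
  interpret labelled_graph ?\<Gamma> ?rev lab by fact
  interpret FG: gbs_presentation ?\<Gamma> ?rev lab ?T
    by (rule gbs_presentation_of_maximal_tree[OF \<Gamma> maximal_tree_cycle_graph[OF n]])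
  obtain p where p: "prime p" and P: "p_plateau p ?\<Gamma> ?rev lab P" and ne: "P \<noteq> ?\<Gamma>"
    using plateau by (auto simp: proper_plateau_def plateau_def)
  have sub: "verts P \<subseteq> {..<n}" "arcs P \<subseteq> {..<2 * n}" "tail P = tail ?\<Gamma>" "head P = head ?\<Gamma>" and wf: "wf_digraph P"
    and Prev: "\<And>e. e \<in> arcs P \<Longrightarrow> ?rev e \<in> arcs P"
    and dvd: "\<And>e. e < 2 * n \<Longrightarrow> tail ?\<Gamma> e \<in> verts P \<Longrightarrow> int p dvd lab e \<longleftrightarrow> e \<notin> arcs P"
    using P by (simp_all add: p_plateau_def rev_subgraph_def subgraph_def compatible_def)
  have "verts P \<noteq> {}"
    using P by (simp add: p_plateau_def Digraph_Component.connected_def strongly_connected_def)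
  then obtain v0 where v0: "v0 \<in> verts P" "v0 < n" using sub(1) by auto
  have A_rev: "Suc (2 * i) \<in> arcs P \<longleftrightarrow> 2 * i \<in> arcs P" if "i < n" for i
    using Prev[of "2 * i"] Prev[of "Suc (2 * i)"] that by auto
  have A_ends: "i \<in> verts P" "Suc i mod n \<in> verts P" if "2 * i \<in> arcs P" for i
    using wf_digraph.tail_in_verts[OF wf that] wf_digraph.head_in_verts[OF wf that] by (simp_all add: sub)
  \<comment> \<open>A plateau with all edges would be the whole graph, since every vertex is the
    tail of an even arc.\<close>
  have "\<exists>i0<n. 2 * i0 \<notin> arcs P"
  proof (rule ccontr)
    assume "\<not> ?thesis"
    then have all: "2 * i \<in> arcs P" if "i < n" for i using that by blast
    have "arcs P = {..<2 * n}"
    proof (intro equalityI sub(2) subsetI)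
      fix e assume "e \<in> {..<2 * n}"
      then have "e < 2 * n" by simp
      then show "e \<in> arcs P"
        by (cases e rule: cycle_arc_cases[of _ n]) (use all A_rev in simp_all)
    qed
    moreover have "verts P = {..<n}"
      using sub(1) A_ends(1) all by blast
    ultimately have "P = ?\<Gamma>"
      using sub(3,4) by (intro pre_digraph.equality) simp_all
    then show False using ne by simp
  qed
  then obtain i0 where i0: "i0 < n" "2 * i0 \<notin> arcs P" by blast
  obtain u where u: "\<And>v. v < n \<Longrightarrow> int p dvd u v \<longleftrightarrow> v \<notin> verts P"
    and rel: "\<And>i. i < n \<Longrightarrow> i \<noteq> i0 \<Longrightarrow> int p dvd lab (2 * i) * u i - lab (Suc (2 * i)) * u (Suc i mod n)"
  proof (rule plateau_exponents[of p i0 n "\<lambda>i. 2 * i \<in> arcs P" "\<lambda>v. v \<in> verts P" "\<lambda>i. lab (2 * i)" "\<lambda>i. lab (Suc (2 * i))"])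
    show "int p dvd lab (2 * i) \<longleftrightarrow> 2 * i \<notin> arcs P" if "i < n" "i \<in> verts P" for i
      using that dvd[of "2 * i"] by simp
    show "int p dvd lab (Suc (2 * i)) \<longleftrightarrow> 2 * i \<notin> arcs P" if "i < n" "Suc i mod n \<in> verts P" for i
      using that dvd[of "Suc (2 * i)"] A_rev[OF that(1)] by simp
    show "prime p" "i0 < n" "2 * i0 \<notin> arcs P" by fact+
    show "i \<in> verts P \<and> Suc i mod n \<in> verts P" if "2 * i \<in> arcs P" for i
      using A_ends[OF that] by simp
  qed (rule that)
  \<comment> \<open>At an end in the plateau the label is divisible by \<open>p\<close>, at any
    other end the exponent is.\<close>
  have rel0: "int p dvd lab (2 * i0) * u i0" "int p dvd lab (Suc (2 * i0)) * u (Suc i0 mod n)"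
  proof -
    show "int p dvd lab (2 * i0) * u i0"
      using u[OF i0(1)] dvd[of "2 * i0"] i0 by (cases "i0 \<in> verts P") auto
    have "Suc i0 mod n < n" using n by simp
    then show "int p dvd lab (Suc (2 * i0)) * u (Suc i0 mod n)"
      using u[of "Suc i0 mod n"] dvd[of "Suc (2 * i0)"] i0 A_rev[OF i0(1)] by (cases "Suc i0 mod n \<in> verts P") auto
  qed
  have "p > 0" "\<not> int p dvd u v0"
    using p prime_gt_0_nat u[OF v0(2)] v0(1) by simp_all
  then show ?thesis
  proof (rule large_of_cyclic_images[OF FG.gbs_presentation_axioms, where r = 3 and lab = lab], goal_cases)
    case (2 W \<alpha> \<beta>)
    interpret W: group W by (rule 2(1))
    \<comment> \<open>\<open>cycle_tree\<close> omits the edge \<open>n - 1\<close>, which need not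
      be \<open>i0\<close>; conjugating the vertices after \<open>i0\<close> moves the break to the
      omitted edge.\<close>
    define t where "t v = (if v \<le> i0 then \<one>\<^bsub>W\<^esub> else \<beta>)" for v
    have t_c: "t v \<in> carrier W" for v
      using 2(3) by (simp add: t_def)
    let ?X = "\<lambda>v. t v \<otimes>\<^bsub>W\<^esub> \<alpha> [^]\<^bsub>W\<^esub> u v \<otimes>\<^bsub>W\<^esub> inv\<^bsub>W\<^esub> t v"
    let ?s = "\<lambda>e. if e \<in> {2 * (n - 1)} then \<beta> else if ?rev e \<in> {2 * (n - 1)} then inv\<^bsub>W\<^esub> \<beta> else \<one>\<^bsub>W\<^esub>"
    have X_pow: "?X v [^]\<^bsub>W\<^esub> k = t v \<otimes>\<^bsub>W\<^esub> \<alpha> [^]\<^bsub>W\<^esub> (k * u v) \<otimes>\<^bsub>W\<^esub> inv\<^bsub>W\<^esub> t v" for v and k :: int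
      using W.int_pow_conj[OF t_c, of "\<alpha> [^]\<^bsub>W\<^esub> u v" v k] 2(2) by (simp add: W.int_pow_pow mult.commute)
    have X_one: "?X v [^]\<^bsub>W\<^esub> k = \<one>\<^bsub>W\<^esub>" if "int p dvd k * u v" for v and k :: int
      using W.int_pow_cong[OF 2(2,4), of "k * u v" 0] that t_c[of v] by (simp add: X_pow)
    have last: "2 * (n - 1) < 2 * n" "n - 1 < n" "Suc (n - 1) mod n = 0" using n by simp_all
    have im: "gbs_images W ?\<Gamma> ?rev lab ?T ?X ?s"
    proof (rule gbs_images_of_arcs[OF 2(1) bidirected_digraph _ FG.arcs_T arcs_cycle_tree])
      show "?X v \<in> carrier W" for v using t_c 2(2) by simp
      show "arcs ?\<Gamma> - arcs ?T = {2 * (n - 1)} \<union> ?rev ` {2 * (n - 1)}"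
        using arcs_cycle_tree_compl[OF n] last by auto
      show "?rev e \<notin> {2 * (n - 1)}" if "e \<in> {2 * (n - 1)}" for e
        using that last by simp
      fix e
      show "?X (tail ?\<Gamma> e) [^]\<^bsub>W\<^esub> lab e = ?X (head ?\<Gamma> e) [^]\<^bsub>W\<^esub> lab (?rev e)"
        if e: "e \<in> set (map (\<lambda>i. Suc (2 * i)) [0..<n - 1])"
      proof -
        obtain i where i: "i < n - 1" "e = Suc (2 * i)" using e by auto
        then have i': "i < n" "Suc i mod n = Suc i" by auto
        have "?X (Suc i) [^]\<^bsub>W\<^esub> lab (Suc (2 * i)) = ?X i [^]\<^bsub>W\<^esub> lab (2 * i)"
        proof (cases "i = i0")
          case True
          then show ?thesis
            using rel0 i'(2) by (simp only: X_one)
        next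
          case False
          then have "t (Suc i) = t i" by (auto simp: t_def)
          moreover have "\<alpha> [^]\<^bsub>W\<^esub> (lab (2 * i) * u i) = \<alpha> [^]\<^bsub>W\<^esub> (lab (Suc (2 * i)) * u (Suc i))"
            using rel[OF i'(1) False] i'(2) by (intro W.int_pow_cong[OF 2(2,4)]) simp
          ultimately show ?thesis unfolding X_pow by simp
        qed
        then show ?thesis using i i' by simp
      qed
      have eq: "\<beta> \<otimes>\<^bsub>W\<^esub> ?X 0 [^]\<^bsub>W\<^esub> lab (Suc (2 * (n - 1))) = ?X (n - 1) [^]\<^bsub>W\<^esub> lab (2 * (n - 1)) \<otimes>\<^bsub>W\<^esub> \<beta>"
      proof (cases "i0 = n - 1")
        case True
        then have "?X 0 [^]\<^bsub>W\<^esub> lab (Suc (2 * (n - 1))) = \<one>\<^bsub>W\<^esub>" "?X (n - 1) [^]\<^bsub>W\<^esub> lab (2 * (n - 1)) = \<one>\<^bsub>W\<^esub>"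
          using rel0 last(3) by (simp_all only: X_one)
        then show ?thesis using 2(3) by simp
      next
        case False
        then have t: "t 0 = \<one>\<^bsub>W\<^esub>" "t (n - 1) = \<beta>"
          using i0(1) by (auto simp: t_def)
        have "\<alpha> [^]\<^bsub>W\<^esub> (lab (2 * (n - 1)) * u (n - 1)) = \<alpha> [^]\<^bsub>W\<^esub> (lab (Suc (2 * (n - 1))) * u 0)"
          using rel[OF last(2)] False last(3) by (intro W.int_pow_cong[OF 2(2,4)]) simp
        then show ?thesis
          unfolding X_pow unfolding t using 2(2,3) by (simp add: W.m_assoc)
      qed
      show "\<beta> \<in> carrier W \<and> \<beta> \<otimes>\<^bsub>W\<^esub> ?X (head ?\<Gamma> e) [^]\<^bsub>W\<^esub> lab (?rev e) = ?X (tail ?\<Gamma> e) [^]\<^bsub>W\<^esub> lab e \<otimes>\<^bsub>W\<^esub> \<beta>"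
        if e: "e \<in> {2 * (n - 1)}"
      proof -
        have "tail ?\<Gamma> e = n - 1" "head ?\<Gamma> e = 0" "?rev e = Suc (2 * (n - 1))" "e = 2 * (n - 1)"
          using e last by (simp_all only: singleton_iff cycle_graph_simps cycle_rev_simps)
        then show ?thesis using eq 2(3) by simp
      qed
    qed
    show ?case
    proof (rule 2(6)[OF im])
      fix K assume K: "subgroup K W" "\<And>v. v \<in> verts ?\<Gamma> \<Longrightarrow> ?X v \<in> K" "\<And>a. a \<in> arcs ?\<Gamma> \<Longrightarrow> ?s a \<in> K"
      have \<beta>: "\<beta> \<in> K" using K(3)[of "2 * (n - 1)"] last by simp
      then have tK: "t v0 \<in> K" by (simp add: t_def subgroup.one_closed[OF K(1)])
      have Xv: "?X v0 \<in> K" by (rule K(2)) (use v0(2) in simp)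
      \<comment> \<open>As \<open>t v0\<close> lies in \<open>K\<close>, the conjugation can be
        undone there.\<close>
      have "inv\<^bsub>W\<^esub> t v0 \<otimes>\<^bsub>W\<^esub> ?X v0 \<otimes>\<^bsub>W\<^esub> t v0 \<in> K"
        by (rule subgroup.m_closed[OF K(1) subgroup.m_closed[OF K(1) subgroup.m_inv_closed[OF K(1) tK] Xv] tK])
      also have "inv\<^bsub>W\<^esub> t v0 \<otimes>\<^bsub>W\<^esub> ?X v0 \<otimes>\<^bsub>W\<^esub> t v0 = (inv\<^bsub>W\<^esub> t v0 \<otimes>\<^bsub>W\<^esub> t v0) \<otimes>\<^bsub>W\<^esub> \<alpha> [^]\<^bsub>W\<^esub> u v0 \<otimes>\<^bsub>W\<^esub> (inv\<^bsub>W\<^esub> t v0 \<otimes>\<^bsub>W\<^esub> t v0)"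
        using t_c[of v0] 2(2) by (simp only: W.m_assoc W.m_closed W.inv_closed W.int_pow_closed)
      also have "\<dots> = \<alpha> [^]\<^bsub>W\<^esub> u v0"
        using t_c[of v0] 2(2) by simp
      finally show "\<alpha> [^]\<^bsub>W\<^esub> u v0 \<in> K \<and> \<beta> \<in> K" using \<beta> by simp
    qed
  qed simp
qed

section \<open>Graphs with one cycle\<close>

lemma grows_induct:
  assumes "grows \<Gamma> S L" "\<And>v. v \<in> S \<Longrightarrow> Pr v" "\<And>e. e \<in> set L \<Longrightarrow> Pr (head \<Gamma> e) \<Longrightarrow> Pr (tail \<Gamma> e)"
    and "v \<in> S \<union> tail \<Gamma> ` set L"
  shows "Pr v"
  using assms
proof (induction L arbitrary: S)
  case (Cons e L)
  have e: "head \<Gamma> e \<in> S" and L: "grows \<Gamma> (insert (tail \<Gamma> e) S) L" using Cons.prems(1) by simp_all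
  have "Pr (tail \<Gamma> e)" using Cons.prems(3)[of e] Cons.prems(2)[OF e] by simp
  then show ?case
    by (intro Cons.IH[OF L]) (use Cons.prems(2-4) in auto)
qed simp

lemma is_path_nth:
  "is_path \<Gamma> u P w \<Longrightarrow> (\<forall>i<length P. head \<Gamma> (P ! i) = (u # map (tail \<Gamma>) P) ! i) \<and> (u # map (tail \<Gamma>) P) ! length P = w"
proof (induction P arbitrary: u)
  case (Cons e P)
  then have "head \<Gamma> e = u" and IH: "\<forall>i<length P. head \<Gamma> (P ! i) = (tail \<Gamma> e # map (tail \<Gamma>) P) ! i"
    "(tail \<Gamma> e # map (tail \<Gamma>) P) ! length P = w" by simp_all
  then show ?case
    by (auto simp: less_Suc_eq_0_disj)
qed simp

section \<open>Consequences of the edge relations\<close>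

context gbs_presentation
begin

lemma ge_tree: "e \<in> arcs T \<Longrightarrow> ge e = \<one>\<^bsub>G\<^esub>"
  using gbs_images_G by (simp add: gbs_images_def)

lemma ge_arev: "e \<in> arcs \<Gamma> \<Longrightarrow> ge (arev e) = inv\<^bsub>G\<^esub> ge e"
proof -
  assume e: "e \<in> arcs \<Gamma>"
  have "ge (arev e) \<otimes>\<^bsub>G\<^esub> ge e = \<one>\<^bsub>G\<^esub>"
    using gbs_images_G e arev_in_arcs[of e] arev_arev[of e] unfolding gbs_images_def by metis
  from G.inv_equality[OF this] show ?thesis using e by simp
qed

lemma ge_relation: "e \<in> arcs \<Gamma> \<Longrightarrow>
    ge e \<otimes>\<^bsub>G\<^esub> gv (head \<Gamma> e) [^]\<^bsub>G\<^esub> lab (arev e) = gv (tail \<Gamma> e) [^]\<^bsub>G\<^esub> lab e \<otimes>\<^bsub>G\<^esub> ge e"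
  using gbs_images_G by (simp add: gbs_images_def)

lemma gv_tree_relation:
  assumes "e \<in> arcs T"
  shows "gv (tail \<Gamma> e) [^]\<^bsub>G\<^esub> lab e = gv (head \<Gamma> e) [^]\<^bsub>G\<^esub> lab (arev e)"
proof -
  have "e \<in> arcs \<Gamma>" using assms arcs_T by blast
  then show ?thesis using ge_relation[of e] ge_tree[OF assms] by simp
qed

text \<open>Raising the edge relation to the power \<open>lab e\<close>, which is its own inverse,
  isolates the generator at the tail.\<close>

lemma gv_unit_power:
  assumes e: "e \<in> arcs T" "\<bar>lab e\<bar> = 1" and w: "w \<in> verts \<Gamma>"
    and k: "lab e * k' = lab (arev e) * k" "gv (head \<Gamma> e) = gv w [^]\<^bsub>G\<^esub> k"
  shows "gv (tail \<Gamma> e) = gv w [^]\<^bsub>G\<^esub> (k' :: int)"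
proof -
  have "e \<in> arcs \<Gamma>" using e(1) arcs_T by blast
  then have t: "gv (tail \<Gamma> e) \<in> carrier G" by simp
  have l: "lab e * lab e = 1"
    using e(2) by (metis abs_mult_self_eq mult_1)
  have "gv (tail \<Gamma> e) = (gv (tail \<Gamma> e) [^]\<^bsub>G\<^esub> lab e) [^]\<^bsub>G\<^esub> lab e"
    using t by (simp add: G.int_pow_pow l)
  also have "\<dots> = gv w [^]\<^bsub>G\<^esub> (k * lab (arev e) * lab e)"
    using w by (simp add: gv_tree_relation[OF e(1)] k(2) G.int_pow_pow)
  also have "k * lab (arev e) * lab e = (lab e * lab e) * k'"
    using k(1) by (simp add: algebra_simps)
  finally show ?thesis by (simp add: l)
qed

end

text \<open>The path \<open>P\<close> together with \<open>\<epsilon>\<close> is a circle, and the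
  arcs of \<open>H\<close> have unit labels at their outer ends. So the generators off the circle
  are powers of those on it, and the hanging trees can be collapsed.\<close>

lemma cycle_of_loop_edge:
  fixes \<Gamma> :: "('v, 'e) pre_digraph"
  assumes \<Gamma>: "labelled_graph \<Gamma> arev lab" and T: "maximal_tree \<Gamma> arev T"
    and N: "arcs \<Gamma> - arcs T = {\<epsilon>, arev \<epsilon>}"
    and L: "grows \<Gamma> {head \<Gamma> \<epsilon>} (P @ H)" "arcs T = set (P @ H) \<union> arev ` set (P @ H)"
      "insert (head \<Gamma> \<epsilon>) (tail \<Gamma> ` set (P @ H)) = verts \<Gamma>"
    and P: "is_path \<Gamma> (head \<Gamma> \<epsilon>) P (tail \<Gamma> \<epsilon>)" and H: "\<And>e. e \<in> set H \<Longrightarrow> \<bar>lab e\<bar> = 1"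
  obtains n lab' where "n > 0" "\<And>e. e < 2 * n \<Longrightarrow> lab' e \<noteq> 0"
    "gbs \<Gamma> arev lab T \<cong> gbs (cycle_graph n) (cycle_rev n) lab' (cycle_tree n)"
proof -
  interpret labelled_graph \<Gamma> arev lab by fact
  interpret FG: gbs_presentation \<Gamma> arev lab T
    by (rule gbs_presentation_of_maximal_tree[OF \<Gamma> T])
  have LA: "set (P @ H) \<subseteq> arcs \<Gamma>" using L(2) FG.arcs_T by blast
  have \<epsilon>: "\<epsilon> \<in> arcs \<Gamma>" using N by blast
  define n where "n = Suc (length P)"
  define vs where "vs = head \<Gamma> \<epsilon> # map (tail \<Gamma>) P"
  \<comment> \<open>The edges of the circle in the direction of the even arcs: path arcs point back
    to the root and are reversed, and \<open>\<epsilon>\<close> leads from the end of the path to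
    its start.\<close>
  define A where "A = map arev P @ [\<epsilon>]"
  define lab' where "lab' e = (if even e then lab (A ! (e div 2)) else lab (arev (A ! (e div 2))))" for e
  have len: "length vs = n" "length A = n" by (simp_all add: vs_def A_def n_def)
  have n: "n > 0" by (simp add: n_def)
  have vs_verts: "set vs \<subseteq> verts \<Gamma>" using L(3) by (auto simp: vs_def)
  have gP: "grows \<Gamma> {head \<Gamma> \<epsilon>} P" and gH: "grows \<Gamma> (set vs) H"
    using L(1) by (simp_all add: grows_append vs_def)
  have "distinct vs"
  proof -
    have "head \<Gamma> \<epsilon> \<notin> tail \<Gamma> ` set P"
    proof
      assume "head \<Gamma> \<epsilon> \<in> tail \<Gamma> ` set P"
      then obtain e where e: "e \<in> set P" "tail \<Gamma> e = head \<Gamma> \<epsilon>" by auto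
      then show False using grows_tail_notin[OF gP e(1)] by simp
    qed
    then show ?thesis
      using grows_distinct[OF gP] by (simp add: vs_def)
  qed
  then have inj: "inj_on ((!) vs) {..<n}"
    by (simp add: inj_on_nth len)
  define idx where "idx = inv_into {..<n} ((!) vs)"
  have im_vs: "(!) vs ` {..<n} = set vs"
    by (auto simp: in_set_conv_nth len)
  have idx: "idx (vs ! i) = i" if "i < n" for i
    unfolding idx_def using inj that by (simp add: inv_into_f_f)
  have idx_less: "idx v < n" and vs_idx: "vs ! idx v = v" if "v \<in> set vs" for v
    unfolding idx_def using inv_into_into[of v "(!) vs" "{..<n}"] f_inv_into_f[of v "(!) vs" "{..<n}"] that
    by (simp_all add: im_vs)
  have P_nth: "head \<Gamma> (P ! i) = vs ! i" "tail \<Gamma> (P ! i) = vs ! Suc i" if "i < length P" for i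
    using is_path_nth[OF P] that by (simp_all add: vs_def)
  have vs_last: "vs ! (n - 1) = tail \<Gamma> \<epsilon>" and vs_0: "vs ! 0 = head \<Gamma> \<epsilon>"
    using is_path_nth[OF P] by (simp_all add: vs_def n_def)
  have A_nth: "A ! i = arev (P ! i)" if "i < n - 1" for i
    using that by (simp add: A_def n_def nth_append)
  have A_last: "A ! (n - 1) = \<epsilon>"
    by (simp add: A_def n_def nth_append)
  have A_arc: "A ! i \<in> arcs \<Gamma>" if "i < n" for i
  proof (cases "i < n - 1")
    case True
    then have "P ! i \<in> arcs \<Gamma>" using LA nth_mem[of i P] by (auto simp: n_def)
    then show ?thesis using True by (simp add: A_nth)
  next
    case False
    then have "i = n - 1" using that by simp
    then show ?thesis using \<epsilon> by (simp only: A_last)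
  qed
  have lab': "lab' (2 * i) = lab (A ! i)" "lab' (Suc (2 * i)) = lab (arev (A ! i))" for i
    by (simp_all add: lab'_def)
  have lab'_P: "lab' (2 * i) = lab (arev (P ! i))" "lab' (Suc (2 * i)) = lab (P ! i)" if "i < n - 1" for i
    using that by (simp_all add: lab' A_nth)
  have lab'_nz: "lab' e \<noteq> 0" if "e < 2 * n" for e
    using that by (cases e rule: cycle_arc_cases[of _ n]) (use lab_nonzero A_arc in \<open>auto simp: lab'\<close>)
  let ?\<Gamma>' = "cycle_graph n" and ?rev = "cycle_rev n" and ?T' = "cycle_tree n" and ?\<epsilon>' = "2 * (n - 1)"
  have \<Gamma>': "labelled_graph ?\<Gamma>' ?rev lab'"
    by (rule labelled_cycle_graph[OF n lab'_nz])
  interpret C: gbs_presentation ?\<Gamma>' ?rev lab' ?T'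
    by (rule gbs_presentation_of_maximal_tree[OF \<Gamma>' maximal_tree_cycle_graph[OF n]])
  have \<epsilon>': "?\<epsilon>' \<in> arcs ?\<Gamma>'" "?rev ?\<epsilon>' = Suc ?\<epsilon>'" "?rev (Suc ?\<epsilon>') = ?\<epsilon>'" "tail ?\<Gamma>' ?\<epsilon>' = n - 1" "head ?\<Gamma>' ?\<epsilon>' = 0"
    using n by (simp, simp_all only: cycle_rev_simps cycle_graph_simps) simp_all
  \<comment> \<open>\<open>\<rho>\<close> retracts the hanging trees to the circle, and
    \<open>k v\<close> is the exponent that expresses the generator at \<open>v\<close> through the
    one at \<open>\<rho> v\<close>.\<close>
  obtain \<rho> k where \<rho>: "\<And>v. v \<in> set vs \<Longrightarrow> \<rho> v = v \<and> k v = 1" "\<And>v. v \<in> set vs \<union> tail \<Gamma> ` set H \<Longrightarrow> \<rho> v \<in> set vs"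
    and \<rho>H: "\<And>e. e \<in> set H \<Longrightarrow> \<rho> (tail \<Gamma> e) = \<rho> (head \<Gamma> e) \<and> lab e * k (tail \<Gamma> e) = lab (arev e) * k (head \<Gamma> e)"
  proof (rule grows_unit[OF gH, of lab arev])
    show "\<bar>lab e\<bar> = 1" if "e \<in> set H" for e by (rule H[OF that])
  qed (rule that)
  have V: "set vs \<union> tail \<Gamma> ` set H = verts \<Gamma>"
    using L(3) by (auto simp: vs_def)
  have gv_\<rho>: "FG.gv v = FG.gv (\<rho> v) [^]\<^bsub>FG.G\<^esub> k v" if "v \<in> verts \<Gamma>" for v
  proof (rule grows_induct[OF gH, where Pr = "\<lambda>v. FG.gv v = FG.gv (\<rho> v) [^]\<^bsub>FG.G\<^esub> k v"])
    show "FG.gv v = FG.gv (\<rho> v) [^]\<^bsub>FG.G\<^esub> k v" if "v \<in> set vs" for v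
      using \<rho>(1)[OF that] that vs_verts by auto
    fix e assume e: "e \<in> set H" "FG.gv (head \<Gamma> e) = FG.gv (\<rho> (head \<Gamma> e)) [^]\<^bsub>FG.G\<^esub> k (head \<Gamma> e)"
    have "e \<in> arcs T" "e \<in> arcs \<Gamma>" using e(1) L(2) LA by auto
    moreover have "\<rho> (head \<Gamma> e) \<in> verts \<Gamma>"
      using \<rho>(2)[of "head \<Gamma> e"] \<open>e \<in> arcs \<Gamma>\<close> V vs_verts by auto
    ultimately show "FG.gv (tail \<Gamma> e) = FG.gv (\<rho> (tail \<Gamma> e)) [^]\<^bsub>FG.G\<^esub> k (tail \<Gamma> e)"
      using FG.gv_unit_power[of e "\<rho> (head \<Gamma> e)" "k (tail \<Gamma> e)" "k (head \<Gamma> e)"] H[OF e(1)] \<rho>H[OF e(1)] e(2) by simp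
  qed (use that V in simp)
  define X where "X v = C.gv (idx (\<rho> v)) [^]\<^bsub>C.G\<^esub> k v" for v
  define \<sigma> where "\<sigma> = (\<lambda>e. if e \<in> {\<epsilon>} then C.ge ?\<epsilon>' else if arev e \<in> {\<epsilon>} then inv\<^bsub>C.G\<^esub> C.ge ?\<epsilon>' else \<one>\<^bsub>C.G\<^esub>)"
  define X' where "X' i = FG.gv (vs ! i)" for i
  define \<sigma>' where "\<sigma>' = (\<lambda>e. if e \<in> {?\<epsilon>'} then FG.ge \<epsilon> else if ?rev e \<in> {?\<epsilon>'} then inv\<^bsub>FG.G\<^esub> FG.ge \<epsilon> else \<one>\<^bsub>FG.G\<^esub>)"
  have X_vs: "X (vs ! i) = C.gv i" if "i < n" for i
    using \<rho>(1)[of "vs ! i"] that len by (simp add: X_def idx)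
  have gvC: "C.gv (idx (\<rho> v)) \<in> carrier C.G" if "v \<in> verts \<Gamma>" for v
    using idx_less[OF \<rho>(2)] that V by simp
  have C_rel: "C.gv (Suc i) [^]\<^bsub>C.G\<^esub> lab' (Suc (2 * i)) = C.gv i [^]\<^bsub>C.G\<^esub> lab' (2 * i)" if "i < n - 1" for i
  proof -
    have "Suc (2 * i) \<in> arcs ?T'" "i < n" "Suc i mod n = Suc i"
      using that by (auto simp: cycle_tree_def)
    then show ?thesis using C.gv_tree_relation[of "Suc (2 * i)"] by simp
  qed
  have imX: "gbs_images C.G \<Gamma> arev lab T X \<sigma>"
    unfolding \<sigma>_def
  proof (rule gbs_images_of_arcs[OF C.group_G bidirected_digraph _ FG.arcs_T L(2)])
    show "X v \<in> carrier C.G" if "v \<in> verts \<Gamma>" for v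
      using gvC[OF that] by (simp add: X_def)
    show "arcs \<Gamma> - arcs T = {\<epsilon>} \<union> arev ` {\<epsilon>}" using N by auto
    show "arev e \<notin> {\<epsilon>}" if "e \<in> {\<epsilon>}" for e
      using that arev_neq[OF \<epsilon>] by simp
    fix e
    show "X (tail \<Gamma> e) [^]\<^bsub>C.G\<^esub> lab e = X (head \<Gamma> e) [^]\<^bsub>C.G\<^esub> lab (arev e)" if "e \<in> set (P @ H)"
    proof (cases "e \<in> set H")
      case True
      have h: "head \<Gamma> e \<in> verts \<Gamma>" using True LA by auto
      have "k (tail \<Gamma> e) * lab e = k (head \<Gamma> e) * lab (arev e)"
        using \<rho>H[OF True] by (simp add: mult.commute)
      then show ?thesis
        using \<rho>H[OF True] gvC[OF h] by (simp add: X_def C.G.int_pow_pow)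
    next
      case False
      then have "e \<in> set P" using that by simp
      then obtain i where i: "i < n - 1" "e = P ! i"
        by (auto simp: in_set_conv_nth n_def)
      then show ?thesis
        using C_rel[of i] P_nth[of i] X_vs[of i] X_vs[of "Suc i"] by (simp add: lab'_P n_def)
    qed
    show "C.ge ?\<epsilon>' \<in> carrier C.G \<and> C.ge ?\<epsilon>' \<otimes>\<^bsub>C.G\<^esub> X (head \<Gamma> e) [^]\<^bsub>C.G\<^esub> lab (arev e) = X (tail \<Gamma> e) [^]\<^bsub>C.G\<^esub> lab e \<otimes>\<^bsub>C.G\<^esub> C.ge ?\<epsilon>'"
      if "e \<in> {\<epsilon>}"
    proof -
      have "X (head \<Gamma> \<epsilon>) = C.gv 0" "X (tail \<Gamma> \<epsilon>) = C.gv (n - 1)"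
        using X_vs[of 0] X_vs[of "n - 1"] n by (simp_all only: vs_0 vs_last)
      moreover have "C.ge ?\<epsilon>' \<otimes>\<^bsub>C.G\<^esub> C.gv 0 [^]\<^bsub>C.G\<^esub> lab (arev \<epsilon>) = C.gv (n - 1) [^]\<^bsub>C.G\<^esub> lab \<epsilon> \<otimes>\<^bsub>C.G\<^esub> C.ge ?\<epsilon>'"
        using C.ge_relation[OF \<epsilon>'(1)] by (simp only: \<epsilon>' lab' A_last)
      ultimately show ?thesis
        using that C.ge_carrier[OF \<epsilon>'(1)] by simp
    qed
  qed
  have imX': "gbs_images FG.G ?\<Gamma>' ?rev lab' ?T' X' \<sigma>'"
    unfolding \<sigma>'_def
  proof (rule gbs_images_of_arcs[OF FG.group_G C.bidirected_digraph _ C.arcs_T arcs_cycle_tree])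
    show "X' v \<in> carrier FG.G" if "v \<in> verts ?\<Gamma>'" for v
    proof -
      have "vs ! v \<in> set vs" using that len by simp
      then show ?thesis using vs_verts by (auto simp: X'_def)
    qed
    show "arcs ?\<Gamma>' - arcs ?T' = {?\<epsilon>'} \<union> ?rev ` {?\<epsilon>'}"
      unfolding arcs_cycle_tree_compl[OF n] using \<epsilon>'(2) by auto
    show "?rev e \<notin> {?\<epsilon>'}" if "e \<in> {?\<epsilon>'}" for e
      using that \<epsilon>'(2) by simp
    fix e
    show "X' (tail ?\<Gamma>' e) [^]\<^bsub>FG.G\<^esub> lab' e = X' (head ?\<Gamma>' e) [^]\<^bsub>FG.G\<^esub> lab' (?rev e)"
      if e: "e \<in> set (map (\<lambda>i. Suc (2 * i)) [0..<n - 1])"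
    proof -
      obtain i where i: "i < n - 1" "e = Suc (2 * i)" using e by auto
      then have i': "i < n" "Suc i mod n = Suc i" by auto
      have "P ! i \<in> arcs T" using i L(2) by (simp add: n_def)
      then show ?thesis
        using FG.gv_tree_relation[of "P ! i"] i i' P_nth[of i] by (simp add: X'_def lab'_P n_def)
    qed
    show "FG.ge \<epsilon> \<in> carrier FG.G \<and> FG.ge \<epsilon> \<otimes>\<^bsub>FG.G\<^esub> X' (head ?\<Gamma>' e) [^]\<^bsub>FG.G\<^esub> lab' (?rev e) = X' (tail ?\<Gamma>' e) [^]\<^bsub>FG.G\<^esub> lab' e \<otimes>\<^bsub>FG.G\<^esub> FG.ge \<epsilon>"
      if "e \<in> {?\<epsilon>'}"
    proof -
      have e: "e = ?\<epsilon>'" using that by simp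
      show ?thesis
        unfolding e \<epsilon>' X'_def vs_0 vs_last lab' A_last using FG.ge_relation[OF \<epsilon>] \<epsilon> by simp
    qed
  qed
  have iso: "FG.G \<cong> C.G"
  proof (rule FG.iso_gbs[OF C.gbs_presentation_axioms imX imX'])
    fix \<phi> \<psi> assume hom: "\<phi> \<in> hom FG.G C.G" "\<psi> \<in> hom C.G FG.G"
      and \<phi>: "\<And>v. v \<in> verts \<Gamma> \<Longrightarrow> \<phi> (FG.gv v) = X v" "\<And>e. e \<in> arcs \<Gamma> \<Longrightarrow> \<phi> (FG.ge e) = \<sigma> e"
      and \<psi>: "\<And>v. v \<in> verts ?\<Gamma>' \<Longrightarrow> \<psi> (C.gv v) = X' v" "\<And>e. e \<in> arcs ?\<Gamma>' \<Longrightarrow> \<psi> (C.ge e) = \<sigma>' e"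
    interpret \<phi>: group_hom FG.G C.G \<phi>
      using hom FG.group_G C.group_G by (simp add: group_hom_def group_hom_axioms_def)
    interpret \<psi>: group_hom C.G FG.G \<psi>
      using hom FG.group_G C.group_G by (simp add: group_hom_def group_hom_axioms_def)
    have 1: "\<psi> (X v) = FG.gv v" if v: "v \<in> verts \<Gamma>" for v
    proof -
      have \<rho>v: "\<rho> v \<in> set vs" by (rule \<rho>(2)) (simp only: V v)
      have "\<psi> (X v) = \<psi> (C.gv (idx (\<rho> v))) [^]\<^bsub>FG.G\<^esub> k v"
        unfolding X_def by (rule \<psi>.hom_int_pow[OF gvC[OF v]])
      also have "\<psi> (C.gv (idx (\<rho> v))) = FG.gv (\<rho> v)"
        using \<psi>(1)[of "idx (\<rho> v)"] idx_less[OF \<rho>v] vs_idx[OF \<rho>v] by (simp add: X'_def)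
      finally show ?thesis using gv_\<rho>[OF v] by simp
    qed
    have \<psi>\<epsilon>: "\<psi> (C.ge ?\<epsilon>') = FG.ge \<epsilon>" and \<phi>\<epsilon>: "\<phi> (FG.ge \<epsilon>) = C.ge ?\<epsilon>'"
      using \<psi>(2)[OF \<epsilon>'(1)] \<phi>(2)[OF \<epsilon>] by (simp_all add: \<sigma>_def \<sigma>'_def)
    have 2: "\<psi> (\<sigma> e) = FG.ge e" if e: "e \<in> arcs \<Gamma>" for e
    proof -
      have "e \<noteq> \<epsilon> \<and> arev e \<noteq> \<epsilon>" if "e \<in> arcs T"
      proof -
        have "\<epsilon> \<notin> arcs T" "arev \<epsilon> \<notin> arcs T" using N by blast+
        then show ?thesis using that arev_arev[of e] by auto
      qed
      moreover have "e \<in> arcs T \<or> e = \<epsilon> \<or> e = arev \<epsilon>" using N e by blast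
      ultimately consider "e = \<epsilon>" | "e = arev \<epsilon>" "e \<noteq> \<epsilon>" | "e \<in> arcs T" "e \<noteq> \<epsilon>" "arev e \<noteq> \<epsilon>"
        by argo
      then show ?thesis
      proof cases
        case 1
        then show ?thesis by (simp only: \<sigma>_def \<psi>\<epsilon> singleton_iff if_True simp_thms)
      next
        case 2
        then show ?thesis
          using \<psi>\<epsilon> C.ge_carrier[OF \<epsilon>'(1)] FG.ge_arev[OF \<epsilon>] \<psi>.hom_inv[of "C.ge ?\<epsilon>'"] by (simp add: \<sigma>_def)
      next
        case 3
        then show ?thesis by (simp add: \<sigma>_def FG.ge_tree)
      qed
    qed
    have 3: "\<phi> (X' i) = C.gv i" if "i \<in> verts ?\<Gamma>'" for i
    proof -
      have "vs ! i \<in> verts \<Gamma>" using that vs_verts len by (auto simp: subset_iff)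
      then show ?thesis using that \<phi>(1)[of "vs ! i"] X_vs[of i] by (simp add: X'_def)
    qed
    have 4: "\<phi> (\<sigma>' e) = C.ge e" if e: "e \<in> arcs ?\<Gamma>'" for e
    proof -
      consider "e = ?\<epsilon>'" | "e = Suc ?\<epsilon>'" | "e \<in> arcs ?T'"
        using e arcs_cycle_tree_compl[OF n] by blast
      then show ?thesis
      proof cases
        case 1
        then show ?thesis by (simp add: \<sigma>'_def \<phi>\<epsilon>)
      next
        case 2
        have "\<sigma>' e = inv\<^bsub>FG.G\<^esub> FG.ge \<epsilon>" unfolding 2 \<sigma>'_def \<epsilon>'(3) by simp
        moreover have "C.ge e = inv\<^bsub>C.G\<^esub> C.ge ?\<epsilon>'"
          using C.ge_arev[OF \<epsilon>'(1)] unfolding 2 \<epsilon>'(2) .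
        ultimately show ?thesis using \<phi>.hom_inv[of "FG.ge \<epsilon>"] \<phi>\<epsilon> \<epsilon> by simp
      next
        case 3
        then have "e < ?\<epsilon>'" by (simp add: cycle_tree_def)
        moreover have "?rev e \<noteq> ?\<epsilon>'"
        proof -
          define i where "i = e div 2"
          have "i < n" using e by (simp add: i_def)
          moreover have "e = 2 * i \<or> e = Suc (2 * i)"
            unfolding i_def by presburger
          ultimately have "?rev e = Suc (2 * i) \<or> ?rev e = 2 * i \<and> e = Suc (2 * i)" by auto
          moreover have "Suc (2 * i) \<noteq> 2 * m" for m by presburger
          ultimately show ?thesis using \<open>e < ?\<epsilon>'\<close> by (elim disjE) simp_all
        qed
        ultimately show ?thesis using C.ge_tree[OF 3] by (simp add: \<sigma>'_def)
      qed
    qed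
    show "(\<forall>v\<in>verts \<Gamma>. \<psi> (X v) = FG.gv v) \<and> (\<forall>e\<in>arcs \<Gamma>. \<psi> (\<sigma> e) = FG.ge e) \<and>
        (\<forall>v\<in>verts ?\<Gamma>'. \<phi> (X' v) = C.gv v) \<and> (\<forall>e\<in>arcs ?\<Gamma>'. \<phi> (\<sigma>' e) = C.ge e)"
      by (intro conjI ballI; (rule 1 | rule 2 | rule 3 | rule 4); assumption)
  qed
  show thesis by (rule that[OF n lab'_nz iso])
qed

section \<open>Trees\<close>

lemma gbs_images_tree:
  assumes H: "group H" and \<Gamma>: "bidirected_digraph \<Gamma> arev"
    and X: "\<And>v. v \<in> verts \<Gamma> \<Longrightarrow> X v \<in> carrier H"
    and T: "arcs T = arcs \<Gamma>" "arcs T = set L \<union> arev ` set L"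
    and rel: "\<And>e. e \<in> set L \<Longrightarrow> X (tail \<Gamma> e) [^]\<^bsub>H\<^esub> lab e = X (head \<Gamma> e) [^]\<^bsub>H\<^esub> lab (arev e)"
  shows "gbs_images H \<Gamma> arev lab T X (\<lambda>_. \<one>\<^bsub>H\<^esub>)"
  using gbs_images_of_arcs[OF H \<Gamma> X _ T(2) rel, of "{}"] T(1) by simp

lemma (in gbs_presentation) cyclic_group_if_powers:
  assumes x: "x \<in> carrier G" and v: "\<And>v. v \<in> verts \<Gamma> \<Longrightarrow> \<exists>k :: int. gv v = x [^]\<^bsub>G\<^esub> k" and T: "arcs T = arcs \<Gamma>"
  shows "cyclic_group G"
proof -
  let ?C = "range (\<lambda>k :: int. x [^]\<^bsub>G\<^esub> k)"
  have "?C = carrier G"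
  proof (rule G_generated)
    show "subgroup ?C G"
    proof (rule subgroup.intro)
      show "?C \<subseteq> carrier G" using x by auto
      show "\<one>\<^bsub>G\<^esub> \<in> ?C" using int_pow_0 by (metis rangeI)
      show "a \<otimes>\<^bsub>G\<^esub> c \<in> ?C" if "a \<in> ?C" "c \<in> ?C" for a c
        using that x by (auto simp flip: G.int_pow_mult)
      show "inv\<^bsub>G\<^esub> a \<in> ?C" if "a \<in> ?C" for a
        using that x by (auto simp flip: G.int_pow_neg)
    qed
    show "gv w \<in> ?C" if "w \<in> verts \<Gamma>" for w
      using v[OF that] by auto
    show "ge e \<in> ?C" if "e \<in> arcs \<Gamma>" for e
      using ge_tree[of e] that T int_pow_0[of G x] by (metis rangeI)
  qed
  then show ?thesis
    using x by (auto simp: G.cyclic_group)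
qed

lemma (in gbs_presentation) cyclic_group_if_units:
  assumes K: "grows \<Gamma> {z} K" "arcs T = set K \<union> arev ` set K" "insert z (tail \<Gamma> ` set K) = verts \<Gamma>"
    and T: "arcs T = arcs \<Gamma>" and unit: "\<And>e. e \<in> set K \<Longrightarrow> \<bar>lab e\<bar> = 1"
  shows "cyclic_group G"
proof (rule cyclic_group_if_powers)
  have z: "z \<in> verts \<Gamma>" using K(3) by blast
  then show "gv z \<in> carrier G" by simp
  show "\<exists>k :: int. gv v = gv z [^]\<^bsub>G\<^esub> k" if "v \<in> verts \<Gamma>" for v
  proof (rule grows_induct[OF K(1), where Pr = "\<lambda>v. \<exists>k :: int. gv v = gv z [^]\<^bsub>G\<^esub> k"])
    show "\<exists>k :: int. gv v = gv z [^]\<^bsub>G\<^esub> k" if "v \<in> {z}" for v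
      using that z by (intro exI[of _ 1]) simp
    fix e assume e: "e \<in> set K" and "\<exists>k :: int. gv (head \<Gamma> e) = gv z [^]\<^bsub>G\<^esub> k"
    then obtain k :: int where k: "gv (head \<Gamma> e) = gv z [^]\<^bsub>G\<^esub> k" by blast
    have "lab e * lab e = 1"
      using unit[OF e] by (metis abs_mult_self_eq mult_1)
    then have "lab e * (lab e * (lab (arev e) * k)) = lab (arev e) * k"
      by (simp flip: mult.assoc)
    moreover have "e \<in> arcs T" using e K(2) by blast
    ultimately have "gv (tail \<Gamma> e) = gv z [^]\<^bsub>G\<^esub> (lab e * (lab (arev e) * k))"
      using unit[OF e] z k by (intro gv_unit_power)
    then show "\<exists>k :: int. gv (tail \<Gamma> e) = gv z [^]\<^bsub>G\<^esub> k" by blast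
  qed (use that K(3) in simp)
qed (rule T)

text \<open>If all but one of the labels \<open>lab e\<close>, \<open>e \<in> set K\<close>, are units, then the vertex generators
  are powers of that of the root \<open>z\<close> or of that of \<open>y = tail \<Gamma> e0\<close>, so that the group is
  \<open>\<langle>y, z | y\<^bsup>lab e0\<^esup> = z\<^sup>m\<rangle>\<close>.\<close>

locale two_generator_tree = gbs_presentation \<Gamma> arev lab T
  for \<Gamma> :: "('v, 'e) pre_digraph" and arev :: "'e \<Rightarrow> 'e" and lab :: "'e \<Rightarrow> int" and T +
  fixes z :: 'v and e0 :: 'e and K :: "'e list" and b :: "'v \<Rightarrow> bool" and \<kappa> :: "'v \<Rightarrow> int" and m :: int
  assumes lab_nz: "\<And>e. e \<in> arcs \<Gamma> \<Longrightarrow> lab e \<noteq> 0" and T: "arcs T = arcs \<Gamma>"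
    and K: "grows \<Gamma> {z} K" "arcs T = set K \<union> arev ` set K" "insert z (tail \<Gamma> ` set K) = verts \<Gamma>"
    and e0: "e0 \<in> set K" and unit: "\<And>e. e \<in> set K \<Longrightarrow> e \<noteq> e0 \<Longrightarrow> \<bar>lab e\<bar> = 1"
    and bz: "\<not> b z" "\<kappa> z = 1" and by': "b (tail \<Gamma> e0)" "\<kappa> (tail \<Gamma> e0) = 1" and bh: "\<not> b (head \<Gamma> e0)"
    and step: "\<And>e. e \<in> set K \<Longrightarrow> e \<noteq> e0 \<Longrightarrow>
       (b (tail \<Gamma> e) \<longleftrightarrow> b (head \<Gamma> e)) \<and> lab e * \<kappa> (tail \<Gamma> e) = lab (arev e) * \<kappa> (head \<Gamma> e)"
  defines "m \<equiv> \<kappa> (head \<Gamma> e0) * lab (arev e0)"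
begin

abbreviation "y \<equiv> tail \<Gamma> e0"

lemma K_arcs: "e \<in> set K \<Longrightarrow> e \<in> arcs \<Gamma>"
  using K(2) T by blast

lemma zy [simp]: "z \<in> verts \<Gamma>" "y \<in> verts \<Gamma>"
  using K(3) K_arcs[OF e0] by auto

text \<open>\<open>b\<close> tells which of the two generators a vertex follows and
  \<open>\<kappa>\<close> with which exponent, so that the equation of \<open>e0\<close> is the only
  one that remains.\<close>

lemma images:
  assumes H: "group H" and h: "hy \<in> carrier H" "hz \<in> carrier H" and eq: "hy [^]\<^bsub>H\<^esub> lab e0 = hz [^]\<^bsub>H\<^esub> m"
  shows "gbs_images H \<Gamma> arev lab T (\<lambda>v. (if b v then hy else hz) [^]\<^bsub>H\<^esub> \<kappa> v) (\<lambda>_. \<one>\<^bsub>H\<^esub>)"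
proof (rule gbs_images_tree[OF H bidirected_digraph _ T K(2)])
  interpret H: group H by fact
  show "(if b v then hy else hz) [^]\<^bsub>H\<^esub> \<kappa> v \<in> carrier H" for v
    using h by simp
  fix e assume e: "e \<in> set K"
  show "((if b (tail \<Gamma> e) then hy else hz) [^]\<^bsub>H\<^esub> \<kappa> (tail \<Gamma> e)) [^]\<^bsub>H\<^esub> lab e =
      ((if b (head \<Gamma> e) then hy else hz) [^]\<^bsub>H\<^esub> \<kappa> (head \<Gamma> e)) [^]\<^bsub>H\<^esub> lab (arev e)"
  proof (cases "e = e0")
    case True
    then show ?thesis using by' bh eq h by (simp add: H.int_pow_pow m_def)
  next
    case False
    have "\<kappa> (tail \<Gamma> e) * lab e = \<kappa> (head \<Gamma> e) * lab (arev e)"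
      using step[OF e False] by (simp add: mult.commute)
    then show ?thesis using step[OF e False] h by (simp add: H.int_pow_pow)
  qed
qed

lemma gv_eq: "v \<in> verts \<Gamma> \<Longrightarrow> gv v = (if b v then gv y else gv z) [^]\<^bsub>G\<^esub> \<kappa> v"
proof (rule grows_induct[OF K(1), where Pr = "\<lambda>v. gv v = (if b v then gv y else gv z) [^]\<^bsub>G\<^esub> \<kappa> v"])
  show "gv v = (if b v then gv y else gv z) [^]\<^bsub>G\<^esub> \<kappa> v" if "v \<in> {z}" for v
    using that bz by simp
  fix e assume e: "e \<in> set K" and IH: "gv (head \<Gamma> e) = (if b (head \<Gamma> e) then gv y else gv z) [^]\<^bsub>G\<^esub> \<kappa> (head \<Gamma> e)"
  show "gv (tail \<Gamma> e) = (if b (tail \<Gamma> e) then gv y else gv z) [^]\<^bsub>G\<^esub> \<kappa> (tail \<Gamma> e)"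
  proof (cases "e = e0")
    case True
    then show ?thesis using by' by simp
  next
    case False
    have "e \<in> arcs T" using e K(2) by blast
    then show ?thesis
      using gv_unit_power[of e y "\<kappa> (tail \<Gamma> e)" "\<kappa> (head \<Gamma> e)"] gv_unit_power[of e z "\<kappa> (tail \<Gamma> e)" "\<kappa> (head \<Gamma> e)"]
        unit[OF e False] step[OF e False] IH by simp
  qed
qed (use K(3) in simp)

lemma yz_relation: "gv y [^]\<^bsub>G\<^esub> lab e0 = gv z [^]\<^bsub>G\<^esub> m"
proof -
  have "e0 \<in> arcs T" using e0 K(2) by blast
  moreover have "gv (head \<Gamma> e0) = gv z [^]\<^bsub>G\<^esub> \<kappa> (head \<Gamma> e0)"
    using gv_eq[of "head \<Gamma> e0"] bh K_arcs[OF e0] by simp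
  ultimately show ?thesis
    by (simp add: gv_tree_relation G.int_pow_pow m_def)
qed

lemma m_nz: "m \<noteq> 0"
proof -
  have "\<kappa> v \<noteq> 0" if "v \<in> verts \<Gamma>" for v
  proof (rule grows_induct[OF K(1), where Pr = "\<lambda>v. \<kappa> v \<noteq> 0"])
    show "\<kappa> v \<noteq> 0" if "v \<in> {z}" for v using that bz by simp
    fix e assume e: "e \<in> set K" "\<kappa> (head \<Gamma> e) \<noteq> 0"
    show "\<kappa> (tail \<Gamma> e) \<noteq> 0"
    proof (cases "e = e0")
      case True
      then show ?thesis using by' by simp
    next
      case False
      have "lab (arev e) * \<kappa> (head \<Gamma> e) \<noteq> 0"
        using lab_nz[of "arev e"] K_arcs[OF e(1)] e(2) by simp
      then show ?thesis using step[OF e(1) False] by auto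
    qed
  qed (use that K(3) in simp)
  moreover have "head \<Gamma> e0 \<in> verts \<Gamma>" "lab (arev e0) \<noteq> 0"
    using K_arcs[OF e0] lab_nz by simp_all
  ultimately show ?thesis by (simp add: m_def)
qed

text \<open>When \<open>m\<close> is a unit, the relation makes the generator at \<open>z\<close> a
  power of that at \<open>y\<close>.\<close>

lemma cyclic_group_if_unit:
  assumes "\<bar>m\<bar> = 1"
  shows "cyclic_group G"
proof (rule cyclic_group_if_powers[OF gv_carrier[OF zy(2)] _ T])
  fix v assume v: "v \<in> verts \<Gamma>"
  have mm: "m * m = 1"
    using assms by (metis abs_mult_self_eq mult_1)
  have "gv z = (gv y [^]\<^bsub>G\<^esub> lab e0) [^]\<^bsub>G\<^esub> m"
    by (simp add: yz_relation G.int_pow_pow mm)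
  then have z: "gv z = gv y [^]\<^bsub>G\<^esub> (lab e0 * m)"
    by (simp add: G.int_pow_pow)
  show "\<exists>k :: int. gv v = gv y [^]\<^bsub>G\<^esub> k"
  proof (cases "b v")
    case True
    then show ?thesis using gv_eq[OF v] by auto
  next
    case False
    then have "gv v = gv y [^]\<^bsub>G\<^esub> (lab e0 * m * \<kappa> v)"
      using gv_eq[OF v] by (simp add: z G.int_pow_pow)
    then show ?thesis by blast
  qed
qed

text \<open>Killing the powers \<open>lab e0\<close> of \<open>y\<close> and \<open>m\<close> of
  \<open>z\<close> leaves a free product of two cyclic groups, which is large unless both have order
  2. The cases differ by exchanging the factors, as the second one must have order at least
  3.\<close>

lemma large_if_not_2:
  assumes "\<bar>lab e0\<bar> > 1" "\<bar>m\<bar> > 1" "\<not> (\<bar>lab e0\<bar> = 2 \<and> \<bar>m\<bar> = 2)"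
  shows "large G"
proof -
  define Q where "Q = nat \<bar>lab e0\<bar>"
  define M where "M = nat \<bar>m\<bar>"
  have QM: "Q > 1" "M > 1" "int Q = \<bar>lab e0\<bar>" "int M = \<bar>m\<bar>" "M \<ge> 3 \<or> Q \<ge> 3"
    using assms by (auto simp: Q_def M_def)
  from QM(5) show ?thesis
  proof
    assume "M \<ge> 3"
    moreover have "Q > 0" "\<not> int Q dvd 1" using QM by simp_all
    ultimately show ?thesis
    proof (rule_tac large_of_cyclic_images[OF gbs_presentation_axioms, where q = Q and r = M and lab = lab and a = 1], goal_cases)
      case (4 W \<alpha> \<beta>)
      interpret W: group W by (rule 4(4))
      have "\<alpha> [^]\<^bsub>W\<^esub> lab e0 = \<beta> [^]\<^bsub>W\<^esub> m"
        using W.int_pow_cong[OF 4(5,7), of "lab e0" 0] W.int_pow_cong[OF 4(6,8), of m 0] QM by simp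
      from images[OF 4(4,5,6) this] show ?case
      proof (rule 4(9))
        fix K' assume K': "\<And>v. v \<in> verts \<Gamma> \<Longrightarrow> (if b v then \<alpha> else \<beta>) [^]\<^bsub>W\<^esub> \<kappa> v \<in> K'"
        show "\<alpha> [^]\<^bsub>W\<^esub> (1 :: int) \<in> K' \<and> \<beta> \<in> K'"
          using K'[of y] K'[of z] by' bz 4(5,6) by simp
      qed
    qed
  next
    assume "Q \<ge> 3"
    moreover have "M > 0" "\<not> int M dvd 1" using QM by simp_all
    ultimately show ?thesis
    proof (rule_tac large_of_cyclic_images[OF gbs_presentation_axioms, where q = M and r = Q and lab = lab and a = 1], goal_cases)
      case (4 W \<alpha> \<beta>)
      interpret W: group W by (rule 4(4))
      have "\<beta> [^]\<^bsub>W\<^esub> lab e0 = \<alpha> [^]\<^bsub>W\<^esub> m"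
        using W.int_pow_cong[OF 4(5,7), of m 0] W.int_pow_cong[OF 4(6,8), of "lab e0" 0] QM by simp
      from images[OF 4(4,6,5) this] show ?case
      proof (rule 4(9))
        fix K' assume K': "\<And>v. v \<in> verts \<Gamma> \<Longrightarrow> (if b v then \<beta> else \<alpha>) [^]\<^bsub>W\<^esub> \<kappa> v \<in> K'"
        show "\<alpha> [^]\<^bsub>W\<^esub> (1 :: int) \<in> K' \<and> \<beta> \<in> K'"
          using K'[of y] K'[of z] by' bz 4(5,6) by simp
      qed
    qed
  qed
qed

text \<open>The group of the Klein bottle, \<open>\<langle>y, z | y\<^sup>2 = z\<^sup>2\<rangle> = \<langle>c, \<tau> | \<tau> c\<^sup>-\<^sup>1 = c \<tau>\<rangle>\<close>, where \<open>y = c \<tau>\<close> and \<open>z = \<tau>\<close>.\<close>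

lemma klein_bottle:
  assumes "\<bar>lab e0\<bar> = 2" "\<bar>m\<bar> = 2" and n: "n = 1" and lab': "lab' 0 = 1" "lab' (Suc 0) = - 1"
  shows "G \<cong> gbs (cycle_graph n) (cycle_rev n) lab' (cycle_tree n)"
proof -
  \<comment> \<open>With \<open>y\<close> replaced by its power \<open>s\<close>, the relation says
    that two squares are equal, whatever the signs of \<open>lab e0\<close> and
    \<open>m\<close>.\<close>
  define s where "s = sgn (lab e0) * sgn m"
  have s: "s * s = 1" "s * lab e0 = m" "lab e0 * sgn m = 2 * s" "m * sgn m = 2" "m = 2 * sgn m"
    using assms by (auto simp: s_def sgn_if)
  have C0: "labelled_graph (cycle_graph n) (cycle_rev n) lab'"
  proof (rule labelled_cycle_graph)
    show "lab' e \<noteq> 0" if "e < 2 * n" for e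
      using that lab' n by (cases e rule: cycle_arc_cases[of _ n]) simp_all
  qed (simp add: n)
  interpret C: gbs_presentation "cycle_graph n" "cycle_rev n" lab' "cycle_tree n"
    by (rule gbs_presentation_of_maximal_tree[OF C0 maximal_tree_cycle_graph]) (simp add: n)
  define c where "c = C.gv 0"
  define \<tau> where "\<tau> = C.ge 0"
  have arc: "e = 0 \<or> e = Suc 0" if "e \<in> arcs (cycle_graph n)" for e
    using that by (auto simp: n)
  have arc0: "0 \<in> arcs (cycle_graph n)" "0 \<in> verts (cycle_graph n)"
    by (simp_all add: n)
  have c: "c \<in> carrier C.G" "\<tau> \<in> carrier C.G"
    using C.gv_carrier[OF arc0(2)] C.ge_carrier[OF arc0(1)] by (simp_all only: c_def \<tau>_def)
  have ends: "tail (cycle_graph n) 0 = 0" "head (cycle_graph n) 0 = 0" "cycle_rev n 0 = Suc 0" "cycle_rev n (Suc 0) = 0"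
    "tail (cycle_graph n) (Suc 0) = 0" "head (cycle_graph n) (Suc 0) = 0"
    by (simp_all add: cycle_graph_def cycle_rev_def n)
  have rel: "\<tau> \<otimes>\<^bsub>C.G\<^esub> inv\<^bsub>C.G\<^esub> c = c \<otimes>\<^bsub>C.G\<^esub> \<tau>"
    using C.ge_relation[OF arc0(1)] c unfolding ends by (simp add: c_def \<tau>_def lab' C.G.int_pow_neg)
  let ?w = "c \<otimes>\<^bsub>C.G\<^esub> \<tau>"
  \<comment> \<open>One factor is rewritten by the relation of the loop, after which
    \<open>c\<close> cancels in the middle.\<close>
  have "?w \<otimes>\<^bsub>C.G\<^esub> ?w = (\<tau> \<otimes>\<^bsub>C.G\<^esub> inv\<^bsub>C.G\<^esub> c) \<otimes>\<^bsub>C.G\<^esub> (c \<otimes>\<^bsub>C.G\<^esub> \<tau>)"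
    by (simp only: rel)
  also have "\<dots> = \<tau> \<otimes>\<^bsub>C.G\<^esub> (inv\<^bsub>C.G\<^esub> c \<otimes>\<^bsub>C.G\<^esub> (c \<otimes>\<^bsub>C.G\<^esub> \<tau>))"
    using c by (simp only: C.G.m_assoc C.G.m_closed C.G.inv_closed)
  also have "inv\<^bsub>C.G\<^esub> c \<otimes>\<^bsub>C.G\<^esub> (c \<otimes>\<^bsub>C.G\<^esub> \<tau>) = \<tau>"
    using c by (simp flip: C.G.m_assoc)
  finally have sq: "?w \<otimes>\<^bsub>C.G\<^esub> ?w = \<tau> \<otimes>\<^bsub>C.G\<^esub> \<tau>" .
  have two: "x [^]\<^bsub>C.G\<^esub> (2 :: int) = x \<otimes>\<^bsub>C.G\<^esub> x" if "x \<in> carrier C.G" for x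
    using C.G.int_pow_mult[OF that, of 1 1] that by simp
  have two': "x [^]\<^bsub>G\<^esub> (2 :: int) = x \<otimes>\<^bsub>G\<^esub> x" if "x \<in> carrier G" for x
    using G.int_pow_mult[OF that, of 1 1] that by simp
  have pow_m: "?w [^]\<^bsub>C.G\<^esub> m = \<tau> [^]\<^bsub>C.G\<^esub> m"
  proof -
    have "?w [^]\<^bsub>C.G\<^esub> (2 * sgn m) = (?w [^]\<^bsub>C.G\<^esub> (2 :: int)) [^]\<^bsub>C.G\<^esub> sgn m"
      using c by (simp only: C.G.int_pow_pow C.G.m_closed)
    also have "\<dots> = (\<tau> [^]\<^bsub>C.G\<^esub> (2 :: int)) [^]\<^bsub>C.G\<^esub> sgn m"
      using c by (simp only: two sq C.G.m_closed)
    also have "\<dots> = \<tau> [^]\<^bsub>C.G\<^esub> (2 * sgn m)"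
      using c by (simp only: C.G.int_pow_pow)
    finally show ?thesis using s(5) by simp
  qed
  have im: "gbs_images C.G \<Gamma> arev lab T (\<lambda>v. (if b v then ?w [^]\<^bsub>C.G\<^esub> s else \<tau>) [^]\<^bsub>C.G\<^esub> \<kappa> v) (\<lambda>_. \<one>\<^bsub>C.G\<^esub>)"
    by (rule images[OF C.group_G]) (use c in \<open>simp_all add: C.G.int_pow_pow s(2) pow_m\<close>)
  let ?y = "gv y" and ?z = "gv z"
  \<comment> \<open>The solution for \<open>c\<close> when the power \<open>s\<close> of
    \<open>?y\<close> is \<open>c \<tau>\<close> and \<open>?z\<close> is
    \<open>\<tau>\<close>.\<close>
  let ?c = "?y [^]\<^bsub>G\<^esub> s \<otimes>\<^bsub>G\<^esub> inv\<^bsub>G\<^esub> ?z"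
  have yz: "?y \<in> carrier G" "?z \<in> carrier G" "?c \<in> carrier G" by simp_all
  have "?z [^]\<^bsub>G\<^esub> (2 :: int) = (?z [^]\<^bsub>G\<^esub> m) [^]\<^bsub>G\<^esub> sgn m"
    using yz by (simp add: G.int_pow_pow s(4))
  also have "\<dots> = ?y [^]\<^bsub>G\<^esub> (lab e0 * sgn m)"
    using yz by (simp add: yz_relation[symmetric] G.int_pow_pow)
  also have "\<dots> = ?y [^]\<^bsub>G\<^esub> s \<otimes>\<^bsub>G\<^esub> ?y [^]\<^bsub>G\<^esub> s"
    using yz by (simp add: s(3) flip: G.int_pow_mult)
  finally have zz: "?z \<otimes>\<^bsub>G\<^esub> ?z = ?y [^]\<^bsub>G\<^esub> s \<otimes>\<^bsub>G\<^esub> ?y [^]\<^bsub>G\<^esub> s"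
    using two'[OF yz(2)] by simp
  have cz: "?c \<otimes>\<^bsub>G\<^esub> ?z = ?y [^]\<^bsub>G\<^esub> s"
    using yz by (simp add: G.m_assoc)
  have zc: "?z \<otimes>\<^bsub>G\<^esub> inv\<^bsub>G\<^esub> ?c = ?y [^]\<^bsub>G\<^esub> s"
  proof -
    have "?z \<otimes>\<^bsub>G\<^esub> inv\<^bsub>G\<^esub> ?c = (?z \<otimes>\<^bsub>G\<^esub> ?z) \<otimes>\<^bsub>G\<^esub> inv\<^bsub>G\<^esub> (?y [^]\<^bsub>G\<^esub> s)"
      using yz by (simp add: G.inv_mult_group G.m_assoc)
    also have "\<dots> = ?y [^]\<^bsub>G\<^esub> s"
      unfolding zz using yz by (simp add: G.m_assoc)
    finally show ?thesis .
  qed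
  define d where "d = ?c"
  have d: "d \<in> carrier G" "d \<otimes>\<^bsub>G\<^esub> ?z = ?z \<otimes>\<^bsub>G\<^esub> inv\<^bsub>G\<^esub> d"
    unfolding d_def cz zc using yz by simp_all
  have "inv\<^bsub>G\<^esub> ?z \<otimes>\<^bsub>G\<^esub> d = inv\<^bsub>G\<^esub> ?z \<otimes>\<^bsub>G\<^esub> (d \<otimes>\<^bsub>G\<^esub> ?z) \<otimes>\<^bsub>G\<^esub> inv\<^bsub>G\<^esub> ?z"
    using d(1) yz by (simp add: G.m_assoc)
  also have "\<dots> = inv\<^bsub>G\<^esub> d \<otimes>\<^bsub>G\<^esub> inv\<^bsub>G\<^esub> ?z"
    unfolding d(2) using d(1) yz by (simp flip: G.m_assoc)
  finally have d': "inv\<^bsub>G\<^esub> ?z \<otimes>\<^bsub>G\<^esub> d = inv\<^bsub>G\<^esub> d \<otimes>\<^bsub>G\<^esub> inv\<^bsub>G\<^esub> ?z" .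
  have d_pow: "d [^]\<^bsub>G\<^esub> (- 1 :: int) = inv\<^bsub>G\<^esub> d" "d [^]\<^bsub>G\<^esub> (1 :: int) = d"
    using d(1) by (simp_all add: G.int_pow_neg)
  define X' where "X' i = d" for i :: nat
  define \<sigma>' where "\<sigma>' e = (if e = 0 then ?z else inv\<^bsub>G\<^esub> ?z)" for e :: nat
  have im': "gbs_images G (cycle_graph n) (cycle_rev n) lab' (cycle_tree n) X' \<sigma>'"
    unfolding gbs_images_def
  proof (intro conjI ballI)
    show "X' v \<in> carrier G" for v using d by (simp add: X'_def)
    show "\<sigma>' e = \<one>\<^bsub>G\<^esub>" if "e \<in> arcs (cycle_tree n)" for e
      using that by (simp add: cycle_tree_def n)
    show "\<sigma>' e \<in> carrier G" for e by (simp add: \<sigma>'_def)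
    fix e assume "e \<in> arcs (cycle_graph n)"
    then have e: "e = 0 \<or> e = Suc 0" by (rule arc)
    show "\<sigma>' e \<otimes>\<^bsub>G\<^esub> \<sigma>' (cycle_rev n e) = \<one>\<^bsub>G\<^esub>"
      using e by (elim disjE) (simp_all add: ends \<sigma>'_def)
    show "\<sigma>' e \<otimes>\<^bsub>G\<^esub> X' (head (cycle_graph n) e) [^]\<^bsub>G\<^esub> lab' (cycle_rev n e) = X' (tail (cycle_graph n) e) [^]\<^bsub>G\<^esub> lab' e \<otimes>\<^bsub>G\<^esub> \<sigma>' e"
      using e by (elim disjE) (simp_all add: ends \<sigma>'_def X'_def lab' d_pow d' d(2))
  qed
  show ?thesis
  proof (rule iso_gbs[OF C.gbs_presentation_axioms im im'])
    fix \<phi> \<psi> assume hom: "\<phi> \<in> hom G C.G" "\<psi> \<in> hom C.G G"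
      and \<phi>: "\<And>v. v \<in> verts \<Gamma> \<Longrightarrow> \<phi> (gv v) = (if b v then ?w [^]\<^bsub>C.G\<^esub> s else \<tau>) [^]\<^bsub>C.G\<^esub> \<kappa> v"
      and \<psi>: "\<And>v. v \<in> verts (cycle_graph n) \<Longrightarrow> \<psi> (C.gv v) = X' v" "\<And>e. e \<in> arcs (cycle_graph n) \<Longrightarrow> \<psi> (C.ge e) = \<sigma>' e"
    interpret \<phi>: group_hom G C.G \<phi>
      using hom group_G C.group_G by (simp add: group_hom_def group_hom_axioms_def)
    interpret \<psi>: group_hom C.G G \<psi>
      using hom group_G C.group_G by (simp add: group_hom_def group_hom_axioms_def)
    have \<psi>': "\<psi> c = d" "\<psi> \<tau> = ?z"
      using \<psi>(1)[OF arc0(2)] \<psi>(2)[OF arc0(1)] by (simp_all add: c_def \<tau>_def X'_def \<sigma>'_def)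
    have \<psi>w: "\<psi> (?w [^]\<^bsub>C.G\<^esub> s) = ?y"
      using c yz cz by (simp add: \<psi>.hom_int_pow \<psi>' flip: d_def) (simp add: G.int_pow_pow s(1))
    have \<phi>': "\<phi> ?y = ?w [^]\<^bsub>C.G\<^esub> s" "\<phi> ?z = \<tau>"
      using \<phi>[of y] \<phi>[of z] by' bz c by simp_all
    have \<phi>c: "\<phi> d = c"
    proof -
      have "\<phi> d = ?w \<otimes>\<^bsub>C.G\<^esub> inv\<^bsub>C.G\<^esub> \<tau>"
        using yz c by (simp add: d_def \<phi>.hom_int_pow \<phi>' C.G.int_pow_pow s(1))
      then show ?thesis using c by (simp add: C.G.m_assoc)
    qed
    have 1: "\<psi> ((if b v then ?w [^]\<^bsub>C.G\<^esub> s else \<tau>) [^]\<^bsub>C.G\<^esub> \<kappa> v) = gv v" if "v \<in> verts \<Gamma>" for v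
      unfolding gv_eq[OF that] using c by (simp add: \<psi>.hom_int_pow \<psi>w \<psi>')
    have 2: "\<psi> \<one>\<^bsub>C.G\<^esub> = ge e" if "e \<in> arcs \<Gamma>" for e
      using that T by (simp add: ge_tree)
    have 3: "\<phi> (X' v) = C.gv v" if "v \<in> verts (cycle_graph n)" for v
    proof -
      have "v = 0" using that n by simp
      then show ?thesis using \<phi>c by (simp add: X'_def c_def)
    qed
    have 4: "\<phi> (\<sigma>' e) = C.ge e" if "e \<in> arcs (cycle_graph n)" for e
      using arc[OF that]
    proof
      assume e: "e = Suc 0"
      have "C.ge (Suc 0) = inv\<^bsub>C.G\<^esub> \<tau>"
        using C.ge_arev[OF arc0(1)] unfolding ends by (simp add: \<tau>_def)
      then show ?thesis unfolding e using yz \<phi>' by (simp add: \<sigma>'_def)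
    qed (simp add: \<sigma>'_def \<phi>' \<tau>_def)
    show "(\<forall>v\<in>verts \<Gamma>. \<psi> ((if b v then ?w [^]\<^bsub>C.G\<^esub> s else \<tau>) [^]\<^bsub>C.G\<^esub> \<kappa> v) = gv v) \<and>
        (\<forall>e\<in>arcs \<Gamma>. \<psi> \<one>\<^bsub>C.G\<^esub> = ge e) \<and>
        (\<forall>v\<in>verts (cycle_graph n). \<phi> (X' v) = C.gv v) \<and> (\<forall>e\<in>arcs (cycle_graph n). \<phi> (\<sigma>' e) = C.ge e)"
      by (intro conjI ballI; (rule 1 | rule 2 | rule 3 | rule 4); assumption)
  qed
qed

end

text \<open>Two retractions along unit labels: the arcs before \<open>e0\<close> fold onto
  \<open>z\<close>, and those after it fold onto what was there already or onto
  \<open>tail \<Gamma> e0\<close>. \<open>b\<close> holds where the second retraction ends at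
  \<open>tail \<Gamma> e0\<close>.\<close>

lemma grows_two_units:
  fixes lab :: "'e \<Rightarrow> int"
  assumes L: "grows \<Gamma> {z} (K1 @ e0 # K2)" and unit: "\<And>e. e \<in> set K1 \<union> set K2 \<Longrightarrow> \<bar>lab e\<bar> = 1"
  obtains b :: "'v \<Rightarrow> bool" and \<kappa> :: "'v \<Rightarrow> int" where "\<not> b z" "\<kappa> z = 1" "b (tail \<Gamma> e0)" "\<kappa> (tail \<Gamma> e0) = 1"
    "\<not> b (head \<Gamma> e0)"
    "\<And>e. e \<in> set K1 \<union> set K2 \<Longrightarrow> (b (tail \<Gamma> e) \<longleftrightarrow> b (head \<Gamma> e)) \<and> lab e * \<kappa> (tail \<Gamma> e) = lab (arev e) * \<kappa> (head \<Gamma> e)"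
proof -
  let ?S = "{z} \<union> tail \<Gamma> ` set K1" and ?y = "tail \<Gamma> e0"
  have K1: "grows \<Gamma> {z} K1" and e0: "head \<Gamma> e0 \<in> ?S" "?y \<notin> ?S" and K2: "grows \<Gamma> (insert ?y ?S) K2"
    using L by (simp_all add: grows_append)
  have u1: "\<bar>lab e\<bar> = 1" if "e \<in> set K1" for e using unit that by simp
  have u2: "\<bar>lab e\<bar> = 1" if "e \<in> set K2" for e using unit that by simp
  obtain \<rho>1 k1 where k1: "\<And>v. v \<in> {z} \<Longrightarrow> \<rho>1 v = v \<and> k1 v = 1" "\<And>v. v \<in> {z} \<union> tail \<Gamma> ` set K1 \<Longrightarrow> \<rho>1 v \<in> {z}"
    "\<And>e. e \<in> set K1 \<Longrightarrow> \<rho>1 (tail \<Gamma> e) = \<rho>1 (head \<Gamma> e) \<and> lab e * k1 (tail \<Gamma> e) = lab (arev e) * k1 (head \<Gamma> e)"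
    by (rule grows_unit[OF K1 u1, where arev = arev]) (assumption, rule that)
  obtain \<rho> k2 where k2: "\<And>v. v \<in> insert ?y ?S \<Longrightarrow> \<rho> v = v \<and> k2 v = 1" "\<And>v. v \<in> insert ?y ?S \<union> tail \<Gamma> ` set K2 \<Longrightarrow> \<rho> v \<in> insert ?y ?S"
    "\<And>e. e \<in> set K2 \<Longrightarrow> \<rho> (tail \<Gamma> e) = \<rho> (head \<Gamma> e) \<and> lab e * k2 (tail \<Gamma> e) = lab (arev e) * k2 (head \<Gamma> e)"
    by (rule grows_unit[OF K2 u2, where arev = arev]) (assumption, rule that)
  define b where "b v \<longleftrightarrow> \<rho> v = ?y" for v
  \<comment> \<open>Exponents of successive retractions multiply; at \<open>tail \<Gamma> e0\<close>
    the first one has nothing to add.\<close>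
  define \<kappa> where "\<kappa> v = (if b v then 1 else k1 (\<rho> v)) * k2 v" for v
  have S: "\<not> b v \<and> \<kappa> v = k1 v" if "v \<in> ?S" for v
    using k2(1)[of v] that e0(2) by (auto simp: b_def \<kappa>_def)
  show thesis
  proof (rule that[of b \<kappa>])
    show "\<not> b z" "\<kappa> z = 1"
      using S[of z] k1(1)[of z] by simp_all
    show "b ?y" "\<kappa> ?y = 1"
      using k2(1)[of ?y] by (simp_all add: b_def \<kappa>_def)
    show "\<not> b (head \<Gamma> e0)"
      using S[OF e0(1)] by simp
    fix e assume "e \<in> set K1 \<union> set K2"
    then consider "e \<in> set K1" | "e \<in> set K2" by blast
    then show "(b (tail \<Gamma> e) \<longleftrightarrow> b (head \<Gamma> e)) \<and> lab e * \<kappa> (tail \<Gamma> e) = lab (arev e) * \<kappa> (head \<Gamma> e)"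
    proof cases
      case 1
      have "tail \<Gamma> e \<in> ?S" "head \<Gamma> e \<in> ?S"
        using 1 grows_head_in[OF K1 1] by simp_all
      then show ?thesis
        using S[of "tail \<Gamma> e"] S[of "head \<Gamma> e"] k1(3)[OF 1] by simp
    next
      case 2
      then show ?thesis
        using k2(3)[OF 2] by (simp add: b_def \<kappa>_def mult.left_commute)
    qed
  qed
qed

text \<open>Two non-units \<open>g1\<close> and \<open>g2\<close> beyond the arc \<open>f\<close> at \<open>z\<close>: the root goes to a generator of one
  free factor, and the vertices of \<open>f # M\<close> to the other factor, a product of two cyclic groups
  in which \<open>tail \<Gamma> g1\<close> and \<open>tail \<Gamma> g2\<close> have different non-trivial images.\<close>

lemma large_two_nonunits:
  assumes \<Gamma>: "labelled_graph \<Gamma> arev lab" and T: "maximal_tree \<Gamma> arev T" "arcs T = arcs \<Gamma>"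
    and K: "grows \<Gamma> {z} ((f # M) @ L2)" "arcs T = set ((f # M) @ L2) \<union> arev ` set ((f # M) @ L2)"
      "insert z (tail \<Gamma> ` set ((f # M) @ L2)) = verts \<Gamma>"
    and M: "\<And>e. e \<in> set M \<Longrightarrow> head \<Gamma> e \<noteq> z" and f: "\<bar>lab (arev f)\<bar> \<noteq> 1"
    and L2: "\<And>e. e \<in> set L2 \<Longrightarrow> \<bar>lab e\<bar> = 1"
    and split: "f # M = Ka @ g1 # Kb @ g2 # Kd" and g: "\<bar>lab g1\<bar> \<noteq> 1" "\<bar>lab g2\<bar> \<noteq> 1"
  shows "large (gbs \<Gamma> arev lab T)"
proof -
  interpret labelled_graph \<Gamma> arev lab by fact
  interpret FG: gbs_presentation \<Gamma> arev lab T
    by (rule gbs_presentation_of_maximal_tree[OF \<Gamma> T(1)])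
  let ?F = "f # M"
  have KA: "e \<in> arcs \<Gamma>" if "e \<in> set (?F @ L2)" for e
    using that K(2) T(2) by blast
  have gF: "grows \<Gamma> {z} ?F" and gL2: "grows \<Gamma> ({z} \<union> tail \<Gamma> ` set ?F) L2"
    using K(1) unfolding grows_append by blast+
  have hf: "head \<Gamma> f = z" using gF by simp
  have split2: "?F = (Ka @ g1 # Kb) @ g2 # Kd" using split by simp
  have gF1: "grows \<Gamma> {z} (Ka @ g1 # (Kb @ g2 # Kd))" and gF2: "grows \<Gamma> {z} ((Ka @ g1 # Kb) @ g2 # Kd)"
    using gF by (simp_all only: split append_Cons append_assoc)
  have nz: "lab e \<noteq> 0" if "e \<in> set ?F" for e
    by (rule lab_nonzero[OF KA]) (use that in auto)
  have g1F: "g1 \<in> set ?F" and g2F: "g2 \<in> set ?F"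
    unfolding split by simp_all
  have nz1: "lab e \<noteq> 0" if "e \<in> set (Ka @ g1 # (Kb @ g2 # Kd))" for e
    by (rule nz) (use that in \<open>simp only: split append_Cons append_assoc\<close>)
  have nz2: "lab e \<noteq> 0" if "e \<in> set ((Ka @ g1 # Kb) @ g2 # Kd)" for e
    by (rule nz) (use that in \<open>simp only: split2\<close>)
  \<comment> \<open>Two systems of exponents, starting at \<open>g1\<close> and at
    \<open>g2\<close>. The second is still 0 at \<open>tail \<Gamma> g1\<close>, so the pairs at the
    two tails are \<open>(0, k2)\<close> and \<open>(k1, u2 (tail \<Gamma> g2))\<close>: both
    non-trivial, and different in the first entry.\<close>
  obtain k2 u2 where k2: "k2 > 0" and u2z: "\<And>v. v \<in> {z} \<union> tail \<Gamma> ` set Ka \<Longrightarrow> u2 v = 0" and u2: "u2 (tail \<Gamma> g1) = int k2"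
    and rel2': "\<And>e. e \<in> set (Ka @ g1 # (Kb @ g2 # Kd)) \<Longrightarrow> int k2 * \<bar>lab g1\<bar> dvd lab e * u2 (tail \<Gamma> e) - lab (arev e) * u2 (head \<Gamma> e)"
    by (rule grows_nonunit[OF gF1 nz1, where arev = arev]) (assumption, rule that)
  obtain k1 u1 where k1: "k1 > 0" and u1z: "\<And>v. v \<in> {z} \<union> tail \<Gamma> ` set (Ka @ g1 # Kb) \<Longrightarrow> u1 v = 0" and u1: "u1 (tail \<Gamma> g2) = int k1"
    and rel1': "\<And>e. e \<in> set ((Ka @ g1 # Kb) @ g2 # Kd) \<Longrightarrow> int k1 * \<bar>lab g2\<bar> dvd lab e * u1 (tail \<Gamma> e) - lab (arev e) * u1 (head \<Gamma> e)"
    by (rule grows_nonunit[OF gF2 nz2, where arev = arev]) (assumption, rule that)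
  have rel1: "int k1 * \<bar>lab g2\<bar> dvd lab e * u1 (tail \<Gamma> e) - lab (arev e) * u1 (head \<Gamma> e)" if "e \<in> set ?F" for e
    by (rule rel1') (use that in \<open>simp only: split2\<close>)
  have rel2: "int k2 * \<bar>lab g1\<bar> dvd lab e * u2 (tail \<Gamma> e) - lab (arev e) * u2 (head \<Gamma> e)" if "e \<in> set ?F" for e
    by (rule rel2') (use that in \<open>simp only: split append_Cons append_assoc\<close>)
  have z0: "u1 z = 0" "u2 z = 0" "u1 (tail \<Gamma> g1) = 0"
    by (rule u1z, simp)+ (rule u2z, simp, rule u1z, simp)
  have tz: "tail \<Gamma> e \<noteq> z" if "e \<in> set ?F" for e
    using grows_tail_notin[OF gF that] by simp
  \<comment> \<open>The order for \<open>\<alpha>\<close> that makes the root side of the relation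
    of \<open>f\<close> trivial; the other side is trivial because both exponents are 0 at
    \<open>z\<close>.\<close>
  define q where "q = nat \<bar>lab (arev f)\<bar>"
  define M1 where "M1 = k1 * nat \<bar>lab g2\<bar>"
  define M2 where "M2 = k2 * nat \<bar>lab g1\<bar>"
  have M12: "int M1 = int k1 * \<bar>lab g2\<bar>" "int M2 = int k2 * \<bar>lab g1\<bar>" "int q = \<bar>lab (arev f)\<bar>"
    by (simp_all add: M1_def M2_def q_def)
  have lf: "lab (arev f) \<noteq> 0"
    by (rule lab_nonzero) (use KA[of f] in simp)
  have pos: "q > 0" "M1 > 0" "M2 > 0"
    using lf k1 k2 nz[OF g1F] nz[OF g2F] by (simp_all add: q_def M1_def M2_def)
  have nd: "\<not> int q dvd 1" "\<not> int M1 dvd int k1" "\<not> int M2 dvd int k2"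
    using f not_mult_abs_dvd[OF g(2) k1] not_mult_abs_dvd[OF g(1) k2] by (simp_all add: M12)
  show ?thesis
  proof (rule large_of_images[OF FG.gbs_presentation_axioms pos nd(1), where lab = lab and ?i1.0 = "int k1" and ?i2.0 = "u2 (tail \<Gamma> g2)" and ?j1.0 = 0 and ?j2.0 = "int k2"], goal_cases)
    case (4 W \<alpha> \<beta>1 \<beta>2)
    interpret W: group W by (rule 4(1))
    note c = 4(2,3,4)
    define B where "B v = \<beta>1 [^]\<^bsub>W\<^esub> u1 v \<otimes>\<^bsub>W\<^esub> \<beta>2 [^]\<^bsub>W\<^esub> u2 v" for v
    have B_c: "B v \<in> carrier W" for v using c by (simp add: B_def)
    have B_pow: "B v [^]\<^bsub>W\<^esub> l = \<beta>1 [^]\<^bsub>W\<^esub> (u1 v * l) \<otimes>\<^bsub>W\<^esub> \<beta>2 [^]\<^bsub>W\<^esub> (u2 v * l)" for v and l :: int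
      unfolding B_def using c W.int_pow_mult_distrib[OF 4(8)[of "u1 v" "u2 v"], of l] by (simp add: W.int_pow_pow)
    have B_rel: "B (tail \<Gamma> e) [^]\<^bsub>W\<^esub> lab e = B (head \<Gamma> e) [^]\<^bsub>W\<^esub> lab (arev e)" if e: "e \<in> set ?F" for e
    proof -
      have "\<beta>1 [^]\<^bsub>W\<^esub> (u1 (tail \<Gamma> e) * lab e) = \<beta>1 [^]\<^bsub>W\<^esub> (u1 (head \<Gamma> e) * lab (arev e))"
        by (rule W.int_pow_cong[OF c(2) 4(6)]) (use rel1[OF e] in \<open>simp add: M12 mult.commute\<close>)
      moreover have "\<beta>2 [^]\<^bsub>W\<^esub> (u2 (tail \<Gamma> e) * lab e) = \<beta>2 [^]\<^bsub>W\<^esub> (u2 (head \<Gamma> e) * lab (arev e))"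
        by (rule W.int_pow_cong[OF c(3) 4(7)]) (use rel2[OF e] in \<open>simp add: M12 mult.commute\<close>)
      ultimately show ?thesis by (simp add: B_pow)
    qed
    let ?X = "\<lambda>v. if v = z then \<alpha> else B v"
    have X_rel: "?X (tail \<Gamma> e) [^]\<^bsub>W\<^esub> lab e = ?X (head \<Gamma> e) [^]\<^bsub>W\<^esub> lab (arev e)" if e: "e \<in> set ?F" for e
    proof (cases "e = f")
      case True
      have "B z = \<one>\<^bsub>W\<^esub>" by (simp add: B_def z0)
      then have "B (tail \<Gamma> f) [^]\<^bsub>W\<^esub> lab f = \<one>\<^bsub>W\<^esub>"
        using B_rel[of f] hf by simp
      moreover have "\<alpha> [^]\<^bsub>W\<^esub> lab (arev f) = \<one>\<^bsub>W\<^esub>"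
        using W.int_pow_cong[OF c(1) 4(5), of "lab (arev f)" 0] by (simp add: M12)
      ultimately show ?thesis using True hf tz[OF e] by simp
    next
      case False
      then have "head \<Gamma> e \<noteq> z" using e M by simp
      then show ?thesis using B_rel[OF e] tz[OF e] by simp
    qed
    have c': "?X v \<in> carrier W" for v using B_c c by simp
    \<comment> \<open>A unit label at the new vertex imposes no condition: the equation is solvable
      in any group.\<close>
    have solve: "\<exists>x\<in>carrier W. x [^]\<^bsub>W\<^esub> lab e = y [^]\<^bsub>W\<^esub> lab (arev e)" if "e \<in> set L2" "y \<in> carrier W" for e y
    proof (rule bexI[of _ "y [^]\<^bsub>W\<^esub> (lab (arev e) * lab e)"])
      have "lab e * lab e = 1"
        using L2[OF that(1)] by (metis abs_mult_self_eq mult_1)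
      then show "(y [^]\<^bsub>W\<^esub> (lab (arev e) * lab e)) [^]\<^bsub>W\<^esub> lab e = y [^]\<^bsub>W\<^esub> lab (arev e)"
        using that(2) by (simp add: W.int_pow_pow mult.assoc)
    qed (use that in simp)
    obtain X where X: "\<And>v. v \<in> {z} \<union> tail \<Gamma> ` set ?F \<Longrightarrow> X v = ?X v"
      "\<And>v. v \<in> {z} \<union> tail \<Gamma> ` set ?F \<union> tail \<Gamma> ` set L2 \<Longrightarrow> X v \<in> carrier W"
      "\<And>e. e \<in> set L2 \<Longrightarrow> X (tail \<Gamma> e) [^]\<^bsub>W\<^esub> lab e = X (head \<Gamma> e) [^]\<^bsub>W\<^esub> lab (arev e)"
      by (rule grows_extend[OF gL2, of ?X "carrier W" "\<lambda>e x y. x [^]\<^bsub>W\<^esub> lab e = y [^]\<^bsub>W\<^esub> lab (arev e)", OF c' solve]) (assumption, assumption, rule that)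
    have V: "{z} \<union> tail \<Gamma> ` set ?F \<union> tail \<Gamma> ` set L2 = verts \<Gamma>"
      unfolding K(3)[symmetric] by auto
    have im: "gbs_images W \<Gamma> arev lab T X (\<lambda>_. \<one>\<^bsub>W\<^esub>)"
    proof (rule gbs_images_tree[OF 4(1) bidirected_digraph _ T(2) K(2)])
      show "X v \<in> carrier W" if "v \<in> verts \<Gamma>" for v
        by (rule X(2)) (simp only: V that)
      fix e assume "e \<in> set (?F @ L2)"
      then consider "e \<in> set L2" | "e \<in> set ?F" by auto
      then show "X (tail \<Gamma> e) [^]\<^bsub>W\<^esub> lab e = X (head \<Gamma> e) [^]\<^bsub>W\<^esub> lab (arev e)"
      proof cases
        case 2
        have "X (tail \<Gamma> e) = ?X (tail \<Gamma> e)"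
          by (rule X(1)) (rule UnI2, rule imageI, rule 2)
        moreover have "X (head \<Gamma> e) = ?X (head \<Gamma> e)"
          by (rule X(1)) (rule grows_head_in[OF gF 2])
        ultimately show ?thesis using X_rel[OF 2] by simp
      qed (rule X(3))
    qed
    show ?case
    proof (rule 4(9)[OF im])
      fix K' assume K': "\<And>v. v \<in> verts \<Gamma> \<Longrightarrow> X v \<in> K'"
      have mem: "?X v \<in> K'" if "v \<in> {z} \<union> tail \<Gamma> ` set ?F" for v
      proof -
        have v: "v \<in> verts \<Gamma>" unfolding V[symmetric] using that by blast
        show ?thesis using K'[OF v] unfolding X(1)[OF that] .
      qed
      have "\<alpha> \<in> K'" using mem[of z] by simp
      moreover have "B (tail \<Gamma> e) \<in> K'" if "e \<in> set ?F" for e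
        using mem[OF UnI2[OF imageI[OF that]]] tz[OF that] by simp
      note this[OF g1F] this[OF g2F]
      ultimately show "\<alpha> [^]\<^bsub>W\<^esub> (1 :: int) \<in> K' \<and> \<beta>1 [^]\<^bsub>W\<^esub> int k1 \<otimes>\<^bsub>W\<^esub> \<beta>2 [^]\<^bsub>W\<^esub> u2 (tail \<Gamma> g2) \<in> K' \<and>
          \<beta>1 [^]\<^bsub>W\<^esub> (0 :: int) \<otimes>\<^bsub>W\<^esub> \<beta>2 [^]\<^bsub>W\<^esub> int k2 \<in> K'"
        using c by (simp add: B_def u1 u2 z0(3))
    qed
  qed (use nd in simp_all)
qed

text \<open>The tree is re-rooted at the tail \<open>z\<close> of its last non-unit arc
  \<open>f\<close>. Then \<open>arev f\<close> is the first arc and has a non-unit label near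
  \<open>z\<close>, and what grew after \<open>f\<close> has unit labels only. The number of
  non-units in \<open>arev f # M\<close> decides: none gives a cyclic group, one the two-generator
  case, two a large group.\<close>

theorem tree_cases:
  fixes \<Gamma> :: "('v, 'e) pre_digraph"
  assumes \<Gamma>: "labelled_graph \<Gamma> arev lab" and T: "maximal_tree \<Gamma> arev T" "arcs T = arcs \<Gamma>"
  shows "large (gbs \<Gamma> arev lab T) \<or> cyclic_group (gbs \<Gamma> arev lab T) \<or>
    (\<forall>n lab'. n = 1 \<longrightarrow> lab' 0 = 1 \<longrightarrow> lab' (Suc 0) = - 1 \<longrightarrow>
       gbs \<Gamma> arev lab T \<cong> gbs (cycle_graph n) (cycle_rev n) lab' (cycle_tree n))"
proof -
  interpret labelled_graph \<Gamma> arev lab by fact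
  interpret FG: gbs_presentation \<Gamma> arev lab T
    by (rule gbs_presentation_of_maximal_tree[OF \<Gamma> T(1)])
  have "verts \<Gamma> \<noteq> {}"
    using maximal_tree_connected[OF T(1)] by (simp add: Digraph_Component.connected_def strongly_connected_def)
  then obtain r where r: "r \<in> verts \<Gamma>" by blast
  obtain L where L: "grows \<Gamma> {r} L" "set L \<subseteq> arcs \<Gamma>" "insert r (tail \<Gamma> ` set L) = verts \<Gamma>" "arcs T = set L \<union> arev ` set L"
    by (rule maximal_tree_grows[OF bidirected_digraph _ T(1) r]) simp
  show ?thesis
  proof (cases "\<exists>f\<in>set L. \<bar>lab f\<bar> \<noteq> 1")
    case False
    then show ?thesis
      using FG.cyclic_group_if_units[OF L(1,4,3) T(2)] by blast
  next
    case True
    then obtain L1 f L2 where LL: "L = L1 @ f # L2" and f: "\<bar>lab f\<bar> \<noteq> 1" and L2: "\<forall>e\<in>set L2. \<not> \<bar>lab e\<bar> \<noteq> 1"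
      using split_list_last_prop[of L "\<lambda>f. \<bar>lab f\<bar> \<noteq> 1"] by blast
    have gL1: "grows \<Gamma> {r} L1" and hf: "head \<Gamma> f \<in> insert r (tail \<Gamma> ` set L1)" and tf: "tail \<Gamma> f \<notin> insert r (tail \<Gamma> ` set L1)"
      and gL2: "grows \<Gamma> (insert (tail \<Gamma> f) (insert r (tail \<Gamma> ` set L1))) L2"
      using L(1) by (simp_all add: LL grows_append)
    have L1A: "set L1 \<subseteq> arcs \<Gamma>" and fA: "f \<in> arcs \<Gamma>" using L(2) by (simp_all add: LL)
    let ?h = "head \<Gamma> f" and ?z = "tail \<Gamma> f" and ?f = "arev f"
    obtain M where M: "grows \<Gamma> {?h} M" "set M \<subseteq> arcs \<Gamma>" "set M \<union> arev ` set M = set L1 \<union> arev ` set L1"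
      "insert ?h (tail \<Gamma> ` set M) = insert r (tail \<Gamma> ` set L1)"
      by (rule reroot[OF bidirected_digraph gL1 L1A hf])
    have fe: "head \<Gamma> ?f = ?z" "tail \<Gamma> ?f = ?h" "arev ?f = f"
      using fA by simp_all
    have V: "{?z} \<union> tail \<Gamma> ` set (?f # M) = insert ?z (insert r (tail \<Gamma> ` set L1))"
      using M(4) fe by auto
    have zM: "?z \<notin> insert ?h (tail \<Gamma> ` set M)" using tf M(4) by simp
    then have hz: "?h \<noteq> ?z" by auto
    have hM: "?h \<notin> tail \<Gamma> ` set M"
    proof
      assume "?h \<in> tail \<Gamma> ` set M"
      then obtain e where e: "e \<in> set M" "tail \<Gamma> e = ?h" by auto
      then show False using grows_tail_notin[OF M(1) e(1)] by simp
    qed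
    have gM: "grows \<Gamma> {?h, ?z} M"
      by (rule grows_mono[OF M(1)]) (use zM hM in auto)
    have K: "grows \<Gamma> {?z} ((?f # M) @ L2)"
      unfolding grows_append V using gM gL2 hz fe by simp
    have KV: "insert ?z (tail \<Gamma> ` set ((?f # M) @ L2)) = verts \<Gamma>"
      unfolding L(3)[symmetric] LL using V by auto
    have KT: "arcs T = set ((?f # M) @ L2) \<union> arev ` set ((?f # M) @ L2)"
    proof -
      have "arcs T = (set L1 \<union> arev ` set L1) \<union> {f, ?f} \<union> set L2 \<union> arev ` set L2"
        unfolding L(4) LL by auto
      also have "\<dots> = set ((?f # M) @ L2) \<union> arev ` set ((?f # M) @ L2)"
        unfolding M(3)[symmetric] using fe(3) by auto
      finally show ?thesis .
    qed
    have u2: "\<bar>lab e\<bar> = 1" if "e \<in> set L2" for e using L2 that by blast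
    show ?thesis
    proof (cases "\<exists>g\<in>set (?f # M). \<bar>lab g\<bar> \<noteq> 1")
      case False
      then have "\<bar>lab e\<bar> = 1" if "e \<in> set ((?f # M) @ L2)" for e using u2 that by auto
      then show ?thesis
        using FG.cyclic_group_if_units[OF K KT KV T(2)] by blast
    next
      case True
      then obtain Ka g1 R where R: "?f # M = Ka @ g1 # R" and g1: "\<bar>lab g1\<bar> \<noteq> 1" and Ka: "\<forall>e\<in>set Ka. \<not> \<bar>lab e\<bar> \<noteq> 1"
        using split_list_first_prop[of "?f # M" "\<lambda>f. \<bar>lab f\<bar> \<noteq> 1"] by blast
      show ?thesis
      proof (cases "\<exists>g\<in>set R. \<bar>lab g\<bar> \<noteq> 1")
        case True
        then obtain g2 where g2: "g2 \<in> set R" "\<bar>lab g2\<bar> \<noteq> 1" by blast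
        then obtain Kb Kd where "R = Kb @ g2 # Kd" by (meson split_list)
        then have split: "?f # M = Ka @ g1 # Kb @ g2 # Kd" using R by simp
        have "head \<Gamma> e \<noteq> ?z" if "e \<in> set M" for e
        proof
          have "head \<Gamma> e \<in> insert ?h (tail \<Gamma> ` set M)"
            using grows_head_in[OF M(1) that] by simp
          moreover assume "head \<Gamma> e = ?z"
          ultimately show False using zM by (simp only:)
        qed
        then have "large FG.G"
          by (rule large_two_nonunits[OF \<Gamma> T K KT KV _ _ u2 split g1 g2(2)]) (use f fe(3) in simp_all)
        then show ?thesis ..
      next
        case False
        have KR: "(?f # M) @ L2 = Ka @ g1 # (R @ L2)" using R by simp
        have unit: "\<bar>lab e\<bar> = 1" if "e \<in> set Ka \<union> set (R @ L2)" for e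
          using that Ka False u2 by auto
        obtain b \<kappa> where b: "\<not> b ?z" "\<kappa> ?z = 1" "b (tail \<Gamma> g1)" "\<kappa> (tail \<Gamma> g1) = 1" "\<not> b (head \<Gamma> g1)"
          "\<And>e. e \<in> set Ka \<union> set (R @ L2) \<Longrightarrow> (b (tail \<Gamma> e) \<longleftrightarrow> b (head \<Gamma> e)) \<and> lab e * \<kappa> (tail \<Gamma> e) = lab (arev e) * \<kappa> (head \<Gamma> e)"
          by (rule grows_two_units[OF K[unfolded KR] unit, where arev = arev]) (assumption, rule that)
        have notg1: "e \<in> set Ka \<union> set (R @ L2)" if "e \<in> set ((?f # M) @ L2)" "e \<noteq> g1" for e
          using that unfolding KR by auto
        interpret two_generator_tree \<Gamma> arev lab T ?z g1 "(?f # M) @ L2" b \<kappa> "\<kappa> (head \<Gamma> g1) * lab (arev g1)"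
        proof (unfold_locales)
          show "lab e \<noteq> 0" if "e \<in> arcs \<Gamma>" for e by (rule lab_nonzero[OF that])
          show "arcs T = arcs \<Gamma>" by (rule T(2))
          show "grows \<Gamma> {?z} ((?f # M) @ L2)" by (rule K)
          show "arcs T = set ((?f # M) @ L2) \<union> arev ` set ((?f # M) @ L2)" by (rule KT)
          show "insert ?z (tail \<Gamma> ` set ((?f # M) @ L2)) = verts \<Gamma>" by (rule KV)
          show "g1 \<in> set ((?f # M) @ L2)" unfolding KR by simp
          show "\<bar>lab e\<bar> = 1" if "e \<in> set ((?f # M) @ L2)" "e \<noteq> g1" for e
            by (rule unit[OF notg1[OF that]])
          show "(b (tail \<Gamma> e) \<longleftrightarrow> b (head \<Gamma> e)) \<and> lab e * \<kappa> (tail \<Gamma> e) = lab (arev e) * \<kappa> (head \<Gamma> e)"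
            if "e \<in> set ((?f # M) @ L2)" "e \<noteq> g1" for e
            by (rule b(6)[OF notg1[OF that]])
        qed (rule b(1) b(2) b(3) b(4) b(5))+
        \<comment> \<open>Three outcomes remain: \<open>?m\<close> is a unit, both absolute values
          are 2, or the group is large.\<close>
        let ?m = "\<kappa> (head \<Gamma> g1) * lab (arev g1)"
        have "\<bar>lab g1\<bar> > 1"
          using g1 lab_nz[OF K_arcs[OF e0]] by linarith
        moreover have "\<bar>?m\<bar> = 1 \<or> \<bar>?m\<bar> > 1"
          using m_nz by linarith
        ultimately show ?thesis
          using cyclic_group_if_unit large_if_not_2 klein_bottle by blast
      qed
    qed
  qed
qed

section \<open>GBS groups that are not large\<close>

text \<open>Two edges outside the tree, or one such edge and a non-unit off the cycle, would make
  the group large; otherwise the graph collapses to its cycle. If the graph is a tree, only the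
  Klein bottle is left.\<close>

lemma not_large_cycle:
  fixes \<Gamma> :: "('v, 'e) pre_digraph"
  assumes \<Gamma>: "labelled_graph \<Gamma> arev lab" and T: "maximal_tree \<Gamma> arev T"
    and nl: "\<not> large (gbs \<Gamma> arev lab T)" and nc: "\<not> cyclic_group (gbs \<Gamma> arev lab T)"
  obtains n lab' where "n > 0" "\<And>e. e < 2 * n \<Longrightarrow> lab' e \<noteq> 0"
    "gbs \<Gamma> arev lab T \<cong> gbs (cycle_graph n) (cycle_rev n) lab' (cycle_tree n)"
proof -
  interpret labelled_graph \<Gamma> arev lab by fact
  have TA: "arcs T \<subseteq> arcs \<Gamma>" and Trev: "\<And>e. e \<in> arcs T \<Longrightarrow> arev e \<in> arcs T"
    using T by (auto simp: maximal_tree_def rev_subgraph_def subgraph_def)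
  show thesis
  proof (cases "arcs \<Gamma> - arcs T = {}")
    case True
    then have "arcs T = arcs \<Gamma>" using TA by blast
    \<comment> \<open>The labels 1 and -1 on a loop present the group of the Klein bottle.\<close>
    then have iso: "gbs \<Gamma> arev lab T \<cong> gbs (cycle_graph 1) (cycle_rev 1) (\<lambda>e. if e = 0 then 1 else - 1) (cycle_tree 1)"
      using tree_cases[OF \<Gamma> T] nl nc by simp
    show thesis
      by (rule that[OF _ _ iso]) simp_all
  next
    case False
    then obtain \<epsilon> where \<epsilon>: "\<epsilon> \<in> arcs \<Gamma> - arcs T" by blast
    have "arev \<epsilon> \<in> arcs \<Gamma> - arcs T"
      using \<epsilon> Trev[of "arev \<epsilon>"] by auto
    moreover have "e = \<epsilon> \<or> e = arev \<epsilon>" if "e \<in> arcs \<Gamma> - arcs T" for e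
      using large_two_loops[OF \<Gamma> T \<epsilon> that] nl by blast
    ultimately have N: "arcs \<Gamma> - arcs T = {\<epsilon>, arev \<epsilon>}"
      using \<epsilon> by blast
    have ht: "head \<Gamma> \<epsilon> \<in> verts \<Gamma>" "tail \<Gamma> \<epsilon> \<in> verts \<Gamma>" using \<epsilon> by auto
    obtain L where L: "grows \<Gamma> {head \<Gamma> \<epsilon>} L" "set L \<subseteq> arcs \<Gamma>" "insert (head \<Gamma> \<epsilon>) (tail \<Gamma> ` set L) = verts \<Gamma>"
      "arcs T = set L \<union> arev ` set L"
      by (rule maximal_tree_grows[OF bidirected_digraph _ T ht(1)]) simp
    have w: "tail \<Gamma> \<epsilon> \<in> insert (head \<Gamma> \<epsilon>) (tail \<Gamma> ` set L)" unfolding L(3) by (rule ht(2))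
    obtain P H where P: "is_path \<Gamma> (head \<Gamma> \<epsilon>) P (tail \<Gamma> \<epsilon>)" and g: "grows \<Gamma> {head \<Gamma> \<epsilon>} (P @ H)" and PH: "set P \<union> set H = set L"
      by (rule split_path[OF L(1) w])
    have PH': "set (P @ H) = set L" using PH by simp
    have PT: "arcs T = set (P @ H) \<union> arev ` set (P @ H)" and PV: "insert (head \<Gamma> \<epsilon>) (tail \<Gamma> ` set (P @ H)) = verts \<Gamma>"
      unfolding PH' by (rule L(4), rule L(3))
    have "tail \<Gamma> \<epsilon> \<in> set (head \<Gamma> \<epsilon> # map (tail \<Gamma>) P)"
      using is_path_nth[OF P] nth_mem[of "length P" "head \<Gamma> \<epsilon> # map (tail \<Gamma>) P"] by simp
    then have wP: "tail \<Gamma> \<epsilon> \<in> insert (head \<Gamma> \<epsilon>) (tail \<Gamma> ` set P)" by simp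
    have unit: "\<bar>lab e\<bar> = 1" if e: "e \<in> set H" for e
    proof (rule ccontr)
      assume ne: "\<bar>lab e\<bar> \<noteq> 1"
      obtain H1 H2 where "H = H1 @ e # H2" using e by (meson split_list)
      then have PH'': "P @ H = (P @ H1) @ e # H2" by simp
      have "large (gbs \<Gamma> arev lab T)"
        by (rule large_hanging_nonunit[OF \<Gamma> T N g[unfolded PH''] PT[unfolded PH''] PV[unfolded PH''] _ ne])
          (use wP in auto)
      then show False using nl by blast
    qed
    show thesis
      by (rule cycle_of_loop_edge[OF \<Gamma> T N g PT PV P unit that])
  qed
qed

theorem theorem1p4:
  fixes G :: "('a, 'b) monoid_scheme"
  assumes "GBS_group G" and "\<not> cyclic_group G"
  shows "large G \<longleftrightarrow>
    \<not> (\<exists>(\<Gamma> :: (nat, nat) pre_digraph) arev lab.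
         represents \<Gamma> arev lab G \<and> homeomorphic_to_circle \<Gamma> arev \<and>
         \<not> (\<exists>P. proper_plateau \<Gamma> arev lab P))"
proof -
  have G: "group G" using assms(1) by (simp add: GBS_group_def)
  obtain \<Gamma>0 :: "(nat, nat) pre_digraph" and arev0 lab0 T0 where \<Gamma>0: "labelled_graph \<Gamma>0 arev0 lab0"
    and T0: "maximal_tree \<Gamma>0 arev0 T0" and iso0: "G \<cong> gbs \<Gamma>0 arev0 lab0 T0"
    using assms(1) by (auto simp: GBS_group_def represents_def)
  interpret F: gbs_presentation \<Gamma>0 arev0 lab0 T0
    by (rule gbs_presentation_of_maximal_tree[OF \<Gamma>0 T0])
  show ?thesis
  proof
    assume large: "large G"
    show "\<not> (\<exists>(\<Gamma> :: (nat, nat) pre_digraph) arev lab.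
         represents \<Gamma> arev lab G \<and> homeomorphic_to_circle \<Gamma> arev \<and> \<not> (\<exists>P. proper_plateau \<Gamma> arev lab P))"
    proof (intro notI, elim exE conjE)
      fix \<Gamma> :: "(nat, nat) pre_digraph" and arev lab
      assume rep: "represents \<Gamma> arev lab G" and circle: "homeomorphic_to_circle \<Gamma> arev"
        and np: "\<not> (\<exists>P. proper_plateau \<Gamma> arev lab P)"
      obtain T where \<Gamma>: "labelled_graph \<Gamma> arev lab" and T: "maximal_tree \<Gamma> arev T" and iso: "G \<cong> gbs \<Gamma> arev lab T"
        using rep by (auto simp: represents_def)
      interpret labelled_graph \<Gamma> arev lab by fact
      interpret K: gbs_presentation \<Gamma> arev lab T
        by (rule gbs_presentation_of_maximal_tree[OF \<Gamma> T])
      \<comment> \<open>The circle enters this direction only as a bound on the edges outside the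
        maximal tree.\<close>
      have one: "b = a \<or> b = arev a" if "a \<in> arcs \<Gamma> - arcs T" "b \<in> arcs \<Gamma> - arcs T" for a b
        by (rule circle_arcs_outside_tree[OF bidirected_digraph _ T circle that]) simp
      have "large K.G"
        by (rule large_iso[OF K.group_G G group.iso_sym[OF G iso] large])
      then show False
        using no_proper_plateau_not_large[OF \<Gamma> T one np] by blast
    qed
  next
    assume none: "\<not> (\<exists>(\<Gamma> :: (nat, nat) pre_digraph) arev lab.
         represents \<Gamma> arev lab G \<and> homeomorphic_to_circle \<Gamma> arev \<and> \<not> (\<exists>P. proper_plateau \<Gamma> arev lab P))"
    show "large G"
    proof (rule ccontr)
      assume nl: "\<not> large G"
      have nlF: "\<not> large F.G"
        using large_iso[OF G F.group_G iso0] nl by blast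
      \<comment> \<open>Cyclic groups are not large either; this discards the trees whose vertex
        generators are powers of a single element.\<close>
      have ncF: "\<not> cyclic_group F.G"
        using isomorphic_group_cyclicity[OF iso0 G F.group_G] assms(2) by blast
      obtain n lab' where n: "n > 0" and lab': "\<And>e. e < 2 * n \<Longrightarrow> lab' e \<noteq> 0"
        and iso: "F.G \<cong> gbs (cycle_graph n) (cycle_rev n) lab' (cycle_tree n)"
        by (rule not_large_cycle[OF \<Gamma>0 T0 nlF ncF]) (rule that)
      have C: "labelled_graph (cycle_graph n) (cycle_rev n) lab'"
        by (rule labelled_cycle_graph[OF n lab'])
      note TC = maximal_tree_cycle_graph[OF n]
      interpret C: gbs_presentation "cycle_graph n" "cycle_rev n" lab' "cycle_tree n"
        by (rule gbs_presentation_of_maximal_tree[OF C TC])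
      have "\<not> large C.G"
        using large_iso[OF F.group_G C.group_G iso] nlF by blast
      \<comment> \<open>A proper plateau on the cycle just found would make the group large; so this
        cycle is a representation of the excluded kind.\<close>
      then have "\<not> (\<exists>P. proper_plateau (cycle_graph n) (cycle_rev n) lab' P)"
        using large_cycle_with_plateau[OF n C] by blast
      moreover have "represents (cycle_graph n) (cycle_rev n) lab' G"
        unfolding represents_def using C TC maximal_tree_connected[OF TC] iso_trans[OF iso0 iso] by blast
      ultimately show False
        using none circle_cycle_graph[OF n] by blast
    qed
  qed
qed

end
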